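(* Let $\Omega$ be a bounded, connected, open subset of $\mathbb{R}^N$, let $\gamma,\theta$ be real numbers with $-\frac{\pi}{2}<\theta,\gamma<\frac{\pi}{2}$, and let $H=\{u\in H^1_0(\Omega):\ \Delta u\in L^2(\Omega)\}$. Then there exist $\alpha_0>0$ and continuous maps $u:(0,\alpha_0)\to H$ and $\omega:[0,\alpha_0]\to\mathbb{R}$ such that for every $\alpha\in(0,\alpha_0)$, $u=u(\alpha)$ is a nontrivial (not identically zero) solution of $$e^{i\theta}\Delta u+e^{i\gamma}|u|^\alpha u=i\omega u \quad\text{in } \Omega$$ with $\omega=\omega(\alpha)$. In particular, $\phi(t,x)=e^{i\omega t}u(x)$ is a standing wave solution of $\phi_t=e^{i\theta}\Delta\phi+e^{i\gamma}|\phi|^\alpha\phi$ on $\Omega$ with Dirichlet boundary conditions.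
   Context: All function spaces consist of complex-valued functions regarded as real Hilbert spaces; $L^2(\Omega)$ has inner product $(u,v)=\mathrm{Re}\int_\Omega u\bar v$. The space $H$ is equipped with the real inner product $(u,v)_H=\mathrm{Re}\int_\Omega u\bar v+\mathrm{Re}\int_\Omega\Delta u\,\Delta\bar v$, making it a real Hilbert space continuously embedded in $H^1_0(\Omega)$. *)

theory Defs
  imports "HOL-Analysis.Analysis"
begin

definition pd :: "'a::euclidean_space \<Rightarrow> ('a \<Rightarrow> real) \<Rightarrow> 'a \<Rightarrow> real" where
  "pd b f x = frechet_derivative f (at x) b"

text \<open>C-infinity: differentiable, and all partial derivatives again C-infinity
  (greatest fixed point, i.e. derivatives of every order exist).\<close>
coinductive smooth :: "('a::euclidean_space \<Rightarrow> real) \<Rightarrow> bool" where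
  "f differentiable_on UNIV \<Longrightarrow> (\<forall>b\<in>Basis. smooth (pd b f)) \<Longrightarrow> smooth f"

definition tsupp :: "('a::euclidean_space \<Rightarrow> real) \<Rightarrow> 'a set" where
  "tsupp f = closure {x. f x \<noteq> 0}"

definition test_fun :: "'a::euclidean_space set \<Rightarrow> ('a \<Rightarrow> real) \<Rightarrow> bool" where
  "test_fun \<Omega> \<phi> \<longleftrightarrow> smooth \<phi> \<and> compact (tsupp \<phi>) \<and> tsupp \<phi> \<subseteq> \<Omega>"

definition lap_test :: "('a::euclidean_space \<Rightarrow> real) \<Rightarrow> 'a \<Rightarrow> real" where
  "lap_test \<phi> x = (\<Sum>b\<in>Basis. pd b (pd b \<phi>) x)"

definition L2 :: "'a::euclidean_space set \<Rightarrow> ('a \<Rightarrow> complex) \<Rightarrow> bool" where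
  "L2 \<Omega> u \<longleftrightarrow> set_borel_measurable lebesgue \<Omega> u
     \<and> set_integrable lebesgue \<Omega> (\<lambda>x. (cmod (u x))^2)"

definition L2sq :: "'a::euclidean_space set \<Rightarrow> ('a \<Rightarrow> complex) \<Rightarrow> real" where
  "L2sq \<Omega> u = set_lebesgue_integral lebesgue \<Omega> (\<lambda>x. (cmod (u x))^2)"

definition weak_pd :: "'a::euclidean_space set \<Rightarrow> 'a \<Rightarrow> ('a \<Rightarrow> complex) \<Rightarrow> ('a \<Rightarrow> complex) \<Rightarrow> bool" where
  "weak_pd \<Omega> b u g \<longleftrightarrow> (\<forall>\<phi>. test_fun \<Omega> \<phi> \<longrightarrow>
      set_lebesgue_integral lebesgue \<Omega> (\<lambda>x. u x * complex_of_real (pd b \<phi> x))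
      = - set_lebesgue_integral lebesgue \<Omega> (\<lambda>x. g x * complex_of_real (\<phi> x)))"

definition weak_lap :: "'a::euclidean_space set \<Rightarrow> ('a \<Rightarrow> complex) \<Rightarrow> ('a \<Rightarrow> complex) \<Rightarrow> bool" where
  "weak_lap \<Omega> u f \<longleftrightarrow> (\<forall>\<phi>. test_fun \<Omega> \<phi> \<longrightarrow>
      set_lebesgue_integral lebesgue \<Omega> (\<lambda>x. u x * complex_of_real (lap_test \<phi> x))
      = set_lebesgue_integral lebesgue \<Omega> (\<lambda>x. f x * complex_of_real (\<phi> x)))"

definition H10 :: "'a::euclidean_space set \<Rightarrow> ('a \<Rightarrow> complex) \<Rightarrow> bool" where
  "H10 \<Omega> u \<longleftrightarrow> L2 \<Omega> u \<and> (\<exists>g. (\<forall>b\<in>Basis. L2 \<Omega> (g b) \<and> weak_pd \<Omega> b u (g b)) \<and>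
     (\<exists>p q. (\<forall>n. test_fun \<Omega> (p n) \<and> test_fun \<Omega> (q n)) \<and>
        (\<lambda>n. L2sq \<Omega> (\<lambda>x. complex_of_real (p n x) + \<i> * complex_of_real (q n x) - u x))
          \<longlonglongrightarrow> 0 \<and>
        (\<forall>b\<in>Basis. (\<lambda>n. L2sq \<Omega> (\<lambda>x. complex_of_real (pd b (p n) x)
             + \<i> * complex_of_real (pd b (q n) x) - g b x)) \<longlonglongrightarrow> 0)))"

definition Hspace :: "'a::euclidean_space set \<Rightarrow> ('a \<Rightarrow> complex) set" where
  "Hspace \<Omega> = {u. H10 \<Omega> u \<and> (\<exists>f. L2 \<Omega> f \<and> weak_lap \<Omega> u f)}"

text \<open>The (a.e.-determined) weak Laplacian in L2.\<close>
definition lap :: "'a::euclidean_space set \<Rightarrow> ('a \<Rightarrow> complex) \<Rightarrow> 'a \<Rightarrow> complex" where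
  "lap \<Omega> u = (SOME f. L2 \<Omega> f \<and> weak_lap \<Omega> u f)"

definition Hnorm :: "'a::euclidean_space set \<Rightarrow> ('a \<Rightarrow> complex) \<Rightarrow> real" where
  "Hnorm \<Omega> u = sqrt (L2sq \<Omega> u + L2sq \<Omega> (lap \<Omega> u))"

end

theory Submission
  imports Defs
begin

text \<open>
  Let \<open>K = (1 - \<Delta>)\<inverse>\<close> be the Dirichlet resolvent. It is compact, symmetric and positivity
  preserving, so by the strong maximum principle its top eigenvalue \<open>\<kappa> < 1\<close> is simple with an
  eigenfunction \<open>\<phi>\<close> that is positive almost everywhere in \<open>\<Omega>\<close>.
  Writing \<open>u = m\<^bsup>1/\<alpha>\<^esup> K f\<close> and \<open>v = K f\<close>, the equation becomes
  \<open>f = (1 + c) K f + m e\<^bsup>i(\<gamma> - \<theta>)\<^esup> (|v|\<^bsup>\<alpha>\<^esup> - 1) v\<close> with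
  \<open>c e\<^bsup>i\<theta>\<^esup> = m e\<^bsup>i\<gamma>\<^esup> - i \<omega>\<close>, and \<open>c\<close> determines both \<open>m = Re (c e\<^bsup>i\<theta>\<^esup>) / cos \<gamma>\<close> and \<open>\<omega>\<close>.
  At \<open>\<alpha> = 0\<close> the nonlinear term vanishes and \<open>f = \<phi>\<close>, \<open>c = 1/\<kappa> - 1\<close> is a solution, with \<open>m > 0\<close> because
  \<open>cos \<theta>\<close> and \<open>cos \<gamma>\<close> are positive. Near \<open>\<phi>\<close> the nonlinear term has a Lipschitz constant that tends to 0
  with \<open>\<alpha>\<close>: its derivative is small except where \<open>|v|\<close> is close to 0 or large; the set where \<open>|v|\<close> is small has
  small measure because \<open>\<phi> > 0\<close>, and large values are controlled by the gain of integrability of \<open>K\<close>.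
  A contraction argument then continues the solution to small \<open>\<alpha> > 0\<close>.
\<close>

subsection \<open>The Hilbert space of square-integrable functions\<close>

text \<open>The obstacle is that the nonlinear term is not small in any uniform sense: for every
  \<alpha> > 0 the map z |-> (|z|^\<alpha> - 1) z has derivative -1 at 0 and grows superlinearly at
  infinity. It acts as a small perturbation only because K f takes extreme values on a set of small
  measure, while the differences K f - K g are bounded in some L^p with p > 2. Almost everywhere
  positivity of the ground state and this gain of integrability are the regularity facts extracted
  from K; the gain and the compactness of K both come from the single estimate that a shift by h
  moves K f by at most |h| times the norm of f. The shift by 1 in K makes the quadratic form of 1 -
  \<Delta> the inner product of the space of pairs (u, grad u), so K f is read off from a Riesz
  representative. The factor m^(1/\<alpha>) turns |u|^\<alpha> into m |K f|^\<alpha>. It takes the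
  amplitude, which may blow up or vanish as \<alpha> tends to 0, out of the fixed point problem: f
  and c extend continuously to \<alpha> = 0, u need not.\<close>

definition sqint :: "('a::euclidean_space \<Rightarrow> 'b::euclidean_space) \<Rightarrow> bool" where
  "sqint f \<longleftrightarrow> f \<in> borel_measurable borel \<and> integrable lborel (\<lambda>x. (norm (f x))\<^sup>2)"

lemma sqint_measurable: "sqint f \<Longrightarrow> f \<in> borel_measurable borel"
  and sqint_integrable: "sqint f \<Longrightarrow> integrable lborel (\<lambda>x. (norm (f x))\<^sup>2)"
  by (auto simp: sqint_def)

lemma sqint_bound:
  assumes "sqint f" "g \<in> borel_measurable borel" "AE x in lborel. norm (g x) \<le> C * norm (f x)"
  shows "sqint g"
proof -
  have [measurable]: "f \<in> borel_measurable borel" "g \<in> borel_measurable borel"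
    using assms by (auto simp: sqint_def)
  have "integrable lborel (\<lambda>x. (norm (g x))\<^sup>2)"
  proof (rule Bochner_Integration.integrable_bound)
    show "integrable lborel (\<lambda>x. C\<^sup>2 * (norm (f x))\<^sup>2)"
      using assms by (auto simp: sqint_def)
    show "AE x in lborel. norm ((norm (g x))\<^sup>2) \<le> norm (C\<^sup>2 * (norm (f x))\<^sup>2)"
      using assms(3)
    proof eventually_elim
      case (elim x)
      then have "(norm (g x))\<^sup>2 \<le> (C * norm (f x))\<^sup>2"
        by (intro power_mono) auto
      then show ?case by (simp add: power_mult_distrib)
    qed
  qed auto
  then show ?thesis using assms by (auto simp: sqint_def)
qed

lemma sqint_zero [simp]: "sqint (\<lambda>x. 0)"
  by (simp add: sqint_def)

lemma sqint_inner:
  assumes "sqint f" "sqint g"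
  shows "integrable lborel (\<lambda>x. f x \<bullet> g x)"
proof -
  have [measurable]: "f \<in> borel_measurable borel" "g \<in> borel_measurable borel"
    using assms by (auto simp: sqint_def)
  show ?thesis
  proof (rule Bochner_Integration.integrable_bound)
    show "integrable lborel (\<lambda>x. (norm (f x))\<^sup>2 + (norm (g x))\<^sup>2)"
      using assms by (auto simp: sqint_def)
    show "AE x in lborel. norm (f x \<bullet> g x) \<le> norm ((norm (f x))\<^sup>2 + (norm (g x))\<^sup>2)"
    proof (rule AE_I2)
      fix x
      have "\<bar>f x \<bullet> g x\<bar> \<le> norm (f x) * norm (g x)" by (rule Cauchy_Schwarz_ineq2)
      also have "\<dots> \<le> (norm (f x))\<^sup>2 + (norm (g x))\<^sup>2"
        using sum_squares_bound[of "norm (f x)" "norm (g x)"]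
          mult_nonneg_nonneg[OF norm_ge_zero[of "f x"] norm_ge_zero[of "g x"]] by linarith
      finally show "norm (f x \<bullet> g x) \<le> norm ((norm (f x))\<^sup>2 + (norm (g x))\<^sup>2)" by simp
    qed
  qed auto
qed

lemma sqint_add:
  assumes "sqint f" "sqint g" shows "sqint (\<lambda>x. f x + g x)"
proof -
  have [measurable]: "f \<in> borel_measurable borel" "g \<in> borel_measurable borel"
    using assms by (auto simp: sqint_def)
  have "integrable lborel (\<lambda>x. (norm (f x))\<^sup>2 + 2 * (f x \<bullet> g x) + (norm (g x))\<^sup>2)"
    using assms sqint_inner[OF assms] by (auto simp: sqint_def)
  moreover have "(norm (f x))\<^sup>2 + 2 * (f x \<bullet> g x) + (norm (g x))\<^sup>2 = (norm (f x + g x))\<^sup>2" for x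
    by (simp add: power2_norm_eq_inner inner_add_left inner_add_right inner_commute)
  ultimately show ?thesis by (simp add: sqint_def)
qed

lemma sqint_scaleR: "sqint f \<Longrightarrow> sqint (\<lambda>x. c *\<^sub>R f x)"
  by (rule sqint_bound[of f _ "\<bar>c\<bar>"]) (auto simp: sqint_def)

lemma sqint_minus: "sqint f \<Longrightarrow> sqint (\<lambda>x. - f x)"
  using sqint_scaleR[of f "-1"] by simp

lemma sqint_diff: "sqint f \<Longrightarrow> sqint g \<Longrightarrow> sqint (\<lambda>x. f x - g x)"
  using sqint_add[of f "\<lambda>x. - g x"] sqint_minus[of g] by simp

text \<open>Only square-integrable functions are related to themselves, so this is a partial
  equivalence and the quotient carries the integrability. Representatives are Borel because shifts
  and Fubini's theorem need joint measurability; the Lebesgue integrals of the statement are reached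
  by completion.\<close>

definition l2rel :: "('a::euclidean_space \<Rightarrow> 'b::euclidean_space) \<Rightarrow> ('a \<Rightarrow> 'b) \<Rightarrow> bool" where
  "l2rel f g \<longleftrightarrow> sqint f \<and> sqint g \<and> (AE x in lborel. f x = g x)"

quotient_type (overloaded) ('a, 'b) l2 = "'a::euclidean_space \<Rightarrow> 'b::euclidean_space" / partial: l2rel
  morphisms rep_l2 abs_l2
proof (rule part_equivpI)
  show "\<exists>f::'a \<Rightarrow> 'b. l2rel f f"
    by (rule exI[of _ "\<lambda>x. 0"]) (simp add: l2rel_def)
  show "symp (l2rel :: ('a \<Rightarrow> 'b) \<Rightarrow> _)"
    by (auto simp: symp_def l2rel_def elim: AE_mp)
  show "transp (l2rel :: ('a \<Rightarrow> 'b) \<Rightarrow> _)"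
  proof (rule transpI)
    fix f g h :: "'a \<Rightarrow> 'b"
    assume *: "l2rel f g" "l2rel g h"
    then have "AE x in lborel. f x = g x" "AE x in lborel. g x = h x"
      by (auto simp: l2rel_def)
    then have "AE x in lborel. f x = h x" by eventually_elim simp
    then show "l2rel f h" using * by (auto simp: l2rel_def)
  qed
qed

instantiation l2 :: (euclidean_space, euclidean_space) real_inner
begin

lift_definition zero_l2 :: "('a, 'b) l2" is "\<lambda>x. 0"
  by (simp add: l2rel_def)

lift_definition plus_l2 :: "('a, 'b) l2 \<Rightarrow> ('a, 'b) l2 \<Rightarrow> ('a, 'b) l2" is "\<lambda>f g x. f x + g x"
proof -
  fix f f' g g' :: "'a \<Rightarrow> 'b"
  assume *: "l2rel f f'" "l2rel g g'"
  then have "AE x in lborel. f x = f' x" "AE x in lborel. g x = g' x"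
    by (auto simp: l2rel_def)
  then have "AE x in lborel. f x + g x = f' x + g' x" by eventually_elim simp
  then show "l2rel (\<lambda>x. f x + g x) (\<lambda>x. f' x + g' x)"
    using * by (auto simp: l2rel_def intro: sqint_add)
qed

lift_definition minus_l2 :: "('a, 'b) l2 \<Rightarrow> ('a, 'b) l2 \<Rightarrow> ('a, 'b) l2" is "\<lambda>f g x. f x - g x"
proof -
  fix f f' g g' :: "'a \<Rightarrow> 'b"
  assume *: "l2rel f f'" "l2rel g g'"
  then have "AE x in lborel. f x = f' x" "AE x in lborel. g x = g' x"
    by (auto simp: l2rel_def)
  then have "AE x in lborel. f x - g x = f' x - g' x" by eventually_elim simp
  then show "l2rel (\<lambda>x. f x - g x) (\<lambda>x. f' x - g' x)"
    using * by (auto simp: l2rel_def intro: sqint_diff)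
qed

lift_definition uminus_l2 :: "('a, 'b) l2 \<Rightarrow> ('a, 'b) l2" is "\<lambda>f x. - f x"
  by (auto simp: l2rel_def intro: sqint_minus)

lift_definition scaleR_l2 :: "real \<Rightarrow> ('a, 'b) l2 \<Rightarrow> ('a, 'b) l2" is "\<lambda>c f x. c *\<^sub>R f x"
  by (auto simp: l2rel_def intro: sqint_scaleR elim: AE_mp)

lift_definition inner_l2 :: "('a, 'b) l2 \<Rightarrow> ('a, 'b) l2 \<Rightarrow> real"
  is "\<lambda>f g. integral\<^sup>L lborel (\<lambda>x. f x \<bullet> g x)"
proof -
  fix f f' g g' :: "'a \<Rightarrow> 'b"
  assume *: "l2rel f f'" "l2rel g g'"
  then have [measurable]: "f \<in> borel_measurable borel" "g \<in> borel_measurable borel"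
    "f' \<in> borel_measurable borel" "g' \<in> borel_measurable borel"
    by (auto simp: l2rel_def sqint_def)
  have "AE x in lborel. f x = f' x" "AE x in lborel. g x = g' x"
    using * by (auto simp: l2rel_def)
  then have "AE x in lborel. f x \<bullet> g x = f' x \<bullet> g' x" by eventually_elim simp
  then show "integral\<^sup>L lborel (\<lambda>x. f x \<bullet> g x) = integral\<^sup>L lborel (\<lambda>x. f' x \<bullet> g' x)"
    by (intro integral_cong_AE) auto
qed

definition norm_l2 :: "('a, 'b) l2 \<Rightarrow> real" where "norm_l2 u = sqrt (inner u u)"
definition sgn_l2 :: "('a, 'b) l2 \<Rightarrow> ('a, 'b) l2" where "sgn_l2 u = scaleR (inverse (norm u)) u"
definition dist_l2 :: "('a, 'b) l2 \<Rightarrow> ('a, 'b) l2 \<Rightarrow> real" where "dist_l2 u v = norm (u - v)"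
definition uniformity_l2 :: "(('a, 'b) l2 \<times> ('a, 'b) l2) filter" where
  "uniformity_l2 = (INF e\<in>{0 <..}. principal {(x, y). dist x y < e})"
definition open_l2 :: "('a, 'b) l2 set \<Rightarrow> bool" where
  "open_l2 U \<longleftrightarrow> (\<forall>x\<in>U. eventually (\<lambda>(x', y). x' = x \<longrightarrow> y \<in> U) uniformity)"

instance
proof
  fix a b c :: "('a, 'b) l2" and r s :: real
  show "a + b + c = a + (b + c)"
    by transfer (auto simp: l2rel_def algebra_simps intro: sqint_add)
  show "a + b = b + a"
    by transfer (auto simp: l2rel_def algebra_simps intro: sqint_add)
  show "0 + a = a" by transfer (auto simp: l2rel_def)
  show "- a + a = 0" by transfer (auto simp: l2rel_def)
  show "a - b = a + - b"
    by transfer (auto simp: l2rel_def intro: sqint_diff)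
  show "r *\<^sub>R (a + b) = r *\<^sub>R a + r *\<^sub>R b"
    by transfer (auto simp: l2rel_def algebra_simps intro!: sqint_add sqint_scaleR)
  show "(r + s) *\<^sub>R a = r *\<^sub>R a + s *\<^sub>R a"
    by transfer (auto simp: l2rel_def algebra_simps intro!: sqint_add sqint_scaleR)
  show "r *\<^sub>R s *\<^sub>R a = (r * s) *\<^sub>R a"
    by transfer (auto simp: l2rel_def algebra_simps intro!: sqint_scaleR)
  show "1 *\<^sub>R a = a" by transfer (auto simp: l2rel_def)
  show "sgn a = scaleR (inverse (norm a)) a" by (rule sgn_l2_def)
  show "dist a b = norm (a - b)" by (rule dist_l2_def)
  show "(uniformity :: (('a, 'b) l2 \<times> ('a, 'b) l2) filter) = (INF e\<in>{0 <..}. principal {(x, y). dist x y < e})"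
    by (rule uniformity_l2_def)
  show "open U = (\<forall>x\<in>U. \<forall>\<^sub>F (x', y) in uniformity. x' = x \<longrightarrow> y \<in> U)" for U :: "('a, 'b) l2 set"
    by (rule open_l2_def)
  show "a \<bullet> b = b \<bullet> a" by transfer (simp add: inner_commute)
  show "(a + b) \<bullet> c = a \<bullet> c + b \<bullet> c"
    by transfer (auto simp: inner_add_left l2rel_def intro!: Bochner_Integration.integral_add sqint_inner)
  show "(r *\<^sub>R a) \<bullet> b = r * (a \<bullet> b)"
    by transfer simp
  show "0 \<le> a \<bullet> a" by transfer (auto intro: Bochner_Integration.integral_nonneg)
  show "(a \<bullet> a = 0) = (a = 0)"
  proof transfer
    fix f :: "'a \<Rightarrow> 'b" assume "l2rel f f"
    then have f: "sqint f" by (simp add: l2rel_def)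
    have "(integral\<^sup>L lborel (\<lambda>x. f x \<bullet> f x) = 0) = (AE x in lborel. f x \<bullet> f x = 0)"
      by (rule integral_nonneg_eq_0_iff_AE) (auto intro: sqint_inner f)
    then show "(integral\<^sup>L lborel (\<lambda>x. f x \<bullet> f x) = 0) = l2rel f (\<lambda>x. 0)"
      using f by (simp add: l2rel_def)
  qed
  show "norm a = sqrt (a \<bullet> a)" by (rule norm_l2_def)
qed

end

lemma sqint_rep [simp, intro]: "sqint (rep_l2 u)"
  using Quotient_rep_reflp[OF Quotient_l2, of u] by (simp add: l2rel_def)

lemma abs_rep_l2 [simp]: "abs_l2 (rep_l2 u) = u"
  using Quotient_abs_rep[OF Quotient_l2] .

lemma rep_l2_measurable [measurable]: "rep_l2 u \<in> borel_measurable borel"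
  using sqint_rep sqint_measurable by blast

lemma rep_abs_l2: "sqint f \<Longrightarrow> AE x in lborel. rep_l2 (abs_l2 f) x = f x"
  using Quotient_rep_abs[OF Quotient_l2, of f] by (simp add: l2rel_def)

lemma abs_l2_eq_iff: "sqint f \<Longrightarrow> sqint g \<Longrightarrow> abs_l2 f = abs_l2 g \<longleftrightarrow> (AE x in lborel. f x = g x)"
  using Quotient_rel[OF Quotient_l2, of f g] by (auto simp: l2rel_def)

lemma l2_eq_iff: "u = v \<longleftrightarrow> (AE x in lborel. rep_l2 u x = rep_l2 v x)"
  using abs_l2_eq_iff[of "rep_l2 u" "rep_l2 v"] by simp

lemma abs_l2_add: "sqint f \<Longrightarrow> sqint g \<Longrightarrow> abs_l2 f + abs_l2 g = abs_l2 (\<lambda>x. f x + g x)"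
  by (simp add: l2rel_def plus_l2.abs_eq)

lemma abs_l2_diff: "sqint f \<Longrightarrow> sqint g \<Longrightarrow> abs_l2 f - abs_l2 g = abs_l2 (\<lambda>x. f x - g x)"
  by (simp add: l2rel_def minus_l2.abs_eq)

lemma abs_l2_scaleR: "sqint f \<Longrightarrow> c *\<^sub>R abs_l2 f = abs_l2 (\<lambda>x. c *\<^sub>R f x)"
  by (simp add: l2rel_def scaleR_l2.abs_eq)

lemma abs_l2_zero: "abs_l2 (\<lambda>x. 0) = 0"
  by (simp add: zero_l2_def)

lemma inner_abs_l2: "sqint f \<Longrightarrow> sqint g \<Longrightarrow> abs_l2 f \<bullet> abs_l2 g = (\<integral>x. f x \<bullet> g x \<partial>lborel)"
  by (simp add: l2rel_def inner_l2.abs_eq)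

lemma inner_l2_rep: "u \<bullet> v = (\<integral>x. rep_l2 u x \<bullet> rep_l2 v x \<partial>lborel)"
  using inner_abs_l2[of "rep_l2 u" "rep_l2 v"] by simp

lemma inner_l2_rep_abs: "sqint f \<Longrightarrow> u \<bullet> abs_l2 f = (\<integral>x. rep_l2 u x \<bullet> f x \<partial>lborel)"
  using inner_abs_l2[of "rep_l2 u" f] by simp

lemma norm_abs_l2: "sqint f \<Longrightarrow> (norm (abs_l2 f))\<^sup>2 = (\<integral>x. (norm (f x))\<^sup>2 \<partial>lborel)"
  by (simp add: power2_norm_eq_inner inner_abs_l2)

lemma norm_l2_rep: "(norm u)\<^sup>2 = (\<integral>x. (norm (rep_l2 u x))\<^sup>2 \<partial>lborel)"
  using norm_abs_l2[of "rep_l2 u"] by simp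

lemma nn_norm_abs_l2: "sqint f \<Longrightarrow> (\<integral>\<^sup>+x. ennreal ((norm (f x))\<^sup>2) \<partial>lborel) = ennreal ((norm (abs_l2 f))\<^sup>2)"
  by (simp add: norm_abs_l2 nn_integral_eq_integral sqint_integrable)

lemma nn_norm_l2_rep: "(\<integral>\<^sup>+x. ennreal ((norm (rep_l2 u x))\<^sup>2) \<partial>lborel) = ennreal ((norm u)\<^sup>2)"
  using nn_norm_abs_l2[of "rep_l2 u"] by simp

lemma rep_l2_zero: "AE x in lborel. rep_l2 0 x = 0"
  using rep_abs_l2[OF sqint_zero] by (simp add: abs_l2_zero)

lemma rep_l2_add: "AE x in lborel. rep_l2 (u + v) x = rep_l2 u x + rep_l2 v x"
  using rep_abs_l2[OF sqint_add[OF sqint_rep[of u] sqint_rep[of v]]]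
  by (simp add: abs_l2_add[OF sqint_rep sqint_rep, symmetric])

lemma rep_l2_diff: "AE x in lborel. rep_l2 (u - v) x = rep_l2 u x - rep_l2 v x"
  using rep_abs_l2[OF sqint_diff[OF sqint_rep[of u] sqint_rep[of v]]]
  by (simp add: abs_l2_diff[OF sqint_rep sqint_rep, symmetric])

lemma rep_l2_scaleR: "AE x in lborel. rep_l2 (c *\<^sub>R u) x = c *\<^sub>R rep_l2 u x"
  using rep_abs_l2[OF sqint_scaleR[OF sqint_rep[of u]]]
  by (simp add: abs_l2_scaleR[OF sqint_rep, symmetric])

lemma norm_abs_l2_le:
  assumes "sqint f" "(\<integral>\<^sup>+x. ennreal ((norm (f x))\<^sup>2) \<partial>lborel) \<le> ennreal (c\<^sup>2)" "0 \<le> c"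
  shows "norm (abs_l2 f) \<le> c"
proof -
  have "ennreal ((norm (abs_l2 f))\<^sup>2) \<le> ennreal (c\<^sup>2)"
    using assms by (simp add: nn_norm_abs_l2)
  then have "(norm (abs_l2 f))\<^sup>2 \<le> c\<^sup>2" by (simp add: ennreal_le_iff)
  then show ?thesis using assms(3) by (rule power2_le_imp_le)
qed

lemma sqint_nn:
  assumes "f \<in> borel_measurable borel" "(\<integral>\<^sup>+x. ennreal ((norm (f x))\<^sup>2) \<partial>lborel) < \<infinity>"
  shows "sqint f"
  using assms by (auto simp: sqint_def intro!: integrableI_bounded)

text \<open>Riesz--Fischer: along a subsequence with summable increments the representatives converge
  almost everywhere, and Fatou's lemma identifies the limit.\<close>
instance l2 :: (euclidean_space, euclidean_space) complete_space
proof
  fix X :: "nat \<Rightarrow> ('a, 'b) l2"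
  assume X: "Cauchy X"
  have "\<forall>n. \<exists>M. \<forall>k\<ge>M. \<forall>l\<ge>M. norm (X k - X l) < (1/2)^n"
    using X by (simp add: Cauchy_def dist_norm)
  then obtain M where M: "\<And>n k l. k \<ge> M n \<Longrightarrow> l \<ge> M n \<Longrightarrow> norm (X k - X l) < (1/2)^n"
    by metis
  \<comment> \<open>The summand n makes \<open>r\<close> strictly increasing, and the sum dominates
    every \<open>M m\<close> with m \<le> n.\<close>
  define r where "r n = n + (\<Sum>i\<le>n. M i)" for n
  have r_mono: "r m \<le> r n" if "m \<le> n" for m n
    unfolding r_def by (intro add_mono that sum_mono2) (use that in auto)
  have r_ge: "r n \<ge> M m" if "m \<le> n" for m n
    unfolding r_def using member_le_sum[of m "{..n}" M] that by auto
  define F where "F n = rep_l2 (X (r n))" for n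
  have F[measurable]: "F n \<in> borel_measurable borel" for n by (simp add: F_def)
  have sF: "sqint (F n)" for n by (simp add: F_def)
  have nF: "(\<integral>\<^sup>+x. ennreal ((norm (F n x - F m x))\<^sup>2) \<partial>lborel) = ennreal ((norm (X (r n) - X (r m)))\<^sup>2)" for n m
    using nn_norm_abs_l2[OF sqint_diff[OF sF sF], of n m] abs_l2_diff[OF sF sF, of n m]
    by (simp add: F_def)
  have le1: "norm (X (r n) - X (r m)) < (1/2)^k" if "k \<le> n" "k \<le> m" for n m k
    using M r_ge that by blast
  \<comment> \<open>The squared increments are at most 4^(-n), so the weight 2^n still leaves a
    convergent series. Its finiteness at x forces the increments at x below a geometric sequence of
    ratio sqrt (1/2).\<close>
  have "(\<integral>\<^sup>+x. (\<Sum>n. ennreal (2^n * (norm (F (Suc n) x - F n x))\<^sup>2)) \<partial>lborel)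
      = (\<Sum>n. (\<integral>\<^sup>+x. ennreal (2^n * (norm (F (Suc n) x - F n x))\<^sup>2) \<partial>lborel))"
    by (rule nn_integral_suminf) auto
  also have "\<dots> = (\<Sum>n. ennreal (2^n) * ennreal ((norm (X (r (Suc n)) - X (r n)))\<^sup>2))"
    by (simp add: ennreal_mult nn_integral_cmult nF)
  also have "\<dots> \<le> (\<Sum>n. ennreal ((1/2)^n))"
  proof (rule suminf_le)
    fix n
    have "(norm (X (r (Suc n)) - X (r n)))\<^sup>2 \<le> ((1/2)^n)\<^sup>2"
      using le1[of n "Suc n" n] by (intro power_mono) auto
    then have "2^n * (norm (X (r (Suc n)) - X (r n)))\<^sup>2 \<le> 2^n * ((1/2)^n)\<^sup>2"
      by simp
    also have "\<dots> = (1/2::real)^n" by (simp add: power2_eq_square power_one_over)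
    finally show "ennreal (2^n) * ennreal ((norm (X (r (Suc n)) - X (r n)))\<^sup>2) \<le> ennreal ((1/2)^n)"
      by (simp add: ennreal_mult[symmetric] del: ennreal_power ennreal_numeral)
  qed auto
  also have "\<dots> = ennreal (\<Sum>n. (1/2::real)^n)"
    by (rule suminf_ennreal2) (auto intro: summable_geometric)
  finally have fin: "(\<integral>\<^sup>+x. (\<Sum>n. ennreal (2^n * (norm (F (Suc n) x - F n x))\<^sup>2)) \<partial>lborel) \<noteq> \<infinity>"
    by (metis ennreal_neq_top infinity_ennreal_def top.extremum_unique)
  have AEconv: "AE x in lborel. convergent (\<lambda>n. F n x)"
    using nn_integral_PInf_AE[OF _ fin]
  proof (rule AE_mp)
    show "AE x in lborel. (\<Sum>n. ennreal (2^n * (norm (F (Suc n) x - F n x))\<^sup>2)) \<noteq> \<infinity> \<longrightarrow> convergent (\<lambda>n. F n x)"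
    proof (rule AE_I2, rule impI)
      fix x
      assume "(\<Sum>n. ennreal (2^n * (norm (F (Suc n) x - F n x))\<^sup>2)) \<noteq> \<infinity>"
      then have "summable (\<lambda>n. 2^n * (norm (F (Suc n) x - F n x))\<^sup>2)"
        by (intro summable_suminf_not_top) auto
      then have "(\<lambda>n. 2^n * (norm (F (Suc n) x - F n x))\<^sup>2) \<longlonglongrightarrow> 0" by (rule summable_LIMSEQ_zero)
      then have "eventually (\<lambda>n. 2^n * (norm (F (Suc n) x - F n x))\<^sup>2 < 1) sequentially"
        by (rule order_tendstoD) simp
      then have ev: "eventually (\<lambda>n. norm (F (Suc n) x - F n x) \<le> (sqrt (1/2))^n) sequentially"
      proof eventually_elim
        case (elim n)
        then have "(norm (F (Suc n) x - F n x))\<^sup>2 \<le> (1/2)^n"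
          by (simp add: field_simps)
        also have "\<dots> = ((sqrt (1/2))^n)\<^sup>2"
          by (subst power_mult[symmetric], subst mult.commute, subst power_mult) simp
        finally show ?case by (rule power2_le_imp_le) simp
      qed
      have "summable (\<lambda>n. (sqrt (1/2))^n)"
        by (rule summable_geometric) (simp add: real_sqrt_divide)
      then have "summable (\<lambda>n. F (Suc n) x - F n x)"
        using ev by (rule summable_comparison_test_ev[rotated])
      then have "convergent (\<lambda>n. \<Sum>i<n. F (Suc i) x - F i x)"
        by (simp add: summable_iff_convergent)
      then have "convergent (\<lambda>n. F n x - F 0 x)"
        by (simp only: sum_lessThan_telescope[of "\<lambda>n. F n x"])
      then show "convergent (\<lambda>n. F n x)"
        using convergent_add[OF _ convergent_const[of "F 0 x"]] by fastforce
    qed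
  qed auto
  define L where "L x = lim (\<lambda>n. F n x)" for x
  have L[measurable]: "L \<in> borel_measurable borel"
    unfolding L_def[abs_def] by (rule borel_measurable_lim_metric) simp
  have close: "(\<integral>\<^sup>+x. ennreal ((norm (L x - F n x))\<^sup>2) \<partial>lborel) \<le> ennreal (((1/2)^n)\<^sup>2)" for n
  proof -
    have "(\<integral>\<^sup>+x. ennreal ((norm (L x - F n x))\<^sup>2) \<partial>lborel)
        = (\<integral>\<^sup>+x. liminf (\<lambda>m. ennreal ((norm (F m x - F n x))\<^sup>2)) \<partial>lborel)"
    proof (rule nn_integral_cong_AE, use AEconv in eventually_elim)
      case (elim x)
      then have "(\<lambda>m. F m x) \<longlonglongrightarrow> L x" by (simp add: L_def convergent_LIMSEQ_iff)
      then have "(\<lambda>m. ennreal ((norm (F m x - F n x))\<^sup>2)) \<longlonglongrightarrow> ennreal ((norm (L x - F n x))\<^sup>2)"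
        by (intro tendsto_ennrealI tendsto_intros)
      from lim_imp_Liminf[OF _ this] show ?case by simp
    qed
    also have "\<dots> \<le> liminf (\<lambda>m. \<integral>\<^sup>+x. ennreal ((norm (F m x - F n x))\<^sup>2) \<partial>lborel)"
      by (rule nn_integral_liminf) auto
    also have "\<dots> \<le> ennreal (((1/2)^n)\<^sup>2)"
    proof (rule Liminf_le)
      show "\<forall>\<^sub>F m in sequentially. (\<integral>\<^sup>+x. ennreal ((norm (F m x - F n x))\<^sup>2) \<partial>lborel) \<le> ennreal (((1/2)^n)\<^sup>2)"
        using eventually_ge_at_top[of n]
      proof eventually_elim
        case (elim m)
        have "(norm (X (r m) - X (r n)))\<^sup>2 \<le> ((1/2)^n)\<^sup>2"
          using le1[of n m n] elim by (intro power_mono) auto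
        then show ?case by (simp add: nF ennreal_le_iff del: ennreal_power)
      qed
    qed simp
    finally show ?thesis .
  qed
  have sL0: "sqint (\<lambda>x. L x - F n x)" for n
    by (rule sqint_nn) (use close[of n] in \<open>auto simp: less_top[symmetric] top_unique\<close>)
  have sL: "sqint L" using sqint_add[OF sL0[of 0] sF[of 0]] by simp
  have "norm (abs_l2 L - X (r n)) \<le> (1/2)^n" for n
    using norm_abs_l2_le[OF sL0 close] abs_l2_diff[OF sL sF, of n] by (simp add: F_def)
  then have "norm (X (r n) - abs_l2 L) \<le> (1/2)^n" for n
    by (simp add: norm_minus_commute)
  moreover have "(\<lambda>n. (1/2::real)^n) \<longlonglongrightarrow> 0" by (rule LIMSEQ_realpow_zero) auto
  ultimately have "(\<lambda>n. X (r n) - abs_l2 L) \<longlonglongrightarrow> 0"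
    by (intro Lim_null_comparison[of "\<lambda>n. X (r n) - abs_l2 L"] always_eventually) auto
  then have "(X \<circ> r) \<longlonglongrightarrow> abs_l2 L" by (simp add: LIM_zero_iff o_def)
  moreover have "strict_mono r"
    by (rule strict_monoI_Suc) (simp add: r_def)
  ultimately show "convergent X"
    using Cauchy_converges_subseq[OF X] convergent_def by blast
qed

subsection \<open>Smooth functions and test functions\<close>

lemma pd_eqI: "(f has_derivative f') (at x) \<Longrightarrow> pd b f x = f' b"
  unfolding pd_def using frechet_derivative_at by metis

lemma smooth_differentiable: "smooth f \<Longrightarrow> f differentiable (at x)"
  by (erule smooth.cases) (auto simp: differentiable_on_def)

lemma smooth_pd: "smooth f \<Longrightarrow> b \<in> Basis \<Longrightarrow> smooth (pd b f)"
  by (erule smooth.cases) auto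

lemma smooth_coinduct_set:
  assumes "f \<in> A" "\<And>g. g \<in> A \<Longrightarrow> g differentiable_on UNIV" "\<And>g b. g \<in> A \<Longrightarrow> b \<in> Basis \<Longrightarrow> pd b g \<in> A"
  shows "smooth f"
  using assms(1)
proof (coinduction arbitrary: f)
  case smooth
  then show ?case using assms(2,3) by blast
qed

definition grad :: "('a::euclidean_space \<Rightarrow> real) \<Rightarrow> 'a \<Rightarrow> 'a" where
  "grad f x = (\<Sum>b\<in>Basis. pd b f x *\<^sub>R b)"

lemma grad_inner_Basis: "b \<in> Basis \<Longrightarrow> grad f x \<bullet> b = pd b f x"
  by (simp add: grad_def)

lemma has_derivative_grad:
  assumes "f differentiable (at x)"
  shows "(f has_derivative (\<lambda>h. grad f x \<bullet> h)) (at x)"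
proof -
  have D: "(f has_derivative (frechet_derivative f (at x))) (at x)"
    using assms frechet_derivative_works by blast
  have "frechet_derivative f (at x) h = grad f x \<bullet> h" for h
  proof -
    interpret bounded_linear "frechet_derivative f (at x)"
      using D has_derivative_bounded_linear by blast
    have "frechet_derivative f (at x) h = frechet_derivative f (at x) (\<Sum>b\<in>Basis. (h \<bullet> b) *\<^sub>R b)"
      by (simp add: euclidean_representation)
    also have "\<dots> = (\<Sum>b\<in>Basis. (h \<bullet> b) * pd b f x)"
      by (simp add: sum scaleR pd_def)
    also have "\<dots> = grad f x \<bullet> h"
      by (simp add: grad_def inner_sum_left inner_sum_right inner_commute mult.commute)
    finally show ?thesis .
  qed
  then show ?thesis using D by (metis (no_types, lifting) ext)
qed

lemma has_derivative_imp_grad: "(f has_derivative f') (at x) \<Longrightarrow> f' h = grad f x \<bullet> h"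
  using has_derivative_grad[of f x] has_derivative_unique[of f f' x] differentiable_def by metis

lemma smooth_continuous: "smooth f \<Longrightarrow> continuous_on A f"
  using smooth_differentiable differentiable_imp_continuous_on
  by (metis differentiable_at_imp_differentiable_on)

lemma smooth_continuous_grad: "smooth f \<Longrightarrow> continuous_on A (grad f)"
  unfolding grad_def[abs_def]
  by (intro continuous_intros smooth_continuous smooth_pd)

text \<open>Coinduction needs a set closed under partial derivatives. Products alone are not such a
  set, since the product rule produces sums and the chain rule produces products; the closure under
  all three operations is.\<close>

inductive smooth_gen :: "('a::euclidean_space \<Rightarrow> real) \<Rightarrow> bool" where
  base: "smooth f \<Longrightarrow> smooth_gen f"
| add: "smooth_gen f \<Longrightarrow> smooth_gen g \<Longrightarrow> smooth_gen (\<lambda>x. f x + g x)"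
| mult: "smooth_gen f \<Longrightarrow> smooth_gen g \<Longrightarrow> smooth_gen (\<lambda>x. f x * g x)"
| comp: "smooth_gen f \<Longrightarrow> smooth (h::real \<Rightarrow> real) \<Longrightarrow> smooth_gen (\<lambda>x. h (f x))"

lemma smooth_gen_deriv:
  "smooth_gen f \<Longrightarrow> (\<forall>x. f differentiable (at x)) \<and> (\<forall>b\<in>Basis. smooth_gen (pd b f))"
proof (induction rule: smooth_gen.induct)
  case (base f)
  then show ?case using smooth_differentiable smooth_pd smooth_gen.base by blast
next
  case (add f g)
  have "pd b (\<lambda>x. f x + g x) = (\<lambda>x. pd b f x + pd b g x)" for b
  proof
    fix x
    show "pd b (\<lambda>x. f x + g x) x = pd b f x + pd b g x"
      unfolding pd_def[of b f] pd_def[of b g]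
      by (rule pd_eqI[OF has_derivative_add[of f _ _ g]])
        (use add in \<open>auto simp flip: frechet_derivative_works\<close>)
  qed
  then show ?case using add by (auto intro: smooth_gen.add)
next
  case (mult f g)
  have "pd b (\<lambda>x. f x * g x) = (\<lambda>x. f x * pd b g x + pd b f x * g x)" for b
  proof
    fix x
    show "pd b (\<lambda>x. f x * g x) x = f x * pd b g x + pd b f x * g x"
      unfolding pd_def[of b f] pd_def[of b g]
      by (rule pd_eqI[OF has_derivative_mult[of f _ _ _ g]])
        (use mult in \<open>auto simp flip: frechet_derivative_works\<close>)
  qed
  moreover have "smooth_gen (\<lambda>x. f x * pd b g x + pd b f x * g x)" if "b \<in> Basis" for b
    using mult that by (intro smooth_gen.add smooth_gen.mult) auto
  ultimately show ?case using mult by auto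
next
  case (comp f h)
  have D: "((\<lambda>x. h (f x)) has_derivative (\<lambda>k. frechet_derivative h (at (f x)) (frechet_derivative f (at x) k))) (at x)" for x
    using diff_chain_at[of f "frechet_derivative f (at x)" x h "frechet_derivative h (at (f x))"]
      comp smooth_differentiable[of h] by (auto simp: o_def simp flip: frechet_derivative_works)
  have "pd b (\<lambda>x. h (f x)) = (\<lambda>x. pd 1 h (f x) * pd b f x)" for b
  proof
    fix x
    have "pd b (\<lambda>x. h (f x)) x = frechet_derivative h (at (f x)) (pd b f x)"
      using pd_eqI[OF D] by (simp add: pd_def)
    also have "\<dots> = grad h (f x) \<bullet> pd b f x"
      using comp smooth_differentiable frechet_derivative_works has_derivative_imp_grad by metis
    finally show "pd b (\<lambda>x. h (f x)) x = pd 1 h (f x) * pd b f x"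
      by (simp add: grad_def)
  qed
  moreover have "smooth_gen (\<lambda>x. pd 1 h (f x) * pd b f x)" if "b \<in> Basis" for b
  proof (rule smooth_gen.mult)
    show "smooth_gen (\<lambda>x. pd 1 h (f x))"
      by (rule smooth_gen.comp[OF comp.hyps(1)], rule smooth_pd[OF comp.hyps(2)]) simp
  qed (use comp.IH that in auto)
  moreover have "(\<lambda>x. h (f x)) differentiable at x" for x
    using D differentiable_def by blast
  ultimately show ?case by auto
qed

lemma smooth_gen_imp_smooth: "smooth_gen f \<Longrightarrow> smooth f"
  by (rule smooth_coinduct_set[of f "Collect smooth_gen"])
    (simp_all add: differentiable_on_def smooth_gen_deriv)

lemma smooth_add: "smooth f \<Longrightarrow> smooth g \<Longrightarrow> smooth (\<lambda>x. f x + g x)"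
  by (rule smooth_gen_imp_smooth, rule smooth_gen.add) (auto intro: smooth_gen.base)

lemma smooth_mult: "smooth f \<Longrightarrow> smooth g \<Longrightarrow> smooth (\<lambda>x. f x * g x)"
  by (rule smooth_gen_imp_smooth, rule smooth_gen.mult) (auto intro: smooth_gen.base)

lemma smooth_compose: "smooth f \<Longrightarrow> smooth (h::real \<Rightarrow> real) \<Longrightarrow> smooth (\<lambda>x. h (f x))"
  by (rule smooth_gen_imp_smooth, rule smooth_gen.comp) (auto intro: smooth_gen.base)

lemma smooth_const: "smooth (\<lambda>x::'a::euclidean_space. c)"
proof (rule smooth_coinduct_set[of _ "{f. \<exists>c. f = (\<lambda>x. c)}"])
  show "(\<lambda>x::'a. c) \<in> {f. \<exists>c. f = (\<lambda>x. c)}" by blast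
  fix g :: "'a \<Rightarrow> real" and b :: 'a assume "g \<in> {f. \<exists>c. f = (\<lambda>x. c)}"
  then obtain d where g: "g = (\<lambda>x. d)" by blast
  then show "g differentiable_on UNIV" by simp
  have "pd b g = (\<lambda>x. 0)" unfolding g by (simp add: pd_def[abs_def])
  then show "pd b g \<in> {f. \<exists>c. f = (\<lambda>x. c)}" by blast
qed

lemma pd_inner_const: "pd b (\<lambda>x. x \<bullet> c) x = b \<bullet> c"
  by (rule pd_eqI) (auto intro!: derivative_eq_intros)

lemma smooth_inner_const: "smooth (\<lambda>x. x \<bullet> c)"
proof (rule smooth.intros)
  show "(\<lambda>x. x \<bullet> c) differentiable_on UNIV"
    by (auto simp: differentiable_on_def intro!: differentiableI derivative_eq_intros)
  show "\<forall>b\<in>Basis. smooth (pd b (\<lambda>x. x \<bullet> c))"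
    using smooth_const by (auto simp: pd_inner_const[abs_def])
qed

lemma smooth_sum: "finite I \<Longrightarrow> (\<And>i. i \<in> I \<Longrightarrow> smooth (f i)) \<Longrightarrow> smooth (\<lambda>x. \<Sum>i\<in>I. f i x)"
  by (induction I rule: finite_induct) (auto intro: smooth_add smooth_const)

lemma smooth_prod: "finite I \<Longrightarrow> (\<And>i. i \<in> I \<Longrightarrow> smooth (f i)) \<Longrightarrow> smooth (\<lambda>x. \<Prod>i\<in>I. f i x)"
  by (induction I rule: finite_induct) (auto intro: smooth_mult smooth_const)

lemma smooth_norm_diff_sq: "smooth (\<lambda>x. (norm (x - c))\<^sup>2)"
proof -
  have "(norm (x - c))\<^sup>2 = (\<Sum>b\<in>Basis. (x \<bullet> b + - (c \<bullet> b)) * (x \<bullet> b + - (c \<bullet> b)))" for x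
    using euclidean_inner[of "x - c" "x - c"] by (simp add: power2_norm_eq_inner inner_diff_left)
  moreover have "smooth (\<lambda>x. \<Sum>b\<in>Basis. (x \<bullet> b + - (c \<bullet> b)) * (x \<bullet> b + - (c \<bullet> b)))"
    by (intro smooth_sum smooth_mult smooth_add smooth_inner_const smooth_const finite_Basis)
  ultimately show ?thesis by presburger
qed

lemma smooth_realI:
  fixes g :: "real \<Rightarrow> real"
  assumes "g \<in> A" "\<And>g. g \<in> A \<Longrightarrow> \<exists>g'\<in>A. \<forall>x. (g has_real_derivative g' x) (at x)"
  shows "smooth g"
proof (rule smooth_coinduct_set[of g A])
  fix g b assume "g \<in> A"
  then obtain g' where g': "g' \<in> A" "\<And>x. (g has_real_derivative g' x) (at x)" using assms(2) by blast
  show "g differentiable_on UNIV"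
    using g'(2) unfolding differentiable_on_def has_field_derivative_def
    by (metis differentiableI UNIV_I)
  assume "b \<in> (Basis :: real set)"
  then have "pd b g x = g' x" for x
    using pd_eqI[OF g'(2)[unfolded has_field_derivative_def]] by simp
  then have "pd b g = g'" by blast
  then show "pd b g \<in> A" using g' by simp
qed fact

text \<open>The substitution s = 1/t reduces this to exponential decay beating every power. It makes
  all derivatives of \<open>flat\<close> vanish at 0.\<close>

lemma poly_exp_at_right_0: "((\<lambda>t. poly p (1/t) * exp (- (1/t))) \<longlongrightarrow> 0) (at_right (0::real))"
proof -
  have "((\<lambda>s. poly p s * exp (- s)) \<longlongrightarrow> 0) at_top"
  proof (induction p)
    case (pCons a p)
    have 1: "((\<lambda>s. s ^ Suc i * exp (- s)) \<longlongrightarrow> (0::real)) at_top" for i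
      using tendsto_power_div_exp_0[of "Suc i"] by (simp add: exp_minus field_simps)
    have "poly q s * s * exp (- s) = (\<Sum>i\<le>degree q. coeff q i * (s ^ Suc i * exp (- s)))" for q and s :: real
      by (simp add: poly_altdef sum_distrib_right sum_distrib_left algebra_simps)
    then have 2: "((\<lambda>s. poly p s * s * exp (- s)) \<longlongrightarrow> 0) at_top"
      using tendsto_sum[of "{..degree p}" "\<lambda>i s. coeff p i * (s ^ Suc i * exp (- s))" "\<lambda>i. 0" at_top]
        tendsto_mult_right_zero[OF 1] by (simp del: power_Suc)
    have "((\<lambda>s. exp (- s)) \<longlongrightarrow> (0::real)) at_top"
      by (rule filterlim_compose[OF exp_at_bot filterlim_uminus_at_bot_at_top])
    from tendsto_add[OF tendsto_mult_right_zero[OF this, of a] 2]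
    show ?case by (simp add: algebra_simps)
  qed simp
  moreover have "LIM t at_right (0::real). 1 / t :> at_top"
    using filterlim_inverse_at_top_right by (simp add: inverse_eq_divide)
  ultimately show ?thesis by (rule filterlim_compose)
qed

text \<open>The standard smooth function vanishing exactly on the nonpositive half-line. All bumps
  below compose it with polynomials.\<close>

definition flat :: "real \<Rightarrow> real" where "flat t = (if 0 < t then exp (- (1/t)) else 0)"

lemma smooth_flat: "smooth flat"
proof -
  define A where "A = {g. \<exists>p::real poly. g = (\<lambda>t. if 0 < t then poly p (1/t) * exp (- (1/t)) else 0)}"
  have "flat = (\<lambda>t. if 0 < t then poly 1 (1/t) * exp (- (1/t)) else 0)"
    by (auto simp: flat_def)
  then have "flat \<in> A" unfolding A_def by blast
  moreover have "\<exists>g'\<in>A. \<forall>x. (g has_real_derivative g' x) (at x)" if gA: "g \<in> A" for g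
  proof -
    obtain p where g: "g = (\<lambda>t. if 0 < t then poly p (1/t) * exp (- (1/t)) else 0)"
      using gA unfolding A_def by blast
    \<comment> \<open>With s = 1/t one has d/dt = - s^2 d/ds, so p(s) exp (- s) becomes s^2 (p -
      p')(s) exp (- s).\<close>
    define q where "q = [:0,0,1:] * (p - pderiv p)"
    define g' where "g' = (\<lambda>t::real. if 0 < t then poly q (1/t) * exp (- (1/t)) else 0)"
    have "(g has_real_derivative g' x) (at x)" for x
    proof -
      consider "x > 0" | "x < 0" | "x = 0" by linarith
      then show ?thesis
      proof cases
        case 1
        have "((\<lambda>t. poly p (1/t) * exp (- (1/t))) has_real_derivative g' x) (at x)"
          using 1 by (auto intro!: derivative_eq_intros simp: g'_def q_def field_simps power2_eq_square)
        moreover have "\<forall>\<^sub>F t in nhds x. poly p (1/t) * exp (- (1/t)) = g t"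
          using eventually_nhds_in_open[of "{0<..}" x] 1 by (auto simp: g elim!: eventually_mono)
        ultimately show ?thesis
          by (simp add: DERIV_cong_ev[OF refl _ refl])
      next
        case 2
        then have "\<forall>\<^sub>F t in nhds x. g t = 0"
          using eventually_nhds_in_open[of "{..<0}" x] by (auto simp: g elim!: eventually_mono)
        then show ?thesis
          using DERIV_cong_ev[OF refl, of g "\<lambda>_. 0" x "g' x" 0] 2 by (auto simp: g'_def)
      next
        case 3
        have "((\<lambda>h. (g (0 + h) - g 0) / h) \<longlongrightarrow> 0) (at 0)"
        proof (rule filterlim_split_at)
          \<comment> \<open>The quotient g(h)/h carries one more factor 1/h, which is what
            \<open>pCons 0\<close> adds to the polynomial.\<close>
          have "((\<lambda>h. poly (pCons 0 p) (1/h) * exp (- (1/h))) \<longlongrightarrow> 0) (at_right (0::real))"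
            by (rule poly_exp_at_right_0)
          moreover have "\<forall>\<^sub>F h in at_right 0. poly (pCons 0 p) (1/h) * exp (- (1/h)) = (g (0 + h) - g 0) / h"
            using eventually_at_right_less[of 0] by eventually_elim (auto simp: g)
          ultimately show "((\<lambda>h. (g (0 + h) - g 0) / h) \<longlongrightarrow> 0) (at_right 0)"
            by (rule Lim_transform_eventually)
          have "\<forall>\<^sub>F h in at_left (0::real). (g (0 + h) - g 0) / h = 0"
            using eventually_at_left_real[of "-1" "0::real"] by (simp add: g eventually_mono)
          then show "((\<lambda>h. (g (0 + h) - g 0) / h) \<longlongrightarrow> 0) (at_left 0)"
            by (rule tendsto_eventually)
        qed
        then show ?thesis using 3 by (simp add: DERIV_def g'_def)
      qed
    qed
    moreover have "g' \<in> A" unfolding A_def g'_def by blast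
    ultimately show ?thesis by blast
  qed
  ultimately show ?thesis by (rule smooth_realI)
qed

lemma flat_pos: "0 < t \<Longrightarrow> 0 < flat t" and flat_nonneg: "0 \<le> flat t" and flat_zero: "t \<le> 0 \<Longrightarrow> flat t = 0"
  and flat_le_1: "flat t \<le> 1"
  by (auto simp: flat_def)

text \<open>A smooth substitute for the absolute value, which maps test functions to test functions
  once its value e at 0 is subtracted. The family of polynomials times powers of t^2 + e^2 is closed
  under differentiation.\<close>

lemma smooth_sqrt_sq:
  assumes "0 < e" shows "smooth (\<lambda>t::real. sqrt (t\<^sup>2 + e\<^sup>2))"
proof -
  define A where "A = {g. \<exists>(p::real poly) a. g = (\<lambda>t. poly p t * (t\<^sup>2 + e\<^sup>2) powr a)}"
  have pos: "t\<^sup>2 + e\<^sup>2 > 0" for t using assms by (simp add: add_nonneg_pos)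
  have "(\<lambda>t. sqrt (t\<^sup>2 + e\<^sup>2)) = (\<lambda>t. poly 1 t * (t\<^sup>2 + e\<^sup>2) powr (1/2))"
    using pos by (auto simp: powr_half_sqrt less_imp_le)
  then have "(\<lambda>t. sqrt (t\<^sup>2 + e\<^sup>2)) \<in> A" unfolding A_def by blast
  moreover have "\<exists>g'\<in>A. \<forall>x. (g has_real_derivative g' x) (at x)" if gA: "g \<in> A" for g
  proof -
    obtain p a where g: "g = (\<lambda>t. poly p t * (t\<^sup>2 + e\<^sup>2) powr a)"
      using gA unfolding A_def by blast
    define q where "q = pderiv p * [:e\<^sup>2, 0, 1:] + smult (2 * a) ([:0,1:] * p)"
    define g' where "g' = (\<lambda>x. poly q x * (x\<^sup>2 + e\<^sup>2) powr (a - 1))"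
    have "(g has_real_derivative g' x) (at x)" for x
    proof -
      have "(x\<^sup>2 + e\<^sup>2) powr a = (x\<^sup>2 + e\<^sup>2) * (x\<^sup>2 + e\<^sup>2) powr (a - 1)"
        using pos[of x] by (simp add: powr_diff)
      then show ?thesis unfolding g q_def g'_def
        using pos[of x] by (auto intro!: derivative_eq_intros simp: algebra_simps power2_eq_square)
    qed
    moreover have "g' \<in> A" unfolding A_def g'_def by blast
    ultimately show ?thesis by blast
  qed
  ultimately show ?thesis by (rule smooth_realI)
qed

section \<open>Functions of compact support and test functions\<close>

lemma continuous_compact_support_bounded:
  fixes f :: "'a::euclidean_space \<Rightarrow> 'b::euclidean_space"
  assumes "continuous_on UNIV f" "compact S" "\<And>x. x \<notin> S \<Longrightarrow> f x = 0"
  obtains C where "0 \<le> C" "\<And>x. norm (f x) \<le> C * indicator S x"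
proof -
  have "bounded (f ` S)"
    using compact_imp_bounded[OF compact_continuous_image[OF continuous_on_subset[OF assms(1) subset_UNIV] assms(2)]] .
  then obtain C where "\<forall>x\<in>S. norm (f x) \<le> C" by (auto simp: bounded_iff)
  then have "norm (f x) \<le> max C 0 * indicator S x" for x
    using assms(3)[of x] by (cases "x \<in> S") (auto simp: le_max_iff_disj)
  then show ?thesis using that[of "max C 0"] by auto
qed

lemma continuous_compact_support_sqint:
  fixes f :: "'a::euclidean_space \<Rightarrow> 'b::euclidean_space"
  assumes f: "continuous_on UNIV f" and S: "compact S" "\<And>x. x \<notin> S \<Longrightarrow> f x = 0"
  shows "integrable lborel f" "sqint f"
proof -
  have [measurable]: "f \<in> borel_measurable borel" using f by (rule borel_measurable_continuous_onI)
  have *: "integrable lborel g" if "continuous_on UNIV g" "\<And>x. x \<notin> S \<Longrightarrow> g x = 0"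
    for g :: "'a \<Rightarrow> 'c::euclidean_space"
  proof -
    have "integrable lborel (\<lambda>x. indicator S x *\<^sub>R g x)"
      using S that by (intro borel_integrable_compact) (auto intro: continuous_on_subset)
    moreover have "(\<lambda>x. indicator S x *\<^sub>R g x) = g"
      using that(2) by (auto simp: indicator_def)
    ultimately show ?thesis by simp
  qed
  show "integrable lborel f" using * f S by blast
  have "integrable lborel (\<lambda>x. (norm (f x))\<^sup>2)"
    using S f by (intro *) (auto intro!: continuous_intros)
  then show "sqint f" by (simp add: sqint_def)
qed

lemma test_funI:
  assumes "smooth f" "compact S" "S \<subseteq> \<Omega>" "\<And>x. f x \<noteq> 0 \<Longrightarrow> x \<in> S"
  shows "test_fun \<Omega> f"
proof -
  have "tsupp f \<subseteq> S" unfolding tsupp_def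
    using assms by (intro closure_minimal) (auto intro: compact_imp_closed)
  moreover have "compact (tsupp f)"
    using compact_Int_closed[OF assms(2), of "tsupp f"] calculation
    by (simp add: tsupp_def Int_absorb1)
  ultimately show ?thesis using assms unfolding test_fun_def by blast
qed

lemma test_fun_smooth: "test_fun \<Omega> f \<Longrightarrow> smooth f"
  and test_fun_compact: "test_fun \<Omega> f \<Longrightarrow> compact (tsupp f)"
  and test_fun_subset: "test_fun \<Omega> f \<Longrightarrow> tsupp f \<subseteq> \<Omega>"
  by (simp_all add: test_fun_def)

lemma zero_off_tsupp: "x \<notin> tsupp f \<Longrightarrow> f x = 0"
  using closure_subset[of "{x. f x \<noteq> 0}"] by (auto simp: tsupp_def)

lemma test_fun_off: "test_fun \<Omega> f \<Longrightarrow> x \<notin> \<Omega> \<Longrightarrow> f x = 0"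
  using zero_off_tsupp test_fun_subset by blast

lemma pd_off_tsupp:
  assumes "x \<notin> tsupp f" shows "pd b f x = 0"
proof -
  have "((\<lambda>x. 0) has_derivative (\<lambda>h. 0::real)) (at x)" by simp
  then have "(f has_derivative (\<lambda>h. 0)) (at x)"
    by (rule has_derivative_transform_within_open[of _ _ _ _ "- tsupp f"])
      (use assms zero_off_tsupp in \<open>auto simp: tsupp_def open_Compl\<close>)
  then show ?thesis by (rule pd_eqI)
qed

lemma grad_off_tsupp: "x \<notin> tsupp f \<Longrightarrow> grad f x = 0"
  by (simp add: grad_def pd_off_tsupp)

lemma test_fun_pd: "test_fun \<Omega> f \<Longrightarrow> b \<in> Basis \<Longrightarrow> test_fun \<Omega> (pd b f)"
  by (rule test_funI[of _ "tsupp f"]) (use pd_off_tsupp in \<open>auto simp: test_fun_def smooth_pd\<close>)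

lemma test_fun_zero: "test_fun \<Omega> (\<lambda>x. 0)"
  by (rule test_funI[of _ "{}"]) (auto intro: smooth_const)

lemma test_fun_add: "test_fun \<Omega> f \<Longrightarrow> test_fun \<Omega> g \<Longrightarrow> test_fun \<Omega> (\<lambda>x. f x + g x)"
  by (rule test_funI[of _ "tsupp f \<union> tsupp g"])
    (auto simp: test_fun_def intro: smooth_add compact_Un, metis add_0_right zero_off_tsupp)

lemma test_fun_mult: "test_fun \<Omega> f \<Longrightarrow> smooth g \<Longrightarrow> test_fun \<Omega> (\<lambda>x. g x * f x)"
  by (rule test_funI[of _ "tsupp f"])
    (auto simp: test_fun_def intro: smooth_mult zero_off_tsupp)

lemma test_fun_compose:
  "test_fun \<Omega> f \<Longrightarrow> smooth (h::real \<Rightarrow> real) \<Longrightarrow> h 0 = 0 \<Longrightarrow> test_fun \<Omega> (\<lambda>x. h (f x))"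
  by (rule test_funI[of _ "tsupp f"])
    (auto simp: test_fun_def intro: smooth_compose, metis zero_off_tsupp)

lemma grad_eqI:
  assumes "(f has_derivative (\<lambda>h. v \<bullet> h)) (at x)" shows "grad f x = v"
  using has_derivative_imp_grad[OF assms] by (metis vector_eq_rdot inner_commute)

lemma grad_add: "smooth f \<Longrightarrow> smooth g \<Longrightarrow> grad (\<lambda>x. f x + g x) x = grad f x + grad g x"
  by (rule grad_eqI)
    (auto simp: inner_add_left intro!: has_derivative_add has_derivative_grad smooth_differentiable)

lemma grad_cmult: "smooth f \<Longrightarrow> grad (\<lambda>x. c * f x) x = c *\<^sub>R grad f x"
  by (rule grad_eqI)
    (auto intro!: has_derivative_mult_right has_derivative_grad smooth_differentiable)

lemma grad_mult: "smooth f \<Longrightarrow> smooth g \<Longrightarrow> grad (\<lambda>x. f x * g x) x = f x *\<^sub>R grad g x + g x *\<^sub>R grad f x"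
proof (rule grad_eqI)
  assume "smooth f" "smooth g"
  then show "((\<lambda>x. f x * g x) has_derivative (\<bullet>) (f x *\<^sub>R grad g x + g x *\<^sub>R grad f x)) (at x)"
    by (auto intro!: has_derivative_eq_rhs[OF has_derivative_mult[OF has_derivative_grad has_derivative_grad]]
        smooth_differentiable simp: inner_add_left algebra_simps)
qed

lemma grad_compose:
  assumes "smooth f" "(h has_real_derivative h') (at (f x))"
  shows "grad (\<lambda>x. h (f x)) x = h' *\<^sub>R grad f x"
proof (rule grad_eqI)
  have "(h \<circ> f has_derivative (*) h' \<circ> (\<bullet>) (grad f x)) (at x)"
    using assms by (intro diff_chain_at has_derivative_grad smooth_differentiable)
      (auto simp: has_field_derivative_def)
  moreover have "(*) h' \<circ> (\<bullet>) (grad f x) = (\<bullet>) (h' *\<^sub>R grad f x)" by auto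
  ultimately show "((\<lambda>x. h (f x)) has_derivative (\<bullet>) (h' *\<^sub>R grad f x)) (at x)"
    by (simp only: o_def)
qed

lemma test_fun_sqint: "test_fun \<Omega> f \<Longrightarrow> sqint f"
  and test_fun_integrable: "test_fun \<Omega> f \<Longrightarrow> integrable lborel f"
  and test_fun_grad_sqint: "test_fun \<Omega> f \<Longrightarrow> sqint (grad f)"
  using continuous_compact_support_sqint[of f "tsupp f"] continuous_compact_support_sqint[of "grad f" "tsupp f"]
  by (auto simp: test_fun_def smooth_continuous smooth_continuous_grad zero_off_tsupp grad_off_tsupp)

section \<open>Difference quotients, integration by parts and translations\<close>

lemma diff_quotient_tendsto:
  assumes "smooth f"
  shows "(\<lambda>n. real (Suc n) * (f (x + h /\<^sub>R real (Suc n)) - f x)) \<longlonglongrightarrow> grad f x \<bullet> h"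
proof -
  have "((\<lambda>t. f (x + t *\<^sub>R h)) has_derivative (\<lambda>t. grad f (x + 0 *\<^sub>R h) \<bullet> (t *\<^sub>R h))) (at 0)"
    by (rule has_derivative_compose[of "\<lambda>t. x + t *\<^sub>R h" _ _ _ f])
      (auto intro!: derivative_eq_intros has_derivative_grad smooth_differentiable assms)
  then have "((\<lambda>t. f (x + t *\<^sub>R h)) has_real_derivative grad f x \<bullet> h) (at 0)"
    by (simp add: has_field_derivative_def mult.commute[of _ "grad f x \<bullet> h"])
  then have "((\<lambda>t. (f (x + t *\<^sub>R h) - f x) / t) \<longlongrightarrow> grad f x \<bullet> h) (at 0)"
    by (simp add: DERIV_def)
  moreover have "filterlim (\<lambda>n. inverse (real (Suc n))) (at 0) sequentially"
    unfolding filterlim_at using LIMSEQ_inverse_real_of_nat by (auto intro: always_eventually)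
  ultimately have "(\<lambda>n. (f (x + inverse (real (Suc n)) *\<^sub>R h) - f x) / inverse (real (Suc n))) \<longlonglongrightarrow> grad f x \<bullet> h"
    by (rule filterlim_compose)
  then show ?thesis by (simp add: field_simps)
qed

text \<open>The majorant for passing to the limit under integrals. The mean value inequality bounds
  the size, and since every step h/(n+1) is no longer than h, all quotients live on the support of f
  thickened by |h|, which is compact.\<close>

lemma diff_quotient_bound:
  assumes f: "test_fun \<Omega> f"
  obtains C S where "0 \<le> C" "compact S"
    "\<And>n x. \<bar>real (Suc n) * (f (x + h /\<^sub>R real (Suc n)) - f x)\<bar> \<le> C * indicator S x"
    "\<And>x. \<bar>grad f x \<bullet> h\<bar> \<le> C * indicator S x"
proof -
  have sm: "smooth f" using f test_fun_smooth by blast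
  obtain C where C: "0 \<le> C" "\<And>x. norm (grad f x) \<le> C * indicator (tsupp f) x"
    using continuous_compact_support_bounded[of "grad f" "tsupp f"] f
    by (auto simp: test_fun_def smooth_continuous_grad grad_off_tsupp)
  then have C': "norm (grad f x) \<le> C" for x
    by (smt (verit, best) indicator_eq_0_iff indicator_eq_1_iff mult_cancel_left2 mult_eq_0_iff)
  define S where "S = {x - y | x y. x \<in> tsupp f \<and> y \<in> cball 0 (norm h)}"
  have S: "compact S" unfolding S_def using f by (intro compact_differences) (auto simp: test_fun_def)
  have sub: "tsupp f \<subseteq> S" unfolding S_def by force
  have lip: "\<bar>f (x + k) - f x\<bar> \<le> C * norm k" for x k
  proof -
    have "norm (f (x + k) - f x) \<le> C * norm ((x + k) - x)"
    proof (rule differentiable_bound[of UNIV f "\<lambda>x h. grad f x \<bullet> h"])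
      show "(f has_derivative (\<bullet>) (grad f x)) (at x within UNIV)" for x
        using has_derivative_grad smooth_differentiable sm by auto
      show "onorm ((\<bullet>) (grad f x)) \<le> C" for x
      proof (rule onorm_le)
        fix y
        have "\<bar>grad f x \<bullet> y\<bar> \<le> norm (grad f x) * norm y" by (rule Cauchy_Schwarz_ineq2)
        also have "\<dots> \<le> C * norm y" using C' by (intro mult_right_mono) auto
        finally show "norm (grad f x \<bullet> y) \<le> C * norm y" by simp
      qed
    qed auto
    then show ?thesis by simp
  qed
  have "\<bar>real (Suc n) * (f (x + h /\<^sub>R real (Suc n)) - f x)\<bar> \<le> (C * norm h) * indicator S x" for n x
  proof (cases "x \<in> S")
    case True
    have "\<bar>real (Suc n) * (f (x + h /\<^sub>R real (Suc n)) - f x)\<bar> \<le> real (Suc n) * (C * norm (h /\<^sub>R real (Suc n)))"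
      unfolding abs_mult using lip[of x "h /\<^sub>R real (Suc n)"] by (intro mult_mono) (simp_all del: norm_scaleR)
    also have "\<dots> = C * norm h" by simp
    finally show ?thesis using True by simp
  next
    case False
    have "norm (h /\<^sub>R real (Suc n)) \<le> norm h"
      by (simp add: divide_simps mult_le_cancel_left1)
    then have "x + h /\<^sub>R real (Suc n) \<notin> tsupp f"
      using False unfolding S_def by (metis (mono_tags, lifting) add_diff_cancel_right' mem_Collect_eq mem_cball_0)
    moreover have "x \<notin> tsupp f" using False sub by blast
    ultimately show ?thesis using False by (simp add: zero_off_tsupp)
  qed
  moreover have "\<bar>grad f x \<bullet> h\<bar> \<le> (C * norm h) * indicator S x" for x
  proof (cases "x \<in> S")
    case True
    have "\<bar>grad f x \<bullet> h\<bar> \<le> norm (grad f x) * norm h" by (rule Cauchy_Schwarz_ineq2)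
    then show ?thesis using True C'[of x] by (simp add: mult_right_mono order_trans)
  next
    case False
    then have "grad f x = 0" using sub grad_off_tsupp by blast
    then show ?thesis using False by simp
  qed
  ultimately show ?thesis using that[of "C * norm h" S] S C(1) by simp
qed

lemma integral_translate:
  fixes f :: "'a::euclidean_space \<Rightarrow> 'b::euclidean_space"
  assumes "f \<in> borel_measurable borel"
  shows "(\<integral>x. f (x + h) \<partial>lborel) = (\<integral>x. f x \<partial>lborel)"
    and "integrable lborel (\<lambda>x. f (x + h)) \<longleftrightarrow> integrable lborel f"
proof -
  have "(\<integral>x. f x \<partial>lborel) = (\<integral>x. f x \<partial>distr lborel borel ((+) h))"
    by (simp add: lborel_distr_plus)
  also have "\<dots> = (\<integral>x. f (h + x) \<partial>lborel)"
    using assms by (intro integral_distr) auto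
  finally show "(\<integral>x. f (x + h) \<partial>lborel) = (\<integral>x. f x \<partial>lborel)" by (simp add: add.commute)
  have "integrable (distr lborel borel ((+) h)) f \<longleftrightarrow> integrable lborel (\<lambda>x. f (h + x))"
    using assms by (intro integrable_distr_eq) auto
  then show "integrable lborel (\<lambda>x. f (x + h)) \<longleftrightarrow> integrable lborel f"
    by (simp add: lborel_distr_plus add.commute)
qed

lemma AE_translate:
  assumes "AE x in lborel. P x" shows "AE x in lborel. P (x + h :: 'a::euclidean_space)"
proof -
  have "AE x in distr lborel borel ((+) h). P x"
    unfolding lborel_distr_plus by (rule assms)
  then have "AE x in lborel. P (h + x)" by (rule AE_distrD[rotated]) simp
  then show ?thesis by (simp add: add.commute)
qed

text \<open>Each difference quotient has integral 0 by translation invariance, and dominated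
  convergence carries this to the directional derivative.\<close>

lemma integral_grad_zero:
  assumes f: "test_fun \<Omega> f" shows "(\<integral>x. grad f x \<bullet> h \<partial>lborel) = 0"
proof -
  obtain C S where CS: "0 \<le> C" "compact S"
    "\<And>n x. \<bar>real (Suc n) * (f (x + h /\<^sub>R real (Suc n)) - f x)\<bar> \<le> C * indicator S x"
    "\<And>x. \<bar>grad f x \<bullet> h\<bar> \<le> C * indicator S x"
    using diff_quotient_bound[OF f] by blast
  have sm: "smooth f" using f test_fun_smooth by blast
  have [measurable]: "f \<in> borel_measurable borel" "grad f \<in> borel_measurable borel"
    using sm by (auto intro: borel_measurable_continuous_onI smooth_continuous smooth_continuous_grad)
  have [measurable]: "S \<in> sets borel" using CS(2) by (simp add: borel_compact)
  have intf: "integrable lborel f" using f test_fun_integrable by blast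
  have "(\<lambda>n. \<integral>x. real (Suc n) * (f (x + h /\<^sub>R real (Suc n)) - f x) \<partial>lborel) \<longlonglongrightarrow> (\<integral>x. grad f x \<bullet> h \<partial>lborel)"
  proof (rule integral_dominated_convergence[where w="\<lambda>x. C * indicator S x"])
    show "integrable lborel (\<lambda>x. C * indicator S x)"
      using CS(2) emeasure_compact_finite[of S] by (intro integrable_mult_right integrable_real_indicator) auto
    show "AE x in lborel. (\<lambda>n. real (Suc n) * (f (x + h /\<^sub>R real (Suc n)) - f x)) \<longlonglongrightarrow> grad f x \<bullet> h"
      using diff_quotient_tendsto[OF sm] by auto
    show "AE x in lborel. norm (real (Suc n) * (f (x + h /\<^sub>R real (Suc n)) - f x)) \<le> C * indicator S x" for n
      using CS(3)[of n] by simp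
  qed auto
  moreover have "(\<integral>x. real (Suc n) * (f (x + h /\<^sub>R real (Suc n)) - f x) \<partial>lborel) = 0" for n
    using integral_translate[of f "h /\<^sub>R real (Suc n)"] intf by simp
  ultimately show ?thesis using LIMSEQ_unique[OF _ tendsto_const] by fastforce
qed

lemma integral_by_parts:
  assumes f: "test_fun \<Omega> f" and g: "test_fun \<Omega>' g"
  shows "(\<integral>x. f x * (grad g x \<bullet> h) \<partial>lborel) = - (\<integral>x. (grad f x \<bullet> h) * g x \<partial>lborel)"
proof -
  have sm: "smooth f" "smooth g" using f g test_fun_smooth by auto
  have "test_fun \<Omega>' (\<lambda>x. f x * g x)" using test_fun_mult g sm by blast
  from integral_grad_zero[OF this, of h]
  have 0: "(\<integral>x. f x * (grad g x \<bullet> h) + (grad f x \<bullet> h) * g x \<partial>lborel) = 0"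
    using sm by (simp add: grad_mult inner_add_left mult.commute)
  have sq: "sqint f" "sqint g" "sqint (grad f)" "sqint (grad g)"
    using f g by (auto intro: test_fun_sqint test_fun_grad_sqint)
  have sqi: "sqint (\<lambda>x. u x \<bullet> h)" if "sqint u" for u :: "'a \<Rightarrow> 'a"
    using sqint_measurable[OF that] Cauchy_Schwarz_ineq2[of "u x" h for x]
    by (intro sqint_bound[OF that, of _ "norm h"]) (auto simp: mult.commute)
  have "integrable lborel (\<lambda>x. f x * (grad g x \<bullet> h))" "integrable lborel (\<lambda>x. (grad f x \<bullet> h) * g x)"
    using sqint_inner[OF sq(1) sqi[OF sq(4)]] sqint_inner[OF sqi[OF sq(3)] sq(2)] by auto
  then show ?thesis using 0 by simp
qed

lemma sqint_translate: "sqint f \<Longrightarrow> sqint (\<lambda>x. f (x + h))"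
  unfolding sqint_def using integral_translate(2)[of "\<lambda>x. (norm (f x))\<^sup>2" h] by auto

definition tau :: "'a::euclidean_space \<Rightarrow> ('a, 'b::euclidean_space) l2 \<Rightarrow> ('a, 'b) l2" where
  "tau h u = abs_l2 (\<lambda>x. rep_l2 u (x + h))"

lemma tau_abs: assumes "sqint f" shows "tau h (abs_l2 f) = abs_l2 (\<lambda>x. f (x + h))"
  unfolding tau_def
  using AE_translate[OF rep_abs_l2[OF assms]] assms sqint_rep by (subst abs_l2_eq_iff) (auto intro: sqint_translate)

lemma rep_tau: "AE x in lborel. rep_l2 (tau h u) x = rep_l2 u (x + h)"
  unfolding tau_def by (rule rep_abs_l2) (auto intro: sqint_translate)

lemma norm_tau [simp]: "norm (tau h u) = norm u"
proof -
  have "(norm (tau h u))\<^sup>2 = (\<integral>x. (norm (rep_l2 u (x + h)))\<^sup>2 \<partial>lborel)"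
    unfolding tau_def by (intro norm_abs_l2 sqint_translate sqint_rep)
  also have "\<dots> = (norm u)\<^sup>2"
    using integral_translate(1)[of "\<lambda>x. (norm (rep_l2 u x))\<^sup>2" h] by (simp add: norm_l2_rep)
  finally show ?thesis by simp
qed

lemma tau_diff: "tau h (u - v) = tau h u - tau h v"
proof -
  have "tau h (abs_l2 (\<lambda>x. rep_l2 u x - rep_l2 v x)) = tau h u - tau h v"
    by (subst tau_abs) (auto simp: tau_def abs_l2_diff sqint_translate sqint_diff)
  then show ?thesis by (simp flip: abs_l2_diff)
qed

lemma tau_tau: "tau h (tau k u) = tau (h + k) u"
  unfolding tau_def[of k] by (simp add: tau_abs sqint_translate) (simp add: tau_def add.assoc)

lemma tau_0 [simp]: "tau 0 u = u"
  by (simp add: tau_def)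

lemma continuous_tau: "continuous_on UNIV (tau h)"
  by (rule continuous_onI) (metis dist_norm norm_tau tau_diff less_eq_real_def)

text \<open>By the triangle inequality a shift by \<open>h\<close> costs at most \<open>n\<close> shifts by \<open>h/n\<close>, and the
  rescaled small shifts converge to the directional derivative.\<close>
lemma norm_tau_diff_le_grad:
  assumes f: "test_fun \<Omega> f"
  shows "norm (tau h (abs_l2 f) - abs_l2 f) \<le> norm h * norm (abs_l2 (grad f))"
proof -
  let ?u = "abs_l2 f"
  have sq: "sqint f" "sqint (grad f)" using f by (auto intro: test_fun_sqint test_fun_grad_sqint)
  have step: "norm (tau (real n *\<^sub>R k) ?u - ?u) \<le> real n * norm (tau k ?u - ?u)" for n k
  proof (induction n)
    case (Suc n)
    have "tau (real (Suc n) *\<^sub>R k) ?u - ?u = tau k (tau (real n *\<^sub>R k) ?u - ?u) + (tau k ?u - ?u)"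
      by (simp add: tau_diff tau_tau scaleR_add_left)
    also have "norm \<dots> \<le> norm (tau (real n *\<^sub>R k) ?u - ?u) + norm (tau k ?u - ?u)"
      by (metis norm_tau norm_triangle_ineq)
    finally show ?case using Suc by (simp add: algebra_simps)
  qed simp
  define q where "q n x = real (Suc n) * (f (x + h /\<^sub>R real (Suc n)) - f x)" for n x
  obtain C S where CS: "0 \<le> C" "compact S" "\<And>n x. \<bar>q n x\<bar> \<le> C * indicator S x"
    "\<And>x. \<bar>grad f x \<bullet> h\<bar> \<le> C * indicator S x"
    using diff_quotient_bound[OF f, of h] unfolding q_def by blast
  have sm: "smooth f" using f test_fun_smooth by blast
  have [measurable]: "f \<in> borel_measurable borel" "grad f \<in> borel_measurable borel"
    using sq sqint_measurable by auto
  have [measurable]: "S \<in> sets borel" using CS(2) by (simp add: borel_compact)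
  have le: "(norm (tau h ?u - ?u))\<^sup>2 \<le> (\<integral>x. (q n x)\<^sup>2 \<partial>lborel)" for n
  proof -
    let ?k = "h /\<^sub>R real (Suc n)"
    have "norm (tau h ?u - ?u) \<le> real (Suc n) * norm (tau ?k ?u - ?u)"
      using step[of "Suc n" ?k] by (simp del: of_nat_Suc)
    then have "(norm (tau h ?u - ?u))\<^sup>2 \<le> (real (Suc n))\<^sup>2 * (norm (tau ?k ?u - ?u))\<^sup>2"
      by (metis norm_ge_zero power_mono power_mult_distrib)
    also have "\<dots> = (\<integral>x. (real (Suc n))\<^sup>2 * (norm (f (x + ?k) - f x))\<^sup>2 \<partial>lborel)"
      using sq(1) by (simp add: tau_abs abs_l2_diff sqint_translate norm_abs_l2 sqint_diff del: of_nat_Suc)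
    also have "\<dots> = (\<integral>x. (q n x)\<^sup>2 \<partial>lborel)"
      by (simp add: q_def power_mult_distrib del: of_nat_Suc)
    finally show ?thesis .
  qed
  have "(\<lambda>n. \<integral>x. (q n x)\<^sup>2 \<partial>lborel) \<longlonglongrightarrow> (\<integral>x. (grad f x \<bullet> h)\<^sup>2 \<partial>lborel)"
  proof (rule integral_dominated_convergence[where w="\<lambda>x. C\<^sup>2 * indicator S x"])
    show "integrable lborel (\<lambda>x. C\<^sup>2 * indicator S x)"
      using CS(2) emeasure_compact_finite[of S] by (intro integrable_mult_right integrable_real_indicator) auto
    show "AE x in lborel. (\<lambda>n. (q n x)\<^sup>2) \<longlonglongrightarrow> (grad f x \<bullet> h)\<^sup>2"
      using diff_quotient_tendsto[OF sm, of _ h] unfolding q_def by (auto intro!: tendsto_power)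
    show "AE x in lborel. norm ((q n x)\<^sup>2) \<le> C\<^sup>2 * indicator S x" for n
    proof (rule AE_I2)
      fix x
      have "\<bar>q n x\<bar>\<^sup>2 \<le> (C * indicator S x)\<^sup>2" using CS(3)[of n x] by (intro power_mono) auto
      then show "norm ((q n x)\<^sup>2) \<le> C\<^sup>2 * indicator S x"
        by (cases "x \<in> S") (auto simp: power_mult_distrib)
    qed
  qed (auto simp: q_def)
  then have "(norm (tau h ?u - ?u))\<^sup>2 \<le> (\<integral>x. (grad f x \<bullet> h)\<^sup>2 \<partial>lborel)"
    using le by (intro LIMSEQ_le_const) auto
  also have "\<dots> \<le> (\<integral>x. (norm h)\<^sup>2 * (norm (grad f x))\<^sup>2 \<partial>lborel)"
  proof (rule integral_mono')
    show "integrable lborel (\<lambda>x. (norm h)\<^sup>2 * (norm (grad f x))\<^sup>2)"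
      using sq(2) sqint_integrable by auto
    show "(grad f x \<bullet> h)\<^sup>2 \<le> (norm h)\<^sup>2 * (norm (grad f x))\<^sup>2" for x
      using Cauchy_Schwarz_ineq[of "grad f x" h] by (simp add: power2_norm_eq_inner mult.commute)
  qed auto
  also have "\<dots> = (norm h * norm (abs_l2 (grad f)))\<^sup>2"
    using sq(2) by (simp add: norm_abs_l2 power_mult_distrib)
  finally show ?thesis by (rule power2_le_imp_le) simp
qed

subsection \<open>The Dirichlet resolvent\<close>

text \<open>Minimize |v|^2 - 2 l v over S. The parallelogram identity makes a minimizing sequence
  Cauchy, and the first variation at the minimizer is the representation formula.\<close>

lemma riesz_closed_subspace:
  fixes S :: "'h::{real_inner, complete_space} set" and l :: "'h \<Rightarrow> real"
  assumes S: "subspace S" "closed S" and l: "bounded_linear l"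
  shows "\<exists>w\<in>S. \<forall>v\<in>S. l v = w \<bullet> v"
proof -
  interpret l: bounded_linear l by fact
  obtain B where B: "\<And>x. norm (l x) \<le> norm x * B" using l.bounded by blast
  define J where "J v = (norm v)\<^sup>2 - 2 * l v" for v
  have J_ge: "- B\<^sup>2 \<le> J v" for v
  proof -
    have "l v \<le> norm v * B" using B[of v] by simp
    moreover have "0 \<le> (norm v - B)\<^sup>2" by simp
    ultimately show ?thesis by (simp add: J_def power2_diff)
  qed
  define m where "m = Inf (J ` S)"
  have bdd: "bdd_below (J ` S)" using J_ge by (auto intro!: bdd_belowI2)
  have ne: "J ` S \<noteq> {}" using S(1) subspace_0 by auto
  have m_le: "m \<le> J v" if "v \<in> S" for v
    unfolding m_def using bdd that by (intro cInf_lower) auto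
  have "\<exists>v\<in>S. J v < m + 1 / real (Suc n)" for n
    using cInf_lessD[OF ne, of "m + 1 / real (Suc n)"] unfolding m_def by auto
  then obtain v where v: "\<And>n. v n \<in> S" "\<And>n. J (v n) < m + 1 / real (Suc n)" by metis
  have par: "(norm (v n - v k))\<^sup>2 < 2 * (1 / real (Suc n)) + 2 * (1 / real (Suc k))" for n k
  proof -
    have "(1/2) *\<^sub>R (v n + v k) \<in> S" using S(1) v(1) subspace_add subspace_scale by blast
    then have "m \<le> J ((1/2) *\<^sub>R (v n + v k))" by (rule m_le)
    moreover have "(norm (v n - v k))\<^sup>2 = 2 * J (v n) + 2 * J (v k) - 4 * J ((1/2) *\<^sub>R (v n + v k))"
      by (simp add: J_def power2_norm_eq_inner l.add l.scaleR inner_add_left inner_add_right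
          inner_diff_left inner_diff_right inner_commute power_mult_distrib field_simps)
    ultimately show ?thesis using v(2)[of n] v(2)[of k] by linarith
  qed
  have "Cauchy v"
  proof (rule metric_CauchyI)
    fix e :: real assume "0 < e"
    then obtain M where M: "4 / e\<^sup>2 < real M" using reals_Archimedean2 by blast
    have "dist (v n) (v k) < e" if "n \<ge> M" "k \<ge> M" for n k
    proof -
      have "0 < 4 / e\<^sup>2" using \<open>0 < e\<close> by simp
      then have M0: "0 < real M" using M by linarith
      have "1 / real (Suc n) \<le> 1 / real M" "1 / real (Suc k) \<le> 1 / real M"
        using that M0 by (auto intro!: frac_le)
      moreover have "4 * (1 / real M) < e\<^sup>2"
        using M M0 \<open>0 < e\<close> by (simp add: field_simps)
      ultimately have "(norm (v n - v k))\<^sup>2 < e\<^sup>2" using par[of n k] by linarith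
      then show ?thesis using \<open>0 < e\<close> by (simp add: dist_norm power_less_imp_less_base)
    qed
    then show "\<exists>M. \<forall>n\<ge>M. \<forall>k\<ge>M. dist (v n) (v k) < e" by blast
  qed
  then obtain w where w: "v \<longlonglongrightarrow> w" using Cauchy_convergent convergent_def by blast
  have wS: "w \<in> S" using S(2) v(1) w closed_sequential_limits by blast
  have "(\<lambda>n. J (v n)) \<longlonglongrightarrow> J w"
    unfolding J_def by (intro tendsto_intros w l.tendsto)
  moreover have "(\<lambda>n. m + 1 / real (Suc n)) \<longlonglongrightarrow> m + 0"
    by (intro tendsto_intros LIMSEQ_Suc[OF lim_1_over_n])
  ultimately have "J w \<le> m + 0"
    by (rule LIMSEQ_le) (use v(2) less_imp_le in blast)
  then have min: "J w \<le> J u" if "u \<in> S" for u using m_le[OF that] by simp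
  have "l u = w \<bullet> u" if u: "u \<in> S" for u
  proof (cases "u = 0")
    case False
    define d where "d = l u - w \<bullet> u"
    \<comment> \<open>The minimizer of the quadratic t |-> J (w + t u) - J w = - 2 t d + t^2 |u|^2;
      the minimum is negative unless d = 0.\<close>
    define t where "t = d / (norm u)\<^sup>2"
    have nz: "(norm u)\<^sup>2 \<noteq> 0" using False by simp
    have "w + t *\<^sub>R u \<in> S" using S(1) wS u subspace_add subspace_scale by blast
    then have "J w \<le> J (w + t *\<^sub>R u)" by (rule min)
    moreover have "J (w + t *\<^sub>R u) = J w - 2 * t * d + t\<^sup>2 * (norm u)\<^sup>2"
      unfolding J_def d_def power2_norm_eq_inner
      by (simp add: l.add l.scaleR inner_add_left inner_add_right
          inner_commute algebra_simps power2_eq_square)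
    ultimately have "2 * t * d \<le> t\<^sup>2 * (norm u)\<^sup>2" by simp
    moreover have "t * d = d\<^sup>2 / (norm u)\<^sup>2" "t\<^sup>2 * (norm u)\<^sup>2 = d\<^sup>2 / (norm u)\<^sup>2"
      using nz by (simp_all add: t_def power2_eq_square)
    ultimately have "d\<^sup>2 / (norm u)\<^sup>2 \<le> 0" by simp
    then have "d = 0" using nz by (simp add: divide_le_0_iff)
    then show ?thesis by (simp add: d_def)
  qed (simp add: l.zero)
  then show ?thesis using wS by blast
qed

lemma subspace_closure_normed:
  fixes S :: "'h::real_normed_vector set"
  assumes "subspace S" shows "subspace (closure S)"
proof (rule subspaceI)
  show "0 \<in> closure S" using assms subspace_0 closure_subset by blast
next
  fix x y assume "x \<in> closure S" "y \<in> closure S"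
  then obtain f g where "\<And>n. f n \<in> S" "f \<longlonglongrightarrow> x" "\<And>n. g n \<in> S" "g \<longlonglongrightarrow> y"
    unfolding closure_sequential by blast
  then show "x + y \<in> closure S" unfolding closure_sequential
    by (intro exI[of _ "\<lambda>n. f n + g n"]) (auto intro: tendsto_add subspace_add[OF assms])
next
  fix c and x assume "x \<in> closure S"
  then obtain f where "\<And>n. f n \<in> S" "f \<longlonglongrightarrow> x"
    unfolding closure_sequential by blast
  then show "c *\<^sub>R x \<in> closure S" unfolding closure_sequential
    by (intro exI[of _ "\<lambda>n. c *\<^sub>R f n"]) (auto intro: tendsto_scaleR subspace_scale[OF assms])
qed

lemma norm_abs_l2_mono:
  assumes "sqint f" "sqint g" "AE x in lborel. norm (f x) \<le> norm (g x)"
  shows "norm (abs_l2 f) \<le> norm (abs_l2 g)"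
proof -
  have "(norm (abs_l2 f))\<^sup>2 \<le> (norm (abs_l2 g))\<^sup>2"
    unfolding norm_abs_l2[OF assms(1)] norm_abs_l2[OF assms(2)]
    using assms(3) by (intro integral_mono_AE sqint_integrable assms) (auto elim!: eventually_mono intro: power_mono)
  then show ?thesis by (rule power2_le_imp_le) simp
qed

text \<open>Test against the part w of the limit that lies outside A: it is orthogonal to every
  member of the sequence, hence to the limit, whose product with w is |w|^2.\<close>

lemma closed_l2_support:
  assumes A: "A \<in> sets borel"
  shows "closed {u :: ('a::euclidean_space, 'b::euclidean_space) l2. AE x in lborel. x \<notin> A \<longrightarrow> rep_l2 u x = 0}"
  unfolding closed_sequential_limits
proof (intro allI impI, elim conjE)
  fix U :: "nat \<Rightarrow> ('a, 'b) l2" and u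
  assume U: "\<forall>n. U n \<in> {u. AE x in lborel. x \<notin> A \<longrightarrow> rep_l2 u x = 0}" and lim: "U \<longlonglongrightarrow> u"
  define w where "w x = indicator (- A) x *\<^sub>R rep_l2 u x" for x
  have [measurable]: "A \<in> sets borel" by fact
  have w: "sqint w" unfolding w_def[abs_def]
    by (rule sqint_bound[OF sqint_rep[of u], of _ 1]) (auto simp: indicator_def)
  have "U n \<bullet> abs_l2 w = 0" for n
  proof -
    have "AE x in lborel. x \<notin> A \<longrightarrow> rep_l2 (U n) x = 0" using U by auto
    then have "AE x in lborel. rep_l2 (U n) x \<bullet> w x = 0"
      by eventually_elim (auto simp: w_def indicator_def)
    then show ?thesis
      unfolding inner_l2_rep_abs[OF w] by (rule integral_eq_zero_AE)
  qed
  moreover have "(\<lambda>n. U n \<bullet> abs_l2 w) \<longlonglongrightarrow> u \<bullet> abs_l2 w" by (intro tendsto_intros lim)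
  ultimately have "u \<bullet> abs_l2 w = 0" using LIMSEQ_unique[OF _ tendsto_const] by fastforce
  moreover have "rep_l2 u x \<bullet> w x = (norm (w x))\<^sup>2" for x
    by (cases "x \<in> A") (auto simp: w_def power2_norm_eq_inner)
  ultimately have "(\<integral>x. (norm (w x))\<^sup>2 \<partial>lborel) = 0"
    unfolding inner_l2_rep_abs[OF w] by simp
  then have "AE x in lborel. (norm (w x))\<^sup>2 = 0"
    using integral_nonneg_eq_0_iff_AE[OF sqint_integrable[OF w]] by auto
  then have "AE x in lborel. x \<notin> A \<longrightarrow> rep_l2 u x = 0"
    by eventually_elim (auto simp: w_def indicator_def)
  then show "u \<in> {u. AE x in lborel. x \<notin> A \<longrightarrow> rep_l2 u x = 0}" by simp
qed

text \<open>Test against the negative part w of the limit: the products with the sequence are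
  nonnegative, but the product with the limit is - |w|^2.\<close>

lemma closed_l2_nonneg:
  "closed {u :: ('a::euclidean_space, real) l2. AE x in lborel. 0 \<le> rep_l2 u x}"
  unfolding closed_sequential_limits
proof (intro allI impI, elim conjE)
  fix U :: "nat \<Rightarrow> ('a, real) l2" and u
  assume U: "\<forall>n. U n \<in> {u. AE x in lborel. 0 \<le> rep_l2 u x}" and lim: "U \<longlonglongrightarrow> u"
  define w where "w x = max (- rep_l2 u x) 0" for x
  have w: "sqint w" unfolding w_def[abs_def]
    by (rule sqint_bound[OF sqint_rep[of u], of _ 1]) auto
  have "0 \<le> U n \<bullet> abs_l2 w" for n
  proof -
    have "AE x in lborel. 0 \<le> rep_l2 (U n) x" using U by auto
    then have "AE x in lborel. 0 \<le> rep_l2 (U n) x \<bullet> w x"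
      by eventually_elim (auto simp: w_def)
    then show ?thesis
      unfolding inner_l2_rep_abs[OF w] by (rule integral_nonneg_AE)
  qed
  moreover have "(\<lambda>n. U n \<bullet> abs_l2 w) \<longlonglongrightarrow> u \<bullet> abs_l2 w" by (intro tendsto_intros lim)
  ultimately have "0 \<le> u \<bullet> abs_l2 w" by (intro LIMSEQ_le_const) auto
  moreover have "u \<bullet> abs_l2 w = - (\<integral>x. (norm (w x))\<^sup>2 \<partial>lborel)"
    unfolding inner_l2_rep_abs[OF w] integral_minus[symmetric]
    by (intro Bochner_Integration.integral_cong) (auto simp: w_def max_def power2_eq_square)
  moreover have "0 \<le> (\<integral>x. (norm (w x))\<^sup>2 \<partial>lborel)"
    by (rule Bochner_Integration.integral_nonneg) simp
  ultimately have "(\<integral>x. (norm (w x))\<^sup>2 \<partial>lborel) = 0" by linarith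
  then have "AE x in lborel. (norm (w x))\<^sup>2 = 0"
    using integral_nonneg_eq_0_iff_AE[OF sqint_integrable[OF w]] by auto
  then have "AE x in lborel. 0 \<le> rep_l2 u x"
    by eventually_elim (auto simp: w_def)
  then show "u \<in> {u. AE x in lborel. 0 \<le> rep_l2 u x}" by simp
qed

section \<open>The Sobolev space of the Dirichlet problem and its resolvent\<close>

definition graph_grad :: "('a::euclidean_space \<Rightarrow> real) \<Rightarrow> ('a, real) l2 \<times> ('a, 'a) l2" where
  "graph_grad p = (abs_l2 p, abs_l2 (grad p))"

text \<open>The real space H^1_0, encoded as the closed graph of the gradient. The gradient is then
  the second component, and the inner product of the product space is the H^1 inner product.\<close>

definition V :: "'a::euclidean_space set \<Rightarrow> (('a, real) l2 \<times> ('a, 'a) l2) set" where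
  "V \<Omega> = closure (graph_grad ` Collect (test_fun \<Omega>))"

lemma subspace_V: "subspace (V \<Omega>)"
  unfolding V_def
proof (rule subspace_closure_normed, rule subspaceI)
  have "graph_grad (\<lambda>x. 0) = 0"
    by (simp add: graph_grad_def grad_def[abs_def] pd_def zero_prod_def abs_l2_zero)
  then show "0 \<in> graph_grad ` Collect (test_fun \<Omega>)" using test_fun_zero by (metis image_eqI mem_Collect_eq)
next
  fix x y assume "x \<in> graph_grad ` Collect (test_fun \<Omega>)" "y \<in> graph_grad ` Collect (test_fun \<Omega>)"
  then obtain p q where pq: "test_fun \<Omega> p" "test_fun \<Omega> q" "x = graph_grad p" "y = graph_grad q" by auto
  have "grad (\<lambda>x. p x + q x) = (\<lambda>x. grad p x + grad q x)"
    using pq test_fun_smooth by (intro ext grad_add) auto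
  then have "x + y = graph_grad (\<lambda>x. p x + q x)"
    using pq by (simp add: graph_grad_def abs_l2_add[symmetric] test_fun_sqint test_fun_grad_sqint)
  then show "x + y \<in> graph_grad ` Collect (test_fun \<Omega>)" using test_fun_add pq by blast
next
  fix c x assume "x \<in> graph_grad ` Collect (test_fun \<Omega>)"
  then obtain p where p: "test_fun \<Omega> p" "x = graph_grad p" by auto
  have "grad (\<lambda>x. c * p x) = (\<lambda>x. c *\<^sub>R grad p x)"
    using p test_fun_smooth by (intro ext grad_cmult) auto
  then have "c *\<^sub>R x = graph_grad (\<lambda>x. c * p x)"
    using p by (simp add: graph_grad_def abs_l2_scaleR test_fun_sqint test_fun_grad_sqint)
  then show "c *\<^sub>R x \<in> graph_grad ` Collect (test_fun \<Omega>)"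
    using test_fun_mult[OF p(1) smooth_const] by blast
qed

lemma closed_V: "closed (V \<Omega>)"
  by (simp add: V_def)

lemma graph_grad_in_V: "test_fun \<Omega> p \<Longrightarrow> graph_grad p \<in> V \<Omega>"
  unfolding V_def by (rule subsetD[OF closure_subset]) auto

lemma V_induct:
  assumes "w \<in> V \<Omega>" "closed {w. P w}" "\<And>p. test_fun \<Omega> p \<Longrightarrow> P (graph_grad p)"
  shows "P w"
proof -
  have "V \<Omega> \<subseteq> {w. P w}"
    unfolding V_def using assms(2,3) by (intro closure_minimal) auto
  then show ?thesis using assms(1) by auto
qed

lemma V_translate:
  assumes "w \<in> V \<Omega>" shows "norm (tau h (fst w) - fst w) \<le> norm h * norm (snd w)"
  using assms
proof (rule V_induct)
  show "closed {w :: ('a, real) l2 \<times> ('a, 'a) l2. norm (tau h (fst w) - fst w) \<le> norm h * norm (snd w)}"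
    by (intro closed_Collect_le continuous_intros continuous_on_compose2[OF continuous_tau]) auto
qed (auto simp: graph_grad_def norm_tau_diff_le_grad)

lemma V_support:
  assumes "w \<in> V \<Omega>" "open \<Omega>"
  shows "AE x in lborel. x \<notin> \<Omega> \<longrightarrow> rep_l2 (fst w) x = 0" "AE x in lborel. x \<notin> \<Omega> \<longrightarrow> rep_l2 (snd w) x = 0"
proof -
  have [measurable]: "\<Omega> \<in> sets borel" using assms by simp
  have cl: "closed {w :: ('a, real) l2 \<times> ('a, 'a) l2. AE x in lborel. x \<notin> \<Omega> \<longrightarrow> rep_l2 (fst w) x = 0}"
    "closed {w :: ('a, real) l2 \<times> ('a, 'a) l2. AE x in lborel. x \<notin> \<Omega> \<longrightarrow> rep_l2 (snd w) x = 0}"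
    using closed_vimage[OF closed_l2_support[of \<Omega>, where 'b=real] continuous_on_fst[OF continuous_on_id]]
      closed_vimage[OF closed_l2_support[of \<Omega>, where 'b='a] continuous_on_snd[OF continuous_on_id]]
    by (auto simp: vimage_def)
  show "AE x in lborel. x \<notin> \<Omega> \<longrightarrow> rep_l2 (fst w) x = 0"
    using assms(1)
  proof (rule V_induct[OF _ cl(1)])
    fix p assume p: "test_fun \<Omega> p"
    from rep_abs_l2[OF test_fun_sqint[OF p]]
    show "AE x in lborel. x \<notin> \<Omega> \<longrightarrow> rep_l2 (fst (graph_grad p)) x = 0"
      by eventually_elim (simp add: graph_grad_def test_fun_off[OF p])
  qed
  show "AE x in lborel. x \<notin> \<Omega> \<longrightarrow> rep_l2 (snd w) x = 0"
    using assms(1)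
  proof (rule V_induct[OF _ cl(2)])
    fix p assume p: "test_fun \<Omega> p"
    from rep_abs_l2[OF test_fun_grad_sqint[OF p]]
    show "AE x in lborel. x \<notin> \<Omega> \<longrightarrow> rep_l2 (snd (graph_grad p)) x = 0"
      by eventually_elim (use test_fun_subset[OF p] grad_off_tsupp in \<open>auto simp: graph_grad_def\<close>)
  qed
qed

lemma V_by_parts:
  assumes "w \<in> V \<Omega>" and g: "test_fun \<Omega>' g"
  shows "fst w \<bullet> abs_l2 (\<lambda>x. grad g x \<bullet> h) = - (snd w \<bullet> abs_l2 (\<lambda>x. g x *\<^sub>R h))"
  using assms(1)
proof (rule V_induct)
  show "closed {w :: ('a, real) l2 \<times> ('a, 'a) l2.
      fst w \<bullet> abs_l2 (\<lambda>x. grad g x \<bullet> h) = - (snd w \<bullet> abs_l2 (\<lambda>x. g x *\<^sub>R h))}"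
    by (intro closed_Collect_eq continuous_intros)
  fix p assume p: "test_fun \<Omega> p"
  note sq = test_fun_sqint[OF p] test_fun_sqint[OF g] test_fun_grad_sqint[OF p] test_fun_grad_sqint[OF g]
  have 1: "sqint (\<lambda>x. grad g x \<bullet> h)"
    using sqint_measurable[OF sq(4)] Cauchy_Schwarz_ineq2[of "grad g x" h for x]
    by (intro sqint_bound[OF sq(4), of _ "norm h"]) (auto simp: mult.commute)
  have 2: "sqint (\<lambda>x. g x *\<^sub>R h)"
    using sqint_measurable[OF sq(2)]
    by (intro sqint_bound[OF sq(2), of _ "norm h"]) (auto simp: mult.commute)
  show "fst (graph_grad p) \<bullet> abs_l2 (\<lambda>x. grad g x \<bullet> h) = - (snd (graph_grad p) \<bullet> abs_l2 (\<lambda>x. g x *\<^sub>R h))"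
    using integral_by_parts[OF p g, of h] sq 1 2
    by (simp add: graph_grad_def inner_abs_l2 mult.commute)
qed

text \<open>The pair of K f and its gradient. Since the inner product of pairs is the integral of w
  v + grad w . grad v, the condition is the weak form of w - \<Delta> w = f with zero boundary
  values.\<close>

definition Rop :: "'a::euclidean_space set \<Rightarrow> ('a, real) l2 \<Rightarrow> ('a, real) l2 \<times> ('a, 'a) l2" where
  "Rop \<Omega> f = (SOME w. w \<in> V \<Omega> \<and> (\<forall>v\<in>V \<Omega>. f \<bullet> fst v = w \<bullet> v))"

definition K :: "'a::euclidean_space set \<Rightarrow> ('a, real) l2 \<Rightarrow> ('a, real) l2" where
  "K \<Omega> f = fst (Rop \<Omega> f)"

lemma Rop: shows Rop_in_V: "Rop \<Omega> f \<in> V \<Omega>" and Rop_inner: "v \<in> V \<Omega> \<Longrightarrow> Rop \<Omega> f \<bullet> v = f \<bullet> fst v"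
proof -
  have "bounded_linear (\<lambda>v::('a, real) l2 \<times> ('a, 'a) l2. f \<bullet> fst v)"
    by (intro bounded_linear_intros)
  from riesz_closed_subspace[OF subspace_V closed_V this]
  have "\<exists>w. w \<in> V \<Omega> \<and> (\<forall>v\<in>V \<Omega>. f \<bullet> fst v = w \<bullet> v)" by blast
  from someI_ex[OF this] show "Rop \<Omega> f \<in> V \<Omega>" "v \<in> V \<Omega> \<Longrightarrow> Rop \<Omega> f \<bullet> v = f \<bullet> fst v"
    unfolding Rop_def[symmetric] by auto
qed

lemma Rop_unique:
  assumes "w \<in> V \<Omega>" "\<And>v. v \<in> V \<Omega> \<Longrightarrow> w \<bullet> v = f \<bullet> fst v" shows "w = Rop \<Omega> f"
proof -
  have "w - Rop \<Omega> f \<in> V \<Omega>" using assms Rop_in_V subspace_V subspace_diff by blast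
  from assms(2)[OF this] Rop_inner[OF this, of f]
  have "(w - Rop \<Omega> f) \<bullet> (w - Rop \<Omega> f) = 0"
    by (simp only: inner_diff_left)
  then show ?thesis by simp
qed

lemma Rop_add: "Rop \<Omega> (f + g) = Rop \<Omega> f + Rop \<Omega> g"
  by (rule Rop_unique[symmetric])
    (auto simp: inner_add_left Rop_inner intro: subspace_add[OF subspace_V] Rop_in_V)

lemma Rop_scaleR: "Rop \<Omega> (c *\<^sub>R f) = c *\<^sub>R Rop \<Omega> f"
  by (rule Rop_unique[symmetric])
    (auto simp: Rop_inner intro: subspace_scale[OF subspace_V] Rop_in_V)

lemma K_add: "K \<Omega> (f + g) = K \<Omega> f + K \<Omega> g" and K_scaleR: "K \<Omega> (c *\<^sub>R f) = c *\<^sub>R K \<Omega> f"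
  by (simp_all add: K_def Rop_add Rop_scaleR)

lemma K_diff: "K \<Omega> (f - g) = K \<Omega> f - K \<Omega> g"
  using K_add[of \<Omega> "f - g" g] by simp

text \<open>The form of K is a Gram form in the graph space. Symmetry, nonnegativity and the
  Cauchy-Schwarz inequality for this form all come from here.\<close>

lemma Rop_inner_Rop: "Rop \<Omega> f \<bullet> Rop \<Omega> g = K \<Omega> f \<bullet> g"
  using Rop_inner[OF Rop_in_V, of \<Omega> g f] by (simp add: K_def inner_commute)

lemma K_symmetric: "K \<Omega> f \<bullet> g = f \<bullet> K \<Omega> g"
  using Rop_inner_Rop[of \<Omega> f g] Rop_inner_Rop[of \<Omega> g f] by (simp add: inner_commute)

lemma norm_fst_le: "norm (fst w) \<le> norm w" and norm_snd_le: "norm (snd w) \<le> norm w"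
  by (cases w; simp add: norm_Pair real_le_rsqrt)+

lemma norm_Rop_le: "norm (Rop \<Omega> f) \<le> norm f"
proof -
  have "(norm (Rop \<Omega> f))\<^sup>2 = K \<Omega> f \<bullet> f" by (simp add: power2_norm_eq_inner Rop_inner_Rop)
  also have "\<dots> \<le> norm (K \<Omega> f) * norm f" by (rule norm_cauchy_schwarz)
  also have "\<dots> \<le> norm (Rop \<Omega> f) * norm f"
    unfolding K_def by (intro mult_right_mono norm_fst_le) auto
  finally show ?thesis
    by (cases "Rop \<Omega> f = 0") (auto simp: power2_eq_square)
qed

lemma norm_K_le: "norm (K \<Omega> f) \<le> norm f"
  using norm_fst_le[of "Rop \<Omega> f"] norm_Rop_le[of \<Omega> f] by (simp add: K_def)

text \<open>Equicontinuity under shifts, uniform on bounded sets of f. Together with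
  \<open>K_support\<close> it gives compactness of K, and by itself the gain of
  integrability.\<close>

lemma K_translate: "norm (tau h (K \<Omega> f) - K \<Omega> f) \<le> norm h * norm f"
proof -
  have "norm (tau h (K \<Omega> f) - K \<Omega> f) \<le> norm h * norm (snd (Rop \<Omega> f))"
    unfolding K_def by (rule V_translate[OF Rop_in_V])
  also have "\<dots> \<le> norm h * norm f"
    using norm_snd_le[of "Rop \<Omega> f"] norm_Rop_le[of \<Omega> f] by (intro mult_left_mono) auto
  finally show ?thesis .
qed

lemma K_support: "open \<Omega> \<Longrightarrow> AE x in lborel. x \<notin> \<Omega> \<longrightarrow> rep_l2 (K \<Omega> f) x = 0"
  unfolding K_def by (rule V_support(1)[OF Rop_in_V])

lemma sqint_indicator: "A \<in> sets borel \<Longrightarrow> bounded A \<Longrightarrow> sqint (indicator A :: 'a::euclidean_space \<Rightarrow> real)"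
proof -
  assume A: "A \<in> sets borel" "bounded A"
  have "(\<lambda>x. (norm (indicator A x :: real))\<^sup>2) = indicator A" by (auto simp: indicator_def)
  then show ?thesis using A emeasure_bounded_finite[OF A(2)] by (simp add: sqint_def)
qed

text \<open>Replacing a minimizing sequence \<open>p\<close> of \<open>\<parallel>w\<parallel>\<^sup>2 - 2 f \<bullet> fst w\<close> by the smoothed absolute values
  \<open>sqrt (p\<^sup>2 + e\<^sup>2) - e\<close> keeps it minimizing, so the minimizer is a limit of nonnegative functions.\<close>
lemma K_nonneg:
  assumes \<Omega>: "open \<Omega>" "bounded \<Omega>" and f: "AE x in lborel. 0 \<le> rep_l2 f x"
  shows "AE x in lborel. 0 \<le> rep_l2 (K \<Omega> f) x"
proof -
  let ?R = "Rop \<Omega> f"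
  have "?R \<in> closure (graph_grad ` Collect (test_fun \<Omega>))" using Rop_in_V[of \<Omega> f] by (simp add: V_def)
  then obtain P where P: "\<And>n. P n \<in> graph_grad ` Collect (test_fun \<Omega>)" "P \<longlonglongrightarrow> ?R"
    unfolding closure_sequential by blast
  from P(1) have "\<forall>n. \<exists>p. test_fun \<Omega> p \<and> P n = graph_grad p" by auto
  then obtain p where p: "\<And>n. test_fun \<Omega> (p n)" "\<And>n. P n = graph_grad (p n)" by metis
  define e where "e n = inverse (real (Suc n))" for n
  have e0: "0 < e n" for n by (simp add: e_def)
  define q where "q n x = sqrt ((p n x)\<^sup>2 + (e n)\<^sup>2) - e n" for n x
  have q: "test_fun \<Omega> (q n)" for n
    unfolding q_def[abs_def]
    using test_fun_compose[OF p(1), of "\<lambda>t. sqrt (t\<^sup>2 + (e n)\<^sup>2) + (- e n)" n]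
      smooth_add[OF smooth_sqrt_sq[OF e0[of n]] smooth_const[of "- e n"]] e0[of n] by simp
  have qn: "0 \<le> q n x" for n x
    unfolding q_def using e0[of n] by (simp add: real_le_rsqrt)
  have qle: "\<bar>q n x\<bar> \<le> \<bar>p n x\<bar>" for n x
  proof -
    have "sqrt ((p n x)\<^sup>2 + (e n)\<^sup>2) \<le> \<bar>p n x\<bar> + e n"
      using sqrt_sum_squares_le_sum_abs[of "p n x" "e n"] e0[of n] by simp
    then show ?thesis using qn[of n x] by (simp add: q_def)
  qed
  have qge: "p n x \<le> q n x + e n" for n x
    unfolding q_def by (simp add: real_le_rsqrt)
  have gle: "norm (grad (q n) x) \<le> norm (grad (p n) x)" for n x
  proof -
    let ?s = "sqrt ((p n x)\<^sup>2 + (e n)\<^sup>2)"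
    have pos: "0 < (p n x)\<^sup>2 + (e n)\<^sup>2" using e0[of n] by (simp add: add_nonneg_pos)
    have "((\<lambda>t. sqrt (t\<^sup>2 + (e n)\<^sup>2) - e n) has_real_derivative p n x / ?s) (at (p n x))"
      using pos by (auto intro!: derivative_eq_intros simp: field_simps)
    from grad_compose[OF test_fun_smooth[OF p(1)], of _ _ n x, OF this]
    have "grad (q n) x = (p n x / ?s) *\<^sub>R grad (p n) x" by (simp add: q_def[abs_def])
    moreover have "\<bar>p n x / ?s\<bar> \<le> 1"
      using pos by (simp add: divide_le_eq_1 real_le_rsqrt)
    ultimately show ?thesis
      using mult_right_mono[of "\<bar>p n x / ?s\<bar>" 1 "norm (grad (p n) x)"] by simp
  qed
  have nle: "norm (graph_grad (q n)) \<le> norm (graph_grad (p n))" for n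
    unfolding graph_grad_def norm_Pair
    using norm_abs_l2_mono[OF test_fun_sqint[OF q[of n]] test_fun_sqint[OF p(1)[of n]]]
      norm_abs_l2_mono[OF test_fun_grad_sqint[OF q[of n]] test_fun_grad_sqint[OF p(1)[of n]]] qle gle
    by (intro real_sqrt_le_mono add_mono power_mono) auto
  have [measurable]: "\<Omega> \<in> sets borel" using \<Omega> by simp
  have si: "sqint (indicator \<Omega> :: 'a \<Rightarrow> real)" using \<Omega> by (intro sqint_indicator) auto
  \<comment> \<open>The smoothed absolute value falls short of \<open>p n\<close> by at most
    \<open>e n\<close>, and both vanish outside \<Omega>, so pairing with the nonnegative f loses at
    most \<open>e n * c\<close>.\<close>
  define c where "c = f \<bullet> abs_l2 (indicator \<Omega>)"
  have fle: "f \<bullet> abs_l2 (p n) \<le> f \<bullet> abs_l2 (q n) + e n * c" for n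
  proof -
    have sq: "sqint (p n)" "sqint (q n)" using test_fun_sqint[OF p(1)] test_fun_sqint[OF q] .
    have "f \<bullet> abs_l2 (q n) + e n * c = f \<bullet> (abs_l2 (q n) + e n *\<^sub>R abs_l2 (indicator \<Omega>))"
      by (simp add: c_def inner_add_right)
    also have "\<dots> = f \<bullet> abs_l2 (\<lambda>x. q n x + e n *\<^sub>R indicator \<Omega> x)"
      using sq si by (simp only: abs_l2_scaleR abs_l2_add sqint_scaleR)
    finally have eq: "f \<bullet> abs_l2 (q n) + e n * c = f \<bullet> abs_l2 (\<lambda>x. q n x + e n *\<^sub>R indicator \<Omega> x)" .
    have s2: "sqint (\<lambda>x. q n x + e n *\<^sub>R indicator \<Omega> x :: real)"
      using sq si by (intro sqint_add sqint_scaleR)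
    show ?thesis unfolding eq inner_l2_rep_abs[OF sq(1)] inner_l2_rep_abs[OF s2]
    proof (rule integral_mono_AE)
      show "AE x in lborel. rep_l2 f x \<bullet> p n x \<le> rep_l2 f x \<bullet> (q n x + e n *\<^sub>R indicator \<Omega> x)"
        using f
      proof eventually_elim
        case (elim x)
        have "p n x \<le> q n x + e n *\<^sub>R indicator \<Omega> x"
          using qge[of n x] test_fun_off[OF p(1), of x n] test_fun_off[OF q, of x n]
          by (cases "x \<in> \<Omega>") auto
        then show ?case using elim by (auto intro: mult_left_mono)
      qed
    qed (intro sqint_inner sqint_rep sq s2)+
  qed
  have "(norm (graph_grad (q n) - ?R))\<^sup>2 \<le> (norm (P n - ?R))\<^sup>2 + 2 * e n * c" for n
  proof -
    \<comment> \<open>Completing the square: the functional differs from the squared distance to its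
      minimizer by a constant. Not increasing the functional, up to an error tending to 0, therefore
      means not moving away from the minimizer.\<close>
    have eq: "(norm (graph_grad s - ?R))\<^sup>2 = (norm (graph_grad s))\<^sup>2 - 2 * (f \<bullet> abs_l2 s) + (norm ?R)\<^sup>2"
      if "test_fun \<Omega> s" for s
      using Rop_inner[OF graph_grad_in_V[OF that], of f]
      by (simp add: power2_norm_eq_inner inner_diff_left inner_diff_right inner_commute graph_grad_def)
    have "(norm (graph_grad (q n)))\<^sup>2 \<le> (norm (graph_grad (p n)))\<^sup>2"
      using nle by (intro power_mono) auto
    then show ?thesis using fle[of n] unfolding p(2) eq[OF p(1)] eq[OF q] by linarith
  qed
  moreover have "(\<lambda>n. (norm (P n - ?R))\<^sup>2 + 2 * e n * c) \<longlonglongrightarrow> (norm (?R - ?R))\<^sup>2 + 2 * 0 * c"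
    unfolding e_def by (intro tendsto_intros P(2) LIMSEQ_inverse_real_of_nat)
  ultimately have "(\<lambda>n. (norm (graph_grad (q n) - ?R))\<^sup>2) \<longlonglongrightarrow> 0"
    by (intro Lim_null_comparison[of "\<lambda>n. (norm (graph_grad (q n) - ?R))\<^sup>2"] always_eventually) auto
  then have "(\<lambda>n. norm (graph_grad (q n) - ?R)) \<longlonglongrightarrow> 0"
    using tendsto_real_sqrt[of _ 0] by fastforce
  then have "(\<lambda>n. graph_grad (q n)) \<longlonglongrightarrow> ?R"
    by (metis (no_types) tendsto_norm_zero_cancel LIM_zero_cancel)
  then have lim: "(\<lambda>n. abs_l2 (q n)) \<longlonglongrightarrow> K \<Omega> f"
    unfolding K_def using tendsto_fst by (fastforce simp: graph_grad_def)
  have mem: "abs_l2 (q n) \<in> {u. AE x in lborel. 0 \<le> rep_l2 u x}" for n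
  proof -
    from rep_abs_l2[OF test_fun_sqint[OF q[of n]]] have "AE x in lborel. 0 \<le> rep_l2 (abs_l2 (q n)) x"
      by eventually_elim (simp add: qn)
    then show ?thesis by simp
  qed
  have "K \<Omega> f \<in> {u. AE x in lborel. 0 \<le> rep_l2 u x}"
    using closed_sequentially[OF closed_l2_nonneg mem lim] .
  then show ?thesis by simp
qed

subsection \<open>Averages, integrability and compactness\<close>

text \<open>The type argument fixes the dimension, which a radius alone does not determine.\<close>

definition vol :: "'a::euclidean_space itself \<Rightarrow> real \<Rightarrow> real" where
  "vol _ r = measure lborel (ball (0::'a) r)"

text \<open>The mean of u over the ball of radius r around x, written as a pairing with a shifted
  class. It is thus defined at every point, independently of representatives, and inherits a
  Lipschitz bound from the shift estimate.\<close>

definition avg :: "real \<Rightarrow> ('a::euclidean_space, real) l2 \<Rightarrow> 'a \<Rightarrow> real" where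
  "avg r u x = (abs_l2 (indicator (ball 0 r)) \<bullet> tau x u) / vol TYPE('a) r"

lemma vol_eq: "0 \<le> r \<Longrightarrow> vol TYPE('a::euclidean_space) r = unit_ball_vol (real DIM('a)) * r ^ DIM('a)"
  unfolding vol_def using content_ball[of r "0::'a"] by simp

lemma vol_pos: "0 < r \<Longrightarrow> 0 < vol TYPE('a::euclidean_space) r"
  by (simp add: vol_eq)

lemma sqint_ball: "sqint (indicator (ball (0::'a::euclidean_space) r) :: 'a \<Rightarrow> real)"
  by (rule sqint_indicator) auto

lemma norm_indicator_ball:
  "(norm (abs_l2 (indicator (ball (0::'a::euclidean_space) r) :: 'a \<Rightarrow> real)))\<^sup>2 = vol TYPE('a) r"
proof -
  have "(\<lambda>x. (norm (indicator (ball (0::'a) r) x :: real))\<^sup>2) = indicator (ball 0 r)"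
    by (auto simp: indicator_def)
  then show ?thesis using norm_abs_l2[OF sqint_ball[of r, where 'a='a]] by (simp add: vol_def)
qed

lemma abs_inner_ball_le:
  fixes v :: "('a::euclidean_space, real) l2"
  assumes "0 < r"
  shows "\<bar>abs_l2 (indicator (ball (0::'a) r)) \<bullet> v\<bar> / vol TYPE('a) r
    \<le> norm v / sqrt (vol TYPE('a) r)"
proof -
  let ?c = "abs_l2 (indicator (ball (0::'a) r) :: 'a \<Rightarrow> real)"
  note v = vol_pos[OF assms, where 'a='a]
  have n: "norm ?c = sqrt (vol TYPE('a) r)"
    using norm_indicator_ball[of r, where 'a='a] by (metis norm_ge_zero real_sqrt_unique)
  have "\<bar>?c \<bullet> v\<bar> \<le> sqrt (vol TYPE('a) r) * norm v"
    using Cauchy_Schwarz_ineq2[of ?c v] n by simp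
  then have "\<bar>?c \<bullet> v\<bar> / vol TYPE('a) r \<le> sqrt (vol TYPE('a) r) * norm v / vol TYPE('a) r"
    using v by (intro divide_right_mono) auto
  also have "\<dots> = norm v / sqrt (vol TYPE('a) r)"
    using v real_sqrt_mult_self[of "vol TYPE('a) r"] by (simp add: field_simps)
  finally show ?thesis .
qed

lemma avg_bound:
  fixes u :: "('a::euclidean_space, real) l2"
  assumes "0 < r" shows "\<bar>avg r u x\<bar> \<le> norm u / sqrt (vol TYPE('a) r)"
  using abs_inner_ball_le[OF assms, of "tau x u"] vol_pos[OF assms, where 'a='a]
  by (simp add: avg_def)

lemma avg_lipschitz:
  fixes u :: "('a::euclidean_space, real) l2"
  assumes "0 < r" "\<And>h. norm (tau h u - u) \<le> norm h * A"
  shows "\<bar>avg r u x - avg r u y\<bar> \<le> norm (x - y) * A / sqrt (vol TYPE('a) r)"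
proof -
  note v = vol_pos[OF assms(1), where 'a='a]
  have "tau x u - tau y u = tau y (tau (x - y) u - u)" by (simp add: tau_diff tau_tau)
  then have n: "norm (tau x u - tau y u) \<le> norm (x - y) * A" using assms(2) by simp
  have "\<bar>avg r u x - avg r u y\<bar> = \<bar>abs_l2 (indicator (ball 0 r)) \<bullet> (tau x u - tau y u)\<bar> / vol TYPE('a) r"
    using v by (simp add: avg_def inner_diff_right diff_divide_distrib[symmetric])
  also have "\<dots> \<le> norm (tau x u - tau y u) / sqrt (vol TYPE('a) r)"
    by (rule abs_inner_ball_le[OF assms(1)])
  also have "\<dots> \<le> norm (x - y) * A / sqrt (vol TYPE('a) r)"
    using n v by (intro divide_right_mono) auto
  finally show ?thesis .
qed

lemma avg_measurable:
  fixes u :: "('a::euclidean_space, real) l2"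
  assumes "0 < r" "\<And>h. norm (tau h u - u) \<le> norm h * A"
  shows "avg r u \<in> borel_measurable borel"
proof (rule borel_measurable_continuous_onI)
  define L where "L = \<bar>A\<bar> / sqrt (vol TYPE('a) r) + 1"
  note v = vol_pos[OF assms(1), where 'a='a]
  have L0: "0 < L" using v by (auto simp: L_def add_nonneg_pos)
  have le: "dist (avg r u x) (avg r u y) \<le> L * dist x y" for x y
  proof -
    have "dist (avg r u x) (avg r u y) \<le> norm (x - y) * (A / sqrt (vol TYPE('a) r))"
      using avg_lipschitz[OF assms, of x y] by (simp add: dist_norm)
    also have "\<dots> \<le> norm (x - y) * L"
      using v divide_right_mono[OF abs_ge_self[of A], of "sqrt (vol TYPE('a) r)"]
      unfolding L_def by (intro mult_left_mono) auto
    finally show ?thesis by (simp add: dist_norm mult.commute)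
  qed
  show "continuous_on UNIV (avg r u)"
  proof (rule continuous_onI)
    fix x :: 'a and e :: real assume "0 < e"
    then have "dist (avg r u x') (avg r u x) \<le> e" if "dist x' x < e / L" for x'
      using le[of x' x] that L0 by (simp add: field_simps)
    then show "\<exists>d>0. \<forall>x'\<in>UNIV. dist x' x < d \<longrightarrow> dist (avg r u x') (avg r u x) \<le> e"
      using \<open>0 < e\<close> L0 by (intro exI[of _ "e / L"]) auto
  qed
qed

text \<open>Pointwise, Cauchy-Schwarz bounds the squared deviation by the mean of |u(x) - u(x +
  h)|^2 over |h| < r. Integrating in x first, by Fubini, leaves the mean of the squared shift
  errors, each at most (r A)^2.\<close>

lemma avg_close:
  fixes u :: "('a::euclidean_space, real) l2"
  assumes r: "0 < r" and A: "0 \<le> A" "\<And>h. norm (tau h u - u) \<le> norm h * A"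
  shows "(\<integral>\<^sup>+x. ennreal ((rep_l2 u x - avg r u x)\<^sup>2) \<partial>lborel) \<le> ennreal (r\<^sup>2 * A\<^sup>2)"
proof -
  let ?I = "indicator (ball (0::'a) r) :: 'a \<Rightarrow> real"
  let ?v = "vol TYPE('a) r"
  note v = vol_pos[OF r, where 'a='a]
  have pt: "ennreal ((rep_l2 u x - avg r u x)\<^sup>2)
      \<le> ennreal (1 / ?v) * (\<integral>\<^sup>+h. ennreal (?I h * (rep_l2 u x - rep_l2 u (h + x))\<^sup>2) \<partial>lborel)" for x
  proof -
    define F where "F h = ?I h * (rep_l2 u x - rep_l2 u (h + x))" for h
    have s1: "sqint (\<lambda>h. ?I h * rep_l2 u (h + x))"
      by (rule sqint_bound[OF sqint_translate[OF sqint_rep[of u]], of _ 1 x]) (auto simp: indicator_def)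
    have s2: "sqint (\<lambda>h. rep_l2 u x *\<^sub>R ?I h)" by (rule sqint_scaleR[OF sqint_ball])
    have sF: "sqint F"
      using sqint_diff[OF s2 s1] by (simp add: F_def[abs_def] algebra_simps)
    have "abs_l2 ?I \<bullet> abs_l2 F = (\<integral>h. ?I h * F h \<partial>lborel)"
      by (simp add: inner_abs_l2[OF sqint_ball sF])
    also have "\<dots> = (\<integral>h. ?I h \<bullet> (rep_l2 u x *\<^sub>R ?I h) - ?I h \<bullet> rep_l2 u (h + x) \<partial>lborel)"
      by (intro Bochner_Integration.integral_cong) (auto simp: F_def indicator_def)
    also have "\<dots> = (\<integral>h. ?I h \<bullet> (rep_l2 u x *\<^sub>R ?I h) \<partial>lborel) - (\<integral>h. ?I h \<bullet> rep_l2 u (h + x) \<partial>lborel)"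
      by (intro Bochner_Integration.integral_diff sqint_inner sqint_ball s2 sqint_translate sqint_rep)
    also have "\<dots> = abs_l2 ?I \<bullet> (rep_l2 u x *\<^sub>R abs_l2 ?I) - abs_l2 ?I \<bullet> tau x u"
      by (simp only: tau_def abs_l2_scaleR[OF sqint_ball] inner_abs_l2[OF sqint_ball s2]
          inner_abs_l2[OF sqint_ball sqint_translate[OF sqint_rep]])
    also have "\<dots> = ?v * rep_l2 u x - ?v * avg r u x"
      using v by (simp add: avg_def norm_indicator_ball flip: power2_norm_eq_inner)
    finally have "?v * (rep_l2 u x - avg r u x) = abs_l2 ?I \<bullet> abs_l2 F" by (simp add: algebra_simps)
    then have "rep_l2 u x - avg r u x = (abs_l2 ?I \<bullet> abs_l2 F) / ?v" using v by (simp add: field_simps)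
    then have "\<bar>rep_l2 u x - avg r u x\<bar> \<le> norm (abs_l2 F) / sqrt ?v"
      using abs_inner_ball_le[OF r, of "abs_l2 F"] v by simp
    then have "\<bar>rep_l2 u x - avg r u x\<bar>\<^sup>2 \<le> (norm (abs_l2 F) / sqrt ?v)\<^sup>2" by (intro power_mono) auto
    then have "(rep_l2 u x - avg r u x)\<^sup>2 \<le> 1 / ?v * (norm (abs_l2 F))\<^sup>2"
      using v by (simp add: power_divide)
    then have "ennreal ((rep_l2 u x - avg r u x)\<^sup>2) \<le> ennreal (1 / ?v * (norm (abs_l2 F))\<^sup>2)"
      by (rule ennreal_leI)
    also have "\<dots> = ennreal (1 / ?v) * (\<integral>\<^sup>+h. ennreal ((norm (F h))\<^sup>2) \<partial>lborel)"
      unfolding nn_norm_abs_l2[OF sF] using v by (intro ennreal_mult) auto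
    also have "(\<lambda>h. (norm (F h))\<^sup>2) = (\<lambda>h. ?I h * (rep_l2 u x - rep_l2 u (h + x))\<^sup>2)"
      by (auto simp: F_def indicator_def)
    finally show ?thesis .
  qed
  define I where "I = ?I"
  have [measurable]: "I \<in> borel_measurable borel"
    unfolding I_def by (intro borel_measurable_indicator) simp
  have mes: "(\<lambda>(x, h). ennreal (I h * (rep_l2 u x - rep_l2 u (h + x))\<^sup>2)) \<in> borel_measurable (lborel \<Otimes>\<^sub>M lborel)"
    by measurable
  have mes': "(\<lambda>x. \<integral>\<^sup>+h. ennreal (I h * (rep_l2 u x - rep_l2 u (h + x))\<^sup>2) \<partial>lborel) \<in> borel_measurable lborel"
    by measurable
  have "(\<integral>\<^sup>+x. (\<integral>\<^sup>+h. ennreal (?I h * (rep_l2 u x - rep_l2 u (h + x))\<^sup>2) \<partial>lborel) \<partial>lborel)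
      = (\<integral>\<^sup>+h. (\<integral>\<^sup>+x. ennreal (?I h * (rep_l2 u x - rep_l2 u (h + x))\<^sup>2) \<partial>lborel) \<partial>lborel)"
    using lborel_pair.Fubini'[OF mes] by (simp add: I_def)
  also have "\<dots> \<le> (\<integral>\<^sup>+h. ennreal (r\<^sup>2 * A\<^sup>2) * indicator (ball (0::'a) r) h \<partial>lborel)"
  proof (rule nn_integral_mono)
    fix h :: 'a
    show "(\<integral>\<^sup>+x. ennreal (?I h * (rep_l2 u x - rep_l2 u (h + x))\<^sup>2) \<partial>lborel)
        \<le> ennreal (r\<^sup>2 * A\<^sup>2) * indicator (ball 0 r) h"
    proof (cases "h \<in> ball 0 r")
      case True
      have s: "sqint (\<lambda>x. rep_l2 u (x + h) - rep_l2 u x)"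
        by (intro sqint_diff sqint_translate sqint_rep)
      have "(\<integral>\<^sup>+x. ennreal (?I h * (rep_l2 u x - rep_l2 u (h + x))\<^sup>2) \<partial>lborel)
          = (\<integral>\<^sup>+x. ennreal ((norm (rep_l2 u (x + h) - rep_l2 u x))\<^sup>2) \<partial>lborel)"
        using True by (simp add: power2_commute add.commute)
      also have "\<dots> = ennreal ((norm (abs_l2 (\<lambda>x. rep_l2 u (x + h) - rep_l2 u x)))\<^sup>2)"
        by (rule nn_norm_abs_l2[OF s])
      also have "abs_l2 (\<lambda>x. rep_l2 u (x + h) - rep_l2 u x) = tau h u - u"
        by (simp add: tau_def abs_l2_diff[symmetric] sqint_translate)
      also have "ennreal ((norm (tau h u - u))\<^sup>2) \<le> ennreal ((r * A)\<^sup>2)"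
      proof (intro ennreal_leI power_mono)
        have "norm h * A \<le> r * A" using True A by (intro mult_right_mono) auto
        then show "norm (tau h u - u) \<le> r * A" using A(2)[of h] by linarith
      qed simp
      finally show ?thesis using True by (simp add: power_mult_distrib)
    qed simp
  qed
  also have "\<dots> = ennreal (r\<^sup>2 * A\<^sup>2) * ennreal ?v"
    using emeasure_eq_ennreal_measure[of lborel "ball (0::'a) r"]
      emeasure_bounded_finite[OF bounded_ball[of "0::'a" r]]
    by (subst nn_integral_cmult_indicator) (auto simp: vol_def)
  finally have fub: "(\<integral>\<^sup>+x. (\<integral>\<^sup>+h. ennreal (?I h * (rep_l2 u x - rep_l2 u (h + x))\<^sup>2) \<partial>lborel) \<partial>lborel)
    \<le> ennreal (r\<^sup>2 * A\<^sup>2) * ennreal ?v" .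
  have "(\<integral>\<^sup>+x. ennreal ((rep_l2 u x - avg r u x)\<^sup>2) \<partial>lborel)
      \<le> (\<integral>\<^sup>+x. ennreal (1 / ?v) * (\<integral>\<^sup>+h. ennreal (?I h * (rep_l2 u x - rep_l2 u (h + x))\<^sup>2) \<partial>lborel) \<partial>lborel)"
    by (intro nn_integral_mono pt)
  also have "\<dots> = ennreal (1 / ?v) * (\<integral>\<^sup>+x. (\<integral>\<^sup>+h. ennreal (?I h * (rep_l2 u x - rep_l2 u (h + x))\<^sup>2) \<partial>lborel) \<partial>lborel)"
    using mes' by (intro nn_integral_cmult) (simp add: I_def)
  also have "\<dots> \<le> ennreal (1 / ?v) * (ennreal (r\<^sup>2 * A\<^sup>2) * ennreal ?v)"
    by (intro mult_left_mono fub) simp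
  also have "\<dots> = ennreal (r\<^sup>2 * A\<^sup>2)"
    using v by (simp add: ennreal_mult[symmetric])
  finally show ?thesis .
qed

text \<open>At height \<open>2^k\<close> compare \<open>u\<close> with its average over balls so small that the average is at most
  half that height: there \<open>|u|\<close> is controlled by \<open>u - avg\<close>, whose norm decays geometrically in \<open>k\<close>.\<close>
lemma Lp_bound:
  fixes p :: real
  assumes p: "p = 2 + 2 / real DIM('a::euclidean_space)"
  shows "\<exists>C\<ge>0. \<forall>u :: ('a, real) l2. norm u \<le> 1 \<longrightarrow> (\<forall>h. norm (tau h u - u) \<le> norm h) \<longrightarrow>
    (\<integral>\<^sup>+x. ennreal (\<bar>rep_l2 u x\<bar> powr p) \<partial>lborel) \<le> ennreal C"
proof -
  let ?N = "real DIM('a)"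
  define ub where "ub = unit_ball_vol ?N"
  have ub: "0 < ub" by (simp add: ub_def)
  define t where "t = 2 / ?N"
  have N: "0 < ?N" by simp
  have t: "0 < t" by (simp add: t_def)
  \<comment> \<open>The radius at which a ball has volume 4 * 4^(-k); for |u| \<le> 1 the averages
    are then at most 2^k / 2, half of the height 2^k.\<close>
  define r where "r k = (4 * (1/4) ^ k / ub) powr (1 / ?N)" for k :: nat
  have r0: "0 < r k" for k using ub by (simp add: r_def)
  have vr: "vol TYPE('a) (r k) = 4 * (1/4) ^ k" for k
  proof -
    have "r k ^ DIM('a) = 4 * (1/4) ^ k / ub"
      using r0[of k] ub by (simp add: powr_realpow[symmetric] r_def powr_powr)
    then show ?thesis
      unfolding vol_eq[OF less_imp_le[OF r0]] ub_def[symmetric] using ub by simp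
  qed
  have sv: "1 / sqrt (vol TYPE('a) (r k)) = 2 ^ k / 2" for k
    unfolding vr by (simp add: real_sqrt_mult real_sqrt_power real_sqrt_divide power_divide)
  \<comment> \<open>The bound for the level 2^k \<le> |u| < 2^(k+1): the power of 2^(k+1) controls
    |u|^t, the 4 comes from |u| \<le> 2 |u - avg|, and (r k)^2 from \<open>avg_close\<close>. Since
    (r k)^2 decays like 4^(- t k), these bounds decay like 2^(- t k).\<close>
  define a where "a k = 4 * (2 ^ Suc k) powr t * (r k)\<^sup>2" for k
  define M where "M = 4 * 2 powr t * (4 / ub) powr t"
  have a_eq: "a k = M * (2 powr (- t)) ^ k" for k
  proof -
    have "(r k)\<^sup>2 = (4 * (1/4) ^ k / ub) powr t"
      using r0[of k] ub by (simp add: r_def powr_realpow[symmetric] powr_powr t_def)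
    also have "\<dots> = (4 / ub) powr t * ((1/4) ^ k) powr t"
      using ub by (subst powr_mult[symmetric]) auto
    also have "((1/4::real) ^ k) powr t = 2 powr (- 2 * t * k)"
    proof -
      have q: "(2::real) powr (-2) = 1/4" by (simp add: powr_minus powr_numeral)
      have "(2::real) powr (-2 * real k) = (2 powr (-2)) powr real k" by (simp only: powr_powr)
      also have "\<dots> = (1/4) ^ k" unfolding q by (simp add: powr_realpow)
      finally have e: "(1/4::real) ^ k = 2 powr (-2 * real k)" by simp
      show ?thesis unfolding e powr_powr by (simp add: mult_ac)
    qed
    finally have 1: "(r k)\<^sup>2 = (4 / ub) powr t * 2 powr (- 2 * t * k)" .
    have 2: "((2::real) ^ Suc k) powr t = 2 powr t * 2 powr (t * k)"
    proof -
      have "((2::real) ^ Suc k) powr t = 2 powr (t * real (Suc k))"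
        by (simp add: powr_realpow[symmetric] powr_powr mult.commute del: of_nat_Suc power_Suc)
      then show ?thesis by (simp add: powr_add[symmetric] algebra_simps)
    qed
    have 3: "(2 powr (- t)) ^ k = 2 powr (- (t * real k))"
      by (simp add: powr_power mult.commute)
    have "2 powr (t * k) * 2 powr (- 2 * t * k) = 2 powr (- (t * real k))"
      by (simp add: powr_add[symmetric])
    then show ?thesis unfolding a_def M_def 1 2 3 by (simp add: mult_ac)
  qed
  have "2 powr (- t) < 1" using t by (simp add: powr_less_one)
  then have suma: "summable a" unfolding a_eq[abs_def]
    by (intro summable_mult summable_geometric) auto
  have a0: "0 \<le> a k" for k by (simp add: a_def)
  define C where "C = 1 + (\<Sum>k. a k)"
  have C0: "0 \<le> C" using suminf_nonneg[OF suma a0] by (simp add: C_def)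
  have "(\<integral>\<^sup>+x. ennreal (\<bar>rep_l2 u x\<bar> powr p) \<partial>lborel) \<le> ennreal C"
    if u: "norm u \<le> 1" and tr: "\<And>h. norm (tau h u - u) \<le> norm h" for u :: "('a, real) l2"
  proof -
    have tr1: "norm (tau h u - u) \<le> norm h * 1" for h using tr by simp
    have [measurable]: "avg (r k) u \<in> borel_measurable borel" for k
      using avg_measurable[OF r0 tr1] .
    define b where "b k x = 4 * (2 ^ Suc k) powr t * (rep_l2 u x - avg (r k) u x)\<^sup>2" for k x
    have b0: "0 \<le> b k x" for k x by (simp add: b_def)
    have [measurable]: "b k \<in> borel_measurable borel" for k unfolding b_def[abs_def] by measurable
    have pt: "ennreal (\<bar>rep_l2 u x\<bar> powr p) \<le> ennreal ((norm (rep_l2 u x))\<^sup>2) + (\<Sum>k. ennreal (b k x))" for x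
    proof (cases "\<bar>rep_l2 u x\<bar> < 1")
      case True
      have "\<bar>rep_l2 u x\<bar> powr p \<le> \<bar>rep_l2 u x\<bar> powr 2"
        using True t unfolding p t_def[symmetric]
        by (intro powr_mono') auto
      also have "\<dots> = (norm (rep_l2 u x))\<^sup>2" by (cases "rep_l2 u x = 0") (auto simp: powr_numeral)
      finally have "ennreal (\<bar>rep_l2 u x\<bar> powr p) \<le> ennreal ((norm (rep_l2 u x))\<^sup>2)" by (rule ennreal_leI)
      then show ?thesis by (rule add_increasing2[OF zero_le])
    next
      case False
      let ?y = "\<bar>rep_l2 u x\<bar>"
      have "\<exists>n. ?y < 2 ^ n" using real_arch_pow[of 2 ?y] by auto
      then obtain n where n: "?y < 2 ^ n" "\<forall>m<n. \<not> ?y < 2 ^ m" by (meson LeastI_ex not_less_Least)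
      then obtain k where k: "n = Suc k" using False by (cases n) auto
      have le: "2 ^ k \<le> ?y" "?y < 2 ^ Suc k" using n k by auto
      have "\<bar>avg (r k) u x\<bar> \<le> norm u / sqrt (vol TYPE('a) (r k))" by (rule avg_bound[OF r0])
      also have "\<dots> \<le> 1 / sqrt (vol TYPE('a) (r k))"
        using u vr[of k] by (intro divide_right_mono) auto
      also have "\<dots> = 2 ^ k / 2" by (rule sv)
      finally have "\<bar>avg (r k) u x\<bar> \<le> 2 ^ k / 2" .
      moreover have "?y \<le> \<bar>rep_l2 u x - avg (r k) u x\<bar> + \<bar>avg (r k) u x\<bar>" by simp
      moreover have "y \<le> 2 * d" if "a \<le> K / 2" "y \<le> d + a" "K \<le> y" for a d y K :: real
        using that by linarith
      ultimately have "?y \<le> 2 * \<bar>rep_l2 u x - avg (r k) u x\<bar>" using le(1) by blast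
      then have "?y\<^sup>2 \<le> (2 * \<bar>rep_l2 u x - avg (r k) u x\<bar>)\<^sup>2" by (intro power_mono) auto
      then have y2: "?y\<^sup>2 \<le> 4 * (rep_l2 u x - avg (r k) u x)\<^sup>2" by (simp add: power_mult_distrib)
      have y0: "0 < ?y" using False by simp
      have "?y powr p = ?y powr t * ?y\<^sup>2"
        using y0 unfolding p t_def[symmetric] by (simp add: powr_add powr_numeral)
      also have "\<dots> \<le> (2 ^ Suc k) powr t * (4 * (rep_l2 u x - avg (r k) u x)\<^sup>2)"
        using le y2 t y0 by (intro mult_mono powr_mono2) auto
      also have "\<dots> = b k x" by (simp add: b_def)
      finally have "ennreal (?y powr p) \<le> ennreal (b k x)" by (rule ennreal_leI)
      also have "\<dots> \<le> (\<Sum>k. ennreal (b k x))"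
        using sum_le_suminf[of "\<lambda>k. ennreal (b k x)" "{k}"] by auto
      finally show ?thesis by (rule add_increasing[OF zero_le])
    qed
    have "(\<integral>\<^sup>+x. ennreal (\<bar>rep_l2 u x\<bar> powr p) \<partial>lborel)
        \<le> (\<integral>\<^sup>+x. ennreal ((norm (rep_l2 u x))\<^sup>2) + (\<Sum>k. ennreal (b k x)) \<partial>lborel)"
      by (intro nn_integral_mono pt)
    also have "\<dots> = (\<integral>\<^sup>+x. ennreal ((norm (rep_l2 u x))\<^sup>2) \<partial>lborel) + (\<integral>\<^sup>+x. (\<Sum>k. ennreal (b k x)) \<partial>lborel)"
      by (intro nn_integral_add) auto
    also have "(\<integral>\<^sup>+x. (\<Sum>k. ennreal (b k x)) \<partial>lborel) = (\<Sum>k. \<integral>\<^sup>+x. ennreal (b k x) \<partial>lborel)"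
      by (intro nn_integral_suminf) auto
    also have "\<dots> \<le> (\<Sum>k. ennreal (a k))"
    proof (rule suminf_le)
      fix k
      have "(\<integral>\<^sup>+x. ennreal (b k x) \<partial>lborel)
          = ennreal (4 * (2 ^ Suc k) powr t) * (\<integral>\<^sup>+x. ennreal ((rep_l2 u x - avg (r k) u x)\<^sup>2) \<partial>lborel)"
        unfolding b_def by (subst nn_integral_cmult[symmetric]) (auto simp: ennreal_mult)
      also have "\<dots> \<le> ennreal (4 * (2 ^ Suc k) powr t) * ennreal ((r k)\<^sup>2 * 1\<^sup>2)"
        by (intro mult_left_mono avg_close[OF r0 _ tr1]) auto
      also have "\<dots> = ennreal (a k)" by (simp add: a_def ennreal_mult)
      finally show "(\<integral>\<^sup>+x. ennreal (b k x) \<partial>lborel) \<le> ennreal (a k)" .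
    qed auto
    also have "(\<Sum>k. ennreal (a k)) = ennreal (\<Sum>k. a k)" by (rule suminf_ennreal2[OF a0 suma])
    also have "(\<integral>\<^sup>+x. ennreal ((norm (rep_l2 u x))\<^sup>2) \<partial>lborel) \<le> ennreal 1"
      unfolding nn_norm_l2_rep using u by (intro ennreal_leI) (simp add: power_le_one)
    finally show ?thesis unfolding C_def
      using suminf_nonneg[OF suma a0] by (simp add: ennreal_plus add_right_mono)
  qed
  then show ?thesis using C0 by blast
qed

text \<open>A Frechet-Kolmogorov criterion. Averages over balls of radius r stay within r of u and
  are uniformly bounded and Lipschitz, so rounding their values at a finite net of \<Omega> leaves
  finitely many patterns. Two functions with the same pattern are at distance less than e.\<close>

lemma compact_translation_bounded:
  fixes \<Omega> :: "'a::euclidean_space set"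
  assumes \<Omega>: "\<Omega> \<in> sets borel" "bounded \<Omega>"
  shows "compact {u :: ('a, real) l2. norm u \<le> 1 \<and> (\<forall>h. norm (tau h u - u) \<le> norm h) \<and>
     (AE x in lborel. x \<notin> \<Omega> \<longrightarrow> rep_l2 u x = 0)}" (is "compact ?S")
  unfolding compact_eq_totally_bounded
proof (intro conjI allI impI)
  have "closed ({u :: ('a, real) l2. norm u \<le> 1} \<inter> (\<Inter>h. {u. norm (tau h u - u) \<le> norm h}) \<inter>
      {u. AE x in lborel. x \<notin> \<Omega> \<longrightarrow> rep_l2 u x = 0})"
    by (intro closed_Int closed_INT ballI closed_Collect_le closed_l2_support \<Omega> continuous_intros
        continuous_on_subset[OF continuous_tau]) auto
  moreover have "{u :: ('a, real) l2. norm u \<le> 1} \<inter> (\<Inter>h. {u. norm (tau h u - u) \<le> norm h}) \<inter>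
      {u. AE x in lborel. x \<notin> \<Omega> \<longrightarrow> rep_l2 u x = 0} = ?S" by auto
  ultimately have "closed ?S" by simp
  then show "complete ?S" by (simp add: complete_eq_closed)
next
  fix e :: real assume e: "0 < e"
  have [measurable]: "\<Omega> \<in> sets borel" by fact
  define r where "r = e / 4"
  have r: "0 < r" using e by (simp add: r_def)
  define b where "b = 1 / sqrt (vol TYPE('a) r)"
  have b: "0 < b" using vol_pos[OF r, where 'a='a] by (simp add: b_def)
  define m where "m = sqrt (measure lborel \<Omega>) + 1"
  have m: "0 < m" by (simp add: m_def add_nonneg_pos)
  \<comment> \<open>The rounding step \<open>\<eta>\<close> and the mesh \<open>\<delta>\<close>
    each contribute e/8 to the L^2 distance of two averages on \<Omega>: \<open>\<eta> * m\<close>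
    and \<open>2 * b * \<delta> * m\<close>.\<close>
  define \<eta> where "\<eta> = e / (8 * m)"
  define \<delta> where "\<delta> = e / (16 * m * b)"
  have \<eta>: "0 < \<eta>" and \<delta>: "0 < \<delta>" using e m b by (auto simp: \<eta>_def \<delta>_def)
  have "compact (closure \<Omega>)" using \<Omega>(2) by simp
  then obtain D where D: "finite D" "closure \<Omega> \<subseteq> (\<Union>x\<in>D. ball x \<delta>)"
    using \<delta> unfolding compact_eq_totally_bounded by blast
  define s where "s u = restrict (\<lambda>c. \<lfloor>avg r u c / \<eta>\<rfloor>) D" for u :: "('a, real) l2"
  have ab: "\<bar>avg r u c\<bar> \<le> b" if "u \<in> ?S" for u c
  proof -
    have "\<bar>avg r u c\<bar> \<le> norm u * b" using avg_bound[OF r, of u c] by (simp add: b_def)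
    also have "\<dots> \<le> 1 * b" using that b by (intro mult_right_mono) auto
    finally show ?thesis by simp
  qed
  have "s ` ?S \<subseteq> PiE D (\<lambda>_. {\<lfloor>- b / \<eta>\<rfloor>..\<lfloor>b / \<eta>\<rfloor>})"
  proof (rule image_subsetI)
    fix u :: "('a, real) l2" assume u: "u \<in> ?S"
    have "\<lfloor>avg r u c / \<eta>\<rfloor> \<in> {\<lfloor>- b / \<eta>\<rfloor>..\<lfloor>b / \<eta>\<rfloor>}" for c
      unfolding atLeastAtMost_iff using ab[OF u, of c] \<eta>
      by (intro conjI floor_mono divide_right_mono) (auto simp: abs_le_iff)
    then show "s u \<in> PiE D (\<lambda>_. {\<lfloor>- b / \<eta>\<rfloor>..\<lfloor>b / \<eta>\<rfloor>})" by (auto simp: s_def)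
  qed
  then have "finite (s ` ?S)" by (rule finite_subset) (use D(1) in \<open>auto intro: finite_PiE\<close>)
  then obtain T where T: "T \<subseteq> ?S" "finite T" "s ` ?S = s ` T"
    using finite_subset_image[of "s ` ?S" s ?S] by blast
  have "dist u' u < e" if u: "u \<in> ?S" and u': "u' \<in> ?S" and eq: "s u = s u'" for u u'
  proof -
    have tr: "norm (tau h u - u) \<le> norm h * 1" "norm (tau h u' - u') \<le> norm h * 1" for h
      using u u' by auto
    have [measurable]: "avg r u \<in> borel_measurable borel" "avg r u' \<in> borel_measurable borel"
      using avg_measurable[OF r tr(1)] avg_measurable[OF r tr(2)] .
    have close: "\<bar>avg r u x - avg r u' x\<bar> \<le> \<eta> + 2 * b * \<delta>" if "x \<in> \<Omega>" for x
    proof -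
      have "x \<in> closure \<Omega>" using that closure_subset[of \<Omega>] by auto
      then obtain c where c: "c \<in> D" "x \<in> ball c \<delta>" using D(2) by auto
      have "\<lfloor>avg r u c / \<eta>\<rfloor> = \<lfloor>avg r u' c / \<eta>\<rfloor>"
        using fun_cong[OF eq, of c] c(1) by (simp add: s_def)
      then have "\<bar>avg r u c / \<eta> - avg r u' c / \<eta>\<bar> \<le> 1" by linarith
      then have 1: "\<bar>avg r u c - avg r u' c\<bar> \<le> \<eta>"
        using \<eta> by (simp add: diff_divide_distrib[symmetric] abs_divide)
      have 2: "\<bar>avg r v x - avg r v c\<bar> \<le> b * \<delta>" if "\<And>h. norm (tau h v - v) \<le> norm h * 1" for v
      proof -
        have "\<bar>avg r v x - avg r v c\<bar> \<le> norm (x - c) * b"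
          using avg_lipschitz[OF r that, of x c] by (simp add: b_def)
        also have "\<dots> \<le> \<delta> * b"
          using c(2) b by (intro mult_right_mono) (auto simp: dist_norm norm_minus_commute)
        finally show ?thesis by (simp add: mult.commute)
      qed
      show ?thesis using 1 2[of u, OF tr(1)] 2[of u', OF tr(2)] by linarith
    qed
    have appr: "norm (v - abs_l2 (\<lambda>x. indicator \<Omega> x * avg r v x)) \<le> r \<and> sqint (\<lambda>x. indicator \<Omega> x * avg r v x)"
      if v: "v \<in> ?S" for v
    proof -
      have tv: "norm (tau h v - v) \<le> norm h * 1" for h using v by auto
      have [measurable]: "avg r v \<in> borel_measurable borel" by (rule avg_measurable[OF r tv])
      have si: "sqint (\<lambda>x. indicator \<Omega> x * avg r v x)"
        using ab[OF v] by (intro sqint_bound[OF sqint_indicator[OF \<Omega>], of _ b]) (auto simp: indicator_def)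
      have sd: "sqint (\<lambda>x. rep_l2 v x - indicator \<Omega> x * avg r v x)" by (intro sqint_diff sqint_rep si)
      have "(\<integral>\<^sup>+x. ennreal ((norm (rep_l2 v x - indicator \<Omega> x * avg r v x))\<^sup>2) \<partial>lborel)
          \<le> (\<integral>\<^sup>+x. ennreal ((rep_l2 v x - avg r v x)\<^sup>2) \<partial>lborel)"
      proof (rule nn_integral_mono_AE)
        have "AE x in lborel. x \<notin> \<Omega> \<longrightarrow> rep_l2 v x = 0" using v by auto
        then show "AE x in lborel. ennreal ((norm (rep_l2 v x - indicator \<Omega> x * avg r v x))\<^sup>2)
            \<le> ennreal ((rep_l2 v x - avg r v x)\<^sup>2)"
          by eventually_elim (auto simp: indicator_def)
      qed
      also have "\<dots> \<le> ennreal (r\<^sup>2)" using avg_close[OF r _ tv] by simp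
      finally have "norm (abs_l2 (\<lambda>x. rep_l2 v x - indicator \<Omega> x * avg r v x)) \<le> r"
        using norm_abs_l2_le[OF sd] r by simp
      then show ?thesis using si by (simp add: abs_l2_diff[symmetric])
    qed
    let ?a = "abs_l2 (\<lambda>x. indicator \<Omega> x * avg r u x)" and ?a' = "abs_l2 (\<lambda>x. indicator \<Omega> x * avg r u' x)"
    have "norm (?a - ?a') \<le> (\<eta> + 2 * b * \<delta>) * sqrt (measure lborel \<Omega>)"
    proof -
      have si: "sqint (\<lambda>x. indicator \<Omega> x * avg r u x)" "sqint (\<lambda>x. indicator \<Omega> x * avg r u' x)"
        using appr[OF u] appr[OF u'] by auto
      have ss: "sqint (\<lambda>x. (\<eta> + 2 * b * \<delta>) *\<^sub>R (indicator \<Omega> x :: real))"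
        by (intro sqint_scaleR sqint_indicator \<Omega>)
      have "norm (?a - ?a') \<le> norm (abs_l2 (\<lambda>x. (\<eta> + 2 * b * \<delta>) *\<^sub>R (indicator \<Omega> x :: real)))"
        unfolding abs_l2_diff[OF si]
        using close \<eta> \<delta> b by (intro norm_abs_l2_mono sqint_diff si ss) (auto simp: indicator_def)
      also have "\<dots> = (\<eta> + 2 * b * \<delta>) * norm (abs_l2 (indicator \<Omega> :: 'a \<Rightarrow> real))"
        unfolding abs_l2_scaleR[OF sqint_indicator[OF \<Omega>], symmetric] norm_scaleR using \<eta> \<delta> b by simp
      also have "norm (abs_l2 (indicator \<Omega> :: 'a \<Rightarrow> real)) = sqrt (measure lborel \<Omega>)"
      proof -
        have "(\<lambda>x. (norm (indicator \<Omega> x :: real))\<^sup>2) = indicator \<Omega>" by (auto simp: indicator_def)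
        then have "(norm (abs_l2 (indicator \<Omega> :: 'a \<Rightarrow> real)))\<^sup>2 = measure lborel \<Omega>"
          using norm_abs_l2[OF sqint_indicator[OF \<Omega>]] by simp
        then show ?thesis by (metis norm_ge_zero real_sqrt_unique)
      qed
      finally show ?thesis .
    qed
    also have "\<dots> \<le> (\<eta> + 2 * b * \<delta>) * m"
      using \<eta> \<delta> b by (intro mult_left_mono) (auto simp: m_def)
    also have "\<dots> = e / 4" using m b by (simp add: \<eta>_def \<delta>_def field_simps)
    finally have "norm (?a - ?a') \<le> e / 4" .
    moreover have "norm (u - ?a) \<le> e / 4" "norm (u' - ?a') \<le> e / 4"
      using appr[OF u] appr[OF u'] by (auto simp: r_def)
    moreover have "norm (u' - u) \<le> norm (u' - ?a') + norm (u - ?a) + norm (?a - ?a')"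
    proof -
      have eq: "u' - u = (u' - ?a') - (u - ?a) - (?a - ?a')" by simp
      show ?thesis unfolding eq
        using norm_triangle_ineq4[of "(u' - ?a') - (u - ?a)" "?a - ?a'"]
          norm_triangle_ineq4[of "u' - ?a'" "u - ?a"] by linarith
    qed
    ultimately show ?thesis using e by (simp add: dist_norm)
  qed
  note near = this
  have "?S \<subseteq> (\<Union>x\<in>T. ball x e)"
  proof
    fix u assume u: "u \<in> ?S"
    then have "s u \<in> s ` T" unfolding T(3)[symmetric] by (rule imageI)
    then obtain u' where u': "u' \<in> T" "s u = s u'" by auto
    have "dist u' u < e" by (rule near[OF u subsetD[OF T(1) u'(1)] u'(2)])
    then show "u \<in> (\<Union>x\<in>T. ball x e)" using u'(1) by auto
  qed
  then show "\<exists>k. finite k \<and> ?S \<subseteq> (\<Union>x\<in>k. ball x e)" using T(2) by blast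
qed

subsection \<open>Eigenvectors of the resolvent\<close>

lemma lap_test_test_fun: "test_fun \<Omega> \<eta> \<Longrightarrow> test_fun \<Omega> (lap_test \<eta>)"
proof -
  assume \<eta>: "test_fun \<Omega> \<eta>"
  have "test_fun \<Omega> (\<lambda>x. \<Sum>b\<in>B. pd b (pd b \<eta>) x)" if "finite B" "B \<subseteq> Basis" for B
    using that
  proof (induction B rule: finite_induct)
    case (insert b B)
    have "test_fun \<Omega> (\<lambda>x. pd b (pd b \<eta>) x + (\<Sum>b\<in>B. pd b (pd b \<eta>) x))"
      by (rule test_fun_add) (use insert \<eta> in \<open>auto intro: test_fun_pd\<close>)
    then show ?case using insert.hyps by simp
  qed (simp add: test_fun_zero)
  from this[OF finite_Basis subset_refl] show ?thesis by (simp add: lap_test_def[abs_def])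
qed

lemma V_lap_test:
  assumes w: "w \<in> V \<Omega>" and \<eta>: "test_fun \<Omega>' \<eta>"
  shows "fst w \<bullet> abs_l2 (lap_test \<eta>) = - (snd w \<bullet> abs_l2 (grad \<eta>))"
proof -
  have b: "fst w \<bullet> abs_l2 (pd b (pd b \<eta>)) = - (snd w \<bullet> abs_l2 (\<lambda>x. pd b \<eta> x *\<^sub>R b))" if "b \<in> Basis" for b
    using V_by_parts[OF w test_fun_pd[OF \<eta> that], of b] that by (simp add: grad_inner_Basis)
  have s1: "sqint (pd b (pd b \<eta>))" if "b \<in> Basis" for b
    using that \<eta> by (intro test_fun_sqint[of \<Omega>'] test_fun_pd)
  have s2: "sqint (\<lambda>x. pd b \<eta> x *\<^sub>R b)" if "b \<in> Basis" for b
    using sqint_measurable[OF test_fun_sqint[OF test_fun_pd[OF \<eta> that]]] that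
    by (intro sqint_bound[OF test_fun_sqint[OF test_fun_pd[OF \<eta> that]], of _ 1]) auto
  have 1: "sqint (\<lambda>x. \<Sum>b\<in>B. pd b (pd b \<eta>) x) \<and> abs_l2 (\<lambda>x. \<Sum>b\<in>B. pd b (pd b \<eta>) x) = (\<Sum>b\<in>B. abs_l2 (pd b (pd b \<eta>)))"
    if "finite B" "B \<subseteq> Basis" for B
    using that by (induction B rule: finite_induct) (auto simp: abs_l2_zero abs_l2_add[symmetric] s1 intro: sqint_add)
  have 2: "sqint (\<lambda>x. \<Sum>b\<in>B. pd b \<eta> x *\<^sub>R b) \<and> abs_l2 (\<lambda>x. \<Sum>b\<in>B. pd b \<eta> x *\<^sub>R b) = (\<Sum>b\<in>B. abs_l2 (\<lambda>x. pd b \<eta> x *\<^sub>R b))"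
    if "finite B" "B \<subseteq> Basis" for B
    using that by (induction B rule: finite_induct) (auto simp: abs_l2_zero abs_l2_add[symmetric] s2 intro: sqint_add)
  have "fst w \<bullet> abs_l2 (lap_test \<eta>) = (\<Sum>b\<in>Basis. fst w \<bullet> abs_l2 (pd b (pd b \<eta>)))"
    using 1[of Basis] by (simp add: lap_test_def[abs_def] inner_sum_right)
  also have "\<dots> = (\<Sum>b\<in>Basis. - (snd w \<bullet> abs_l2 (\<lambda>x. pd b \<eta> x *\<^sub>R b)))"
    by (intro sum.cong b) auto
  also have "\<dots> = - (snd w \<bullet> abs_l2 (grad \<eta>))"
    using 2[of Basis] by (simp add: grad_def[abs_def] inner_sum_right sum_negf)
  finally show ?thesis .
qed

text \<open>The link between the resolvent, defined by a form, and the distributional Laplacian. The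
  supersolution property of eigenvectors and the Laplacian of the final solution are both read off
  from it.\<close>

lemma K_weak_lap:
  assumes \<eta>: "test_fun \<Omega> \<eta>"
  shows "K \<Omega> f \<bullet> abs_l2 (lap_test \<eta>) = K \<Omega> f \<bullet> abs_l2 \<eta> - f \<bullet> abs_l2 \<eta>"
proof -
  have "Rop \<Omega> f \<bullet> graph_grad \<eta> = f \<bullet> abs_l2 \<eta>"
    using Rop_inner[OF graph_grad_in_V[OF \<eta>], of f] by (simp add: graph_grad_def)
  then have "K \<Omega> f \<bullet> abs_l2 \<eta> + snd (Rop \<Omega> f) \<bullet> abs_l2 (grad \<eta>) = f \<bullet> abs_l2 \<eta>"
    by (simp add: K_def graph_grad_def inner_prod_def)
  then show ?thesis using V_lap_test[OF Rop_in_V \<eta>, of \<Omega> f] by (simp add: K_def)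
qed

text \<open>A nonzero test function shows that the form of K is not identically zero, hence that the
  top of its spectrum is positive.\<close>

lemma exists_test_fun:
  fixes \<Omega> :: "'a::euclidean_space set"
  assumes "open \<Omega>" "\<Omega> \<noteq> {}"
  shows "\<exists>p. test_fun \<Omega> p \<and> abs_l2 p \<noteq> 0"
proof -
  obtain c e where c: "0 < e" "cball c e \<subseteq> \<Omega>" using assms by (metis all_not_in_conv open_contains_cball)
  define p :: "'a \<Rightarrow> real" where "p x = flat (e\<^sup>2 + (-1) * (norm (x - c))\<^sup>2)" for x
  have "smooth p" unfolding p_def[abs_def]
    by (intro smooth_compose[OF _ smooth_flat] smooth_add smooth_const smooth_mult smooth_norm_diff_sq)
  then have p: "test_fun \<Omega> p"
  proof (rule test_funI[OF _ compact_cball c(2)])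
    fix x assume "p x \<noteq> 0"
    then have "\<not> e\<^sup>2 + (-1) * (norm (x - c))\<^sup>2 \<le> 0" using flat_zero unfolding p_def by blast
    then have "(norm (x - c))\<^sup>2 \<le> e\<^sup>2" by simp
    then have "norm (x - c) \<le> e" using c(1) power2_le_imp_le by fastforce
    then show "x \<in> cball c e" by (simp add: dist_norm norm_minus_commute)
  qed
  have "abs_l2 p \<noteq> 0"
  proof
    assume "abs_l2 p = 0"
    then have "AE x in lborel. p x = 0"
      using abs_l2_eq_iff[OF test_fun_sqint[OF p] sqint_zero] by (simp add: abs_l2_zero)
    moreover have "p x \<noteq> 0" if "x \<in> ball c e" for x
    proof -
      have "(norm (x - c))\<^sup>2 < e\<^sup>2"
        using that c(1) by (intro power_strict_mono) (auto simp: dist_norm norm_minus_commute)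
      then show ?thesis unfolding p_def using flat_pos[of "e\<^sup>2 - (norm (x - c))\<^sup>2"] by simp
    qed
    ultimately have "AE x in lborel. x \<notin> ball c e" by (elim eventually_mono) blast
    then have "emeasure lborel (ball c e) = 0"
      by (subst (asm) AE_iff_measurable[OF _ refl]) (auto simp del: mem_ball)
    then have "measure lborel (ball c e) = 0" by (simp add: measure_def)
    then show False using content_ball_pos[OF c(1), of c] by simp
  qed
  then show ?thesis using p by blast
qed

lemma continuous_K: "continuous_on UNIV (K \<Omega>)"
  by (rule continuous_onI) (metis K_diff dist_norm norm_K_le order.trans less_imp_le)

text \<open>For a nonnegative symmetric operator the form controls the norm: |K f|^2 is the graph
  product of \<open>Rop \<Omega> f\<close> and \<open>Rop \<Omega> (K \<Omega> f)\<close>, and each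
  factor is bounded by the form.\<close>

lemma K_norm_le_form:
  assumes S: "\<And>f. f \<in> S \<Longrightarrow> K \<Omega> f \<in> S" and \<kappa>: "\<And>f. f \<in> S \<Longrightarrow> K \<Omega> f \<bullet> f \<le> \<kappa> * (norm f)\<^sup>2" "0 \<le> \<kappa>"
    and f: "f \<in> S"
  shows "norm (K \<Omega> f) \<le> \<kappa> * norm f"
proof (cases "K \<Omega> f = 0")
  case False
  have R: "norm (Rop \<Omega> g) \<le> sqrt \<kappa> * norm g" if "g \<in> S" for g
  proof -
    have "(norm (Rop \<Omega> g))\<^sup>2 = K \<Omega> g \<bullet> g" by (simp add: power2_norm_eq_inner Rop_inner_Rop)
    also have "\<dots> \<le> (sqrt \<kappa> * norm g)\<^sup>2" using \<kappa> that by (simp add: power_mult_distrib)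
    finally show ?thesis by (rule power2_le_imp_le) (simp add: \<kappa>)
  qed
  have "(norm (K \<Omega> f))\<^sup>2 = Rop \<Omega> f \<bullet> Rop \<Omega> (K \<Omega> f)" by (simp add: power2_norm_eq_inner Rop_inner_Rop)
  also have "\<dots> \<le> norm (Rop \<Omega> f) * norm (Rop \<Omega> (K \<Omega> f))" by (rule norm_cauchy_schwarz)
  also have "\<dots> \<le> (sqrt \<kappa> * norm f) * (sqrt \<kappa> * norm (K \<Omega> f))"
    using R[OF f] R[OF S[OF f]] \<kappa> by (intro mult_mono) auto
  also have "\<dots> = \<kappa> * norm f * norm (K \<Omega> f)"
    using \<kappa> real_sqrt_mult_self[of \<kappa>] by (simp add: mult_ac)
  finally show ?thesis using False by (simp add: power2_eq_square)
qed (use \<kappa> in simp)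

text \<open>A maximizing sequence is an approximate eigenvector sequence: |K F - \<kappa> F|^2 \<le>
  2 \<kappa>^2 - 2 \<kappa> (K F . F). Compactness makes K F converge along a subsequence, and then
  F itself converges because \<kappa> > 0.\<close>

lemma K_maximizer:
  fixes \<Omega> :: "'a::euclidean_space set"
  assumes \<Omega>: "open \<Omega>" "bounded \<Omega>"
    and S: "closed S" "\<And>f. f \<in> S \<Longrightarrow> K \<Omega> f \<in> S" "\<And>c f. f \<in> S \<Longrightarrow> c *\<^sub>R f \<in> S"
    and \<kappa>: "\<And>f. f \<in> S \<Longrightarrow> K \<Omega> f \<bullet> f \<le> \<kappa> * (norm f)\<^sup>2" "0 < \<kappa>"
    and F: "\<And>n. F n \<in> S" "\<And>n. norm (F n) = 1" "(\<lambda>n. K \<Omega> (F n) \<bullet> F n) \<longlonglongrightarrow> \<kappa>"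
  shows "\<exists>\<phi>\<in>S. norm \<phi> = 1 \<and> K \<Omega> \<phi> = \<kappa> *\<^sub>R \<phi>"
proof -
  let ?C = "{u :: ('a, real) l2. norm u \<le> 1 \<and> (\<forall>h. norm (tau h u - u) \<le> norm h) \<and> (AE x in lborel. x \<notin> \<Omega> \<longrightarrow> rep_l2 u x = 0)}"
  have "compact ?C" using \<Omega> by (intro compact_translation_bounded) auto
  moreover have "K \<Omega> (F n) \<in> ?C" for n
    using norm_K_le[of \<Omega> "F n"] K_translate[of _ \<Omega> "F n"] K_support[OF \<Omega>(1), of "F n"] F(2)[of n] by simp
  ultimately obtain y r where y: "strict_mono (r :: nat \<Rightarrow> nat)" "((\<lambda>n. K \<Omega> (F n)) \<circ> r) \<longlonglongrightarrow> y"
    using seq_compactE[OF compact_imp_seq_compact, of ?C "\<lambda>n. K \<Omega> (F n)"] by metis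
  have "(norm (K \<Omega> (F n) - \<kappa> *\<^sub>R F n))\<^sup>2 \<le> 2 * \<kappa>\<^sup>2 - 2 * \<kappa> * (K \<Omega> (F n) \<bullet> F n)" for n
  proof -
    have "norm (K \<Omega> (F n)) \<le> \<kappa> * norm (F n)"
      using K_norm_le_form[of S \<Omega> \<kappa> "F n"] S \<kappa> F by auto
    then have "(norm (K \<Omega> (F n)))\<^sup>2 \<le> \<kappa>\<^sup>2" using F(2) by (simp add: power_mono)
    moreover have "F n \<bullet> F n = 1" using F(2)[of n] by (simp add: power2_norm_eq_inner[symmetric])
    ultimately show ?thesis unfolding power2_norm_eq_inner
      by (simp add: inner_diff_left inner_diff_right inner_commute algebra_simps power2_eq_square)
  qed
  moreover have "(\<lambda>n. 2 * \<kappa>\<^sup>2 - 2 * \<kappa> * (K \<Omega> (F n) \<bullet> F n)) \<longlonglongrightarrow> 2 * \<kappa>\<^sup>2 - 2 * \<kappa> * \<kappa>"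
    by (intro tendsto_intros F)
  ultimately have "(\<lambda>n. (norm (K \<Omega> (F n) - \<kappa> *\<^sub>R F n))\<^sup>2) \<longlonglongrightarrow> 0"
    by (intro Lim_null_comparison[of "\<lambda>n. (norm (K \<Omega> (F n) - \<kappa> *\<^sub>R F n))\<^sup>2"] always_eventually)
      (auto simp: power2_eq_square)
  then have "(\<lambda>n. norm (K \<Omega> (F n) - \<kappa> *\<^sub>R F n)) \<longlonglongrightarrow> 0"
    using tendsto_real_sqrt[of _ 0] by fastforce
  then have "(\<lambda>n. K \<Omega> (F n) - \<kappa> *\<^sub>R F n) \<longlonglongrightarrow> 0" by (rule tendsto_norm_zero_cancel)
  from LIMSEQ_subseq_LIMSEQ[OF this y(1)]
  have "(\<lambda>n. K \<Omega> (F (r n)) - (K \<Omega> (F (r n)) - \<kappa> *\<^sub>R F (r n))) \<longlonglongrightarrow> y - 0"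
    using y(2) by (intro tendsto_diff) (auto simp: o_def)
  then have "(\<lambda>n. (1 / \<kappa>) *\<^sub>R \<kappa> *\<^sub>R F (r n)) \<longlonglongrightarrow> (1 / \<kappa>) *\<^sub>R y"
    by (intro tendsto_intros) simp
  then have lim: "(\<lambda>n. F (r n)) \<longlonglongrightarrow> (1 / \<kappa>) *\<^sub>R y" using \<kappa>(2) by simp
  define \<phi> where "\<phi> = (1 / \<kappa>) *\<^sub>R y"
  have "\<phi> \<in> S" unfolding \<phi>_def using closed_sequentially[OF S(1) F(1) lim] .
  moreover have "norm \<phi> = 1"
    using tendsto_norm[OF lim] F(2) LIMSEQ_unique[OF tendsto_const] unfolding \<phi>_def by fastforce
  moreover have "K \<Omega> \<phi> = y"
  proof -
    have "(\<lambda>n. K \<Omega> (F (r n))) \<longlonglongrightarrow> K \<Omega> \<phi>"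
      using continuous_on_tendsto_compose[OF continuous_K lim] by (simp add: \<phi>_def)
    then show ?thesis using y(2) LIMSEQ_unique by (fastforce simp: o_def)
  qed
  ultimately show ?thesis using \<kappa>(2) by (intro bexI[of _ \<phi>]) (auto simp: \<phi>_def)
qed

text \<open>S is kept general because two cases occur: the whole space, for the ground state, and
  the orthogonal complement of the ground state, for the spectral gap. An S without unit vectors
  gets \<kappa> = 0, hence the eigenvector only for positive \<kappa>.\<close>

lemma K_form_sup:
  assumes \<Omega>: "open \<Omega>" "bounded \<Omega>"
    and S: "closed S" "\<And>f. f \<in> S \<Longrightarrow> K \<Omega> f \<in> S" "\<And>c f. f \<in> S \<Longrightarrow> c *\<^sub>R f \<in> S"
  shows "\<exists>\<kappa>\<ge>0. (\<forall>f\<in>S. K \<Omega> f \<bullet> f \<le> \<kappa> * (norm f)\<^sup>2) \<and>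
    (\<kappa> > 0 \<longrightarrow> (\<exists>\<phi>\<in>S. norm \<phi> = 1 \<and> K \<Omega> \<phi> = \<kappa> *\<^sub>R \<phi>))"
proof (cases "\<exists>f\<in>S. norm f = 1")
  case False
  have "f = 0" if "f \<in> S" for f
  proof (rule ccontr)
    assume "f \<noteq> 0"
    then have "norm ((1 / norm f) *\<^sub>R f) = 1" by simp
    then show False using False S(3)[OF that] by blast
  qed
  then have "K \<Omega> f \<bullet> f \<le> 0" if "f \<in> S" for f using that by (metis inner_zero_right order_refl)
  then show ?thesis by (intro exI[of _ 0]) simp
next
  case True
  define X where "X = (\<lambda>f. K \<Omega> f \<bullet> f) ` {f\<in>S. norm f = 1}"
  have ne: "X \<noteq> {}" using True by (auto simp: X_def)
  have nn: "0 \<le> K \<Omega> f \<bullet> f" for f using Rop_inner_Rop[of \<Omega> f f] inner_ge_zero by metis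
  have "K \<Omega> f \<bullet> f \<le> 1" if "norm f = 1" for f
    using norm_cauchy_schwarz[of "K \<Omega> f" f] norm_K_le[of \<Omega> f] that by simp
  then have bdd: "bdd_above X" by (auto simp: X_def intro!: bdd_aboveI2)
  define \<kappa> where "\<kappa> = Sup X"
  have le: "K \<Omega> f \<bullet> f \<le> \<kappa>" if "f \<in> S" "norm f = 1" for f
    unfolding \<kappa>_def using that bdd by (intro cSup_upper) (auto simp: X_def)
  have \<kappa>0: "0 \<le> \<kappa>" using True le nn order_trans by blast
  have form: "K \<Omega> f \<bullet> f \<le> \<kappa> * (norm f)\<^sup>2" if f: "f \<in> S" for f
  proof (cases "f = 0")
    case False
    let ?g = "(1 / norm f) *\<^sub>R f"
    have "norm ?g = 1" using False by simp
    then have "K \<Omega> ?g \<bullet> ?g \<le> \<kappa>" by (rule le[OF S(3)[OF f]])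
    then show ?thesis using False by (simp add: K_scaleR power2_eq_square field_simps)
  qed simp
  have "\<exists>\<phi>\<in>S. norm \<phi> = 1 \<and> K \<Omega> \<phi> = \<kappa> *\<^sub>R \<phi>" if pos: "\<kappa> > 0"
  proof -
    have "\<exists>f. f \<in> S \<and> norm f = 1 \<and> \<kappa> - inverse (real (Suc n)) < K \<Omega> f \<bullet> f" for n
      using less_cSupD[OF ne, of "\<kappa> - inverse (real (Suc n))"] unfolding \<kappa>_def X_def by auto
    then obtain F where F: "\<And>n. F n \<in> S" "\<And>n. norm (F n) = 1"
      "\<And>n. \<kappa> - inverse (real (Suc n)) < K \<Omega> (F n) \<bullet> F n" by metis
    have "(\<lambda>n. K \<Omega> (F n) \<bullet> F n) \<longlonglongrightarrow> \<kappa>"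
    proof (rule tendsto_sandwich)
      show "(\<lambda>n. \<kappa> - inverse (real (Suc n))) \<longlonglongrightarrow> \<kappa>"
        using tendsto_diff[OF tendsto_const[of \<kappa>] LIMSEQ_inverse_real_of_nat] by simp
      show "\<forall>\<^sub>F n in sequentially. \<kappa> - inverse (real (Suc n)) \<le> K \<Omega> (F n) \<bullet> F n"
        using F(3) by (auto intro: always_eventually less_imp_le)
      show "\<forall>\<^sub>F n in sequentially. K \<Omega> (F n) \<bullet> F n \<le> \<kappa>"
        using F le by (auto intro: always_eventually)
    qed auto
    then show ?thesis using K_maximizer[of \<Omega> S \<kappa> F] \<Omega> S form pos F by blast
  qed
  then show ?thesis using \<kappa>0 form by blast
qed

text \<open>A shift longer than the diameter moves \<Omega> off itself, so the value at a point of
  \<Omega> equals a value outside, which is 0.\<close>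

lemma l2_translation_invariant_zero:
  fixes u :: "('a::euclidean_space, real) l2"
  assumes "bounded \<Omega>" "AE x in lborel. x \<notin> \<Omega> \<longrightarrow> rep_l2 u x = 0" "\<And>h. tau h u = u"
  shows "u = 0"
proof -
  obtain B where B: "\<And>x. x \<in> \<Omega> \<Longrightarrow> norm x \<le> B" using assms(1) by (auto simp: bounded_iff)
  obtain b :: 'a where b: "b \<in> Basis" using nonempty_Basis by blast
  define h where "h = (2 * \<bar>B\<bar> + 1) *\<^sub>R b"
  have nh: "norm h = 2 * \<bar>B\<bar> + 1" using b by (simp add: h_def)
  have "AE x in lborel. rep_l2 u x = 0"
    using assms(2) AE_translate[OF assms(2), of h] rep_tau[of h u] unfolding assms(3)
  proof eventually_elim
    case (elim x)
    show ?case
    proof (cases "x \<in> \<Omega>")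
      case True
      have "x + h \<notin> \<Omega>"
      proof
        assume "x + h \<in> \<Omega>"
        then have "norm (x + h) \<le> \<bar>B\<bar>" "norm x \<le> \<bar>B\<bar>" using B True by fastforce+
        then show False using norm_triangle_ineq4[of "x + h" x] nh by simp
      qed
      then show ?thesis using elim by simp
    qed (use elim in simp)
  qed
  with rep_l2_zero have "AE x in lborel. rep_l2 u x = rep_l2 0 x"
    by (rule eventually_elim2) simp
  then show ?thesis by (simp add: l2_eq_iff)
qed

text \<open>The equation gives \<kappa> (1 - \<kappa>) |u|^2 = |grad K u|^2. A vanishing gradient
  would make K u invariant under all shifts although it is supported in a bounded set.\<close>

lemma K_eigenvalue_less_1:
  assumes \<Omega>: "open \<Omega>" "bounded \<Omega>" and u: "K \<Omega> u = \<kappa> *\<^sub>R u" "u \<noteq> 0" "0 < \<kappa>"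
  shows "\<kappa> < 1"
proof -
  let ?g = "snd (Rop \<Omega> u)"
  have "(norm (Rop \<Omega> u))\<^sup>2 = (norm (K \<Omega> u))\<^sup>2 + (norm ?g)\<^sup>2"
    by (simp add: K_def power2_norm_eq_inner inner_prod_def)
  moreover have "(norm (Rop \<Omega> u))\<^sup>2 = \<kappa> * (norm u)\<^sup>2"
    using Rop_inner_Rop[of \<Omega> u u] u(1) by (simp add: power2_norm_eq_inner)
  ultimately have eq: "\<kappa> * (1 - \<kappa>) * (norm u)\<^sup>2 = (norm ?g)\<^sup>2"
    using u by (simp add: power_mult_distrib algebra_simps power2_eq_square)
  have "?g \<noteq> 0"
  proof
    assume g: "?g = 0"
    have "tau h (K \<Omega> u) = K \<Omega> u" for h
      using V_translate[OF Rop_in_V[of \<Omega> u], of h] g by (simp add: K_def)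
    then have "K \<Omega> u = 0"
      using l2_translation_invariant_zero[OF \<Omega>(2) K_support[OF \<Omega>(1)]] by blast
    then show False using u by simp
  qed
  then have "0 < \<kappa> * (1 - \<kappa>) * (norm u)\<^sup>2" unfolding eq by simp
  then show ?thesis using u by (simp add: zero_less_mult_iff)
qed

definition l2_abs :: "('a::euclidean_space, real) l2 \<Rightarrow> ('a, real) l2" where
  "l2_abs u = abs_l2 (\<lambda>x. \<bar>rep_l2 u x\<bar>)"

lemma sqint_abs: "sqint (f :: 'a::euclidean_space \<Rightarrow> real) \<Longrightarrow> sqint (\<lambda>x. \<bar>f x\<bar>)"
  by (rule sqint_bound[of f _ 1]) (auto dest: sqint_measurable)

lemma rep_l2_abs: "AE x in lborel. rep_l2 (l2_abs u) x = \<bar>rep_l2 u x\<bar>"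
  unfolding l2_abs_def by (intro rep_abs_l2 sqint_abs sqint_rep)

lemma norm_l2_abs: "norm (l2_abs u) = norm u"
proof -
  have "(norm (l2_abs u))\<^sup>2 = (norm u)\<^sup>2"
    unfolding l2_abs_def by (subst norm_abs_l2) (auto intro: sqint_abs simp: norm_l2_rep)
  then show ?thesis by simp
qed

lemma inner_nonneg_l2:
  assumes "AE x in lborel. 0 \<le> rep_l2 u x" "AE x in lborel. 0 \<le> rep_l2 v x"
  shows "0 \<le> u \<bullet> (v :: ('a::euclidean_space, real) l2)"
  unfolding inner_l2_rep using assms by (intro integral_nonneg_AE) (auto elim!: eventually_elim2)

text \<open>The form of \<open>K\<close> does not decrease under \<open>u \<mapsto> |u|\<close>, so \<open>|u|\<close> again maximizes it.\<close>
lemma K_eigenvector_abs: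
  assumes \<Omega>: "open \<Omega>" "bounded \<Omega>"
    and \<kappa>: "\<And>f. K \<Omega> f \<bullet> f \<le> \<kappa> * (norm f)\<^sup>2" "0 < \<kappa>" and u: "K \<Omega> u = \<kappa> *\<^sub>R u"
  shows "K \<Omega> (l2_abs u) = \<kappa> *\<^sub>R l2_abs u"
proof -
  let ?v = "l2_abs u"
  have "AE x in lborel. 0 \<le> rep_l2 (?v - u) x"
    using rep_l2_abs[of u] rep_l2_diff[of ?v u] by eventually_elim auto
  moreover have "AE x in lborel. 0 \<le> rep_l2 (?v + u) x"
    using rep_l2_abs[of u] rep_l2_add[of ?v u] by eventually_elim auto
  \<comment> \<open>Both factors are nonnegative, so positivity of K gives the sign. Symmetry
    cancels the mixed terms and leaves a comparison of the two forms.\<close>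
  ultimately have "0 \<le> K \<Omega> (?v - u) \<bullet> (?v + u)"
    using K_nonneg[OF \<Omega>] by (intro inner_nonneg_l2)
  also have "\<dots> = K \<Omega> ?v \<bullet> ?v - K \<Omega> u \<bullet> u"
    unfolding K_diff inner_diff_left inner_add_right
    using K_symmetric[of \<Omega> u ?v] by (simp add: inner_commute[of u])
  finally have ge: "\<kappa> * (norm ?v)\<^sup>2 \<le> K \<Omega> ?v \<bullet> ?v"
    by (simp add: u norm_l2_abs power2_norm_eq_inner)
  have "norm (K \<Omega> ?v) \<le> \<kappa> * norm ?v"
    using K_norm_le_form[of UNIV \<Omega> \<kappa> ?v] \<kappa> by auto
  then have "(norm (K \<Omega> ?v))\<^sup>2 \<le> \<kappa>\<^sup>2 * (norm ?v)\<^sup>2"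
    by (metis norm_ge_zero power_mono power_mult_distrib)
  moreover have "(norm (K \<Omega> ?v - \<kappa> *\<^sub>R ?v))\<^sup>2 = (norm (K \<Omega> ?v))\<^sup>2 - 2 * \<kappa> * (K \<Omega> ?v \<bullet> ?v) + \<kappa>\<^sup>2 * (norm ?v)\<^sup>2"
    unfolding power2_norm_eq_inner
    by (simp add: inner_diff_left inner_diff_right inner_commute algebra_simps power2_eq_square)
  moreover have "\<kappa> * (\<kappa> * (norm ?v)\<^sup>2) \<le> \<kappa> * (K \<Omega> ?v \<bullet> ?v)" using ge \<kappa>(2) by simp
  ultimately have "(norm (K \<Omega> ?v - \<kappa> *\<^sub>R ?v))\<^sup>2 \<le> 0"
    by (simp add: power2_eq_square mult.assoc)
  then show ?thesis by simp
qed

subsection \<open>The strong maximum principle\<close>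

definition dflat :: "real \<Rightarrow> real" where "dflat = pd 1 flat"
definition ddflat :: "real \<Rightarrow> real" where "ddflat = pd 1 dflat"

lemma smooth_has_real_derivative:
  fixes f :: "real \<Rightarrow> real"
  assumes "smooth f" shows "(f has_real_derivative pd 1 f t) (at t)"
  using has_derivative_grad[OF smooth_differentiable[OF assms], of t]
  by (simp add: has_field_derivative_def grad_def)

lemma smooth_dflat: "smooth dflat" and smooth_ddflat: "smooth ddflat"
  using smooth_pd[OF smooth_flat, of 1] smooth_pd[OF smooth_pd[OF smooth_flat, of 1], of 1]
  by (simp_all add: dflat_def ddflat_def)

lemma DERIV_flat: "(flat has_real_derivative dflat t) (at t)"
  and DERIV_dflat: "(dflat has_real_derivative ddflat t) (at t)"
  using smooth_has_real_derivative[OF smooth_flat, of t] smooth_has_real_derivative[OF smooth_dflat, of t]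
  by (simp_all add: dflat_def ddflat_def)

lemma dflat_pos_eq: assumes "0 < t" shows "dflat t = exp (- (1 / t)) / t\<^sup>2"
proof -
  have "((\<lambda>t. exp (- (1 / t))) has_real_derivative exp (- (1 / t)) / t\<^sup>2) (at t)"
    using assms by (auto intro!: derivative_eq_intros simp: power2_eq_square)
  moreover have "\<forall>\<^sub>F s in nhds t. exp (- (1 / s)) = flat s"
    using eventually_nhds_in_open[of "{0<..}" t] assms by (auto simp: flat_def elim!: eventually_mono)
  ultimately have "(flat has_real_derivative exp (- (1 / t)) / t\<^sup>2) (at t)"
    by (simp add: DERIV_cong_ev[OF refl _ refl])
  then show ?thesis using DERIV_flat DERIV_unique by blast
qed

lemma dflat_nonpos: assumes "t \<le> 0" shows "dflat t = 0"
proof -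
  have neg: "dflat s = 0" if "s < 0" for s
  proof -
    have "\<forall>\<^sub>F s in nhds s. flat s = 0"
      using eventually_nhds_in_open[of "{..<0}" s] that by (auto simp: flat_def elim!: eventually_mono)
    then have "(flat has_real_derivative 0) (at s)"
      using DERIV_cong_ev[OF refl, of flat "\<lambda>_. 0" s 0 0] by simp
    then show ?thesis using DERIV_flat DERIV_unique by blast
  qed
  have "isCont dflat 0" using DERIV_dflat DERIV_isCont by blast
  then have "(dflat \<longlongrightarrow> dflat 0) (at_left 0)" by (simp add: isCont_def filterlim_split_at_real filterlim_at_split)
  moreover have "(dflat \<longlongrightarrow> 0) (at_left 0)"
    using neg by (intro tendsto_eventually) (auto simp: eventually_at_left_field intro: exI[of _ "-1"])
  ultimately have "dflat 0 = 0" using tendsto_unique trivial_limit_at_left_real by blast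
  then show ?thesis using neg assms by (cases "t = 0") auto
qed

lemma dflat_nonneg: "0 \<le> dflat t"
  by (cases "0 < t") (auto simp: dflat_pos_eq dflat_nonpos)

lemma dflat_bounded: obtains B where "0 < B" "\<And>t. t \<le> 1 \<Longrightarrow> dflat t \<le> B"
proof -
  have "compact (dflat ` {0..1})"
    using smooth_continuous[OF smooth_dflat] by (intro compact_continuous_image) auto
  then obtain B where B: "\<forall>x\<in>dflat ` {0..1}. norm x \<le> B" using compact_imp_bounded bounded_iff by metis
  have "dflat t \<le> max B 1" if "t \<le> 1" for t
    using B that dflat_nonpos[of t] by (cases "0 \<le> t") (force simp: le_max_iff_disj)+
  then show ?thesis using that[of "max B 1"] by auto
qed

text \<open>The threshold 3/4 is the value of 1 - |z - y|^2 / r^2 at half the radius.\<close>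

lemma dflat_ge: assumes "3/4 \<le> t" "t \<le> 1" shows "exp (-2) \<le> dflat t"
proof -
  have "1 / t \<le> 2" using assms by (simp add: divide_le_eq)
  then have "exp (-2) \<le> exp (- (1 / t))" by simp
  also have "\<dots> \<le> exp (- (1 / t)) / t\<^sup>2"
    using assms by (simp add: le_divide_eq mult_le_cancel_left1 power_le_one)
  finally show ?thesis using assms by (simp add: dflat_pos_eq)
qed

text \<open>For r > 0 it is positive exactly inside the ball of radius r and equals 1 at the centre.
  The squared distance keeps it smooth at y.\<close>

definition radial :: "'a::euclidean_space \<Rightarrow> real \<Rightarrow> 'a \<Rightarrow> real" where
  "radial y r z = 1 - (norm (z - y))\<^sup>2 / r\<^sup>2"

lemma has_derivative_radial:
  "(radial y r has_derivative (\<lambda>h. - 2 * ((z - y) \<bullet> h) / r\<^sup>2)) (at z)"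
proof -
  have "((\<lambda>z. (z - y) \<bullet> (z - y)) has_derivative (\<lambda>h. 2 * ((z - y) \<bullet> h))) (at z)"
    by (auto intro!: derivative_eq_intros simp: inner_commute)
  from has_derivative_diff[OF has_derivative_const[of 1] has_derivative_mult_right[OF this, of "1 / r\<^sup>2"]]
  show ?thesis by (simp add: radial_def[abs_def] power2_norm_eq_inner)
qed

lemma smooth_radial: "smooth (radial y r)"
proof -
  have "smooth (\<lambda>z. 1 + (- 1 / r\<^sup>2) * (norm (z - y))\<^sup>2)"
    by (intro smooth_add smooth_mult smooth_const smooth_norm_diff_sq)
  then show ?thesis by (simp add: radial_def[abs_def])
qed

lemma pd_compose_radial:
  assumes "(h has_real_derivative h') (at (radial y r z))"
  shows "pd b (\<lambda>z. h (radial y r z)) z = h' * (- 2 * ((z - y) \<bullet> b) / r\<^sup>2)"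
proof (rule pd_eqI)
  have "(h \<circ> radial y r has_derivative (*) h' \<circ> (\<lambda>h. - 2 * ((z - y) \<bullet> h) / r\<^sup>2)) (at z)"
    using assms by (intro diff_chain_at has_derivative_radial) (simp add: has_field_derivative_def)
  then show "((\<lambda>z. h (radial y r z)) has_derivative (\<lambda>b. h' * (- 2 * ((z - y) \<bullet> b) / r\<^sup>2))) (at z)"
    by (simp add: o_def)
qed

lemma lap_test_radial:
  fixes y :: "'a::euclidean_space"
  assumes r: "0 < r"
  shows "lap_test (\<lambda>z. flat (radial y r z)) z
    = 4 * (norm (z - y))\<^sup>2 / r^4 * ddflat (radial y r z) - 2 * real DIM('a) / r\<^sup>2 * dflat (radial y r z)"
proof -
  have 1: "pd b (\<lambda>z. flat (radial y r z)) = (\<lambda>z. dflat (radial y r z) * (- 2 * ((z - y) \<bullet> b) / r\<^sup>2))" for b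
    by (rule ext, rule pd_compose_radial[OF DERIV_flat])
  have 2: "pd b (\<lambda>z. dflat (radial y r z) * (- 2 * ((z - y) \<bullet> b) / r\<^sup>2)) z
      = 4 / r^4 * ddflat (radial y r z) * ((z - y) \<bullet> b)\<^sup>2 - 2 / r\<^sup>2 * dflat (radial y r z)" if b: "b \<in> Basis" for b z
  proof -
    have D: "((\<lambda>z. dflat (radial y r z)) has_derivative (\<lambda>h. ddflat (radial y r z) * (- 2 * ((z - y) \<bullet> h) / r\<^sup>2))) (at z)"
      using diff_chain_at[OF has_derivative_radial, of dflat "(*) (ddflat (radial y r z))" y r z] DERIV_dflat
      by (simp add: has_field_derivative_def o_def)
    have E: "((\<lambda>z. - 2 * ((z - y) \<bullet> b) / r\<^sup>2) has_derivative (\<lambda>h. - 2 * (h \<bullet> b) / r\<^sup>2)) (at z)"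
    proof -
      have "((\<lambda>z. (z - y) \<bullet> b) has_derivative (\<lambda>h. h \<bullet> b)) (at z)"
        by (auto intro!: derivative_eq_intros)
      from has_derivative_mult_right[OF this, of "- 2 / r\<^sup>2"] show ?thesis by simp
    qed
    have "pd b (\<lambda>z. dflat (radial y r z) * (- 2 * ((z - y) \<bullet> b) / r\<^sup>2)) z
        = dflat (radial y r z) * (- 2 * (b \<bullet> b) / r\<^sup>2)
          + ddflat (radial y r z) * (- 2 * ((z - y) \<bullet> b) / r\<^sup>2) * (- 2 * ((z - y) \<bullet> b) / r\<^sup>2)"
      by (rule pd_eqI[OF has_derivative_mult[OF D E]])
    then show ?thesis using b r by (simp add: field_simps power2_eq_square power4_eq_xxxx)
  qed
  have n: "(norm (z - y))\<^sup>2 = (\<Sum>b\<in>Basis. ((z - y) \<bullet> b)\<^sup>2)"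
    unfolding power2_norm_eq_inner euclidean_inner[of "z - y" "z - y"] by (simp add: power2_eq_square)
  have "lap_test (\<lambda>z. flat (radial y r z)) z
      = (\<Sum>b\<in>Basis. 4 / r^4 * ddflat (radial y r z) * ((z - y) \<bullet> b)\<^sup>2 - 2 / r\<^sup>2 * dflat (radial y r z))"
    unfolding lap_test_def 1 by (intro sum.cong refl 2)
  also have "\<dots> = 4 / r^4 * ddflat (radial y r z) * (\<Sum>b\<in>Basis. ((z - y) \<bullet> b)\<^sup>2)
      - real DIM('a) * (2 / r\<^sup>2 * dflat (radial y r z))"
    by (simp add: sum_subtractf sum_distrib_left)
  finally show ?thesis unfolding n by (simp add: mult_ac)
qed

lemma test_fun_radial:
  assumes "0 < r" "cball y r \<subseteq> \<Omega>"
  shows "test_fun \<Omega> (\<lambda>z. flat (radial y r z))"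
proof (rule test_funI[OF smooth_compose[OF smooth_radial smooth_flat] compact_cball assms(2)])
  fix z assume "flat (radial y r z) \<noteq> 0"
  then have "\<not> radial y r z \<le> 0" using flat_zero by blast
  then have "(norm (z - y))\<^sup>2 \<le> r\<^sup>2" using assms(1) by (simp add: radial_def field_simps)
  then have "norm (z - y) \<le> r" using assms(1) power2_le_imp_le by fastforce
  then show "z \<in> cball y r" by (simp add: dist_norm norm_minus_commute)
qed

text \<open>The rescaled profile r^(-N) \<rho>((z - y)/r) with \<rho>(x) = \<open>dflat\<close> (1 -
  |x|^2): a radial averaging kernel, not normalized, whose mass is independent of r > 0.\<close>

definition kern :: "'a::euclidean_space \<Rightarrow> real \<Rightarrow> 'a \<Rightarrow> real" where
  "kern y r z = dflat (radial y r z) / r ^ DIM('a)"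

definition dkern :: "'a::euclidean_space \<Rightarrow> real \<Rightarrow> 'a \<Rightarrow> real" where
  "dkern y r z = ddflat (radial y r z) * (2 * (norm (z - y))\<^sup>2 / r^3) / r ^ DIM('a)
     - real DIM('a) * dflat (radial y r z) / r ^ Suc DIM('a)"

lemma kern_deriv: "0 < r \<Longrightarrow> ((\<lambda>r. kern y r z) has_real_derivative dkern y r z) (at r)"
proof -
  assume r: "0 < r"
  have q: "((\<lambda>r. radial y r z) has_real_derivative 2 * (norm (z - y))\<^sup>2 / r^3) (at r)"
    unfolding radial_def using r by (auto intro!: derivative_eq_intros simp: field_simps power2_eq_square power3_eq_cube)
  have D: "((\<lambda>r. dflat (radial y r z)) has_real_derivative ddflat (radial y r z) * (2 * (norm (z - y))\<^sup>2 / r^3)) (at r)"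
    by (rule DERIV_chain2[OF DERIV_dflat q])
  have P: "((\<lambda>r. r ^ DIM('a)) has_real_derivative real DIM('a) * r ^ (DIM('a) - 1)) (at r)"
    using DERIV_pow[of "DIM('a)" r] by simp
  have s: "r ^ DIM('a) = r * r ^ (DIM('a) - 1)" by (simp add: power_eq_if)
  show ?thesis unfolding kern_def
    by (rule DERIV_cong[OF DERIV_divide[OF D P]])
      (use r in \<open>auto simp: dkern_def s field_simps power2_eq_square\<close>)
qed

lemma dkern_eq_lap_test:
  fixes y :: "'a::euclidean_space"
  assumes "0 < r"
  shows "dkern y r z = r\<^sup>2 / (2 * r ^ Suc DIM('a)) * lap_test (\<lambda>z. flat (radial y r z)) z"
  unfolding lap_test_radial[OF assms] dkern_def using assms
  by (simp add: field_simps power2_eq_square power4_eq_xxxx power3_eq_cube)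

lemma kern_sqint: assumes "0 < s" shows "sqint (kern y s)"
  unfolding kern_def[abs_def] divide_inverse
proof (rule continuous_compact_support_sqint[OF _ compact_cball[of y s]])
  show "continuous_on UNIV (\<lambda>z. dflat (radial y s z) * inverse (s ^ DIM('a)))"
    by (intro continuous_intros smooth_continuous smooth_compose[OF smooth_radial smooth_dflat])
  fix z assume "z \<notin> cball y s"
  then have "s \<le> norm (z - y)" by (auto simp: dist_norm norm_minus_commute)
  then have "s\<^sup>2 \<le> (norm (z - y))\<^sup>2" using assms by (intro power_mono) auto
  then have "radial y s z \<le> 0" unfolding radial_def using assms by (simp add: le_divide_eq)
  then show "dflat (radial y s z) * inverse (s ^ DIM('a)) = 0" by (simp add: dflat_nonpos)
qed

text \<open>Dilating the radial kernel changes it by a Laplacian of a nonnegative bump: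
  \<open>d/dr (r^(-N) \<rho>((z - y)/r)) = r^(1 - N)/2 \<Delta>\<^sub>z \<eta>((z - y)/r)\<close> whenever \<open>\<nabla>\<eta> = - 2 y \<rho>\<close>. This gives the
  mean value inequality for weak supersolutions.\<close>
lemma kern_mean_deriv:
  fixes u :: "('a::euclidean_space, real) l2"
  assumes r: "0 < r"
  shows "((\<lambda>r. \<integral>z. rep_l2 u z * kern y r z \<partial>lborel) has_real_derivative
     (\<integral>z. rep_l2 u z * dkern y r z \<partial>lborel)) (at r)"
proof -
  \<comment> \<open>Restricting to increments below r/2 keeps all radii in [r/2, 3r/2]. All kernels
    then live in one ball of radius 2r, and their r-derivative is bounded on the compact set
    \<open>Q\<close>.\<close>
  define S where "S = {- r/2 <..< r/2}"
  define Q where "Q = {r/2..3*r/2} \<times> cball y (2 * r)"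
  have Q: "compact Q" by (simp add: Q_def compact_Times)
  have "continuous_on Q (\<lambda>(s, z). dkern y s z)"
    unfolding dkern_def radial_def Q_def case_prod_unfold using r
    by (intro continuous_intros continuous_on_compose2[OF smooth_continuous[OF smooth_ddflat, of UNIV]]
        continuous_on_compose2[OF smooth_continuous[OF smooth_dflat, of UNIV]]) auto
  then have "bounded ((\<lambda>(s, z). dkern y s z) ` Q)"
    using compact_imp_bounded[OF compact_continuous_image[OF _ Q]] by blast
  then obtain C where "\<forall>v\<in>(\<lambda>(s, z). dkern y s z) ` Q. norm v \<le> C" using bounded_iff by metis
  then have C: "norm (dkern y s z) \<le> C" if "(s, z) \<in> Q" for s z using that by force
  have "(r, y) \<in> Q" using r by (simp add: Q_def)
  from order_trans[OF norm_ge_zero C[OF this]] have C0: "0 \<le> C" .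
  have off: "kern y s z = 0" if "s \<in> {r/2..3*r/2}" "z \<notin> cball y (2 * r)" for s z
  proof -
    have "s \<le> norm (z - y)" using that r by (auto simp: dist_norm norm_minus_commute)
    then have "s\<^sup>2 \<le> (norm (z - y))\<^sup>2" using that r by (intro power_mono) auto
    moreover have "0 < s\<^sup>2" using that r by auto
    ultimately have "radial y s z \<le> 0" unfolding radial_def by (simp add: le_divide_eq)
    then show ?thesis by (simp add: kern_def dflat_nonpos)
  qed
  have lip: "\<bar>(kern y (r + h) z - kern y r z) / h\<bar> \<le> C * indicator (cball y (2 * r)) z" if h: "h \<in> S - {0}" for h z
  proof (cases "z \<in> cball y (2 * r)")
    case True
    have "norm (kern y (r + h) z - kern y r z) \<le> C * norm (r + h - r)"
    proof (rule field_differentiable_bound[of "{r/2..3*r/2}"])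
      fix s assume s: "s \<in> {r/2..3*r/2}"
      then show "((\<lambda>r. kern y r z) has_field_derivative dkern y s z) (at s within {r/2..3*r/2})"
        using has_field_derivative_at_within[OF kern_deriv[of s y z]] r by simp
      show "norm (dkern y s z) \<le> C" using C[of s z] s True by (simp add: Q_def)
    qed (use h r in \<open>auto simp: S_def\<close>)
    then show ?thesis using h True by (simp add: divide_le_eq)
  next
    case False
    then have "kern y (r + h) z = 0" "kern y r z = 0" using off h r by (auto simp: S_def)
    then show ?thesis using C0 by simp
  qed
  have km[measurable]: "kern y s \<in> borel_measurable borel" for s
    unfolding kern_def[abs_def] divide_inverse
    by (intro borel_measurable_continuous_onI continuous_intros smooth_continuous smooth_compose[OF smooth_radial smooth_dflat])
  have [measurable]: "lap_test (\<lambda>z. flat (radial y r z)) \<in> borel_measurable borel"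
    by (rule sqint_measurable[OF test_fun_sqint[OF lap_test_test_fun[OF test_fun_radial[OF r subset_UNIV]]]])
  have dkm[measurable]: "dkern y r \<in> borel_measurable borel"
    unfolding dkern_eq_lap_test[OF r, abs_def] by measurable
  have ik: "integrable lborel (\<lambda>z. rep_l2 u z * kern y s z)" if "0 < s" for s
  proof -
    from sqint_inner[OF sqint_rep[of u] kern_sqint[OF that]] show ?thesis by simp
  qed
  define M where "M s = (\<integral>z. rep_l2 u z * kern y s z \<partial>lborel)" for s
  have "((\<lambda>h. (M (r + h) - M r) / h) \<longlongrightarrow> (\<integral>z. rep_l2 u z * dkern y r z \<partial>lborel)) (at 0 within S)"
    unfolding tendsto_at_iff_sequentially
  proof (intro allI impI)
    fix X :: "nat \<Rightarrow> real" assume X: "\<forall>i. X i \<in> S - {0}" "X \<longlonglongrightarrow> 0"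
    have lim: "(\<lambda>n. \<integral>z. rep_l2 u z * ((kern y (r + X n) z - kern y r z) / X n) \<partial>lborel)
        \<longlonglongrightarrow> (\<integral>z. rep_l2 u z * dkern y r z \<partial>lborel)"
    proof (rule integral_dominated_convergence[where w="\<lambda>z. C * (\<bar>rep_l2 u z\<bar> * indicator (cball y (2 * r)) z)"])
      have "integrable lborel (\<lambda>z. \<bar>rep_l2 u z\<bar> \<bullet> indicator (cball y (2 * r)) z)"
        by (intro sqint_inner sqint_abs sqint_rep sqint_indicator) auto
      then show "integrable lborel (\<lambda>z. C * (\<bar>rep_l2 u z\<bar> * indicator (cball y (2 * r)) z))" by simp
      show "AE z in lborel. (\<lambda>n. rep_l2 u z * ((kern y (r + X n) z - kern y r z) / X n)) \<longlonglongrightarrow> rep_l2 u z * dkern y r z"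
      proof (rule AE_I2)
        fix z
        have "((\<lambda>h. (kern y (r + h) z - kern y r z) / h) \<longlongrightarrow> dkern y r z) (at 0)"
          using kern_deriv[OF r, of y z] by (simp add: DERIV_def)
        then have "(\<lambda>n. (kern y (r + X n) z - kern y r z) / X n) \<longlonglongrightarrow> dkern y r z"
          using X by (auto simp: tendsto_at_iff_sequentially o_def)
        then show "(\<lambda>n. rep_l2 u z * ((kern y (r + X n) z - kern y r z) / X n)) \<longlonglongrightarrow> rep_l2 u z * dkern y r z"
          by (rule tendsto_mult_left)
      qed
      fix n
      show "AE z in lborel. norm (rep_l2 u z * ((kern y (r + X n) z - kern y r z) / X n))
          \<le> C * (\<bar>rep_l2 u z\<bar> * indicator (cball y (2 * r)) z)"
      proof (rule AE_I2)
        fix z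
        have "\<bar>rep_l2 u z\<bar> * \<bar>(kern y (r + X n) z - kern y r z) / X n\<bar> \<le> \<bar>rep_l2 u z\<bar> * (C * indicator (cball y (2 * r)) z)"
          using lip[of "X n" z] X(1) by (intro mult_left_mono) auto
        then show "norm (rep_l2 u z * ((kern y (r + X n) z - kern y r z) / X n))
          \<le> C * (\<bar>rep_l2 u z\<bar> * indicator (cball y (2 * r)) z)" by (simp add: abs_mult mult_ac)
      qed
    qed measurable
    have eq: "(\<integral>z. rep_l2 u z * ((kern y (r + X n) z - kern y r z) / X n) \<partial>lborel) = (M (r + X n) - M r) / X n" for n
    proof -
      have "X n \<in> S" using X(1) by blast
      then have "0 < r + X n" using r by (simp add: S_def)
      have "rep_l2 u z * ((kern y (r + X n) z - kern y r z) / X n)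
        = (rep_l2 u z * kern y (r + X n) z - rep_l2 u z * kern y r z) / X n" for z
        by (simp add: right_diff_distrib)
      then have "(\<integral>z. rep_l2 u z * ((kern y (r + X n) z - kern y r z) / X n) \<partial>lborel)
        = (\<integral>z. (rep_l2 u z * kern y (r + X n) z - rep_l2 u z * kern y r z) / X n \<partial>lborel)" by (simp only:)
      also have "\<dots> = (\<integral>z. rep_l2 u z * kern y (r + X n) z - rep_l2 u z * kern y r z \<partial>lborel) / X n" by simp
      finally show ?thesis
        by (simp only: Bochner_Integration.integral_diff[OF ik[OF \<open>0 < r + X n\<close>] ik[OF r]] M_def)
    qed
    show "((\<lambda>h. (M (r + h) - M r) / h) \<circ> X) \<longlonglongrightarrow> (\<integral>z. rep_l2 u z * dkern y r z \<partial>lborel)"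
      using lim unfolding eq o_def .
  qed
  moreover have "at 0 within S = at 0" using r by (intro at_within_open) (auto simp: S_def)
  ultimately have "(M has_real_derivative (\<integral>z. rep_l2 u z * dkern y r z \<partial>lborel)) (at r)"
    by (simp add: DERIV_def)
  then show ?thesis unfolding M_def[abs_def] .
qed

text \<open>The derivative in the radius is a nonnegative multiple of u paired with the Laplacian of
  a nonnegative test function, and this pairing is nonpositive for a supersolution.\<close>

lemma kern_mean_antimono:
  fixes u :: "('a::euclidean_space, real) l2"
  assumes sup: "\<And>\<eta>. test_fun \<Omega> \<eta> \<Longrightarrow> (\<And>x. 0 \<le> \<eta> x) \<Longrightarrow> u \<bullet> abs_l2 (lap_test \<eta>) \<le> 0"
    and ab: "0 < a" "a \<le> b" "cball y b \<subseteq> \<Omega>"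
  shows "(\<integral>z. rep_l2 u z * kern y b z \<partial>lborel) \<le> (\<integral>z. rep_l2 u z * kern y a z \<partial>lborel)"
proof (rule DERIV_nonpos_imp_nonincreasing[OF ab(2)])
  fix r assume r: "a \<le> r" "r \<le> b"
  then have r0: "0 < r" using ab by simp
  have sub: "cball y r \<subseteq> \<Omega>" using ab(3) r(2) by auto
  note t = test_fun_radial[OF r0 sub]
  define c where "c = r\<^sup>2 / (2 * r ^ Suc DIM('a))"
  have c0: "0 \<le> c" using r0 by (simp add: c_def)
  have "(\<integral>z. rep_l2 u z * dkern y r z \<partial>lborel)
      = (\<integral>z. c * (rep_l2 u z \<bullet> lap_test (\<lambda>z. flat (radial y r z)) z) \<partial>lborel)"
    unfolding dkern_eq_lap_test[OF r0] c_def[symmetric] by (simp add: mult_ac)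
  also have "\<dots> = c * (\<integral>z. rep_l2 u z \<bullet> lap_test (\<lambda>z. flat (radial y r z)) z \<partial>lborel)" by simp
  also have "(\<integral>z. rep_l2 u z \<bullet> lap_test (\<lambda>z. flat (radial y r z)) z \<partial>lborel)
      = u \<bullet> abs_l2 (lap_test (\<lambda>z. flat (radial y r z)))"
    by (rule inner_l2_rep_abs[symmetric, OF test_fun_sqint[OF lap_test_test_fun[OF t]]])
  also have "c * \<dots> \<le> 0" using sup[OF t] c0 flat_nonneg by (intro mult_nonneg_nonpos) auto
  finally show "\<exists>d. ((\<lambda>r. \<integral>z. rep_l2 u z * kern y r z \<partial>lborel) has_real_derivative d) (at r) \<and> d \<le> 0"
    using kern_mean_deriv[OF r0] by blast
qed

section \<open>Null sets, Lebesgue points and the propagation of zeros\<close>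

lemma AE_lborel_iff_negligible: "(AE x in lborel. P x) \<longleftrightarrow> negligible {x. \<not> P x}"
proof
  assume "AE x in lborel. P x"
  then obtain N where N: "N \<in> null_sets lborel" "{x. \<not> P x} \<subseteq> N"
    by (auto simp: eventually_ae_filter)
  then have "negligible N" by (simp add: negligible_iff_null_sets null_sets_completionI)
  then show "negligible {x. \<not> P x}" using N(2) negligible_subset by blast
next
  assume "negligible {x. \<not> P x}"
  then have "{x. \<not> P x} \<in> null_sets (completion lborel)" by (simp add: negligible_iff_null_sets)
  then obtain N where "N \<in> null_sets lborel" "{x. \<not> P x} \<subseteq> N"
    unfolding null_sets_completion_iff2 by blast
  then show "AE x in lborel. P x" by (auto simp: eventually_ae_filter)
qed

lemma AE_lebesgue_iff_lborel: "(AE x in lebesgue. P x) \<longleftrightarrow> (AE x in lborel. P x)"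
proof
  assume "AE x in lebesgue. P x"
  then obtain N where N: "N \<in> null_sets lebesgue" "{x. \<not> P x} \<subseteq> N"
    by (auto simp: eventually_ae_filter)
  then show "AE x in lborel. P x"
    using negligible_subset[of N] by (simp add: AE_lborel_iff_negligible negligible_iff_null_sets)
qed (rule AE_completion)

text \<open>Lebesgue's differentiation theorem along cubes that have x as a corner. This is why the
  kernels in \<open>supersolution_vanishes_near\<close> are centred at a point next to x.\<close>

lemma lebesgue_points:
  fixes u :: "('a::euclidean_space, real) l2"
  obtains N where "negligible N" "\<And>x e. x \<notin> N \<Longrightarrow> 0 < e \<Longrightarrow> \<exists>d>0. \<forall>h. 0 < h \<and> h < d \<longrightarrow>
    \<bar>(\<integral>z. indicator (cbox x (x + h *\<^sub>R One)) z * rep_l2 u z \<partial>lborel) / h ^ DIM('a) - rep_l2 u x\<bar> < e"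
proof -
  have si: "set_integrable lborel (cbox a b) (rep_l2 u)" for a b
    unfolding set_integrable_def
    using sqint_inner[OF sqint_indicator sqint_rep, of "cbox a b" u] by auto
  have "integral (cbox a b) (rep_l2 u) = (\<integral>z. indicator (cbox a b) z * rep_l2 u z \<partial>lborel)" for a b
    using set_borel_integral_eq_integral(2)[OF si] by (simp add: set_lebesgue_integral_def)
  moreover obtain N where "negligible N" "\<And>x e. \<lbrakk>x \<notin> N; 0 < e\<rbrakk> \<Longrightarrow> \<exists>d>0. \<forall>h. 0 < h \<and> h < d \<longrightarrow>
      norm (integral (cbox x (x + h *\<^sub>R One)) (rep_l2 u) /\<^sub>R h ^ DIM('a) - rep_l2 u x) < e"
    using integrable_ccontinuous_explicit[of "rep_l2 u"] set_borel_integral_eq_integral(1)[OF si] by blast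
  ultimately show ?thesis using that[of N] by (simp add: divide_inverse mult.commute)
qed

lemma kern_nonneg: "0 < r \<Longrightarrow> 0 \<le> kern y r z"
  by (simp add: kern_def dflat_nonneg)

text \<open>Kernel means of a supersolution decrease with the radius. At small radius the mean is at
  most a constant times a cube average at x, and these tend to 0; hence the mean at the fixed radius
  d is 0. There the kernel is bounded below on the ball of radius d/4 around x, so a nonnegative u
  vanishes on it.\<close>

lemma supersolution_vanishes_near:
  fixes u :: "('a::euclidean_space, real) l2"
  assumes sup: "\<And>\<eta>. test_fun \<Omega> \<eta> \<Longrightarrow> (\<And>x. 0 \<le> \<eta> x) \<Longrightarrow> u \<bullet> abs_l2 (lap_test \<eta>) \<le> 0"
    and nn: "AE z in lborel. 0 \<le> rep_l2 u z"
    and leb: "\<And>e. 0 < e \<Longrightarrow> \<exists>d>0. \<forall>h. 0 < h \<and> h < d \<longrightarrow>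
        \<bar>(\<integral>z. indicator (cbox x (x + h *\<^sub>R One)) z * rep_l2 u z \<partial>lborel) / h ^ DIM('a)\<bar> < e"
    and d: "0 < d" "cball x (2 * d) \<subseteq> \<Omega>"
  shows "AE z in lborel. z \<in> ball x (d / 4) \<longrightarrow> rep_l2 u z = 0"
proof -
  obtain B where B: "0 < B" "\<And>t. t \<le> 1 \<Longrightarrow> dflat t \<le> B" using dflat_bounded by blast
  let ?N = "DIM('a)"
  define J where "J = (\<integral>z. indicator (ball x (d / 4)) z * rep_l2 u z \<partial>lborel)"
  have ib: "integrable lborel (\<lambda>z. indicator A z * rep_l2 u z)" if "bounded A" "A \<in> sets borel" for A
    using sqint_inner[OF sqint_indicator sqint_rep, of A u] that by auto
  have ik: "integrable lborel (\<lambda>z. rep_l2 u z * kern y s z)" if "0 < s" for y s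
    using sqint_inner[OF sqint_rep kern_sqint[OF that], of u y] by simp
  have J0: "0 \<le> J" unfolding J_def using nn by (intro integral_nonneg_AE) (auto elim!: eventually_mono)
  have J_le: "exp (-2) / d ^ ?N * J \<le> 2 ^ ?N * B * e" if e: "0 < e" for e
  proof -
    obtain d' where d': "0 < d'" "\<forall>h. 0 < h \<and> h < d' \<longrightarrow>
        \<bar>(\<integral>z. indicator (cbox x (x + h *\<^sub>R One)) z * rep_l2 u z \<partial>lborel) / h ^ ?N\<bar> < e"
      using leb[OF e] by blast
    define n1 where "n1 = norm (One :: 'a)"
    have n1: "0 \<le> n1" by (simp add: n1_def)
    \<comment> \<open>The last bound keeps the centre y within d/4 of x, because |y - x| is h/2
      times the norm of \<open>One\<close>.\<close>
    define h where "h = min (d' / 2) (min d (d / (2 * (n1 + 1))))"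
    have h: "0 < h" "h < d'" "h \<le> d" "h \<le> d / (2 * (n1 + 1))"
      using d' d(1) n1 by (auto simp: h_def add_nonneg_pos)
    \<comment> \<open>The centre of the cube. The kernel of radius h/2 around it vanishes outside
      the inscribed ball, hence outside the cube.\<close>
    define y where "y = x + (h / 2) *\<^sub>R One"
    have "h * n1 \<le> d / (2 * (n1 + 1)) * n1" using h n1 by (intro mult_right_mono) auto
    also have "\<dots> \<le> d / 2" using n1 d(1) by (simp add: field_simps)
    finally have yx: "norm (y - x) \<le> d / 4" using h(1) by (simp add: y_def n1_def)
    have sub: "cball y d \<subseteq> \<Omega>"
    proof
      fix z assume "z \<in> cball y d"
      then have "norm (z - x) \<le> 2 * d"
        using norm_triangle_ineq[of "z - y" "y - x"] yx d(1) by (simp add: dist_norm norm_minus_commute)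
      then show "z \<in> \<Omega>" using d(2) by (auto simp: dist_norm norm_minus_commute)
    qed
    have "exp (-2) / d ^ ?N * J = (\<integral>z. exp (-2) / d ^ ?N * (indicator (ball x (d / 4)) z * rep_l2 u z) \<partial>lborel)"
      unfolding J_def by simp
    also have "\<dots> \<le> (\<integral>z. rep_l2 u z * kern y d z \<partial>lborel)"
    proof (rule integral_mono_AE[OF integrable_mult_right[OF ib] ik[OF d(1)]])
      show "AE z in lborel. exp (-2) / d ^ ?N * (indicator (ball x (d / 4)) z * rep_l2 u z) \<le> rep_l2 u z * kern y d z"
        using nn
      proof eventually_elim
        case (elim z)
        show ?case
        proof (cases "z \<in> ball x (d / 4)")
          case True
          then have "norm (z - y) \<le> d / 2"
            using norm_triangle_ineq[of "z - x" "x - y"] yx by (simp add: dist_norm norm_minus_commute)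
          then have "(norm (z - y))\<^sup>2 \<le> (d / 2)\<^sup>2" by (intro power_mono) auto
          then have "3/4 \<le> radial y d z" "radial y d z \<le> 1"
            using d(1) by (auto simp: radial_def field_simps)
          then have "exp (-2) \<le> dflat (radial y d z)" by (rule dflat_ge)
          then have "exp (-2) / d ^ ?N \<le> kern y d z"
            unfolding kern_def using d(1) by (intro divide_right_mono) auto
          from mult_left_mono[OF this elim] show ?thesis using True by (simp add: mult.commute)
        qed (use elim kern_nonneg[OF d(1), of y z] in simp)
      qed
    qed auto
    also have "\<dots> \<le> (\<integral>z. rep_l2 u z * kern y (h / 2) z \<partial>lborel)"
      using h d(1) by (intro kern_mean_antimono[OF sup _ _ sub]) auto
    also have "\<dots> \<le> (\<integral>z. B / (h / 2) ^ ?N * (indicator (cbox x (x + h *\<^sub>R One)) z * rep_l2 u z) \<partial>lborel)"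
    proof (rule integral_mono_AE[OF ik integrable_mult_right[OF ib]])
      show "AE z in lborel. rep_l2 u z * kern y (h / 2) z \<le> B / (h / 2) ^ ?N * (indicator (cbox x (x + h *\<^sub>R One)) z * rep_l2 u z)"
        using nn
      proof eventually_elim
        case (elim z)
        show ?case
        proof (cases "z \<in> cbox x (x + h *\<^sub>R One)")
          case True
          have "kern y (h / 2) z \<le> B / (h / 2) ^ ?N"
            unfolding kern_def using h by (intro divide_right_mono B(2)) (auto simp: radial_def)
          from mult_left_mono[OF this elim] show ?thesis using True by (simp add: mult.commute)
        next
          case False
          then obtain b where b: "b \<in> Basis" "\<not> (x \<bullet> b \<le> z \<bullet> b \<and> z \<bullet> b \<le> (x + h *\<^sub>R One) \<bullet> b)"
            by (auto simp: mem_box)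
          then have "h / 2 \<le> \<bar>(z - y) \<bullet> b\<bar>"
            by (auto simp: y_def inner_diff_left inner_add_left abs_if field_simps)
          also have "\<dots> \<le> norm (z - y)" using b(1) by (rule Basis_le_norm)
          finally have "(h / 2)\<^sup>2 \<le> (norm (z - y))\<^sup>2" using h by (intro power_mono) auto
          then have "radial y (h / 2) z \<le> 0" using h(1) by (simp add: radial_def le_divide_eq)
          then show ?thesis using False by (simp add: kern_def dflat_nonpos)
        qed
      qed
    qed (use h in auto)
    also have "\<dots> = 2 ^ ?N * B * ((\<integral>z. indicator (cbox x (x + h *\<^sub>R One)) z * rep_l2 u z \<partial>lborel) / h ^ ?N)"
      using h(1) by (simp add: power_divide)
    also have "\<dots> \<le> 2 ^ ?N * B * e"
    proof (rule mult_left_mono)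
      have "\<bar>(\<integral>z. indicator (cbox x (x + h *\<^sub>R One)) z * rep_l2 u z \<partial>lborel) / h ^ ?N\<bar> < e"
        using d'(2) h(1,2) by blast
      then show "(\<integral>z. indicator (cbox x (x + h *\<^sub>R One)) z * rep_l2 u z \<partial>lborel) / h ^ ?N \<le> e" by linarith
    qed (use B(1) in simp)
    finally show ?thesis .
  qed
  have "J = 0"
  proof (rule ccontr)
    assume "J \<noteq> 0"
    then have pos: "0 < exp (-2) / d ^ ?N * J" using J0 d(1) by simp
    \<comment> \<open>With this e the estimate says that a positive number is at most half of
      itself.\<close>
    define e where "e = exp (-2) / d ^ ?N * J / (2 * (2 ^ ?N * B))"
    have "0 < e" unfolding e_def using pos B(1) by (intro divide_pos_pos) auto
    from J_le[OF this] have "exp (-2) / d ^ ?N * J \<le> exp (-2) / d ^ ?N * J / 2"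
      using B(1) by (simp add: e_def)
    moreover have False if "q \<le> q / 2" "0 < q" for q :: real using that by linarith
    ultimately show False using pos by blast
  qed
  then have "AE z in lborel. indicator (ball x (d / 4)) z * rep_l2 u z = 0"
    unfolding J_def using nn
    by (subst (asm) integral_nonneg_eq_0_iff_AE[OF ib]) (auto elim!: eventually_mono)
  then show ?thesis by eventually_elim (auto simp: indicator_def split: if_splits)
qed

text \<open>Let Z consist of the points near which u vanishes. It is relatively open by definition.
  It is relatively closed because a zero at a Lebesgue point spreads to a ball whose radius is
  governed only by the distance to the boundary. Connectedness leaves Z empty or all of
  \<Omega>.\<close>

lemma strong_maximum_principle:
  fixes u :: "('a::euclidean_space, real) l2"
  assumes \<Omega>: "open \<Omega>" "connected \<Omega>"
    and sup: "\<And>\<eta>. test_fun \<Omega> \<eta> \<Longrightarrow> (\<And>x. 0 \<le> \<eta> x) \<Longrightarrow> u \<bullet> abs_l2 (lap_test \<eta>) \<le> 0"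
    and nn: "AE z in lborel. 0 \<le> rep_l2 u z"
  shows "(AE z in lborel. z \<in> \<Omega> \<longrightarrow> rep_l2 u z = 0) \<or> (AE z in lborel. z \<in> \<Omega> \<longrightarrow> 0 < rep_l2 u z)"
proof -
  obtain N where N: "negligible N" "\<And>x e. x \<notin> N \<Longrightarrow> 0 < e \<Longrightarrow> \<exists>d>0. \<forall>h. 0 < h \<and> h < d \<longrightarrow>
    \<bar>(\<integral>z. indicator (cbox x (x + h *\<^sub>R One)) z * rep_l2 u z \<partial>lborel) / h ^ DIM('a) - rep_l2 u x\<bar> < e"
    using lebesgue_points[of u] by blast
  have near: "AE z in lborel. z \<in> ball x (d / 4) \<longrightarrow> rep_l2 u z = 0"
    if "x \<notin> N" "rep_l2 u x = 0" "0 < d" "cball x (2 * d) \<subseteq> \<Omega>" for x d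
    using supersolution_vanishes_near[OF sup nn _ that(3,4)] N(2)[OF that(1)] that(2) by simp
  define Z where "Z = {x\<in>\<Omega>. \<exists>e>0. AE z in lborel. z \<in> ball x e \<longrightarrow> rep_l2 u z = 0}"
  have oZ: "openin (top_of_set \<Omega>) Z"
    unfolding openin_euclidean_subtopology_iff
  proof (intro conjI ballI)
    fix x assume "x \<in> Z"
    then obtain e where e: "x \<in> \<Omega>" "0 < e" "AE z in lborel. z \<in> ball x e \<longrightarrow> rep_l2 u z = 0" by (auto simp: Z_def)
    have "y \<in> Z" if "y \<in> \<Omega>" "dist y x < e / 2" for y
    proof -
      have "ball y (e / 2) \<subseteq> ball x e"
        using that(2) by (intro subsetI) (metis dist_commute dist_triangle_half_l mem_ball)
      then have "AE z in lborel. z \<in> ball y (e / 2) \<longrightarrow> rep_l2 u z = 0"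
        using e(3) by (auto elim!: eventually_mono)
      then show ?thesis using that e(2) unfolding Z_def by (intro CollectI conjI exI[of _ "e / 2"]) auto
    qed
    then show "\<exists>e>0. \<forall>y\<in>\<Omega>. dist y x < e \<longrightarrow> y \<in> Z" using e(2) by (intro exI[of _ "e / 2"]) auto
  qed (auto simp: Z_def)
  have cZ: "openin (top_of_set \<Omega>) (\<Omega> - Z)"
    unfolding openin_euclidean_subtopology_iff
  proof (intro conjI ballI)
    fix x assume x: "x \<in> \<Omega> - Z"
    then obtain d0 where d0: "0 < d0" "cball x d0 \<subseteq> \<Omega>" using \<Omega>(1) open_contains_cball by blast
    \<comment> \<open>The margin 3d leaves room for the ball of radius 2d around any w within d/8 of
      x, and the ball of radius d/4 around w then contains the ball of radius d/8 around x.\<close>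
    define d where "d = d0 / 3"
    have d: "0 < d" "cball x (3 * d) \<subseteq> \<Omega>" using d0 by (auto simp: d_def)
    have "y \<notin> Z" if y: "dist y x < d / 16" for y
    proof
      assume "y \<in> Z"
      then obtain e where e: "0 < e" "AE z in lborel. z \<in> ball y e \<longrightarrow> rep_l2 u z = 0" by (auto simp: Z_def)
      define e' where "e' = min e (d / 16)"
      have e': "0 < e'" using e d by (simp add: e'_def)
      \<comment> \<open>A ball is not negligible, so it contains a Lebesgue point at which u
        vanishes.\<close>
      have "\<not> ball y e' \<subseteq> N \<union> {z. \<not> (z \<in> ball y e \<longrightarrow> rep_l2 u z = 0)}"
      proof
        assume "ball y e' \<subseteq> N \<union> {z. \<not> (z \<in> ball y e \<longrightarrow> rep_l2 u z = 0)}"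
        moreover have "negligible (N \<union> {z. \<not> (z \<in> ball y e \<longrightarrow> rep_l2 u z = 0)})"
          using e(2) N(1) unfolding AE_lborel_iff_negligible by (rule negligible_Un[rotated])
        ultimately have "negligible (ball y e')" using negligible_subset by blast
        then show False using e' open_not_negligible[of "ball y e'"] by simp
      qed
      then obtain w where w: "w \<in> ball y e'" "w \<notin> N" "w \<in> ball y e \<longrightarrow> rep_l2 u w = 0" by blast
      have wx: "dist w x < d / 8"
        using w(1) y dist_triangle[of w x y] by (simp add: e'_def dist_commute)
      have "rep_l2 u w = 0" using w by (simp add: e'_def)
      moreover have "cball w (2 * d) \<subseteq> \<Omega>"
      proof
        fix z assume "z \<in> cball w (2 * d)"
        then have "dist x z \<le> 3 * d" using dist_triangle[of x z w] wx d(1) by (simp add: dist_commute)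
        then show "z \<in> \<Omega>" using d(2) by auto
      qed
      ultimately have "AE z in lborel. z \<in> ball w (d / 4) \<longrightarrow> rep_l2 u z = 0"
        using near w(2) d(1) by blast
      moreover have "z \<in> ball w (d / 4)" if "z \<in> ball x (d / 8)" for z
        using that wx dist_triangle[of w z x] by simp
      ultimately have "AE z in lborel. z \<in> ball x (d / 8) \<longrightarrow> rep_l2 u z = 0"
        by (auto elim!: eventually_mono)
      then have "x \<in> Z" using x d(1) unfolding Z_def by (intro CollectI conjI exI[of _ "d / 8"]) auto
      then show False using x by blast
    qed
    then show "\<exists>e>0. \<forall>y\<in>\<Omega>. dist y x < e \<longrightarrow> y \<in> \<Omega> - Z" using d(1) by (intro exI[of _ "d / 16"]) auto
  qed auto
  have "Z = {} \<or> Z = \<Omega>"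
  proof -
    have "closedin (top_of_set \<Omega>) Z"
      unfolding closedin_def using cZ by (auto simp: Z_def)
    then show ?thesis using \<Omega>(2) oZ unfolding connected_clopen by blast
  qed
  then show ?thesis
  proof
    assume Z: "Z = {}"
    have "0 < rep_l2 u x" if x: "x \<in> \<Omega>" "x \<notin> N" "0 \<le> rep_l2 u x" for x
    proof (rule ccontr)
      assume "\<not> 0 < rep_l2 u x"
      then have 0: "rep_l2 u x = 0" using that by simp
      obtain d0 where d0: "0 < d0" "cball x d0 \<subseteq> \<Omega>" using \<Omega>(1) x(1) open_contains_cball by metis
      then have "AE z in lborel. z \<in> ball x (d0 / 2 / 4) \<longrightarrow> rep_l2 u z = 0"
        using near[OF that(2) 0, of "d0 / 2"] by simp
      then have "x \<in> Z" using that(1) d0(1) unfolding Z_def by (intro CollectI conjI exI[of _ "d0 / 2 / 4"]) auto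
      then show False using Z by blast
    qed
    moreover have "AE x in lborel. x \<notin> N" using N(1) by (simp add: AE_lborel_iff_negligible)
    ultimately have "AE z in lborel. z \<in> \<Omega> \<longrightarrow> 0 < rep_l2 u z"
      using nn by (auto elim!: eventually_elim2)
    then show ?thesis ..
  next
    assume Z: "Z = \<Omega>"
    have "negligible {z \<in> \<Omega>. rep_l2 u z \<noteq> 0}"
      unfolding locally_negligible_alt[of "{z \<in> \<Omega>. rep_l2 u z \<noteq> 0}"]
    proof
      fix x assume x: "x \<in> {z \<in> \<Omega>. rep_l2 u z \<noteq> 0}"
      then have "x \<in> Z" using Z by auto
      then obtain e where e: "0 < e" "AE z in lborel. z \<in> ball x e \<longrightarrow> rep_l2 u z = 0" by (auto simp: Z_def)
      have "negligible ({z \<in> \<Omega>. rep_l2 u z \<noteq> 0} \<inter> ball x e)"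
        using e(2) unfolding AE_lborel_iff_negligible by (rule negligible_subset) auto
      moreover have "openin (top_of_set {z \<in> \<Omega>. rep_l2 u z \<noteq> 0}) ({z \<in> \<Omega>. rep_l2 u z \<noteq> 0} \<inter> ball x e)"
        by (intro openin_open_Int) auto
      ultimately show "\<exists>U. openin (top_of_set {z \<in> \<Omega>. rep_l2 u z \<noteq> 0}) U \<and> x \<in> U \<and> negligible U"
        using x e(1) by (intro exI[of _ "{z \<in> \<Omega>. rep_l2 u z \<noteq> 0} \<inter> ball x e"]) auto
    qed
    then have "AE z in lborel. z \<in> \<Omega> \<longrightarrow> rep_l2 u z = 0"
      unfolding AE_lborel_iff_negligible by (rule negligible_subset) auto
    then show ?thesis ..
  qed
qed

section \<open>The fundamental lemma of the calculus of variations\<close>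

lemma flat_tendsto_1: assumes "0 < t" shows "(\<lambda>n. flat (real (Suc n) * t)) \<longlonglongrightarrow> 1"
proof -
  have "(\<lambda>n. exp (- (inverse (real (Suc n)) / t))) \<longlonglongrightarrow> exp (- (0 / t))"
    using assms by (intro tendsto_intros LIMSEQ_inverse_real_of_nat) auto
  moreover have "flat (real (Suc n) * t) = exp (- (inverse (real (Suc n)) / t))" for n
    using assms by (simp add: flat_def field_simps del: of_nat_Suc)
  ultimately show ?thesis by simp
qed

text \<open>Products of the factors \<open>flat\<close> ((n+1) t) over the faces of a box are test
  functions with values in [0, 1] that converge to the indicator of the open box. So f has integral
  0 over every box inside \<Omega>, and differentiation along cubes shows f = 0 almost
  everywhere.\<close>

lemma du_Bois_Reymond:
  fixes f :: "'a::euclidean_space \<Rightarrow> 'b::euclidean_space"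
  assumes \<Omega>: "open \<Omega>" and f: "set_integrable lebesgue \<Omega> f"
    and 0: "\<And>\<phi>. test_fun \<Omega> \<phi> \<Longrightarrow> set_lebesgue_integral lebesgue \<Omega> (\<lambda>x. \<phi> x *\<^sub>R f x) = 0"
  shows "AE x in lebesgue. x \<in> \<Omega> \<longrightarrow> f x = 0"
proof -
  define g where "g x = indicator \<Omega> x *\<^sub>R f x" for x
  have g: "integrable lebesgue g" using f by (simp add: set_integrable_def g_def[abs_def])
  have gm[measurable]: "g \<in> borel_measurable lebesgue" using g by auto
  have sg: "set_integrable lebesgue S g" if "S \<in> sets lebesgue" for S
    unfolding set_integrable_def using g that by (intro integrable_mult_indicator)
  have gi: "g integrable_on cbox a b" for a b
    by (rule set_lebesgue_integral_eq_integral(1)[OF sg]) simp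
  obtain N where N: "negligible N" "\<And>x e. \<lbrakk>x \<notin> N; 0 < e\<rbrakk> \<Longrightarrow> \<exists>d>0. \<forall>h. 0 < h \<and> h < d \<longrightarrow>
      norm (integral (cbox x (x + h *\<^sub>R One)) g /\<^sub>R h ^ DIM('a) - g x) < e"
    using integrable_ccontinuous_explicit[OF gi] by blast
  have z: "integral (cbox a b) g = 0" if ab: "cbox a b \<subseteq> \<Omega>" for a b
  proof -
    define p where "p n z = (\<Prod>i\<in>Basis. flat (real (Suc n) * ((z - a) \<bullet> i)) * flat (real (Suc n) * ((b - z) \<bullet> i)))" for n and z :: 'a
    have p0: "p n z = 0" if zb: "z \<notin> box a b" for n z
    proof -
      obtain i where i: "i \<in> Basis" "(z - a) \<bullet> i \<le> 0 \<or> (b - z) \<bullet> i \<le> 0"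
        using zb by (auto simp: mem_box inner_diff_left not_less)
      then have "flat (real (Suc n) * ((z - a) \<bullet> i)) * flat (real (Suc n) * ((b - z) \<bullet> i)) = 0"
        using flat_zero mult_nonneg_nonpos[of "real (Suc n)"] by (auto simp del: of_nat_Suc)
      then show ?thesis unfolding p_def using i(1) by (intro prod_zero) auto
    qed
    have "smooth (p n)" for n
    proof -
      have "smooth (\<lambda>z. flat (real (Suc n) * (z \<bullet> i + - (a \<bullet> i))) * flat (real (Suc n) * (b \<bullet> i + (-1) * (z \<bullet> i))))" for i
        by (intro smooth_mult smooth_compose[OF _ smooth_flat] smooth_add smooth_const smooth_inner_const)
      then have "smooth (\<lambda>z. \<Prod>i\<in>Basis. flat (real (Suc n) * (z \<bullet> i + - (a \<bullet> i))) * flat (real (Suc n) * (b \<bullet> i + (-1) * (z \<bullet> i))))"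
        by (intro smooth_prod) auto
      then show ?thesis by (simp add: p_def[abs_def] inner_diff_left del: of_nat_Suc)
    qed
    then have p: "test_fun \<Omega> (p n)" for n
      using p0 box_subset_cbox[of a b] ab by (intro test_funI[OF _ compact_cbox[of a b]]) blast+
    have p1: "\<bar>p n z\<bar> \<le> 1" for n z
      unfolding p_def abs_prod
      by (intro prod_le_1) (auto simp: abs_mult flat_nonneg intro!: mult_le_one flat_le_1)
    have pm[measurable]: "p n \<in> borel_measurable lebesgue" for n
      using sqint_measurable[OF test_fun_sqint[OF p]] measurable_completion[of "p n" lborel borel] by simp
    have lim: "(\<lambda>n. p n z) \<longlonglongrightarrow> indicator (box a b) z" for z
    proof (cases "z \<in> box a b")
      case True
      have "(\<lambda>n. flat (real (Suc n) * ((z - a) \<bullet> i)) * flat (real (Suc n) * ((b - z) \<bullet> i))) \<longlonglongrightarrow> 1 * 1"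
        if "i \<in> Basis" for i
        using True that by (intro tendsto_mult flat_tendsto_1) (auto simp: mem_box inner_diff_left)
      from tendsto_prod[OF this] have "(\<lambda>n. p n z) \<longlonglongrightarrow> (\<Prod>i\<in>(Basis::'a set). 1 * 1)"
        unfolding p_def .
      then show ?thesis using True by simp
    qed (simp add: p0)
    have "(\<lambda>n. \<integral>z. p n z *\<^sub>R g z \<partial>lebesgue) \<longlonglongrightarrow> (\<integral>z. indicator (box a b) z *\<^sub>R g z \<partial>lebesgue)"
    proof (rule integral_dominated_convergence[where w="\<lambda>z. norm (g z)"])
      show "AE z in lebesgue. (\<lambda>n. p n z *\<^sub>R g z) \<longlonglongrightarrow> indicator (box a b) z *\<^sub>R g z"
        using lim by (auto intro!: tendsto_scaleR)
      show "AE z in lebesgue. norm (p n z *\<^sub>R g z) \<le> norm (g z)" for n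
        using p1 by (auto intro!: mult_left_le_one_le)
      show "(\<lambda>z. indicator (box a b) z *\<^sub>R g z) \<in> borel_measurable lebesgue"
        using sg[of "box a b"] by (auto simp: set_integrable_def)
    qed (use g in auto)
    moreover have "(\<integral>z. p n z *\<^sub>R g z \<partial>lebesgue) = 0" for n
      using 0[OF p[of n]] by (simp add: set_lebesgue_integral_def g_def mult.commute)
    ultimately have "(\<integral>z. indicator (box a b) z *\<^sub>R g z \<partial>lebesgue) = 0"
      using LIMSEQ_unique[OF _ tendsto_const] by fastforce
    then have "integral (box a b) g = 0"
      using set_lebesgue_integral_eq_integral(2)[OF sg, of "box a b"] by (simp add: set_lebesgue_integral_def)
    then show ?thesis by (simp add: integral_open_interval)
  qed
  have "f x = 0" if x: "x \<in> \<Omega>" "x \<notin> N" for x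
  proof (rule ccontr)
    assume "f x \<noteq> 0"
    then have e: "0 < norm (g x)" using x(1) by (simp add: g_def)
    obtain d where d: "0 < d" "\<forall>h. 0 < h \<and> h < d \<longrightarrow>
      norm (integral (cbox x (x + h *\<^sub>R One)) g /\<^sub>R h ^ DIM('a) - g x) < norm (g x)"
      using N(2)[OF x(2) e] by blast
    obtain r where r: "0 < r" "cball x r \<subseteq> \<Omega>" using \<Omega> x(1) open_contains_cball by blast
    define n1 where "n1 = norm (One :: 'a)"
    have n1: "0 \<le> n1" by (simp add: n1_def)
    define h where "h = min (d / 2) (r / (n1 + 1))"
    have h: "0 < h" "h < d" "h \<le> r / (n1 + 1)" using d r n1 by (auto simp: h_def add_nonneg_pos)
    have "cbox x (x + h *\<^sub>R One) \<subseteq> \<Omega>"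
    proof
      fix z assume z: "z \<in> cbox x (x + h *\<^sub>R One)"
      have "norm (z - x) \<le> norm (h *\<^sub>R (One :: 'a))"
      proof (rule norm_le_componentwise)
        fix b :: 'a assume b: "b \<in> Basis"
        show "\<bar>(z - x) \<bullet> b\<bar> \<le> \<bar>(h *\<^sub>R One) \<bullet> b\<bar>"
          using z b h(1) by (auto simp: mem_box inner_diff_left inner_add_left)
      qed
      also have "\<dots> = h * n1" using h(1) by (simp add: n1_def)
      also have "\<dots> \<le> r / (n1 + 1) * n1" using h n1 by (intro mult_right_mono) auto
      also have "\<dots> \<le> r" using n1 r(1) by (simp add: field_simps)
      finally show "z \<in> \<Omega>" using r(2) by (auto simp: dist_norm norm_minus_commute)
    qed
    from z[OF this] d(2) h show False by auto
  qed
  moreover have "AE x in lborel. x \<notin> N" using N(1) by (simp add: AE_lborel_iff_negligible)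
  ultimately show ?thesis unfolding AE_lebesgue_iff_lborel by (auto elim!: eventually_mono)
qed

subsection \<open>The ground state\<close>

text \<open>From K u = \<kappa> u one gets \<Delta> u = (1 - 1/\<kappa>) u weakly, which is
  nonpositive for u \<ge> 0 and \<kappa> \<le> 1.\<close>

lemma K_eigenvector_supersolution:
  assumes u: "K \<Omega> u = \<kappa> *\<^sub>R u" "0 < \<kappa>" "\<kappa> \<le> 1" "AE x in lborel. 0 \<le> rep_l2 u x"
    and \<eta>: "test_fun \<Omega> \<eta>" "\<And>x. 0 \<le> \<eta> x"
  shows "u \<bullet> abs_l2 (lap_test \<eta>) \<le> 0"
proof -
  have "\<kappa> * (u \<bullet> abs_l2 (lap_test \<eta>)) = (\<kappa> - 1) * (u \<bullet> abs_l2 \<eta>)"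
    using K_weak_lap[OF \<eta>(1), of u] by (simp add: u(1) algebra_simps)
  moreover have "0 \<le> u \<bullet> abs_l2 \<eta>"
  proof (rule inner_nonneg_l2[OF u(4)])
    show "AE x in lborel. 0 \<le> rep_l2 (abs_l2 \<eta>) x"
      using rep_abs_l2[OF test_fun_sqint[OF \<eta>(1)]] by eventually_elim (simp add: \<eta>(2))
  qed
  ultimately have "\<kappa> * (u \<bullet> abs_l2 (lap_test \<eta>)) \<le> 0"
    using u(3) by (simp add: mult_nonpos_nonneg)
  then show ?thesis using u(2) by (simp add: mult_le_0_iff)
qed

text \<open>Both |u| and |u| + u are nonnegative eigenvectors, so each is either zero or positive
  almost everywhere. The first is positive since u is not 0; the second then decides the sign of
  u.\<close>

lemma K_eigenvector_sign:
  assumes \<Omega>: "open \<Omega>" "bounded \<Omega>" "connected \<Omega>"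
    and \<kappa>: "\<And>f. K \<Omega> f \<bullet> f \<le> \<kappa> * (norm f)\<^sup>2" "0 < \<kappa>" and u: "K \<Omega> u = \<kappa> *\<^sub>R u" "u \<noteq> 0"
  shows "(AE x in lborel. x \<in> \<Omega> \<longrightarrow> 0 < rep_l2 u x) \<or> (AE x in lborel. x \<in> \<Omega> \<longrightarrow> rep_l2 u x < 0)"
proof -
  have \<kappa>1: "\<kappa> \<le> 1" using K_eigenvalue_less_1[OF \<Omega>(1,2) u \<kappa>(2)] by simp
  have a: "K \<Omega> (l2_abs u) = \<kappa> *\<^sub>R l2_abs u" by (rule K_eigenvector_abs[OF \<Omega>(1,2) \<kappa> u(1)])
  have off: "AE x in lborel. x \<notin> \<Omega> \<longrightarrow> rep_l2 u x = 0"
    using K_support[OF \<Omega>(1), of u] rep_l2_scaleR[of \<kappa> u] unfolding u(1)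
    by eventually_elim (use \<kappa>(2) in auto)
  have nn: "AE x in lborel. 0 \<le> rep_l2 (l2_abs u) x"
    using rep_l2_abs[of u] by eventually_elim simp
  have dich: "(AE z in lborel. z \<in> \<Omega> \<longrightarrow> rep_l2 v z = 0) \<or> (AE z in lborel. z \<in> \<Omega> \<longrightarrow> 0 < rep_l2 v z)"
    if "K \<Omega> v = \<kappa> *\<^sub>R v" "AE x in lborel. 0 \<le> rep_l2 v x" for v
    using strong_maximum_principle[OF \<Omega>(1,3) _ that(2)] K_eigenvector_supersolution[OF that(1) \<kappa>(2) \<kappa>1 that(2)] by blast
  have pos: "AE z in lborel. z \<in> \<Omega> \<longrightarrow> 0 < rep_l2 (l2_abs u) z"
  proof (rule ccontr)
    assume "\<not> (AE z in lborel. z \<in> \<Omega> \<longrightarrow> 0 < rep_l2 (l2_abs u) z)"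
    then have "AE z in lborel. z \<in> \<Omega> \<longrightarrow> rep_l2 (l2_abs u) z = 0" using dich[OF a nn] by blast
    then have "AE z in lborel. rep_l2 u z = rep_l2 0 z"
      using rep_l2_abs[of u] off rep_l2_zero by eventually_elim auto
    then show False using u(2) l2_eq_iff by blast
  qed
  have "K \<Omega> (l2_abs u + u) = \<kappa> *\<^sub>R (l2_abs u + u)" by (simp add: K_add a u(1) scaleR_add_right)
  moreover have "AE x in lborel. 0 \<le> rep_l2 (l2_abs u + u) x"
    using rep_l2_abs[of u] rep_l2_add[of "l2_abs u" u] by eventually_elim auto
  ultimately have "(AE z in lborel. z \<in> \<Omega> \<longrightarrow> rep_l2 (l2_abs u + u) z = 0) \<or> (AE z in lborel. z \<in> \<Omega> \<longrightarrow> 0 < rep_l2 (l2_abs u + u) z)"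
    by (rule dich)
  then show ?thesis
  proof
    assume *: "AE z in lborel. z \<in> \<Omega> \<longrightarrow> rep_l2 (l2_abs u + u) z = 0"
    have "AE x in lborel. x \<in> \<Omega> \<longrightarrow> rep_l2 u x < 0"
      using * pos rep_l2_add[of "l2_abs u" u] by eventually_elim auto
    then show ?thesis ..
  next
    assume *: "AE z in lborel. z \<in> \<Omega> \<longrightarrow> 0 < rep_l2 (l2_abs u + u) z"
    have "AE x in lborel. x \<in> \<Omega> \<longrightarrow> 0 < rep_l2 u x"
      using * rep_l2_abs[of u] rep_l2_add[of "l2_abs u" u] by eventually_elim auto
    then show ?thesis ..
  qed
qed

lemma l2_inner_pos:
  fixes u v :: "('a::euclidean_space, real) l2"
  assumes \<Omega>: "open \<Omega>" "\<Omega> \<noteq> {}"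
    and u: "AE x in lborel. x \<in> \<Omega> \<longrightarrow> 0 < rep_l2 u x" "AE x in lborel. x \<notin> \<Omega> \<longrightarrow> rep_l2 u x = 0"
    and v: "AE x in lborel. x \<in> \<Omega> \<longrightarrow> 0 < rep_l2 v x"
  shows "u \<bullet> v \<noteq> 0"
proof
  assume "u \<bullet> v = 0"
  then have "(\<integral>x. rep_l2 u x \<bullet> rep_l2 v x \<partial>lborel) = 0" by (simp add: inner_l2_rep)
  moreover have "AE x in lborel. 0 \<le> rep_l2 u x \<bullet> rep_l2 v x"
    using u v
  proof eventually_elim
    case (elim x)
    then show ?case by (cases "x \<in> \<Omega>") auto
  qed
  ultimately have "AE x in lborel. rep_l2 u x \<bullet> rep_l2 v x = 0"
    using integral_nonneg_eq_0_iff_AE[OF sqint_inner[OF sqint_rep sqint_rep]] by blast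
  then have "AE x in lborel. x \<notin> \<Omega>" using u(1) v by eventually_elim auto
  then have "negligible \<Omega>" by (simp add: AE_lborel_iff_negligible)
  then show False using open_not_negligible[OF \<Omega>] by blast
qed

text \<open>An eigenvector for \<kappa> has one sign, so it is never orthogonal to the positive
  \<phi>. The supremum \<kappa>' of the form on the orthogonal complement is attained there when
  positive, hence cannot equal \<kappa>; this is the spectral gap.\<close>

lemma ground_state:
  fixes \<Omega> :: "'a::euclidean_space set"
  assumes \<Omega>: "open \<Omega>" "bounded \<Omega>" "connected \<Omega>" "\<Omega> \<noteq> {}"
  obtains \<phi> \<kappa> \<kappa>' where "0 < \<kappa>" "\<kappa> < 1" "norm \<phi> = 1" "K \<Omega> \<phi> = \<kappa> *\<^sub>R \<phi>"
    "AE x in lborel. x \<in> \<Omega> \<longrightarrow> 0 < rep_l2 \<phi> x" "0 \<le> \<kappa>'" "\<kappa>' < \<kappa>"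
    "\<And>f. f \<bullet> \<phi> = 0 \<Longrightarrow> norm (K \<Omega> f) \<le> \<kappa>' * norm f"
proof -
  obtain \<kappa> where \<kappa>: "0 \<le> \<kappa>" "\<And>f. K \<Omega> f \<bullet> f \<le> \<kappa> * (norm f)\<^sup>2"
    "\<kappa> > 0 \<Longrightarrow> \<exists>\<phi>. norm \<phi> = 1 \<and> K \<Omega> \<phi> = \<kappa> *\<^sub>R \<phi>"
    using K_form_sup[OF \<Omega>(1,2), of UNIV] by auto
  have pos: "0 < \<kappa>"
  proof -
    obtain p where p: "test_fun \<Omega> p" "abs_l2 p \<noteq> 0" using exists_test_fun[OF \<Omega>(1,4)] by blast
    let ?f = "abs_l2 p"
    have "Rop \<Omega> ?f \<bullet> graph_grad p = ?f \<bullet> ?f"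
      using Rop_inner[OF graph_grad_in_V[OF p(1)], of ?f] by (simp add: graph_grad_def)
    then have "Rop \<Omega> ?f \<noteq> 0" using p(2) by auto
    then have "0 < K \<Omega> ?f \<bullet> ?f" by (simp flip: Rop_inner_Rop)
    also have "\<dots> \<le> \<kappa> * (norm ?f)\<^sup>2" by (rule \<kappa>)
    finally show ?thesis using \<kappa>(1) by (cases "\<kappa> = 0") auto
  qed
  obtain \<phi>0 where \<phi>0: "norm \<phi>0 = 1" "K \<Omega> \<phi>0 = \<kappa> *\<^sub>R \<phi>0" using \<kappa>(3)[OF pos] by blast
  have neg: "K \<Omega> (- v) = - K \<Omega> v" for v using K_scaleR[of \<Omega> "-1" v] by simp
  have sneg: "AE x in lborel. rep_l2 (- v) x = - rep_l2 v x" for v :: "('a, real) l2"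
    using rep_l2_scaleR[of "-1" v] by simp
  have nz: "v \<noteq> 0" if "norm v = 1" for v :: "('a, real) l2" using that by auto
  note sgn = K_eigenvector_sign[OF \<Omega>(1-3) \<kappa>(2) pos]
  have "\<exists>\<phi>. norm \<phi> = 1 \<and> K \<Omega> \<phi> = \<kappa> *\<^sub>R \<phi> \<and> (AE x in lborel. x \<in> \<Omega> \<longrightarrow> 0 < rep_l2 \<phi> x)"
  proof (cases "AE x in lborel. x \<in> \<Omega> \<longrightarrow> 0 < rep_l2 \<phi>0 x")
    case False
    then have "AE x in lborel. x \<in> \<Omega> \<longrightarrow> rep_l2 \<phi>0 x < 0" using sgn[OF \<phi>0(2) nz[OF \<phi>0(1)]] by auto
    then have "AE x in lborel. x \<in> \<Omega> \<longrightarrow> 0 < rep_l2 (- \<phi>0) x"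
      using sneg[of \<phi>0] by eventually_elim auto
    then show ?thesis using \<phi>0 by (intro exI[of _ "- \<phi>0"]) (simp add: neg)
  qed (use \<phi>0 in blast)
  then obtain \<phi> where \<phi>: "norm \<phi> = 1" "K \<Omega> \<phi> = \<kappa> *\<^sub>R \<phi>" "AE x in lborel. x \<in> \<Omega> \<longrightarrow> 0 < rep_l2 \<phi> x" by blast
  have off: "AE x in lborel. x \<notin> \<Omega> \<longrightarrow> rep_l2 \<phi> x = 0"
    using K_support[OF \<Omega>(1), of \<phi>] rep_l2_scaleR[of \<kappa> \<phi>] unfolding \<phi>(2)
    by eventually_elim (use pos in auto)
  have simple: "\<psi> \<bullet> \<phi> \<noteq> 0" if "K \<Omega> \<psi> = \<kappa> *\<^sub>R \<psi>" "\<psi> \<noteq> 0" for \<psi>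
  proof (cases "AE x in lborel. x \<in> \<Omega> \<longrightarrow> 0 < rep_l2 \<psi> x")
    case True
    then show ?thesis using l2_inner_pos[OF \<Omega>(1,4) \<phi>(3) off True] by (simp add: inner_commute)
  next
    case False
    then have "AE x in lborel. x \<in> \<Omega> \<longrightarrow> rep_l2 \<psi> x < 0" using sgn[OF that] by auto
    then have "AE x in lborel. x \<in> \<Omega> \<longrightarrow> 0 < rep_l2 (- \<psi>) x"
      using sneg[of \<psi>] by eventually_elim auto
    then show ?thesis using l2_inner_pos[OF \<Omega>(1,4) \<phi>(3) off] by (fastforce simp: inner_commute)
  qed
  define S where "S = {f. f \<bullet> \<phi> = 0}"
  have S: "closed S" "\<And>f. f \<in> S \<Longrightarrow> K \<Omega> f \<in> S" "\<And>c f. f \<in> S \<Longrightarrow> c *\<^sub>R f \<in> S"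
    unfolding S_def using K_symmetric[of \<Omega> _ \<phi>] by (auto intro!: closed_Collect_eq continuous_intros simp: \<phi>(2))
  obtain \<kappa>' where \<kappa>': "0 \<le> \<kappa>'" "\<And>f. f \<in> S \<Longrightarrow> K \<Omega> f \<bullet> f \<le> \<kappa>' * (norm f)\<^sup>2"
    "\<kappa>' > 0 \<Longrightarrow> \<exists>\<psi>\<in>S. norm \<psi> = 1 \<and> K \<Omega> \<psi> = \<kappa>' *\<^sub>R \<psi>"
    using K_form_sup[OF \<Omega>(1,2) S] by blast
  have "\<kappa>' < \<kappa>"
  proof (cases "0 < \<kappa>'")
    case True
    then obtain \<psi> where \<psi>: "\<psi> \<in> S" "norm \<psi> = 1" "K \<Omega> \<psi> = \<kappa>' *\<^sub>R \<psi>" using \<kappa>'(3) by blast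
    have "\<kappa>' \<le> \<kappa>" using \<kappa>(2)[of \<psi>] \<psi> by (simp add: power2_norm_eq_inner[symmetric])
    moreover have "\<kappa>' \<noteq> \<kappa>" using simple[of \<psi>] \<psi> nz[OF \<psi>(2)] by (auto simp: S_def)
    ultimately show ?thesis by simp
  qed (use \<kappa>'(1) pos in simp)
  moreover have "norm (K \<Omega> f) \<le> \<kappa>' * norm f" if "f \<bullet> \<phi> = 0" for f
    using K_norm_le_form[of S \<Omega> \<kappa>' f] S \<kappa>' that by (auto simp: S_def)
  moreover have "\<kappa> < 1" by (rule K_eigenvalue_less_1[OF \<Omega>(1,2) \<phi>(2) nz[OF \<phi>(1)] pos])
  ultimately show ?thesis using that[of \<kappa> \<phi> \<kappa>'] pos \<phi> \<kappa>'(1) by blast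
qed

section \<open>Contractions depending on a parameter\<close>

text \<open>The bound (1 - q) r on the motion of the centre keeps the ball invariant. Continuity of
  the fixed point needs continuity of \<Phi> in the parameter only at frozen arguments: (1 - q) dist
  (x \<alpha>) (x \<beta>) \<le> dist (\<Phi> \<alpha> (x \<beta>)) (\<Phi> \<beta> (x
  \<beta>)).\<close>

lemma uniform_contraction:
  fixes \<Phi> :: "real \<Rightarrow> 'x::complete_space \<Rightarrow> 'x"
  assumes q: "0 \<le> q" "q < 1" and r: "0 \<le> r"
    and lip: "\<And>\<alpha> x y. \<alpha> \<in> I \<Longrightarrow> x \<in> cball x0 r \<Longrightarrow> y \<in> cball x0 r \<Longrightarrow> dist (\<Phi> \<alpha> x) (\<Phi> \<alpha> y) \<le> q * dist x y"
    and self: "\<And>\<alpha>. \<alpha> \<in> I \<Longrightarrow> dist (\<Phi> \<alpha> x0) x0 \<le> (1 - q) * r"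
    and cont: "\<And>x. x \<in> cball x0 r \<Longrightarrow> continuous_on I (\<lambda>\<alpha>. \<Phi> \<alpha> x)"
  obtains x where "continuous_on I x" "\<And>\<alpha>. \<alpha> \<in> I \<Longrightarrow> x \<alpha> \<in> cball x0 r \<and> \<Phi> \<alpha> (x \<alpha>) = x \<alpha>"
    "\<And>\<alpha> y. \<alpha> \<in> I \<Longrightarrow> y \<in> cball x0 r \<Longrightarrow> \<Phi> \<alpha> y = y \<Longrightarrow> y = x \<alpha>"
proof -
  have x0: "x0 \<in> cball x0 r" using r by simp
  have ex: "\<exists>!x. x \<in> cball x0 r \<and> \<Phi> \<alpha> x = x" if \<alpha>: "\<alpha> \<in> I" for \<alpha>
  proof -
    have "\<Phi> \<alpha> ` cball x0 r \<subseteq> cball x0 r"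
    proof (rule image_subsetI)
      fix x assume x: "x \<in> cball x0 r"
      have "dist (\<Phi> \<alpha> x) x0 \<le> dist (\<Phi> \<alpha> x) (\<Phi> \<alpha> x0) + dist (\<Phi> \<alpha> x0) x0" by (rule dist_triangle)
      also have "\<dots> \<le> q * r + (1 - q) * r"
        using lip[OF \<alpha> x x0] self[OF \<alpha>] mult_left_mono[OF _ q(1), of "dist x x0" r] x
        by (simp add: dist_commute)
      also have "\<dots> = r" by (simp add: algebra_simps)
      finally show "\<Phi> \<alpha> x \<in> cball x0 r" by (simp add: dist_commute)
    qed
    then have "\<exists>!x\<in>cball x0 r. \<Phi> \<alpha> x = x"
      using lip[OF \<alpha>] x0 q by (intro Banach_fix[of _ q]) (auto simp: complete_eq_closed)
    then show ?thesis by simp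
  qed
  define x where "x \<alpha> = (THE x. x \<in> cball x0 r \<and> \<Phi> \<alpha> x = x)" for \<alpha>
  have x: "x \<alpha> \<in> cball x0 r \<and> \<Phi> \<alpha> (x \<alpha>) = x \<alpha>" if "\<alpha> \<in> I" for \<alpha>
    unfolding x_def by (rule theI'[OF ex[OF that]])
  have xc: "continuous_on I x"
    unfolding continuous_on_def
  proof
    fix \<beta> assume \<beta>: "\<beta> \<in> I"
    have le: "dist (x \<alpha>) (x \<beta>) \<le> dist (\<Phi> \<alpha> (x \<beta>)) (\<Phi> \<beta> (x \<beta>)) / (1 - q)" if \<alpha>: "\<alpha> \<in> I" for \<alpha>
    proof -
      have "dist (x \<alpha>) (x \<beta>) = dist (\<Phi> \<alpha> (x \<alpha>)) (\<Phi> \<beta> (x \<beta>))" using x \<alpha> \<beta> by simp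
      also have "\<dots> \<le> dist (\<Phi> \<alpha> (x \<alpha>)) (\<Phi> \<alpha> (x \<beta>)) + dist (\<Phi> \<alpha> (x \<beta>)) (\<Phi> \<beta> (x \<beta>))" by (rule dist_triangle)
      also have "\<dots> \<le> q * dist (x \<alpha>) (x \<beta>) + dist (\<Phi> \<alpha> (x \<beta>)) (\<Phi> \<beta> (x \<beta>))" by (intro add_right_mono lip \<alpha> x[THEN conjunct1] \<beta>)
      finally show ?thesis using q by (simp add: le_divide_eq algebra_simps)
    qed
    have "((\<lambda>\<alpha>. \<Phi> \<alpha> (x \<beta>)) \<longlongrightarrow> \<Phi> \<beta> (x \<beta>)) (at \<beta> within I)"
      using cont[of "x \<beta>"] x[OF \<beta>] \<beta> by (auto simp: continuous_on_def)
    then have "((\<lambda>\<alpha>. dist (\<Phi> \<alpha> (x \<beta>)) (\<Phi> \<beta> (x \<beta>)) / (1 - q)) \<longlongrightarrow> dist (\<Phi> \<beta> (x \<beta>)) (\<Phi> \<beta> (x \<beta>)) / (1 - q)) (at \<beta> within I)"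
      using q by (intro tendsto_intros) auto
    then have "((\<lambda>\<alpha>. dist (x \<alpha>) (x \<beta>)) \<longlongrightarrow> 0) (at \<beta> within I)"
      using le by (intro Lim_null_comparison[of "\<lambda>\<alpha>. dist (x \<alpha>) (x \<beta>)"]) (auto simp: eventually_at_filter)
    then show "(x \<longlongrightarrow> x \<beta>) (at \<beta> within I)" by (rule tendsto_dist_iff[THEN iffD2])
  qed
  have "y = x \<alpha>" if "\<alpha> \<in> I" "y \<in> cball x0 r" "\<Phi> \<alpha> y = y" for \<alpha> y
    using ex[OF that(1)] x[OF that(1)] that(2,3) by metis
  from that[OF xc x this] show ?thesis .
qed

subsection \<open>Perturbation of a simple eigenvalue\<close>

text \<open>The complexification of a real inner product space is \<open>'h \<times> 'h\<close>, with \<open>cmul\<close> as complex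
  scalar multiplication.\<close>
definition cmul :: "complex \<Rightarrow> 'h::real_vector \<times> 'h \<Rightarrow> 'h \<times> 'h" where
  "cmul c x = (Re c *\<^sub>R fst x - Im c *\<^sub>R snd x, Re c *\<^sub>R snd x + Im c *\<^sub>R fst x)"

text \<open>The Hermitian product of a complexified vector with the real vector \<phi>.\<close>

definition coef :: "'h::real_inner \<Rightarrow> 'h \<times> 'h \<Rightarrow> complex" where
  "coef \<phi> x = Complex (fst x \<bullet> \<phi>) (snd x \<bullet> \<phi>)"

lemma cmul_add_right: "cmul c (x + y) = cmul c x + cmul c y"
  and cmul_diff_right: "cmul c (x - y) = cmul c x - cmul c y"
  and cmul_add_left: "cmul (c + d) x = cmul c x + cmul d x"
  and cmul_diff_left: "cmul (c - d) x = cmul c x - cmul d x"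
  and cmul_cmul: "cmul c (cmul d x) = cmul (c * d) x"
  and cmul_0_left [simp]: "cmul 0 x = 0"
  and cmul_0_right [simp]: "cmul c 0 = 0"
  and cmul_1 [simp]: "cmul 1 x = x"
  by (auto simp: cmul_def prod_eq_iff algebra_simps)

lemma norm_cmul: "norm (cmul c x) = cmod c * norm (x :: 'h::real_inner \<times> 'h)"
proof -
  have "(norm (cmul c x))\<^sup>2 = (cmod c * norm x)\<^sup>2"
    unfolding power_mult_distrib cmod_power2 power2_norm_eq_inner
    by (simp add: cmul_def inner_prod_def inner_diff_left inner_diff_right inner_add_left inner_add_right
        inner_commute algebra_simps power2_eq_square)
  then show ?thesis by (simp add: power2_eq_iff_nonneg)
qed

lemma continuous_on_cmul:
  fixes f :: "'t::topological_space \<Rightarrow> 'h::real_inner \<times> 'h"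
  assumes "continuous_on A c" "continuous_on A f"
  shows "continuous_on A (\<lambda>t. cmul (c t) (f t))"
  unfolding cmul_def by (intro continuous_intros assms)

lemma coef_add: "coef \<phi> (x + y) = coef \<phi> x + coef \<phi> y"
  and coef_diff: "coef \<phi> (x - y) = coef \<phi> x - coef \<phi> y"
  and coef_cmul: "coef \<phi> (cmul c x) = c * coef \<phi> x"
  by (auto simp: coef_def cmul_def complex_eq_iff inner_add_left inner_diff_left)

lemma cmod_coef_le:
  assumes "norm \<phi> = 1" shows "cmod (coef \<phi> x) \<le> norm x"
proof -
  have "(fst x \<bullet> \<phi>)\<^sup>2 \<le> (norm (fst x))\<^sup>2" "(snd x \<bullet> \<phi>)\<^sup>2 \<le> (norm (snd x))\<^sup>2"
    using Cauchy_Schwarz_ineq[of "fst x" \<phi>] Cauchy_Schwarz_ineq[of "snd x" \<phi>] assms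
    by (simp_all add: power2_norm_eq_inner[symmetric])
  then show ?thesis unfolding coef_def complex_norm norm_prod_def by (intro real_sqrt_le_mono add_mono) auto
qed

lemma norm_remove_coef_le:
  fixes \<phi> :: "'h::real_inner"
  assumes "norm \<phi> = 1" shows "norm (x - cmul (coef \<phi> x) (\<phi>, 0)) \<le> norm x"
proof -
  have c: "norm (y - (y \<bullet> \<phi>) *\<^sub>R \<phi>) \<le> norm y" for y
  proof -
    have "\<phi> \<bullet> \<phi> = 1" using assms by (simp add: power2_norm_eq_inner[symmetric])
    then have "(norm (y - (y \<bullet> \<phi>) *\<^sub>R \<phi>))\<^sup>2 = (norm y)\<^sup>2 - (y \<bullet> \<phi>)\<^sup>2"
      unfolding power2_norm_eq_inner
      by (simp add: inner_diff_left inner_diff_right inner_commute power2_eq_square algebra_simps)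
    then have "(norm (y - (y \<bullet> \<phi>) *\<^sub>R \<phi>))\<^sup>2 \<le> (norm y)\<^sup>2" by simp
    then show ?thesis by (rule power2_le_imp_le) simp
  qed
  show ?thesis
    using c[of "fst x"] c[of "snd x"] unfolding norm_prod_def
    by (intro real_sqrt_le_mono add_mono power_mono) (auto simp: cmul_def coef_def)
qed

text \<open>Write \<open>f = \<phi> + \<psi>\<close> with \<open>\<psi>\<close> orthogonal to \<open>\<phi>\<close>. The component of the equation along \<open>\<phi>\<close> determines
  \<open>c\<close>, the orthogonal component determines \<open>\<psi>\<close>, and on the latter \<open>(1 + c) T\<close> is a strict contraction
  because \<open>1 + c\<close> is close to \<open>1/\<kappa>\<close> while \<open>T\<close> has norm at most \<open>\<kappa>' < \<kappa>\<close> there.\<close>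
lemma perturbed_eigenvalue_branch:
  fixes T :: "'h::{real_inner, complete_space} \<Rightarrow> 'h" and \<phi> :: 'h
    and B :: "complex \<Rightarrow> complex" and G :: "real \<Rightarrow> 'h \<times> 'h \<Rightarrow> 'h \<times> 'h"
  assumes T: "\<And>x y. T (x + y) = T x + T y" "\<And>s x. T (s *\<^sub>R x) = s *\<^sub>R T x" "\<And>x y. T x \<bullet> y = x \<bullet> T y"
    and \<phi>: "norm \<phi> = 1" "T \<phi> = \<kappa> *\<^sub>R \<phi>" and \<kappa>: "0 \<le> \<kappa>'" "\<kappa>' < \<kappa>"
    and gap: "\<And>x. x \<bullet> \<phi> = 0 \<Longrightarrow> norm (T x) \<le> \<kappa>' * norm x"
    and B: "0 \<le> L" "\<And>c d. cmod (B c - B d) \<le> L * cmod (c - d)"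
    and G_lip: "\<And>\<epsilon>. 0 < \<epsilon> \<Longrightarrow> \<exists>r>0. \<exists>a>0. \<forall>\<alpha>\<in>{0..a}. \<forall>f g. norm (f - (\<phi>, 0)) \<le> r \<longrightarrow> norm (g - (\<phi>, 0)) \<le> r
        \<longrightarrow> norm (G \<alpha> f - G \<alpha> g) \<le> \<epsilon> * norm (f - g)"
    and G_cont: "0 < a0" "\<And>f. continuous_on {0..a0} (\<lambda>\<alpha>. G \<alpha> f)"
    and G_0: "\<And>f. G 0 f = 0"
  obtains a c f where "0 < a" "continuous_on {0..a} c" "continuous_on {0..a} f" "c 0 = complex_of_real (1 / \<kappa> - 1)"
    "\<And>\<alpha>. \<alpha> \<in> {0..a} \<Longrightarrow> coef \<phi> (f \<alpha>) = 1 \<and>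
      f \<alpha> = cmul (1 + c \<alpha>) (T (fst (f \<alpha>)), T (snd (f \<alpha>))) + cmul (B (c \<alpha>)) (G \<alpha> (f \<alpha>))"
proof -
  define \<phi>' where "\<phi>' = (\<phi>, 0::'h)"
  define T' where "T' x = (T (fst x), T (snd x))" for x
  define P where "P x = x - cmul (coef \<phi> x) \<phi>'" for x
  define \<mu> where "\<mu> = complex_of_real (1 / \<kappa> - 1)"
  have \<kappa>0: "0 < \<kappa>" using \<kappa> by simp
  have l1: "1 + \<mu> = complex_of_real (1 / \<kappa>)" by (simp add: \<mu>_def)
  have c\<phi>: "coef \<phi> \<phi>' = 1"
    using \<phi>(1) by (simp add: coef_def \<phi>'_def complex_eq_iff power2_norm_eq_inner[symmetric])
  have T_diff: "T (x - y) = T x - T y" for x y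
    using T(1)[of "x - y" y] by simp
  have T_0: "T 0 = 0" using T(2)[of 0 0] by simp
  have T'_add: "T' (x + y) = T' x + T' y" and T'_diff: "T' (x - y) = T' x - T' y" for x y
    by (simp_all add: T'_def T(1) T_diff)
  have T'_\<phi>: "T' \<phi>' = cmul (complex_of_real \<kappa>) \<phi>'"
    by (simp add: T'_def \<phi>'_def \<phi>(2) T_0 cmul_def)
  have P_diff: "P (x - y) = P x - P y" for x y
    by (simp add: P_def coef_diff cmul_diff_left)
  have P_0: "P 0 = 0" by (simp add: P_def coef_def flip: zero_complex.code)
  have normP: "norm (P x) \<le> norm x" for x unfolding P_def \<phi>'_def by (rule norm_remove_coef_le[OF \<phi>(1)])
  have coefP: "coef \<phi> (P x) = 0" for x by (simp add: P_def coef_diff coef_cmul c\<phi>)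
  have coefT: "coef \<phi> (T' x) = complex_of_real \<kappa> * coef \<phi> x" for x
    by (simp add: coef_def T'_def T(3) \<phi>(2) complex_eq_iff)
  have normTP: "norm (T' (P x)) \<le> \<kappa>' * norm x" for x
  proof -
    have "fst (P x) \<bullet> \<phi> = 0" "snd (P x) \<bullet> \<phi> = 0" using coefP[of x] by (auto simp: coef_def complex_eq_iff)
    then have "norm (T (fst (P x))) \<le> \<kappa>' * norm (fst (P x))" "norm (T (snd (P x))) \<le> \<kappa>' * norm (snd (P x))"
      using gap by auto
    then have "norm (T' (P x)) \<le> sqrt ((\<kappa>' * norm (fst (P x)))\<^sup>2 + (\<kappa>' * norm (snd (P x)))\<^sup>2)"
      unfolding T'_def norm_prod_def by (intro real_sqrt_le_mono add_mono power_mono) auto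
    also have "\<dots> = sqrt (\<kappa>'\<^sup>2 * ((norm (fst (P x)))\<^sup>2 + (norm (snd (P x)))\<^sup>2))"
      by (simp add: power_mult_distrib distrib_left)
    also have "\<dots> = \<kappa>' * norm (P x)" using \<kappa>(1) by (simp add: real_sqrt_mult norm_prod_def)
    also have "\<dots> \<le> \<kappa>' * norm x" using normP \<kappa>(1) by (intro mult_left_mono)
    finally show ?thesis .
  qed
  \<comment> \<open>The first component is the coefficient equation (1 + c) \<kappa> + B(c)
    \<open>coef\<close> (G f) = 1, solved for the linear occurrence of c.\<close>
  define \<Phi> where "\<Phi> \<alpha> x = ((1 - B (fst x) * coef \<phi> (G \<alpha> (\<phi>' + snd x))) / complex_of_real \<kappa> - 1,
     cmul (1 + fst x) (T' (P (snd x))) + cmul (B (fst x)) (P (G \<alpha> (\<phi>' + snd x))))" for \<alpha> :: real and x :: "complex \<times> ('h \<times> 'h)"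
  define x0 where "x0 = (\<mu>, 0 :: 'h \<times> 'h)"
  \<comment> \<open>A quarter of the spectral gap, so that q = \<kappa>'/\<kappa> + 2 \<delta> stays
    below 1. One \<delta> pays for the variation of c in the ball, the other for the nonlinear
    term.\<close>
  define \<delta> where "\<delta> = (1 - \<kappa>' / \<kappa>) / 4"
  have \<delta>: "0 < \<delta>" using \<kappa> \<kappa>0 by (simp add: \<delta>_def)
  define q where "q = \<kappa>' / \<kappa> + 2 * \<delta>"
  have "0 \<le> \<kappa>' / \<kappa>" "\<kappa>' / \<kappa> < 1" using \<kappa> \<kappa>0 by auto
  moreover have "0 \<le> t + 2 * ((1 - t) / 4) \<and> t + 2 * ((1 - t) / 4) < 1" if "0 \<le> t" "t < 1" for t :: real
    using that by (simp add: field_simps)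
  ultimately have q: "0 \<le> q" "q < 1" unfolding q_def \<delta>_def by blast+
  define bm where "bm = cmod (B \<mu>) + L"
  have bm0: "0 \<le> bm" using B(1) by (simp add: bm_def)
  \<comment> \<open>On the ball |G| \<le> 2 \<epsilon> and G has Lipschitz constant \<epsilon>, so
    B(c) G has Lipschitz constant (2 L + bm) \<epsilon>. The factor 1/\<kappa> + 1 adds up its
    effect on the two components of \<Phi>.\<close>
  define M where "M = (1 / \<kappa> + 1) * (2 * L + bm) + 1"
  have M: "0 < M" using \<kappa>0 B(1) bm0 by (simp add: M_def add_nonneg_pos)
  define \<epsilon> where "\<epsilon> = \<delta> / M"
  have \<epsilon>: "0 < \<epsilon>" "(1 / \<kappa> + 1) * (2 * L + bm) * \<epsilon> \<le> \<delta>"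
    using \<delta> M by (auto simp: \<epsilon>_def M_def field_simps)
  obtain r1 a1 where r1: "0 < r1" "0 < a1" "\<And>\<alpha> f g. \<alpha> \<in> {0..a1} \<Longrightarrow> norm (f - \<phi>') \<le> r1 \<Longrightarrow> norm (g - \<phi>') \<le> r1
        \<Longrightarrow> norm (G \<alpha> f - G \<alpha> g) \<le> \<epsilon> * norm (f - g)"
    using G_lip[OF \<epsilon>(1)] unfolding \<phi>'_def by blast
  define r where "r = min r1 (min 1 (\<delta> / (2 * \<kappa>' + 1)))"
  have r: "0 < r" "r \<le> r1" "r \<le> 1" "2 * \<kappa>' * r \<le> \<delta>"
  proof -
    show "0 < r" "r \<le> r1" "r \<le> 1" using r1 \<delta> \<kappa>(1) by (auto simp: r_def)
    have "2 * \<kappa>' * r \<le> (2 * \<kappa>' + 1) * (\<delta> / (2 * \<kappa>' + 1))"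
      using \<kappa>(1) \<open>0 < r\<close> by (intro mult_mono) (auto simp: r_def)
    then show "2 * \<kappa>' * r \<le> \<delta>" using \<kappa>(1) by simp
  qed
  \<comment> \<open>The bound for G at the centre: the first entry keeps |G| \<le> 2 \<epsilon> on
    the ball, the second keeps the centre from moving by more than (1 - q) r.\<close>
  define s where "s = min (\<epsilon> * r) ((1 - q) * r / ((1 / \<kappa> + 1) * bm + 1))"
  have D0: "0 < (1 / \<kappa> + 1) * bm + 1" using \<kappa>0 bm0 by (simp add: add_nonneg_pos)
  have s: "0 < s" "s \<le> \<epsilon> * r" "(1 / \<kappa> + 1) * bm * s \<le> (1 - q) * r"
  proof -
    show s0: "0 < s" and "s \<le> \<epsilon> * r" using \<epsilon> r q D0 by (auto simp: s_def)
    have "(1 / \<kappa> + 1) * bm * s \<le> ((1 / \<kappa> + 1) * bm + 1) * ((1 - q) * r / ((1 / \<kappa> + 1) * bm + 1))"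
      using \<kappa>0 bm0 s0 by (intro mult_mono) (auto simp: s_def)
    then show "(1 / \<kappa> + 1) * bm * s \<le> (1 - q) * r" using D0 by simp
  qed
  have "\<exists>d>0. \<forall>\<alpha>\<in>{0..a0}. dist \<alpha> 0 < d \<longrightarrow> dist (G \<alpha> \<phi>') (G 0 \<phi>') < s"
    using bspec[OF G_cont(2)[of \<phi>', unfolded continuous_on_iff], of 0] s(1) G_cont(1) by auto
  then obtain a2 where a2: "0 < a2" "\<And>\<alpha>. \<alpha> \<in> {0..a0} \<Longrightarrow> \<bar>\<alpha>\<bar> < a2 \<Longrightarrow> norm (G \<alpha> \<phi>') < s"
    by (auto simp: G_0)
  define a where "a = min a0 (min a1 (a2 / 2))"
  have a: "0 < a" "a \<le> a0" "a \<le> a1" "a < a2" using G_cont r1 a2 by (auto simp: a_def)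
  have Gs: "norm (G \<alpha> \<phi>') \<le> s" if "\<alpha> \<in> {0..a}" for \<alpha>
    using a2(2)[of \<alpha>] that a by auto
  have norm_le: "norm x \<le> norm (fst x) + norm (snd x)" for x :: "complex \<times> ('h \<times> 'h)"
    by (metis norm_Pair_le prod.collapse)
  have mem: "cmod (fst x - \<mu>) \<le> r" "norm (snd x) \<le> r" if "x \<in> cball x0 r" for x
    using that norm_fst_le[of "x - x0"] norm_snd_le[of "x - x0"]
    by (auto simp: x0_def dist_norm norm_minus_commute)
  have Bb: "cmod (B c) \<le> bm" if "cmod (c - \<mu>) \<le> r" for c
  proof -
    have "cmod (B c) \<le> cmod (B \<mu>) + cmod (B c - B \<mu>)" by (metis norm_triangle_sub)
    also have "cmod (B c - B \<mu>) \<le> L * 1"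
      using B(2)[of c \<mu>] mult_left_mono[OF order_trans[OF that r(3)] B(1)] by linarith
    finally show ?thesis by (simp add: bm_def)
  qed
  have Gl: "norm (G \<alpha> (\<phi>' + v) - G \<alpha> (\<phi>' + w)) \<le> \<epsilon> * norm (v - w)"
    if "\<alpha> \<in> {0..a}" "norm v \<le> r" "norm w \<le> r" for \<alpha> v w
    using r1(3)[of \<alpha> "\<phi>' + v" "\<phi>' + w"] that a r by simp
  have Gn: "norm (G \<alpha> (\<phi>' + v)) \<le> 2 * \<epsilon>" if "\<alpha> \<in> {0..a}" "norm v \<le> r" for \<alpha> v
  proof -
    have "norm (G \<alpha> (\<phi>' + v) - G \<alpha> (\<phi>' + 0)) \<le> \<epsilon> * norm (v - 0)" using that r by (intro Gl) auto
    also have "\<dots> \<le> \<epsilon> * r" using that \<epsilon> by (intro mult_left_mono) auto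
    finally have "norm (G \<alpha> (\<phi>' + v) - G \<alpha> \<phi>') \<le> \<epsilon> * r" by simp
    moreover have "\<epsilon> * r \<le> \<epsilon> * 1" using \<epsilon> r by (intro mult_left_mono) auto
    ultimately show ?thesis
      using Gs[OF that(1)] s(2) norm_triangle_sub[of "G \<alpha> (\<phi>' + v)" "G \<alpha> \<phi>'"] by linarith
  qed
  have lip: "dist (\<Phi> \<alpha> x) (\<Phi> \<alpha> y) \<le> q * dist x y" if \<alpha>: "\<alpha> \<in> {0..a}" and x: "x \<in> cball x0 r" and y: "y \<in> cball x0 r" for \<alpha> x y
  proof -
    define d where "d = norm (x - y)"
    have d: "cmod (fst x - fst y) \<le> d" "norm (snd x - snd y) \<le> d" "0 \<le> d"
      using norm_fst_le[of "x - y"] norm_snd_le[of "x - y"] by (auto simp: d_def)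
    let ?gx = "G \<alpha> (\<phi>' + snd x)" and ?gy = "G \<alpha> (\<phi>' + snd y)"
    have g: "norm (?gx - ?gy) \<le> \<epsilon> * d"
      using Gl[OF \<alpha> mem(2)[OF x] mem(2)[OF y]] mult_left_mono[OF d(2), of \<epsilon>] \<epsilon> by linarith
    have gx: "norm ?gx \<le> 2 * \<epsilon>" by (rule Gn[OF \<alpha> mem(2)[OF x]])
    have Bd: "cmod (B (fst x) - B (fst y)) \<le> L * d"
      using B(2)[of "fst x" "fst y"] mult_left_mono[OF d(1) B(1)] by linarith
    have By: "cmod (B (fst y)) \<le> bm" by (rule Bb[OF mem(1)[OF y]])
    have prod: "cmod (B (fst x) - B (fst y)) * u + cmod (B (fst y)) * v \<le> (2 * L + bm) * \<epsilon> * d"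
      if "0 \<le> u" "u \<le> 2 * \<epsilon>" "0 \<le> v" "v \<le> \<epsilon> * d" for u v
    proof -
      have "cmod (B (fst x) - B (fst y)) * u \<le> L * d * (2 * \<epsilon>)"
        using Bd that B(1) d by (intro mult_mono) auto
      moreover have "cmod (B (fst y)) * v \<le> bm * (\<epsilon> * d)" using By that bm0 by (intro mult_mono) auto
      ultimately show ?thesis by (simp add: algebra_simps)
    qed
    have 1: "cmod (fst (\<Phi> \<alpha> x) - fst (\<Phi> \<alpha> y)) \<le> 1 / \<kappa> * ((2 * L + bm) * \<epsilon> * d)"
    proof -
      have "fst (\<Phi> \<alpha> x) - fst (\<Phi> \<alpha> y)
          = - ((B (fst x) - B (fst y)) * coef \<phi> ?gx + B (fst y) * coef \<phi> (?gx - ?gy)) / complex_of_real \<kappa>"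
        using \<kappa>0 by (simp add: \<Phi>_def coef_diff field_simps)
      then have "cmod (fst (\<Phi> \<alpha> x) - fst (\<Phi> \<alpha> y))
          = 1 / \<kappa> * cmod ((B (fst x) - B (fst y)) * coef \<phi> ?gx + B (fst y) * coef \<phi> (?gx - ?gy))"
        using \<kappa>0 by (simp add: norm_divide norm_minus_cancel del: minus_add_distrib)
      also have "\<dots> \<le> 1 / \<kappa> * (cmod (B (fst x) - B (fst y)) * cmod (coef \<phi> ?gx) + cmod (B (fst y)) * cmod (coef \<phi> (?gx - ?gy)))"
        using \<kappa>0 norm_triangle_ineq[of "(B (fst x) - B (fst y)) * coef \<phi> ?gx" "B (fst y) * coef \<phi> (?gx - ?gy)"]
        by (intro mult_left_mono) (auto simp: norm_mult)
      also have "\<dots> \<le> 1 / \<kappa> * ((2 * L + bm) * \<epsilon> * d)"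
        using \<kappa>0 cmod_coef_le[OF \<phi>(1), of ?gx] cmod_coef_le[OF \<phi>(1), of "?gx - ?gy"] g gx
        by (intro mult_left_mono prod) auto
      finally show ?thesis .
    qed
    have 2: "norm (snd (\<Phi> \<alpha> x) - snd (\<Phi> \<alpha> y)) \<le> (\<kappa>' / \<kappa> + \<delta>) * d + (2 * L + bm) * \<epsilon> * d"
    proof -
      have eq: "snd (\<Phi> \<alpha> x) - snd (\<Phi> \<alpha> y) = (cmul (1 + fst x) (T' (P (snd x - snd y))) + cmul (fst x - fst y) (T' (P (snd y))))
         + (cmul (B (fst x) - B (fst y)) (P ?gx) + cmul (B (fst y)) (P (?gx - ?gy)))"
        by (simp add: \<Phi>_def P_diff T'_diff cmul_diff_right cmul_diff_left cmul_add_left)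
      have n1: "cmod (1 + fst x) * norm (T' (P (snd x - snd y))) \<le> (1 / \<kappa> + r) * (\<kappa>' * d)"
      proof (rule mult_mono)
        have "cmod (1 + fst x) \<le> cmod (1 + \<mu>) + cmod (fst x - \<mu>)"
          using norm_triangle_ineq[of "1 + \<mu>" "fst x - \<mu>"] by simp
        then show "cmod (1 + fst x) \<le> 1 / \<kappa> + r" using mem(1)[OF x] \<kappa>0 unfolding l1 by (simp add: norm_divide)
        show "norm (T' (P (snd x - snd y))) \<le> \<kappa>' * d"
          using normTP[of "snd x - snd y"] mult_left_mono[OF d(2) \<kappa>(1)] by linarith
      qed (use \<kappa>0 r in auto)
      have n2: "cmod (fst x - fst y) * norm (T' (P (snd y))) \<le> d * (\<kappa>' * r)"
        using d normTP[of "snd y"] mult_left_mono[OF mem(2)[OF y] \<kappa>(1)] by (intro mult_mono) auto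
      have n3: "cmod (B (fst x) - B (fst y)) * norm (P ?gx) + cmod (B (fst y)) * norm (P (?gx - ?gy)) \<le> (2 * L + bm) * \<epsilon> * d"
        using normP[of ?gx] normP[of "?gx - ?gy"] g gx by (intro prod) auto
      have "(1 / \<kappa> + r) * (\<kappa>' * d) + d * (\<kappa>' * r) = (\<kappa>' / \<kappa> + 2 * \<kappa>' * r) * d" by (simp add: algebra_simps)
      also have "\<dots> \<le> (\<kappa>' / \<kappa> + \<delta>) * d" using r(4) d(3) by (intro mult_right_mono) auto
      finally have n12: "(1 / \<kappa> + r) * (\<kappa>' * d) + d * (\<kappa>' * r) \<le> (\<kappa>' / \<kappa> + \<delta>) * d" .
      have "norm (snd (\<Phi> \<alpha> x) - snd (\<Phi> \<alpha> y)) \<le>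
        (cmod (1 + fst x) * norm (T' (P (snd x - snd y))) + cmod (fst x - fst y) * norm (T' (P (snd y))))
        + (cmod (B (fst x) - B (fst y)) * norm (P ?gx) + cmod (B (fst y)) * norm (P (?gx - ?gy)))"
        unfolding eq norm_cmul[symmetric]
        by (rule order_trans[OF norm_triangle_ineq add_mono[OF norm_triangle_ineq norm_triangle_ineq]])
      then show ?thesis using n1 n2 n3 n12 by linarith
    qed
    have "dist (\<Phi> \<alpha> x) (\<Phi> \<alpha> y) \<le> cmod (fst (\<Phi> \<alpha> x) - fst (\<Phi> \<alpha> y)) + norm (snd (\<Phi> \<alpha> x) - snd (\<Phi> \<alpha> y))"
      using norm_le[of "\<Phi> \<alpha> x - \<Phi> \<alpha> y"] by (simp add: dist_norm)
    also have "\<dots> \<le> 1 / \<kappa> * ((2 * L + bm) * \<epsilon> * d) + ((\<kappa>' / \<kappa> + \<delta>) * d + (2 * L + bm) * \<epsilon> * d)"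
      using 1 2 by linarith
    also have "\<dots> = (\<kappa>' / \<kappa> + \<delta> + (1 / \<kappa> + 1) * (2 * L + bm) * \<epsilon>) * d" by (simp add: algebra_simps)
    also have "\<dots> \<le> q * d" unfolding q_def using \<epsilon>(2) d(3) by (intro mult_right_mono) auto
    finally show ?thesis by (simp add: d_def dist_norm)
  qed
  have self: "dist (\<Phi> \<alpha> x0) x0 \<le> (1 - q) * r" if \<alpha>: "\<alpha> \<in> {0..a}" for \<alpha>
  proof -
    let ?g = "G \<alpha> \<phi>'"
    have 1: "fst (\<Phi> \<alpha> x0) - \<mu> = - (B \<mu> * coef \<phi> ?g) / complex_of_real \<kappa>"
      using \<kappa>0 by (simp add: \<Phi>_def x0_def \<mu>_def field_simps)
    have 2: "snd (\<Phi> \<alpha> x0) = cmul (B \<mu>) (P ?g)" using P_0 by (simp add: \<Phi>_def x0_def T'_def T_0 zero_prod_def[symmetric])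
    have Bl: "cmod (B \<mu>) \<le> bm" using B(1) by (simp add: bm_def)
    have "cmod (fst (\<Phi> \<alpha> x0) - \<mu>) = 1 / \<kappa> * (cmod (B \<mu>) * cmod (coef \<phi> ?g))"
      unfolding 1 using \<kappa>0 by (simp add: norm_divide norm_mult)
    also have "\<dots> \<le> 1 / \<kappa> * (bm * s)"
      using \<kappa>0 Bl cmod_coef_le[OF \<phi>(1), of ?g] Gs[OF \<alpha>] bm0 by (intro mult_left_mono mult_mono) auto
    finally have 3: "cmod (fst (\<Phi> \<alpha> x0) - \<mu>) \<le> 1 / \<kappa> * (bm * s)" .
    have 4: "norm (snd (\<Phi> \<alpha> x0)) \<le> bm * s"
      unfolding 2 norm_cmul using Bl normP[of ?g] Gs[OF \<alpha>] bm0 by (intro mult_mono) auto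
    have "dist (\<Phi> \<alpha> x0) x0 \<le> cmod (fst (\<Phi> \<alpha> x0) - \<mu>) + norm (snd (\<Phi> \<alpha> x0))"
      using norm_le[of "\<Phi> \<alpha> x0 - x0"] by (simp add: dist_norm x0_def)
    also have "\<dots> \<le> (1 / \<kappa> + 1) * bm * s" using 3 4 by (simp add: algebra_simps)
    also have "\<dots> \<le> (1 - q) * r" by (rule s)
    finally show ?thesis .
  qed
  have cont: "continuous_on {0..a} (\<lambda>\<alpha>. \<Phi> \<alpha> x)" for x
  proof -
    have [continuous_intros]: "continuous_on {0..a} (\<lambda>\<alpha>. G \<alpha> v)" for v
      by (rule continuous_on_subset[OF G_cont(2)]) (use a(2) in auto)
    have "continuous_on UNIV (coef \<phi>)"
    proof -
      have "coef \<phi> = (\<lambda>x. complex_of_real (fst x \<bullet> \<phi>) + \<i> * complex_of_real (snd x \<bullet> \<phi>))"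
        by (auto simp: coef_def complex_eq_iff)
      then show ?thesis by (auto intro!: continuous_intros)
    qed
    from continuous_on_compose2[OF this] have [continuous_intros]: "continuous_on {0..a} (\<lambda>\<alpha>. coef \<phi> (G \<alpha> v))" for v
      by (auto intro!: continuous_intros)
    show ?thesis unfolding \<Phi>_def P_def using \<kappa>0
      by (intro continuous_intros continuous_on_cmul) auto
  qed
  obtain x where x: "continuous_on {0..a} x" "\<And>\<alpha>. \<alpha> \<in> {0..a} \<Longrightarrow> x \<alpha> \<in> cball x0 r \<and> \<Phi> \<alpha> (x \<alpha>) = x \<alpha>"
    "\<And>\<alpha> y. \<alpha> \<in> {0..a} \<Longrightarrow> y \<in> cball x0 r \<Longrightarrow> \<Phi> \<alpha> y = y \<Longrightarrow> y = x \<alpha>"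
    using uniform_contraction[OF q less_imp_le[OF r(1)] lip self cont] by blast
  define c where "c \<alpha> = fst (x \<alpha>)" for \<alpha>
  define f where "f \<alpha> = \<phi>' + snd (x \<alpha>)" for \<alpha>
  have "continuous_on {0..a} c" "continuous_on {0..a} f"
    unfolding c_def f_def by (intro continuous_intros x)+
  moreover have "c 0 = complex_of_real (1 / \<kappa> - 1)"
  proof -
    \<comment> \<open>At \<alpha> = 0 the centre itself is a fixed point, so uniqueness places the
      start of the branch there.\<close>
    have "\<Phi> 0 x0 = x0"
      using P_0 \<kappa>0 by (simp add: \<Phi>_def x0_def G_0 coef_def T'_def T_0 zero_prod_def[symmetric] complex_eq_iff \<mu>_def)
    then have "x0 = x 0" using a(1) r(1) by (intro x(3)) auto
    then show ?thesis by (simp add: c_def x0_def \<mu>_def flip: \<open>x0 = x 0\<close>)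
  qed
  moreover have "coef \<phi> (f \<alpha>) = 1 \<and> f \<alpha> = cmul (1 + c \<alpha>) (T (fst (f \<alpha>)), T (snd (f \<alpha>))) + cmul (B (c \<alpha>)) (G \<alpha> (f \<alpha>))"
    if \<alpha>: "\<alpha> \<in> {0..a}" for \<alpha>
  proof -
    let ?\<psi> = "snd (x \<alpha>)" and ?g = "G \<alpha> (f \<alpha>)"
    have "\<Phi> \<alpha> (x \<alpha>) = x \<alpha>" using x(2)[OF \<alpha>] by blast
    then have e1: "c \<alpha> = (1 - B (c \<alpha>) * coef \<phi> ?g) / complex_of_real \<kappa> - 1"
      and e2: "?\<psi> = cmul (1 + c \<alpha>) (T' (P ?\<psi>)) + cmul (B (c \<alpha>)) (P ?g)"
      by (auto simp: \<Phi>_def c_def f_def prod_eq_iff)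
    \<comment> \<open>Orthogonality is not imposed on the unknown \<psi>. It follows from the fixed
      point equation, since both summands have coefficient 0 along \<phi>.\<close>
    have "coef \<phi> ?\<psi> = coef \<phi> (cmul (1 + c \<alpha>) (T' (P ?\<psi>)) + cmul (B (c \<alpha>)) (P ?g))" using e2 by simp
    also have "\<dots> = 0" by (simp add: coef_add coef_cmul coefT coefP)
    finally have c0: "coef \<phi> ?\<psi> = 0" .
    then have P\<psi>: "P ?\<psi> = ?\<psi>" by (simp add: P_def)
    have k: "(1 + c \<alpha>) * complex_of_real \<kappa> + B (c \<alpha>) * coef \<phi> ?g = 1"
      using e1 \<kappa>0 by (simp add: field_simps)
    have "cmul (1 + c \<alpha>) (T' (f \<alpha>)) + cmul (B (c \<alpha>)) ?g
       = cmul (1 + c \<alpha>) (T' ?\<psi>) + cmul (B (c \<alpha>)) (P ?g)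
         + cmul ((1 + c \<alpha>) * complex_of_real \<kappa> + B (c \<alpha>) * coef \<phi> ?g) \<phi>'"
      by (simp add: f_def T'_add T'_\<phi> cmul_add_right cmul_add_left cmul_cmul P_def cmul_diff_right)
    also have "\<dots> = ?\<psi> + \<phi>'" unfolding k using e2 P\<psi> by simp
    finally have "cmul (1 + c \<alpha>) (T' (f \<alpha>)) + cmul (B (c \<alpha>)) ?g = f \<alpha>" by (simp add: f_def)
    then show ?thesis using c0 c\<phi> by (simp add: T'_def f_def coef_add)
  qed
  ultimately show ?thesis using that[OF a(1)] by blast
qed

subsection \<open>The nonlinearity\<close>

definition gpow :: "real \<Rightarrow> complex \<Rightarrow> complex" where
  "gpow \<alpha> z = complex_of_real (cmod z powr \<alpha> - 1) * z"

lemma gpow_0 [simp]: "gpow 0 z = 0"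
  by (simp add: gpow_def)

lemma gpow_zero [simp]: "gpow \<alpha> 0 = 0"
  by (simp add: gpow_def)

text \<open>Two bounds are needed: a crude one valid everywhere, and one on the annulus between
  \<delta> and M whose factor tends to 0 with \<alpha>. Both start from gpow z - gpow w =
  (|w|^\<alpha> - 1)(z - w) + (|z|^\<alpha> - |w|^\<alpha>) z, where the weight z is the larger
  value.\<close>

lemma gpow_diff_ordered:
  assumes le: "cmod w \<le> cmod z" and \<alpha>: "0 \<le> \<alpha>" "\<alpha> \<le> 1"
  shows "cmod (gpow \<alpha> z - gpow \<alpha> w) \<le> 3 * (max 1 (cmod z)) powr \<alpha> * cmod (z - w)" (is ?A)
    and "0 < \<delta> \<Longrightarrow> \<delta> \<le> 1 \<Longrightarrow> 1 \<le> M \<Longrightarrow> \<delta> \<le> cmod w \<Longrightarrow> cmod z \<le> M \<Longrightarrow>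
      cmod (gpow \<alpha> z - gpow \<alpha> w) \<le> (M powr \<alpha> - \<delta> powr \<alpha> + \<alpha> * (M / \<delta>) * M powr \<alpha>) * cmod (z - w)" (is "_ \<Longrightarrow> _ \<Longrightarrow> _ \<Longrightarrow> _ \<Longrightarrow> _ \<Longrightarrow> ?B")
proof -
  define x where "x = cmod z"
  define y where "y = cmod w"
  have xy: "0 \<le> y" "y \<le> x" using le by (auto simp: x_def y_def)
  have d: "x - y \<le> cmod (z - w)" unfolding x_def y_def by (rule norm_triangle_ineq2)
  have mono: "y powr \<alpha> \<le> x powr \<alpha>" using xy \<alpha> by (intro powr_mono2) auto
  have "gpow \<alpha> z - gpow \<alpha> w = complex_of_real (y powr \<alpha> - 1) * (z - w) + complex_of_real (x powr \<alpha> - y powr \<alpha>) * z"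
    by (simp add: gpow_def x_def y_def algebra_simps)
  then have "cmod (gpow \<alpha> z - gpow \<alpha> w) \<le> cmod (complex_of_real (y powr \<alpha> - 1) * (z - w)) + cmod (complex_of_real (x powr \<alpha> - y powr \<alpha>) * z)"
    by (simp only: norm_triangle_ineq)
  also have "\<dots> = \<bar>y powr \<alpha> - 1\<bar> * cmod (z - w) + (x powr \<alpha> - y powr \<alpha>) * x"
    using mono unfolding norm_mult norm_of_real by (simp add: x_def)
  finally have split: "cmod (gpow \<alpha> z - gpow \<alpha> w) \<le> \<bar>y powr \<alpha> - 1\<bar> * cmod (z - w) + (x powr \<alpha> - y powr \<alpha>) * x" .
  show ?A
  proof -
    let ?m = "(max 1 x) powr \<alpha>"
    have m1: "1 \<le> ?m" using \<alpha> by (intro ge_one_powr_ge_zero) auto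
    have xm: "x powr \<alpha> \<le> ?m" using xy \<alpha> by (intro powr_mono2) auto
    have 1: "\<bar>y powr \<alpha> - 1\<bar> \<le> 2 * ?m" using mono xm m1 powr_ge_zero[of y \<alpha>] by linarith
    have "(x powr \<alpha> - y powr \<alpha>) * x \<le> x powr \<alpha> * (x - y)"
    proof (cases "y = 0")
      case False
      then have y: "0 < y" "0 < x" using xy by auto
      \<comment> \<open>For a ratio y/x in (0, 1] and an exponent in [0, 1], the power is at least
        the ratio.\<close>
      have "x powr \<alpha> * y \<le> y powr \<alpha> * x"
      proof -
        have "(y / x) powr 1 \<le> (y / x) powr \<alpha>" using y xy \<alpha> by (intro powr_mono') auto
        then have "y / x \<le> y powr \<alpha> / x powr \<alpha>" using y by (simp add: powr_divide)
        then show ?thesis using y by (simp add: field_simps)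
      qed
      then show ?thesis by (simp add: algebra_simps)
    qed (use \<alpha> xy in simp)
    also have "\<dots> \<le> ?m * cmod (z - w)" using xm d xy by (intro mult_mono) auto
    finally have 2: "(x powr \<alpha> - y powr \<alpha>) * x \<le> ?m * cmod (z - w)" .
    have "\<bar>y powr \<alpha> - 1\<bar> * cmod (z - w) \<le> 2 * ?m * cmod (z - w)" using 1 by (intro mult_right_mono) auto
    then show ?thesis using split 2 by (simp add: x_def algebra_simps)
  qed
  show ?B if \<delta>: "0 < \<delta>" "\<delta> \<le> 1" and M: "1 \<le> M" and b: "\<delta> \<le> cmod w" "cmod z \<le> M"
  proof -
    have y: "0 < y" "0 < x" "\<delta> \<le> y" "x \<le> M" using b \<delta> xy by (auto simp: x_def y_def)
    have "\<delta> powr \<alpha> \<le> y powr \<alpha>" "y powr \<alpha> \<le> M powr \<alpha>"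
      using \<delta> y xy \<alpha> by (auto intro!: powr_mono2)
    moreover have "\<delta> powr \<alpha> \<le> 1" "1 \<le> M powr \<alpha>"
      using \<delta> M \<alpha> by (auto intro!: powr_le1 ge_one_powr_ge_zero)
    ultimately have 1: "\<bar>y powr \<alpha> - 1\<bar> \<le> M powr \<alpha> - \<delta> powr \<alpha>" by linarith
    \<comment> \<open>With second factor 1, Young's inequality becomes Bernoulli's: (x/y)^\<alpha>
      \<le> 1 + \<alpha> (x/y - 1).\<close>
    have "(x / y) powr \<alpha> * 1 powr (1 - \<alpha>) \<le> \<alpha> * (x / y) + (1 - \<alpha>) * 1"
      using y \<alpha> by (intro Youngs_inequality_0) auto
    then have "x powr \<alpha> / y powr \<alpha> - 1 \<le> \<alpha> * ((x - y) / y)"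
      using y by (simp add: powr_divide field_simps)
    then have "y powr \<alpha> * (x powr \<alpha> / y powr \<alpha> - 1) \<le> y powr \<alpha> * (\<alpha> * ((x - y) / y))"
      by (intro mult_left_mono) auto
    moreover have "y powr \<alpha> * (x powr \<alpha> / y powr \<alpha> - 1) = x powr \<alpha> - y powr \<alpha>"
      using y by (simp add: field_simps)
    ultimately have "x powr \<alpha> - y powr \<alpha> \<le> \<alpha> * y powr \<alpha> * (x - y) / y" by (simp add: mult_ac)
    then have "(x powr \<alpha> - y powr \<alpha>) * x \<le> \<alpha> * y powr \<alpha> * (x - y) / y * x"
      using y by (intro mult_right_mono) auto
    also have "\<dots> = \<alpha> * (x / y) * y powr \<alpha> * (x - y)" by simp
    also have "\<dots> \<le> \<alpha> * (M / \<delta>) * M powr \<alpha> * cmod (z - w)"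
      using y \<delta> xy \<alpha> d \<open>y powr \<alpha> \<le> M powr \<alpha>\<close> by (intro mult_mono frac_le) auto
    finally have 2: "(x powr \<alpha> - y powr \<alpha>) * x \<le> \<alpha> * (M / \<delta>) * M powr \<alpha> * cmod (z - w)" .
    have "\<bar>y powr \<alpha> - 1\<bar> * cmod (z - w) \<le> (M powr \<alpha> - \<delta> powr \<alpha>) * cmod (z - w)" using 1 by (intro mult_right_mono) auto
    then show ?thesis using split 2 by (simp add: algebra_simps)
  qed
qed

lemma gpow_diff:
  assumes \<alpha>: "0 \<le> \<alpha>" "\<alpha> \<le> 1"
  shows "cmod (gpow \<alpha> z - gpow \<alpha> w) \<le> 3 * (max 1 (max (cmod z) (cmod w))) powr \<alpha> * cmod (z - w)"
    and "0 < \<delta> \<Longrightarrow> \<delta> \<le> 1 \<Longrightarrow> 1 \<le> M \<Longrightarrow> \<delta> \<le> cmod w \<Longrightarrow> \<delta> \<le> cmod z \<Longrightarrow> cmod w \<le> M \<Longrightarrow> cmod z \<le> M \<Longrightarrow>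
      cmod (gpow \<alpha> z - gpow \<alpha> w) \<le> (M powr \<alpha> - \<delta> powr \<alpha> + \<alpha> * (M / \<delta>) * M powr \<alpha>) * cmod (z - w)"
proof -
  show "cmod (gpow \<alpha> z - gpow \<alpha> w) \<le> 3 * (max 1 (max (cmod z) (cmod w))) powr \<alpha> * cmod (z - w)"
    using gpow_diff_ordered(1)[of w z \<alpha>] gpow_diff_ordered(1)[of z w \<alpha>] \<alpha>
    by (cases "cmod w \<le> cmod z") (auto simp: norm_minus_commute max_def)
  show "0 < \<delta> \<Longrightarrow> \<delta> \<le> 1 \<Longrightarrow> 1 \<le> M \<Longrightarrow> \<delta> \<le> cmod w \<Longrightarrow> \<delta> \<le> cmod z \<Longrightarrow> cmod w \<le> M \<Longrightarrow> cmod z \<le> M \<Longrightarrow>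
      cmod (gpow \<alpha> z - gpow \<alpha> w) \<le> (M powr \<alpha> - \<delta> powr \<alpha> + \<alpha> * (M / \<delta>) * M powr \<alpha>) * cmod (z - w)"
    using gpow_diff_ordered(2)[of w z \<alpha> \<delta> M] gpow_diff_ordered(2)[of z w \<alpha> \<delta> M] \<alpha>
    by (cases "cmod w \<le> cmod z") (auto simp: norm_minus_commute)
qed

text \<open>Complex L^2 functions become pairs of real classes: the real resolvent acts on each
  component, and \<open>cmul\<close> is multiplication by a complex number.\<close>

definition l2_pair :: "('a::euclidean_space \<Rightarrow> complex) \<Rightarrow> ('a, real) l2 \<times> ('a, real) l2" where
  "l2_pair h = (abs_l2 (\<lambda>x. Re (h x)), abs_l2 (\<lambda>x. Im (h x)))"

lemma sqint_Re: "sqint h \<Longrightarrow> sqint (\<lambda>x. Re (h x))" and sqint_Im: "sqint h \<Longrightarrow> sqint (\<lambda>x. Im (h x))"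
  using abs_Re_le_cmod abs_Im_le_cmod
  by (auto intro!: sqint_bound[of h _ 1] dest: sqint_measurable)

lemma l2_pair_diff:
  "sqint h \<Longrightarrow> sqint k \<Longrightarrow> l2_pair h - l2_pair k = l2_pair (\<lambda>x. h x - k x)"
  by (simp add: l2_pair_def abs_l2_diff sqint_Re sqint_Im)

lemma norm_l2_pair: assumes "sqint h" shows "(norm (l2_pair h))\<^sup>2 = (\<integral>x. (cmod (h x))\<^sup>2 \<partial>lborel)"
proof -
  have "(norm (l2_pair h))\<^sup>2 = (\<integral>x. (Re (h x))\<^sup>2 \<partial>lborel) + (\<integral>x. (Im (h x))\<^sup>2 \<partial>lborel)"
    using norm_abs_l2[OF sqint_Re[OF assms]] norm_abs_l2[OF sqint_Im[OF assms]]
    by (simp add: l2_pair_def norm_Pair)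
  also have "\<dots> = (\<integral>x. (Re (h x))\<^sup>2 + (Im (h x))\<^sup>2 \<partial>lborel)"
    using sqint_integrable[OF sqint_Re[OF assms]] sqint_integrable[OF sqint_Im[OF assms]]
    by (intro Bochner_Integration.integral_add[symmetric]) auto
  finally show ?thesis by (simp add: cmod_power2)
qed

definition l2_fun :: "('a::euclidean_space, real) l2 \<times> ('a, real) l2 \<Rightarrow> 'a \<Rightarrow> complex" where
  "l2_fun u x = Complex (rep_l2 (fst u) x) (rep_l2 (snd u) x)"

lemma l2_fun_measurable [measurable]: "l2_fun u \<in> borel_measurable borel"
proof -
  have "l2_fun u = (\<lambda>x. complex_of_real (rep_l2 (fst u) x) + \<i> * complex_of_real (rep_l2 (snd u) x))"
    by (auto simp: l2_fun_def complex_eq_iff)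
  then show ?thesis by simp
qed

lemma sqint_l2_fun [simp]: "sqint (l2_fun u)"
proof -
  have "integrable lborel (\<lambda>x. (norm (rep_l2 (fst u) x))\<^sup>2 + (norm (rep_l2 (snd u) x))\<^sup>2)"
    by (intro Bochner_Integration.integrable_add sqint_integrable sqint_rep)
  then show ?thesis unfolding sqint_def by (simp add: l2_fun_def cmod_power2)
qed

lemma l2_pair_l2_fun [simp]: "l2_pair (l2_fun u) = u"
  by (simp add: l2_pair_def l2_fun_def)

lemma l2_fun_l2_pair: "sqint h \<Longrightarrow> AE x in lborel. l2_fun (l2_pair h) x = h x"
  using rep_abs_l2[OF sqint_Re, of h] rep_abs_l2[OF sqint_Im, of h]
  by (auto simp: l2_fun_def l2_pair_def complex_eq_iff elim!: eventually_elim2)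

lemma l2_fun_add: "AE x in lborel. l2_fun (u + v) x = l2_fun u x + l2_fun v x"
  using rep_l2_add[of "fst u" "fst v"] rep_l2_add[of "snd u" "snd v"]
  by eventually_elim (simp add: l2_fun_def complex_eq_iff)

lemma l2_fun_diff: "AE x in lborel. l2_fun (u - v) x = l2_fun u x - l2_fun v x"
  using rep_l2_diff[of "fst u" "fst v"] rep_l2_diff[of "snd u" "snd v"]
  by eventually_elim (simp add: l2_fun_def complex_eq_iff)

lemma l2_fun_scaleR: "AE x in lborel. l2_fun (s *\<^sub>R u) x = s *\<^sub>R l2_fun u x"
  using rep_l2_scaleR[of s "fst u"] rep_l2_scaleR[of s "snd u"]
  by eventually_elim (simp add: l2_fun_def complex_eq_iff)

lemma l2_fun_cmul: "AE x in lborel. l2_fun (cmul c u) x = c * l2_fun u x"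
  using rep_l2_scaleR[of "Re c" "fst u"] rep_l2_scaleR[of "Re c" "snd u"]
    rep_l2_scaleR[of "Im c" "fst u"] rep_l2_scaleR[of "Im c" "snd u"]
    rep_l2_diff[of "Re c *\<^sub>R fst u" "Im c *\<^sub>R snd u"] rep_l2_add[of "Re c *\<^sub>R snd u" "Im c *\<^sub>R fst u"]
  by eventually_elim (simp add: l2_fun_def cmul_def complex_eq_iff)

lemma norm_l2_fun: "(norm u)\<^sup>2 = (\<integral>x. (cmod (l2_fun u x))\<^sup>2 \<partial>lborel)"
  using norm_l2_pair[OF sqint_l2_fun, of u] by simp

lemma nn_l2_fun: "(\<integral>\<^sup>+x. ennreal ((cmod (l2_fun u x))\<^sup>2) \<partial>lborel) = ennreal ((norm u)\<^sup>2)"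
  unfolding norm_l2_fun by (rule nn_integral_eq_integral) (use sqint_integrable[OF sqint_l2_fun[of u]] in auto)

definition Kc :: "'a::euclidean_space set \<Rightarrow> ('a, real) l2 \<times> ('a, real) l2 \<Rightarrow> ('a, real) l2 \<times> ('a, real) l2" where
  "Kc \<Omega> f = (K \<Omega> (fst f), K \<Omega> (snd f))"

lemma Kc_diff: "Kc \<Omega> (f - g) = Kc \<Omega> f - Kc \<Omega> g" and Kc_scaleR: "Kc \<Omega> (s *\<^sub>R f) = s *\<^sub>R Kc \<Omega> f"
  by (simp_all add: Kc_def K_diff K_scaleR)

lemma norm_Kc_le: "norm (Kc \<Omega> f) \<le> norm f"
  unfolding Kc_def norm_prod_def using norm_K_le by (intro real_sqrt_le_mono add_mono power_mono) auto

lemma Kc_support: "open \<Omega> \<Longrightarrow> AE x in lborel. x \<notin> \<Omega> \<longrightarrow> l2_fun (Kc \<Omega> f) x = 0"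
  using K_support[of \<Omega> "fst f"] K_support[of \<Omega> "snd f"]
  by (auto simp: l2_fun_def Kc_def complex_eq_iff elim!: eventually_elim2)

lemma Kc_Lp_bound:
  fixes \<Omega> :: "'a::euclidean_space set"
  assumes p: "p = 2 + 2 / real DIM('a)"
  obtains C where "0 \<le> C" "\<And>f. norm f \<le> 1 \<Longrightarrow> (\<integral>\<^sup>+x. ennreal (cmod (l2_fun (Kc \<Omega> f) x) powr p) \<partial>lborel) \<le> ennreal C"
proof -
  obtain C where C: "0 \<le> C" "\<And>u :: ('a, real) l2. norm u \<le> 1 \<Longrightarrow> (\<And>h. norm (tau h u - u) \<le> norm h) \<Longrightarrow>
    (\<integral>\<^sup>+x. ennreal (\<bar>rep_l2 u x\<bar> powr p) \<partial>lborel) \<le> ennreal C"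
    using Lp_bound[OF p] by blast
  have p0: "0 \<le> p" using p by simp
  have KC: "(\<integral>\<^sup>+x. ennreal (\<bar>rep_l2 (K \<Omega> u) x\<bar> powr p) \<partial>lborel) \<le> ennreal C" if "norm u \<le> 1" for u
  proof (rule C(2))
    show "norm (K \<Omega> u) \<le> 1" using norm_K_le[of \<Omega> u] that by simp
    show "norm (tau h (K \<Omega> u) - K \<Omega> u) \<le> norm h" for h
      using K_translate[of h \<Omega> u] mult_left_mono[OF that, of "norm h"] by simp
  qed
  have pt: "ennreal (cmod (l2_fun (Kc \<Omega> f) x) powr p)
      \<le> ennreal (2 powr p) * (ennreal (\<bar>rep_l2 (K \<Omega> (fst f)) x\<bar> powr p) + ennreal (\<bar>rep_l2 (K \<Omega> (snd f)) x\<bar> powr p))" for f x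
  proof -
    let ?a = "\<bar>rep_l2 (K \<Omega> (fst f)) x\<bar>" and ?b = "\<bar>rep_l2 (K \<Omega> (snd f)) x\<bar>"
    have "cmod (l2_fun (Kc \<Omega> f) x) \<le> ?a + ?b"
      using cmod_le[of "l2_fun (Kc \<Omega> f) x"] by (simp add: l2_fun_def Kc_def)
    then have "cmod (l2_fun (Kc \<Omega> f) x) \<le> 2 * max ?a ?b" by linarith
    then have "cmod (l2_fun (Kc \<Omega> f) x) powr p \<le> (2 * max ?a ?b) powr p" using p0 by (intro powr_mono2) auto
    also have "\<dots> = 2 powr p * (max ?a ?b) powr p" by (simp add: powr_mult)
    also have "\<dots> \<le> 2 powr p * (?a powr p + ?b powr p)"
      by (intro mult_left_mono) (auto simp: max_def)
    finally show ?thesis by (simp add: ennreal_mult[symmetric] ennreal_plus[symmetric] del: ennreal_plus)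
  qed
  have "(\<integral>\<^sup>+x. ennreal (cmod (l2_fun (Kc \<Omega> f) x) powr p) \<partial>lborel) \<le> ennreal (2 powr p * (C + C))" if f: "norm f \<le> 1" for f
  proof -
    have n: "norm (fst f) \<le> 1" "norm (snd f) \<le> 1" using norm_fst_le[of f] norm_snd_le[of f] f by auto
    have "(\<integral>\<^sup>+x. ennreal (cmod (l2_fun (Kc \<Omega> f) x) powr p) \<partial>lborel) \<le>
      (\<integral>\<^sup>+x. ennreal (2 powr p) * (ennreal (\<bar>rep_l2 (K \<Omega> (fst f)) x\<bar> powr p) + ennreal (\<bar>rep_l2 (K \<Omega> (snd f)) x\<bar> powr p)) \<partial>lborel)"
      by (intro nn_integral_mono pt)
    also have "\<dots> = ennreal (2 powr p) * ((\<integral>\<^sup>+x. ennreal (\<bar>rep_l2 (K \<Omega> (fst f)) x\<bar> powr p) \<partial>lborel)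
        + (\<integral>\<^sup>+x. ennreal (\<bar>rep_l2 (K \<Omega> (snd f)) x\<bar> powr p) \<partial>lborel))"
      by (simp add: nn_integral_cmult nn_integral_add)
    also have "\<dots> \<le> ennreal (2 powr p) * (ennreal C + ennreal C)"
      by (intro mult_left_mono add_mono KC n) auto
    also have "\<dots> = ennreal (2 powr p * (C + C))" using C(1) by (simp add: ennreal_mult ennreal_plus del: ennreal_plus add: ennreal_plus[symmetric])
    finally show ?thesis .
  qed
  then show ?thesis using that[of "2 powr p * (C + C)"] C(1) by simp
qed

lemma Kc_Lp_integrable:
  fixes \<Omega> :: "'a::euclidean_space set"
  assumes p: "p = 2 + 2 / real DIM('a)"
  shows "integrable lborel (\<lambda>x. cmod (l2_fun (Kc \<Omega> f) x) powr p)"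
proof -
  obtain C where C: "0 \<le> C" "\<And>f. norm f \<le> 1 \<Longrightarrow> (\<integral>\<^sup>+x. ennreal (cmod (l2_fun (Kc \<Omega> f) x) powr p) \<partial>lborel) \<le> ennreal C"
    using Kc_Lp_bound[OF p, of \<Omega>] by metis
  \<comment> \<open>The L^p bound is stated on the unit ball, so f is normalized; the added 1 keeps
    the divisor positive when f = 0.\<close>
  define t where "t = norm f + 1"
  have t: "0 < t" by (simp add: t_def add_nonneg_pos)
  define g where "g = (1 / t) *\<^sub>R f"
  have "norm g \<le> 1" using t by (simp add: g_def t_def divide_le_eq)
  then have le: "(\<integral>\<^sup>+x. ennreal (cmod (l2_fun (Kc \<Omega> g) x) powr p) \<partial>lborel) \<le> ennreal C" by (rule C(2))
  have ig: "integrable lborel (\<lambda>x. cmod (l2_fun (Kc \<Omega> g) x) powr p)"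
    by (rule integrableI_bounded) (use le in \<open>auto simp: less_top[symmetric] top_unique\<close>)
  have "f = t *\<^sub>R g" using t by (simp add: g_def)
  then have "AE x in lborel. l2_fun (Kc \<Omega> f) x = t *\<^sub>R l2_fun (Kc \<Omega> g) x"
    using l2_fun_scaleR[of t "Kc \<Omega> g"] by (simp add: Kc_scaleR)
  then have "AE x in lborel. t powr p * cmod (l2_fun (Kc \<Omega> g) x) powr p = cmod (l2_fun (Kc \<Omega> f) x) powr p"
    by eventually_elim (use t in \<open>simp add: powr_mult\<close>)
  from integrable_cong_AE_imp[OF integrable_mult_right[OF ig, of "t powr p"] _ this] show ?thesis by simp
qed

definition Gop :: "'a::euclidean_space set \<Rightarrow> real \<Rightarrow> ('a, real) l2 \<times> ('a, real) l2 \<Rightarrow> ('a, real) l2 \<times> ('a, real) l2" where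
  "Gop \<Omega> \<alpha> f = l2_pair (\<lambda>x. gpow \<alpha> (l2_fun (Kc \<Omega> f) x))"

text \<open>A majorant independent of the two exponents, from x^c \<le> 1 + x^a for 0 \<le> c \<le>
  a. For a = 1/N the power 2 + 2a is the integrability exponent of \<open>Lp_bound\<close>.\<close>

lemma powr_diff_le:
  assumes "0 \<le> \<alpha>" "\<alpha> \<le> a" "0 \<le> \<beta>" "\<beta> \<le> a" "0 \<le> (x::real)"
  shows "(x * \<bar>x powr \<alpha> - x powr \<beta>\<bar>)\<^sup>2 \<le> 2 * x\<^sup>2 + 2 * x powr (2 + 2 * a)"
proof (cases "x = 0")
  case False
  then have x: "0 < x" using assms by simp
  have b: "0 \<le> x powr c \<and> x powr c \<le> 1 + x powr a" if "0 \<le> c" "c \<le> a" for c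
  proof (cases "x \<le> 1")
    case True
    then have "x powr c \<le> 1" using x that by (intro powr_le1) auto
    then have "x powr c \<le> 1 + x powr a" using powr_ge_zero[of x a] by linarith
    then show ?thesis by simp
  next
    case False
    then have "x powr c \<le> x powr a" using that by (intro powr_mono) auto
    then show ?thesis by auto
  qed
  have "\<bar>x powr \<alpha> - x powr \<beta>\<bar> \<le> 1 + x powr a" using b[of \<alpha>] b[of \<beta>] assms by linarith
  then have "(x * \<bar>x powr \<alpha> - x powr \<beta>\<bar>)\<^sup>2 \<le> (x * (1 + x powr a))\<^sup>2"
    using x by (intro power_mono mult_left_mono) auto
  also have "\<dots> \<le> x\<^sup>2 * (2 * 1 + 2 * (x powr a)\<^sup>2)"
  proof -
    have "(1 + x powr a)\<^sup>2 \<le> 2 * 1 + 2 * (x powr a)\<^sup>2"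
      using zero_le_power2[of "1 - x powr a"] by (simp add: power2_eq_square algebra_simps)
    then show ?thesis unfolding power_mult_distrib by (intro mult_left_mono) auto
  qed
  also have "\<dots> = 2 * x\<^sup>2 + 2 * x powr (2 + 2 * a)"
  proof -
    have "(x powr a)\<^sup>2 = x powr (2 * a)" using x by (simp add: powr_power mult.commute)
    then have "x powr (2 + 2 * a) = x\<^sup>2 * (x powr a)\<^sup>2" using x by (simp add: powr_add powr_numeral)
    then show ?thesis by (simp add: algebra_simps)
  qed
  finally show ?thesis .
qed simp

lemma gpow_diff_exponent: "cmod (gpow \<alpha> z - gpow \<beta> z) = cmod z * \<bar>cmod z powr \<alpha> - cmod z powr \<beta>\<bar>"
proof -
  have "gpow \<alpha> z - gpow \<beta> z = complex_of_real (cmod z powr \<alpha> - cmod z powr \<beta>) * z"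
    by (simp add: gpow_def algebra_simps)
  then show ?thesis by (simp only: norm_mult norm_of_real mult.commute)
qed

lemma gpow_measurable [measurable]:
  assumes [measurable]: "h \<in> borel_measurable M"
  shows "(\<lambda>x. gpow \<alpha> (h x)) \<in> borel_measurable M"
proof -
  have "(\<lambda>x. complex_of_real (cmod (h x) powr \<alpha> - 1)) \<in> borel_measurable M" by simp
  then show ?thesis unfolding gpow_def by (rule borel_measurable_times) fact
qed

lemma Kc_power_integrable:
  fixes \<Omega> :: "'a::euclidean_space set"
  assumes "a = 1 / real DIM('a)"
  shows "integrable lborel (\<lambda>x. 2 * (cmod (l2_fun (Kc \<Omega> f) x))\<^sup>2 + 2 * cmod (l2_fun (Kc \<Omega> f) x) powr (2 + 2 * a))"
  using Kc_Lp_integrable[of "2 + 2 * a" \<Omega> f] sqint_integrable[OF sqint_l2_fun[of "Kc \<Omega> f"]] assms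
  by simp

lemma gpow_sqint:
  fixes \<Omega> :: "'a::euclidean_space set"
  assumes "0 \<le> \<alpha>" "\<alpha> \<le> 1 / real DIM('a)"
  shows "sqint (\<lambda>x. gpow \<alpha> (l2_fun (Kc \<Omega> f) x))"
proof -
  define a where "a = 1 / real DIM('a)"
  have "integrable lborel (\<lambda>x. (cmod (gpow \<alpha> (l2_fun (Kc \<Omega> f) x)))\<^sup>2)"
  proof (rule Bochner_Integration.integrable_bound[OF Kc_power_integrable[OF a_def]])
    show "AE x in lborel. norm ((cmod (gpow \<alpha> (l2_fun (Kc \<Omega> f) x)))\<^sup>2)
        \<le> norm (2 * (cmod (l2_fun (Kc \<Omega> f) x))\<^sup>2 + 2 * cmod (l2_fun (Kc \<Omega> f) x) powr (2 + 2 * a))"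
    proof (rule AE_I2)
      fix x
      let ?z = "l2_fun (Kc \<Omega> f) x"
      have "(cmod (gpow \<alpha> ?z - gpow 0 ?z))\<^sup>2 \<le> 2 * (cmod ?z)\<^sup>2 + 2 * cmod ?z powr (2 + 2 * a)"
        unfolding gpow_diff_exponent using assms by (intro powr_diff_le) (auto simp: a_def)
      then show "norm ((cmod (gpow \<alpha> ?z))\<^sup>2) \<le> norm (2 * (cmod ?z)\<^sup>2 + 2 * cmod ?z powr (2 + 2 * a))" by simp
    qed
  qed measurable
  then show ?thesis by (simp add: sqint_def)
qed

lemma Gop_continuous:
  fixes \<Omega> :: "'a::euclidean_space set"
  shows "continuous_on {0..1 / real DIM('a)} (\<lambda>\<alpha>. Gop \<Omega> \<alpha> f)"
  unfolding continuous_on_sequentially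
proof (intro allI ballI impI, elim conjE)
  define a where "a = 1 / real DIM('a)"
  fix X \<alpha> assume \<alpha>: "\<alpha> \<in> {0..1 / real DIM('a)}" and X: "\<forall>n. X n \<in> {0..1 / real DIM('a)}" "X \<longlonglongrightarrow> \<alpha>"
  let ?w = "l2_fun (Kc \<Omega> f)"
  have "(norm (Gop \<Omega> (X n) f - Gop \<Omega> \<alpha> f))\<^sup>2 = (\<integral>x. (cmod (gpow (X n) (?w x) - gpow \<alpha> (?w x)))\<^sup>2 \<partial>lborel)" for n
    unfolding Gop_def using X(1) \<alpha> by (simp add: l2_pair_diff gpow_sqint norm_l2_pair sqint_diff)
  moreover have "(\<lambda>n. \<integral>x. (cmod (gpow (X n) (?w x) - gpow \<alpha> (?w x)))\<^sup>2 \<partial>lborel) \<longlonglongrightarrow> integral\<^sup>L lborel (\<lambda>x::'a. 0::real)"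
  proof (rule integral_dominated_convergence[OF _ _ Kc_power_integrable[OF a_def, of \<Omega> f]])
    show "AE x in lborel. (\<lambda>n. (cmod (gpow (X n) (?w x) - gpow \<alpha> (?w x)))\<^sup>2) \<longlonglongrightarrow> 0"
    proof (rule AE_I2)
      fix x
      have "(\<lambda>n. gpow (X n) (?w x)) \<longlonglongrightarrow> gpow \<alpha> (?w x)"
      proof (cases "?w x = 0")
        case False
        then show ?thesis unfolding gpow_def by (intro tendsto_intros X(2)) auto
      qed simp
      then have "(\<lambda>n. (cmod (gpow (X n) (?w x) - gpow \<alpha> (?w x)))\<^sup>2) \<longlonglongrightarrow> (cmod (gpow \<alpha> (?w x) - gpow \<alpha> (?w x)))\<^sup>2"
        by (intro tendsto_intros)
      then show "(\<lambda>n. (cmod (gpow (X n) (?w x) - gpow \<alpha> (?w x)))\<^sup>2) \<longlonglongrightarrow> 0" by simp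
    qed
    show "AE x in lborel. norm ((cmod (gpow (X n) (?w x) - gpow \<alpha> (?w x)))\<^sup>2) \<le> 2 * (cmod (?w x))\<^sup>2 + 2 * cmod (?w x) powr (2 + 2 * a)" for n
      unfolding gpow_diff_exponent using powr_diff_le[of "X n" a \<alpha>] X(1) \<alpha> by (simp add: a_def)
  qed measurable
  ultimately have "(\<lambda>n. (norm (Gop \<Omega> (X n) f - Gop \<Omega> \<alpha> f))\<^sup>2) \<longlonglongrightarrow> 0" by simp
  then have "(\<lambda>n. norm (Gop \<Omega> (X n) f - Gop \<Omega> \<alpha> f)) \<longlonglongrightarrow> 0"
    using tendsto_real_sqrt[of _ 0] by fastforce
  then have "(\<lambda>n. Gop \<Omega> (X n) f - Gop \<Omega> \<alpha> f) \<longlonglongrightarrow> 0" by (rule tendsto_norm_zero_cancel)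
  then show "((\<lambda>\<alpha>. Gop \<Omega> \<alpha> f) \<circ> X) \<longlonglongrightarrow> Gop \<Omega> \<alpha> f" by (simp add: LIM_zero_iff o_def)
qed

section \<open>The small Lipschitz constant near the ground state\<close>

lemma l2_fun_chebyshev:
  assumes "0 < c"
  shows "emeasure lborel {x. c \<le> cmod (l2_fun v x)} \<le> ennreal ((norm v)\<^sup>2 / c\<^sup>2)"
proof -
  have "emeasure lborel {x. c \<le> cmod (l2_fun v x)} = (\<integral>\<^sup>+x. indicator {x. c \<le> cmod (l2_fun v x)} x \<partial>lborel)"
    by simp
  also have "\<dots> \<le> (\<integral>\<^sup>+x. ennreal (1 / c\<^sup>2) * ennreal ((cmod (l2_fun v x))\<^sup>2) \<partial>lborel)"
  proof (rule nn_integral_mono)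
    fix x
    show "indicator {x. c \<le> cmod (l2_fun v x)} x \<le> ennreal (1 / c\<^sup>2) * ennreal ((cmod (l2_fun v x))\<^sup>2)"
    proof (cases "c \<le> cmod (l2_fun v x)")
      case True
      then have "c\<^sup>2 \<le> (cmod (l2_fun v x))\<^sup>2" using assms by (intro power_mono) auto
      then have "1 \<le> 1 / c\<^sup>2 * (cmod (l2_fun v x))\<^sup>2" using assms by (simp add: field_simps)
      then show ?thesis using True by (simp add: ennreal_mult[symmetric])
    qed simp
  qed
  also have "\<dots> = ennreal (1 / c\<^sup>2) * ennreal ((norm v)\<^sup>2)"
    by (simp add: nn_integral_cmult nn_l2_fun)
  finally show ?thesis using assms by (simp add: ennreal_mult[symmetric])
qed

text \<open>The sets where u is below 1/(n+1) decrease to a null set, and they have finite measure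
  because \<Omega> is bounded; the measure is then continuous from above.\<close>

lemma small_values_small_measure:
  fixes u :: "('a::euclidean_space, real) l2"
  assumes \<Omega>: "open \<Omega>" "bounded \<Omega>" and pos: "AE x in lborel. x \<in> \<Omega> \<longrightarrow> 0 < rep_l2 u x" and \<eta>: "0 < \<eta>"
  shows "\<exists>d>0. emeasure lborel {x\<in>\<Omega>. rep_l2 u x < d} \<le> ennreal \<eta>"
proof -
  define A where "A n = {x\<in>\<Omega>. rep_l2 u x < inverse (real (Suc n))}" for n
  have [measurable]: "\<Omega> \<in> sets borel" using \<Omega> by simp
  have Am: "A n \<in> sets lborel" for n unfolding A_def by measurable
  have "decseq A"
  proof (rule decseq_SucI, rule subsetI)
    fix n x assume "x \<in> A (Suc n)"
    then have x: "x \<in> \<Omega>" "rep_l2 u x < inverse (real (Suc (Suc n)))" by (auto simp: A_def)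
    have "inverse (real (Suc (Suc n))) \<le> inverse (real (Suc n))" by (simp add: field_simps)
    then have "rep_l2 u x < inverse (real (Suc n))" using x(2) by linarith
    then show "x \<in> A n" using x(1) by (simp add: A_def)
  qed
  moreover have "emeasure lborel (A n) \<noteq> \<infinity>" for n
  proof -
    have "bounded (A n)" using \<Omega>(2) by (rule bounded_subset) (auto simp: A_def)
    then show ?thesis using emeasure_bounded_finite by fastforce
  qed
  ultimately have "(\<lambda>n. emeasure lborel (A n)) \<longlonglongrightarrow> emeasure lborel (\<Inter>n. A n)"
    using Am by (intro Lim_emeasure_decseq) auto
  moreover have "emeasure lborel (\<Inter>n. A n) = 0"
  proof -
    have "(\<Inter>n. A n) \<subseteq> {x. \<not> (x \<in> \<Omega> \<longrightarrow> 0 < rep_l2 u x)}"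
    proof
      fix x assume x: "x \<in> (\<Inter>n. A n)"
      have "rep_l2 u x \<le> 0"
      proof (rule LIMSEQ_le_const[OF LIMSEQ_inverse_real_of_nat])
        show "\<exists>N. \<forall>n\<ge>N. rep_l2 u x \<le> inverse (real (Suc n))"
          using x unfolding A_def by (intro exI[of _ 0]) (auto intro: less_imp_le)
      qed
      then show "x \<in> {x. \<not> (x \<in> \<Omega> \<longrightarrow> 0 < rep_l2 u x)}" using x by (auto simp: A_def)
    qed
    moreover have "emeasure lborel {x. \<not> (x \<in> \<Omega> \<longrightarrow> 0 < rep_l2 u x)} = 0"
    proof -
      have "{x \<in> space lborel. \<not> (x \<in> \<Omega> \<longrightarrow> 0 < rep_l2 u x)} \<in> sets lborel" by measurable
      then show ?thesis using pos AE_iff_measurable[OF _ refl, of lborel "\<lambda>x. x \<in> \<Omega> \<longrightarrow> 0 < rep_l2 u x"] by simp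
    qed
    moreover have "{x. \<not> (x \<in> \<Omega> \<longrightarrow> 0 < rep_l2 u x)} \<in> sets lborel"
    proof -
      have "{x \<in> space lborel. \<not> (x \<in> \<Omega> \<longrightarrow> 0 < rep_l2 u x)} \<in> sets lborel" by measurable
      then show ?thesis by simp
    qed
    ultimately show ?thesis using emeasure_mono[of "\<Inter>n. A n" _ lborel] by (metis le_zero_eq)
  qed
  ultimately have "(\<lambda>n. emeasure lborel (A n)) \<longlonglongrightarrow> 0" by simp
  then have "\<forall>\<^sub>F n in sequentially. emeasure lborel (A n) < ennreal \<eta>"
    using \<eta> by (intro order_tendstoD) auto
  then obtain n where "emeasure lborel (A n) < ennreal \<eta>" by (auto simp: eventually_sequentially)
  then show ?thesis unfolding A_def by (intro exI[of _ "inverse (real (Suc n))"]) auto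
qed

text \<open>A dichotomy. If Y \<le> s d^(2/N), the product is absorbed by d^(2 + 2/N); otherwise
  d^(2/N) < Y/s, and the N-th power of this bounds d^2. It trades a weighted square of d for its L^p
  norm with the small factor s.\<close>

lemma young_split:
  fixes d Y s :: real
  assumes "0 \<le> d" "0 \<le> Y" "0 < s" "0 < N"
  shows "d\<^sup>2 * Y \<le> s * d powr (2 + 2 / real N) + Y * (Y / s) ^ N"
proof (cases "d = 0")
  case True
  then show ?thesis using assms by simp
next
  case False
  then have d: "0 < d" using assms by simp
  define t where "t = 2 / real N"
  show ?thesis
  proof (cases "Y \<le> s * d powr t")
    case True
    have "d\<^sup>2 * Y \<le> d\<^sup>2 * (s * d powr t)" using True by (intro mult_left_mono) auto
    also have "\<dots> = s * d powr (2 + 2 / real N)" using d by (simp add: t_def powr_add powr_numeral mult_ac)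
    finally show ?thesis using assms by (simp add: add_increasing2)
  next
    case False
    then have "d powr t \<le> Y / s" using assms by (simp add: field_simps)
    then have "(d powr t) ^ N \<le> (Y / s) ^ N" by (intro power_mono) auto
    moreover have "(d powr t) ^ N = d\<^sup>2"
      using d assms by (simp add: powr_power t_def powr_numeral)
    ultimately have "d\<^sup>2 * Y \<le> Y * (Y / s) ^ N" using assms by (simp add: mult.commute mult_left_mono)
    then show ?thesis using assms by (simp add: add_increasing)
  qed
qed

lemma Kc_eigenvector:
  fixes \<Omega> :: "'a::euclidean_space set"
  assumes "K \<Omega> \<phi> = \<kappa> *\<^sub>R \<phi>"
  shows "AE x in lborel. l2_fun (Kc \<Omega> (\<phi>, 0)) x = complex_of_real (\<kappa> * rep_l2 \<phi> x)"
proof -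
  have K0: "K \<Omega> 0 = 0" using K_scaleR[of \<Omega> 0 0] by simp
  show ?thesis
    using rep_l2_scaleR[of \<kappa> \<phi>] rep_l2_zero[where 'a='a and 'b=real]
    by eventually_elim (simp add: l2_fun_def Kc_def assms K0 complex_eq_iff)
qed

text \<open>The budget is \<eta>/3 for small values of \<phi> and \<eta>/6 for each of four
  Chebyshev sets. Where \<phi> \<ge> 2 \<delta>/\<kappa>, the function K \<phi> is at least 2
  \<delta>, so |K f| < \<delta> forces |K (f - \<phi>)| \<ge> \<delta>.\<close>

lemma bad_set_small:
  fixes \<Omega> :: "'a::euclidean_space set"
  assumes \<Omega>: "open \<Omega>" and \<phi>: "K \<Omega> \<phi> = \<kappa> *\<^sub>R \<phi>" "norm \<phi> = 1" "0 < \<kappa>"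
    and \<delta>: "0 < \<delta>" "emeasure lborel {x\<in>\<Omega>. rep_l2 \<phi> x < 2 * \<delta> / \<kappa>} \<le> ennreal (\<eta> / 3)"
    and r: "0 \<le> r" "r \<le> 1" "r\<^sup>2 / \<delta>\<^sup>2 \<le> \<eta> / 6" and M: "0 < M" "4 / M\<^sup>2 \<le> \<eta> / 6" and \<eta>: "0 < \<eta>"
    and f: "norm (f - (\<phi>, 0)) \<le> r" and g: "norm (g - (\<phi>, 0)) \<le> r"
  shows "emeasure lborel {x\<in>\<Omega>. \<not> (\<delta> \<le> cmod (l2_fun (Kc \<Omega> f) x) \<and> \<delta> \<le> cmod (l2_fun (Kc \<Omega> g) x)
      \<and> cmod (l2_fun (Kc \<Omega> f) x) \<le> M \<and> cmod (l2_fun (Kc \<Omega> g) x) \<le> M)} \<le> ennreal \<eta>" (is "emeasure _ ?E \<le> _")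
proof -
  have [measurable]: "\<Omega> \<in> sets borel" using \<Omega> by simp
  let ?A = "{x\<in>\<Omega>. rep_l2 \<phi> x < 2 * \<delta> / \<kappa>}"
  let ?L = "\<lambda>f. {x. \<delta> \<le> cmod (l2_fun (Kc \<Omega> (f - (\<phi>, 0))) x)}"
  let ?U = "\<lambda>f. {x. M \<le> cmod (l2_fun (Kc \<Omega> f) x)}"
  have L: "emeasure lborel (?L f) \<le> ennreal (\<eta> / 6)" if "norm (f - (\<phi>, 0)) \<le> r" for f
  proof -
    have "emeasure lborel (?L f) \<le> ennreal ((norm (Kc \<Omega> (f - (\<phi>, 0))))\<^sup>2 / \<delta>\<^sup>2)" by (rule l2_fun_chebyshev[OF \<delta>(1)])
    also have "\<dots> \<le> ennreal (r\<^sup>2 / \<delta>\<^sup>2)"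
      using norm_Kc_le[of \<Omega> "f - (\<phi>, 0)"] that by (intro ennreal_leI divide_right_mono power_mono) auto
    also have "\<dots> \<le> ennreal (\<eta> / 6)" using r by (intro ennreal_leI)
    finally show ?thesis .
  qed
  have U: "emeasure lborel (?U f) \<le> ennreal (\<eta> / 6)" if "norm (f - (\<phi>, 0)) \<le> r" for f
  proof -
    have "norm f \<le> norm (f - (\<phi>, 0)) + norm (\<phi>, 0::('a, real) l2)" using norm_triangle_sub[of f "(\<phi>, 0)"] by simp
    then have n: "norm f \<le> 2" using that r \<phi>(2) by (simp add: norm_Pair)
    have "emeasure lborel (?U f) \<le> ennreal ((norm (Kc \<Omega> f))\<^sup>2 / M\<^sup>2)" by (rule l2_fun_chebyshev[OF M(1)])
    also have "\<dots> \<le> ennreal (2\<^sup>2 / M\<^sup>2)"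
      using norm_Kc_le[of \<Omega> f] n by (intro ennreal_leI divide_right_mono power_mono) auto
    also have "\<dots> \<le> ennreal (\<eta> / 6)" using M by (intro ennreal_leI) simp
    finally show ?thesis .
  qed
  have low: "AE x in lborel. x \<in> \<Omega> \<and> cmod (l2_fun (Kc \<Omega> f) x) < \<delta> \<longrightarrow> x \<in> ?A \<union> ?L f" for f
    using Kc_eigenvector[OF \<phi>(1)] l2_fun_diff[of "Kc \<Omega> f" "Kc \<Omega> (\<phi>, 0)"]
  proof eventually_elim
    case (elim x)
    have "x \<in> ?L f" if x: "x \<in> \<Omega>" "cmod (l2_fun (Kc \<Omega> f) x) < \<delta>" "x \<notin> ?A"
    proof -
      have "2 * \<delta> \<le> \<kappa> * rep_l2 \<phi> x" using x \<phi>(3) by (simp add: field_simps)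
      then have "2 * \<delta> \<le> cmod (l2_fun (Kc \<Omega> (\<phi>, 0)) x)" unfolding elim(1) norm_of_real by linarith
      then have "\<delta> \<le> cmod (l2_fun (Kc \<Omega> f) x - l2_fun (Kc \<Omega> (\<phi>, 0)) x)"
        using norm_triangle_sub[of "l2_fun (Kc \<Omega> (\<phi>, 0)) x" "l2_fun (Kc \<Omega> f) x"] x(2) by (simp add: norm_minus_commute)
      then show ?thesis unfolding Kc_diff mem_Collect_eq elim(2) .
    qed
    then show ?case by blast
  qed
  have "emeasure lborel ?E \<le> emeasure lborel (?A \<union> (?L f \<union> ?L g) \<union> (?U f \<union> ?U g))"
  proof (rule emeasure_mono_AE)
    show "AE x in lborel. x \<in> ?E \<longrightarrow> x \<in> ?A \<union> (?L f \<union> ?L g) \<union> (?U f \<union> ?U g)"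
      using low[of f] low[of g] by eventually_elim (auto simp: not_le)
  qed measurable
  also have "\<dots> \<le> emeasure lborel (?A \<union> (?L f \<union> ?L g)) + emeasure lborel (?U f \<union> ?U g)"
    by (rule emeasure_subadditive) measurable
  also have "\<dots> \<le> (emeasure lborel ?A + emeasure lborel (?L f \<union> ?L g)) + emeasure lborel (?U f \<union> ?U g)"
    by (intro add_right_mono emeasure_subadditive) measurable
  also have "\<dots> \<le> (emeasure lborel ?A + (emeasure lborel (?L f) + emeasure lborel (?L g))) + (emeasure lborel (?U f) + emeasure lborel (?U g))"
    by (intro add_mono order_refl emeasure_subadditive) measurable
  also have "\<dots> \<le> (ennreal (\<eta> / 3) + (ennreal (\<eta> / 6) + ennreal (\<eta> / 6))) + (ennreal (\<eta> / 6) + ennreal (\<eta> / 6))"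
    by (intro add_mono \<delta>(2) L U f g)
  also have "\<dots> = ennreal \<eta>" using \<eta> by (simp add: ennreal_plus[symmetric] del: ennreal_plus)
  finally show ?thesis .
qed

text \<open>The constant \<epsilon>^2 is spent in four quarters: the good set, where the factor is
  below \<epsilon>/2; the L^p norm of K (f - g); the measure of the bad set E; and the L^2 norms of
  K f and K g, which enter through the growth of the weight.\<close>

lemma Gop_lipschitz:
  fixes \<Omega> :: "'a::euclidean_space set"
  assumes \<Omega>: "open \<Omega>" "bounded \<Omega>" and \<phi>: "K \<Omega> \<phi> = \<kappa> *\<^sub>R \<phi>" "norm \<phi> = 1" "0 < \<kappa>"
    and pos: "AE x in lborel. x \<in> \<Omega> \<longrightarrow> 0 < rep_l2 \<phi> x" and \<epsilon>: "0 < \<epsilon>"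
  shows "\<exists>r>0. \<exists>a>0. \<forall>\<alpha>\<in>{0..a}. \<forall>f g. norm (f - (\<phi>, 0)) \<le> r \<longrightarrow> norm (g - (\<phi>, 0)) \<le> r
        \<longrightarrow> norm (Gop \<Omega> \<alpha> f - Gop \<Omega> \<alpha> g) \<le> \<epsilon> * norm (f - g)"
proof -
  have [measurable]: "\<Omega> \<in> sets borel" using \<Omega> by simp
  let ?N = "DIM('a)"
  define p where "p = 2 + 2 / real ?N"
  obtain C where C: "0 \<le> C" "\<And>f. norm f \<le> 1 \<Longrightarrow> (\<integral>\<^sup>+x. ennreal (cmod (l2_fun (Kc \<Omega> f) x) powr p) \<partial>lborel) \<le> ennreal C"
    using Kc_Lp_bound[OF p_def, of \<Omega>] by metis
  \<comment> \<open>The weight of the L^p term: s times the bound C is at most \<epsilon>^2/4, also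
    when C = 0.\<close>
  define s where "s = \<epsilon>\<^sup>2 / (4 * (C + 1))"
  have s: "0 < s" "s * C \<le> \<epsilon>\<^sup>2 / 4" using \<epsilon> C(1) by (auto simp: s_def field_simps)
  \<comment> \<open>For the weight Y = 9 m^(2 \<alpha>) this is the constant in Y (Y/s)^N = Q m^(2
    \<alpha> (N + 1)).\<close>
  define Q where "Q = 9 * (9 / s) ^ ?N"
  have Q: "0 < Q" using s by (simp add: Q_def)
  \<comment> \<open>The parameter in y \<le> (k/2) y^2 + 1/(2k). The squared norms of K f and K g
    are at most 4 each, so the quadratic part costs Q * 4k, a quarter of \<epsilon>^2; \<eta> below
    is the measure for which the constant part costs the next quarter.\<close>
  define k where "k = \<epsilon>\<^sup>2 / (16 * Q)"
  have k: "0 < k" "Q * (4 * k) = \<epsilon>\<^sup>2 / 4" using \<epsilon> Q by (auto simp: k_def)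
  define \<eta> where "\<eta> = \<epsilon>\<^sup>2 / (4 * (Q * (1 + 1 / k)))"
  have k1: "0 < 1 + 1 / k" using k by (simp add: add_pos_pos)
  have \<eta>: "0 < \<eta>" "Q * ((1 + 1 / k) * \<eta>) = \<epsilon>\<^sup>2 / 4" using \<epsilon> Q k1 by (auto simp: \<eta>_def)
  \<comment> \<open>Since M \<ge> 1, one has 24/\<eta> \<le> M \<le> M^2, which is the Chebyshev
    requirement 4/M^2 \<le> \<eta>/6.\<close>
  define M where "M = 1 + 24 / \<eta>"
  have M: "1 \<le> M" "4 / M\<^sup>2 \<le> \<eta> / 6"
  proof -
    show M1: "1 \<le> M" using \<eta> by (simp add: M_def)
    have "24 / \<eta> \<le> M" by (simp add: M_def)
    also have "M \<le> M\<^sup>2" using M1 by (simp add: power2_eq_square mult_le_cancel_left1)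
    finally show "4 / M\<^sup>2 \<le> \<eta> / 6" using \<eta> M1 by (simp add: field_simps)
  qed
  obtain d0 where d0: "0 < d0" "emeasure lborel {x\<in>\<Omega>. rep_l2 \<phi> x < d0} \<le> ennreal (\<eta> / 3)"
    using small_values_small_measure[OF \<Omega> pos, of "\<eta> / 3"] \<eta> by auto
  define \<delta> where "\<delta> = min 1 (\<kappa> * d0 / 2)"
  have \<delta>: "0 < \<delta>" "\<delta> \<le> 1" "2 * \<delta> / \<kappa> \<le> d0" using d0 \<phi>(3) by (auto simp: \<delta>_def field_simps)
  have \<delta>m: "emeasure lborel {x\<in>\<Omega>. rep_l2 \<phi> x < 2 * \<delta> / \<kappa>} \<le> ennreal (\<eta> / 3)"
    using \<delta>(3) by (intro order_trans[OF emeasure_mono d0(2)]) auto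
  define b where "b = min 1 (\<eta> / 6)"
  have b: "0 < b" "b \<le> 1" "b \<le> \<eta> / 6" using \<eta> by (auto simp: b_def)
  define r where "r = min 1 (\<delta> * b)"
  have r: "0 < r" "r \<le> 1" "r\<^sup>2 / \<delta>\<^sup>2 \<le> \<eta> / 6"
  proof -
    show r0: "0 < r" "r \<le> 1" using \<delta> b by (auto simp: r_def)
    have "r \<le> \<delta> * b" by (simp add: r_def)
    then have "r / \<delta> \<le> b" using \<delta>(1) by (simp add: divide_le_eq mult.commute)
    then have "(r / \<delta>)\<^sup>2 \<le> b\<^sup>2" using r0 \<delta> by (intro power_mono) auto
    also have "\<dots> \<le> b" using b by (simp add: power2_eq_square mult_le_cancel_left2)
    also have "\<dots> \<le> \<eta> / 6" by (rule b)
    finally show "r\<^sup>2 / \<delta>\<^sup>2 \<le> \<eta> / 6" by (simp add: power_divide)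
  qed
  \<comment> \<open>The factor of the annulus bound in \<open>gpow_diff\<close>; it is continuous
    and vanishes at \<alpha> = 0, where \<delta> and M are already fixed.\<close>
  define e where "e \<alpha> = M powr \<alpha> - \<delta> powr \<alpha> + \<alpha> * (M / \<delta>) * M powr \<alpha>" for \<alpha>
  have "isCont e 0" unfolding e_def using M \<delta> by (intro continuous_intros) auto
  moreover have "e 0 = 0" using M \<delta> by (simp add: e_def)
  ultimately obtain a1 where a1: "0 < a1" "\<And>\<alpha>. \<bar>\<alpha>\<bar> < a1 \<Longrightarrow> \<bar>e \<alpha>\<bar> < \<epsilon> / 2"
    using \<epsilon> unfolding continuous_at_eps_delta by (metis dist_real_def diff_zero half_gt_zero)
  \<comment> \<open>The second entry gives 2 \<alpha> (N + 1) \<le> 1, so the weight m^(2 \<alpha>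
    (N + 1)) grows at most linearly in |K f| and |K g|.\<close>
  define a where "a = min (a1 / 2) (1 / (2 * (real ?N + 1)))"
  have N1: "1 \<le> real ?N" by (simp add: DIM_ge_Suc0 Suc_leI)
  have a: "0 < a" "a < a1" "a * (2 * (real ?N + 1)) \<le> 1"
    using a1 N1 by (auto simp: a_def min_def field_simps)
  have aN: "a \<le> 1 / real ?N" "a \<le> 1"
  proof -
    have "a * real ?N \<le> a * (2 * (real ?N + 1))" using a(1) by (intro mult_left_mono) auto
    then show "a \<le> 1 / real ?N" using a(3) N1 by (simp add: field_simps)
    also have "\<dots> \<le> 1" using N1 by simp
    finally show "a \<le> 1" .
  qed
  have "norm (Gop \<Omega> \<alpha> f - Gop \<Omega> \<alpha> g) \<le> \<epsilon> * norm (f - g)"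
    if \<alpha>: "\<alpha> \<in> {0..a}" and f: "norm (f - (\<phi>, 0)) \<le> r" and g: "norm (g - (\<phi>, 0)) \<le> r" for \<alpha> f g
  proof (cases "f = g")
    case False
    define t where "t = norm (f - g)"
    have t: "0 < t" using False by (simp add: t_def)
    \<comment> \<open>Normalizing the difference makes the L^p bound on the unit ball apply; the
      factor t = |f - g| is restored at the end.\<close>
    define h where "h = (1 / t) *\<^sub>R (f - g)"
    have h: "norm h = 1" "f - g = t *\<^sub>R h" using t by (auto simp: h_def t_def)
    let ?w = "l2_fun (Kc \<Omega> f)" and ?v = "l2_fun (Kc \<Omega> g)"
    define d where "d x = cmod (l2_fun (Kc \<Omega> h) x)" for x
    have d0': "0 \<le> d x" for x by (simp add: d_def)
    have [measurable]: "d \<in> borel_measurable borel" unfolding d_def[abs_def] by measurable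
    have \<alpha>1: "0 \<le> \<alpha>" "\<alpha> \<le> 1" "\<alpha> \<le> 1 / real ?N" using \<alpha> aN by auto
    define E where "E = {x\<in>\<Omega>. \<not> (\<delta> \<le> cmod (?w x) \<and> \<delta> \<le> cmod (?v x) \<and> cmod (?w x) \<le> M \<and> cmod (?v x) \<le> M)}"
    have [measurable]: "E \<in> sets borel"
    proof -
      have "{x \<in> space borel. x \<in> \<Omega> \<and> \<not> (\<delta> \<le> cmod (?w x) \<and> \<delta> \<le> cmod (?v x) \<and> cmod (?w x) \<le> M \<and> cmod (?v x) \<le> M)} \<in> sets borel"
        by measurable
      then show ?thesis by (simp add: E_def)
    qed
    have mE: "emeasure lborel E \<le> ennreal \<eta>"
      unfolding E_def by (rule bad_set_small[OF \<Omega>(1) \<phi> \<delta>(1) \<delta>m less_imp_le[OF r(1)] r(2,3) _ M(2) \<eta>(1) f g]) (use M in simp)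
    have iE: "integrable lborel (indicator E :: 'a \<Rightarrow> real)" "(\<integral>x. indicator E x \<partial>lborel) \<le> \<eta>"
    proof -
      have fin: "emeasure lborel E < \<infinity>" using mE by (simp add: order_le_less_trans)
      then show "integrable lborel (indicator E :: 'a \<Rightarrow> real)" by simp
      have "ennreal (measure lborel E) \<le> ennreal \<eta>" using mE fin by (simp add: emeasure_eq_ennreal_measure)
      then show "(\<integral>x. indicator E x \<partial>lborel) \<le> \<eta>" using \<eta> by simp
    qed
    have id2: "integrable lborel (\<lambda>x. (d x)\<^sup>2)" "(\<integral>x. (d x)\<^sup>2 \<partial>lborel) \<le> 1"
    proof -
      show "integrable lborel (\<lambda>x. (d x)\<^sup>2)" unfolding d_def using sqint_integrable[OF sqint_l2_fun[of "Kc \<Omega> h"]] by simp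
      have "(norm (Kc \<Omega> h))\<^sup>2 \<le> 1" using norm_Kc_le[of \<Omega> h] h by (simp add: power_le_one)
      then show "(\<integral>x. (d x)\<^sup>2 \<partial>lborel) \<le> 1" by (simp add: d_def norm_l2_fun)
    qed
    have idp: "integrable lborel (\<lambda>x. d x powr p)" "(\<integral>x. d x powr p \<partial>lborel) \<le> C"
    proof -
      show i: "integrable lborel (\<lambda>x. d x powr p)" unfolding d_def by (rule Kc_Lp_integrable[OF p_def])
      have "ennreal (\<integral>x. d x powr p \<partial>lborel) = (\<integral>\<^sup>+x. ennreal (d x powr p) \<partial>lborel)"
        by (rule nn_integral_eq_integral[symmetric, OF i]) simp
      also have "\<dots> \<le> ennreal C" unfolding d_def using C(2)[of h] h by simp
      finally show "(\<integral>x. d x powr p \<partial>lborel) \<le> C" using C(1) by simp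
    qed
    have iw: "integrable lborel (\<lambda>x. (cmod (l2_fun (Kc \<Omega> f) x))\<^sup>2) \<and> (\<integral>x. (cmod (l2_fun (Kc \<Omega> f) x))\<^sup>2 \<partial>lborel) \<le> 4"
      if f: "norm (f - (\<phi>, 0)) \<le> r" for f
    proof -
      have "norm f \<le> norm (f - (\<phi>, 0)) + norm (\<phi>, 0::('a, real) l2)" using norm_triangle_sub[of f "(\<phi>, 0)"] by simp
      then have "norm f \<le> 2" using f r \<phi>(2) by (simp add: norm_Pair)
      then have "(norm (Kc \<Omega> f))\<^sup>2 \<le> 2\<^sup>2" using norm_Kc_le[of \<Omega> f] by (intro power_mono) auto
      then show ?thesis using sqint_integrable[OF sqint_l2_fun[of "Kc \<Omega> f"]] by (simp add: norm_l2_fun)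
    qed
    define R where "R x = t\<^sup>2 * (\<epsilon>\<^sup>2 / 4 * (d x)\<^sup>2 + (s * d x powr p
        + Q * ((1 + 1 / k) * indicator E x + (k / 2) * ((cmod (?w x))\<^sup>2 + (cmod (?v x))\<^sup>2))))" for x
    have iR: "integrable lborel R"
      unfolding R_def[abs_def] using id2 idp iE iw[OF f] iw[OF g] by (intro integrable_mult_right Bochner_Integration.integrable_add) auto
    have pt: "AE x in lborel. (cmod (gpow \<alpha> (?w x) - gpow \<alpha> (?v x)))\<^sup>2 \<le> R x"
      using l2_fun_diff[of "Kc \<Omega> f" "Kc \<Omega> g"] l2_fun_scaleR[of t "Kc \<Omega> h"] Kc_support[OF \<Omega>(1), of f] Kc_support[OF \<Omega>(1), of g]
    proof eventually_elim
      case (elim x)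
      have "?w x - ?v x = t *\<^sub>R l2_fun (Kc \<Omega> h) x"
        using elim(1,2) h(2) by (simp add: Kc_diff[symmetric] Kc_scaleR[symmetric])
      then have D: "cmod (?w x - ?v x) = t * d x" using t by (simp add: d_def)
      have Rge: "0 \<le> s * d x powr p" "0 \<le> Q * ((1 + 1 / k) * indicator E x + (k / 2) * ((cmod (?w x))\<^sup>2 + (cmod (?v x))\<^sup>2))"
        using s Q k k1 by (auto intro!: add_nonneg_nonneg mult_nonneg_nonneg)
      consider "x \<notin> \<Omega>" | "x \<in> \<Omega>" "x \<notin> E" | "x \<in> E" by blast
      then show ?case
      proof cases
        case 1
        then have "gpow \<alpha> (?w x) - gpow \<alpha> (?v x) = 0" using elim by simp
        then show ?thesis unfolding R_def using Rge \<epsilon> by (simp add: add_nonneg_nonneg)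
      next
        case 2
        have "cmod (gpow \<alpha> (?w x) - gpow \<alpha> (?v x)) \<le> e \<alpha> * cmod (?w x - ?v x)"
          unfolding e_def using 2 \<delta> M \<alpha>1 by (intro gpow_diff(2)) (auto simp: E_def)
        also have "\<dots> \<le> \<epsilon> / 2 * cmod (?w x - ?v x)"
          using a1(2)[of \<alpha>] \<alpha> a by (intro mult_right_mono) auto
        finally have "cmod (gpow \<alpha> (?w x) - gpow \<alpha> (?v x)) \<le> \<epsilon> / 2 * (t * d x)" unfolding D .
        then have "(cmod (gpow \<alpha> (?w x) - gpow \<alpha> (?v x)))\<^sup>2 \<le> (\<epsilon> / 2 * (t * d x))\<^sup>2" by (intro power_mono) auto
        also have "\<dots> = t\<^sup>2 * (\<epsilon>\<^sup>2 / 4 * (d x)\<^sup>2)" by (simp add: power_mult_distrib power_divide)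
        also have "\<dots> \<le> R x" unfolding R_def using Rge by (intro mult_left_mono) auto
        finally show ?thesis .
      next
        case 3
        define m where "m = max 1 (max (cmod (?w x)) (cmod (?v x)))"
        have m1: "1 \<le> m" by (simp add: m_def)
        define Y where "Y = 9 * m powr (2 * \<alpha>)"
        have Y0: "0 \<le> Y" by (simp add: Y_def)
        have sq: "(m powr \<alpha>)\<^sup>2 = m powr (2 * \<alpha>)" using m1 by (simp add: powr_power mult.commute)
        have "cmod (gpow \<alpha> (?w x) - gpow \<alpha> (?v x)) \<le> 3 * m powr \<alpha> * (t * d x)"
          using gpow_diff(1)[OF \<alpha>1(1,2), of "?w x" "?v x"] unfolding D m_def .
        then have "(cmod (gpow \<alpha> (?w x) - gpow \<alpha> (?v x)))\<^sup>2 \<le> (3 * m powr \<alpha> * (t * d x))\<^sup>2" by (intro power_mono) auto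
        also have "\<dots> = t\<^sup>2 * ((d x)\<^sup>2 * Y)" unfolding Y_def sq[symmetric] by (simp add: power_mult_distrib)
        also have "\<dots> \<le> t\<^sup>2 * (s * d x powr p + Q * ((1 + 1 / k) * indicator E x + (k / 2) * ((cmod (?w x))\<^sup>2 + (cmod (?v x))\<^sup>2)))"
        proof (rule mult_left_mono)
          have "Y * (Y / s) ^ ?N = Q * (m powr (2 * \<alpha>) * (m powr (2 * \<alpha>)) ^ ?N)"
            by (simp add: Y_def Q_def power_mult_distrib power_divide)
          also have "m powr (2 * \<alpha>) * (m powr (2 * \<alpha>)) ^ ?N = m powr (\<alpha> * (2 * (real ?N + 1)))"
            using m1 by (simp add: powr_power powr_add[symmetric] algebra_simps)
          also have "Q * m powr (\<alpha> * (2 * (real ?N + 1))) \<le> Q * m powr 1"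
          proof (intro mult_left_mono powr_mono m1)
            have "\<alpha> * (2 * (real ?N + 1)) \<le> a * (2 * (real ?N + 1))" using \<alpha> by (intro mult_right_mono) auto
            then show "\<alpha> * (2 * (real ?N + 1)) \<le> 1" using a(3) by linarith
          qed (use Q in auto)
          also have "Q * m powr 1 = Q * m" using m1 by simp
          also have "\<dots> \<le> Q * ((1 + 1 / k) * indicator E x + (k / 2) * ((cmod (?w x))\<^sup>2 + (cmod (?v x))\<^sup>2))"
          proof (rule mult_left_mono)
            have y: "y \<le> (k / 2) * y\<^sup>2 + 1 / (2 * k)" for y
            proof -
              have "0 \<le> (k * y - 1)\<^sup>2 / (2 * k)" using k by simp
              also have "(k * y - 1)\<^sup>2 / (2 * k) = (k / 2) * y\<^sup>2 + 1 / (2 * k) - y"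
                using k by (simp add: power2_eq_square field_simps)
              finally show ?thesis by simp
            qed
            have "m \<le> 1 + cmod (?w x) + cmod (?v x)" by (simp add: m_def)
            also have "\<dots> \<le> 1 + ((k / 2) * (cmod (?w x))\<^sup>2 + 1 / (2 * k)) + ((k / 2) * (cmod (?v x))\<^sup>2 + 1 / (2 * k))"
              by (intro add_mono y order_refl)
            also have "\<dots> = (1 + 1 / k) * indicator E x + (k / 2) * ((cmod (?w x))\<^sup>2 + (cmod (?v x))\<^sup>2)"
              using 3 k by (simp add: field_simps)
            finally show "m \<le> (1 + 1 / k) * indicator E x + (k / 2) * ((cmod (?w x))\<^sup>2 + (cmod (?v x))\<^sup>2)" .
          qed (use Q in simp)
          finally have "Y * (Y / s) ^ ?N \<le> Q * ((1 + 1 / k) * indicator E x + (k / 2) * ((cmod (?w x))\<^sup>2 + (cmod (?v x))\<^sup>2))" .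
          then show "(d x)\<^sup>2 * Y \<le> s * d x powr p + Q * ((1 + 1 / k) * indicator E x + (k / 2) * ((cmod (?w x))\<^sup>2 + (cmod (?v x))\<^sup>2))"
            using young_split[OF d0' Y0 s(1) DIM_positive[where 'a='a], of x] unfolding p_def by linarith
        qed simp
        also have "\<dots> \<le> R x" unfolding R_def by (intro mult_left_mono) auto
        finally show ?thesis .
      qed
    qed
    have sq: "sqint (\<lambda>x. gpow \<alpha> (?w x) - gpow \<alpha> (?v x))"
      by (intro sqint_diff gpow_sqint \<alpha>1)
    have "(norm (Gop \<Omega> \<alpha> f - Gop \<Omega> \<alpha> g))\<^sup>2 = (\<integral>x. (cmod (gpow \<alpha> (?w x) - gpow \<alpha> (?v x)))\<^sup>2 \<partial>lborel)"
      unfolding Gop_def using \<alpha>1 by (simp add: l2_pair_diff gpow_sqint norm_l2_pair sq)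
    also have "\<dots> \<le> (\<integral>x. R x \<partial>lborel)"
      by (rule integral_mono_AE[OF sqint_integrable[OF sq] iR pt])
    also have "\<dots> = t\<^sup>2 * (\<epsilon>\<^sup>2 / 4 * (\<integral>x. (d x)\<^sup>2 \<partial>lborel) + (s * (\<integral>x. d x powr p \<partial>lborel)
        + Q * ((1 + 1 / k) * (\<integral>x. indicator E x \<partial>lborel) + (k / 2) * ((\<integral>x. (cmod (?w x))\<^sup>2 \<partial>lborel) + (\<integral>x. (cmod (?v x))\<^sup>2 \<partial>lborel)))))"
      unfolding R_def using id2(1) idp(1) iE(1) iw[OF f] iw[OF g] by simp
    also have "\<dots> \<le> t\<^sup>2 * (\<epsilon>\<^sup>2 / 4 * 1 + (s * C + Q * ((1 + 1 / k) * \<eta> + (k / 2) * (4 + 4))))"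
      using id2 idp iE iw[OF f] iw[OF g] s Q k k1 by (intro mult_left_mono add_mono) auto
    also have "\<dots> \<le> t\<^sup>2 * \<epsilon>\<^sup>2"
    proof (rule mult_left_mono)
      have "Q * ((1 + 1 / k) * \<eta> + (k / 2) * (4 + 4)) = \<epsilon>\<^sup>2 / 4 + \<epsilon>\<^sup>2 / 4"
        unfolding distrib_left \<eta>(2) using k(2) by simp
      then show "\<epsilon>\<^sup>2 / 4 * 1 + (s * C + Q * ((1 + 1 / k) * \<eta> + (k / 2) * (4 + 4))) \<le> \<epsilon>\<^sup>2"
        using s(2) by linarith
    qed simp
    finally have "(norm (Gop \<Omega> \<alpha> f - Gop \<Omega> \<alpha> g))\<^sup>2 \<le> (\<epsilon> * t)\<^sup>2" by (simp add: power_mult_distrib mult.commute)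
    then show ?thesis unfolding t_def by (rule power2_le_imp_le) (use \<epsilon> in simp)
  qed simp
  then show ?thesis using r(1) a(1) by blast
qed

subsection \<open>The function spaces of the statement\<close>

text \<open>The bridge from complex Lebesgue integrals over \<Omega> in the statement to real inner
  products over the whole space; the two agree because the test side vanishes outside
  \<Omega>.\<close>

lemma set_integral_l2_fun:
  fixes \<psi> :: "'a::euclidean_space \<Rightarrow> real"
  assumes \<Omega>: "open \<Omega>" and \<psi>: "sqint \<psi>" "\<And>x. x \<notin> \<Omega> \<Longrightarrow> \<psi> x = 0"
  shows "set_lebesgue_integral lebesgue \<Omega> (\<lambda>x. l2_fun w x * complex_of_real (\<psi> x))
    = Complex (fst w \<bullet> abs_l2 \<psi>) (snd w \<bullet> abs_l2 \<psi>)"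
proof -
  have [measurable]: "\<psi> \<in> borel_measurable borel" using \<psi> sqint_measurable by blast
  have "set_lebesgue_integral lebesgue \<Omega> (\<lambda>x. l2_fun w x * complex_of_real (\<psi> x))
      = (\<integral>x. complex_of_real (rep_l2 (fst w) x * \<psi> x) + \<i> * complex_of_real (rep_l2 (snd w) x * \<psi> x) \<partial>lebesgue)"
    unfolding set_lebesgue_integral_def
    by (intro Bochner_Integration.integral_cong refl) (auto simp: l2_fun_def indicator_def complex_eq_iff \<psi>(2))
  also have "\<dots> = (\<integral>x. complex_of_real (rep_l2 (fst w) x * \<psi> x) + \<i> * complex_of_real (rep_l2 (snd w) x * \<psi> x) \<partial>lborel)"
    by (rule integral_completion) measurable
  also have "\<dots> = (\<integral>x. complex_of_real (rep_l2 (fst w) x * \<psi> x) \<partial>lborel) + (\<integral>x. \<i> * complex_of_real (rep_l2 (snd w) x * \<psi> x) \<partial>lborel)"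
    using sqint_inner[OF sqint_rep \<psi>(1)] by (intro Bochner_Integration.integral_add integrable_mult_right integrable_of_real) auto
  also have "\<dots> = complex_of_real (\<integral>x. rep_l2 (fst w) x * \<psi> x \<partial>lborel) + \<i> * complex_of_real (\<integral>x. rep_l2 (snd w) x * \<psi> x \<partial>lborel)"
    by (simp del: of_real_mult)
  finally show ?thesis by (simp add: inner_l2_rep_abs[OF \<psi>(1)] complex_eq_iff)
qed

lemma sqint_L2:
  assumes "open \<Omega>" "sqint h"
  shows "L2 \<Omega> h" "L2sq \<Omega> h \<le> (norm (l2_pair h))\<^sup>2" "0 \<le> L2sq \<Omega> h"
proof -
  have [measurable]: "\<Omega> \<in> sets borel" "h \<in> borel_measurable borel" using assms sqint_measurable by auto
  have 1: "(\<lambda>x. indicator \<Omega> x *\<^sub>R h x) \<in> borel_measurable lborel" by measurable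
  have i: "integrable lborel (\<lambda>x. indicator \<Omega> x *\<^sub>R (cmod (h x))\<^sup>2)"
    using sqint_integrable[OF assms(2)] by (intro integrable_mult_indicator) auto
  show "L2 \<Omega> h"
    unfolding L2_def set_borel_measurable_def set_integrable_def
    using measurable_completion[OF 1] i by (simp add: integrable_completion)
  have "L2sq \<Omega> h = (\<integral>x. indicator \<Omega> x *\<^sub>R (cmod (h x))\<^sup>2 \<partial>lborel)"
    unfolding L2sq_def set_lebesgue_integral_def by (rule integral_completion) measurable
  also have "\<dots> \<le> (\<integral>x. (cmod (h x))\<^sup>2 \<partial>lborel)"
    using sqint_integrable[OF assms(2)] i by (intro integral_mono) (auto simp: indicator_def)
  finally show "L2sq \<Omega> h \<le> (norm (l2_pair h))\<^sup>2" by (simp add: norm_l2_pair[OF assms(2)])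
  show "0 \<le> L2sq \<Omega> h"
    unfolding L2sq_def set_lebesgue_integral_def by (intro Bochner_Integration.integral_nonneg) (auto simp: indicator_def)
qed

lemma L2sq_cong_AE:
  assumes "AE x in lebesgue. x \<in> \<Omega> \<longrightarrow> h x = k x" "L2 \<Omega> h" "L2 \<Omega> k"
  shows "L2sq \<Omega> h = L2sq \<Omega> k"
  unfolding L2sq_def set_lebesgue_integral_def
proof (rule integral_cong_AE)
  show "(\<lambda>x. indicator \<Omega> x *\<^sub>R (cmod (h x))\<^sup>2) \<in> borel_measurable lebesgue"
    "(\<lambda>x. indicator \<Omega> x *\<^sub>R (cmod (k x))\<^sup>2) \<in> borel_measurable lebesgue"
    using borel_measurable_integrable[OF conjunct2[OF assms(2)[unfolded L2_def set_integrable_def]]]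
      borel_measurable_integrable[OF conjunct2[OF assms(3)[unfolded L2_def set_integrable_def]]] .
  show "AE x in lebesgue. indicator \<Omega> x *\<^sub>R (cmod (h x))\<^sup>2 = indicator \<Omega> x *\<^sub>R (cmod (k x))\<^sup>2"
    using assms(1)
  proof eventually_elim
    case (elim x)
    then show ?case by (cases "x \<in> \<Omega>") simp_all
  qed
qed

definition comp_l2 :: "'a::euclidean_space \<Rightarrow> ('a, 'a) l2 \<Rightarrow> ('a, real) l2" where
  "comp_l2 b g = abs_l2 (\<lambda>x. rep_l2 g x \<bullet> b)"

lemma sqint_inner_const:
  assumes "sqint f" shows "sqint (\<lambda>x. f x \<bullet> b)"
proof (rule sqint_bound[OF assms, of _ "norm b"])
  have [measurable]: "f \<in> borel_measurable borel" using assms by (rule sqint_measurable)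
  show "(\<lambda>x. f x \<bullet> b) \<in> borel_measurable borel" by measurable
  have "norm (f x \<bullet> b) \<le> norm b * norm (f x)" for x
    using Cauchy_Schwarz_ineq2[of "f x" b] by (simp add: mult.commute)
  then show "AE x in lborel. norm (f x \<bullet> b) \<le> norm b * norm (f x)" by simp
qed

lemma comp_l2_abs: "sqint f \<Longrightarrow> comp_l2 b (abs_l2 f) = abs_l2 (\<lambda>x. f x \<bullet> b)"
  unfolding comp_l2_def using rep_abs_l2[of f]
  by (subst abs_l2_eq_iff) (auto intro: sqint_inner_const elim!: eventually_mono)

lemma norm_comp_l2_diff:
  assumes "b \<in> Basis" shows "norm (comp_l2 b g - comp_l2 b k) \<le> norm (g - k)"
proof -
  have "comp_l2 b g - comp_l2 b k = abs_l2 (\<lambda>x. (rep_l2 g x - rep_l2 k x) \<bullet> b)"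
    unfolding comp_l2_def by (subst abs_l2_diff) (auto intro: sqint_inner_const simp: inner_diff_left)
  also have "norm \<dots> \<le> norm (abs_l2 (\<lambda>x. rep_l2 g x - rep_l2 k x))"
    using Basis_le_norm[OF assms]
    by (intro norm_abs_l2_mono sqint_inner_const sqint_diff sqint_rep) auto
  also have "abs_l2 (\<lambda>x. rep_l2 g x - rep_l2 k x) = g - k" by (simp add: abs_l2_diff[symmetric])
  finally show ?thesis .
qed

lemma V_comp_by_parts:
  assumes "w \<in> V \<Omega>" "test_fun \<Omega> \<eta>" "b \<in> Basis"
  shows "fst w \<bullet> abs_l2 (pd b \<eta>) = - (comp_l2 b (snd w) \<bullet> abs_l2 \<eta>)"
proof -
  have s: "sqint \<eta>" by (rule test_fun_sqint[OF assms(2)])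
  have s2: "sqint (\<lambda>x. \<eta> x *\<^sub>R b)"
    using sqint_measurable[OF s] by (intro sqint_bound[OF s, of _ "norm b"]) (auto simp: mult.commute)
  have "snd w \<bullet> abs_l2 (\<lambda>x. \<eta> x *\<^sub>R b) = comp_l2 b (snd w) \<bullet> abs_l2 \<eta>"
    unfolding comp_l2_def inner_abs_l2[OF sqint_inner_const[OF sqint_rep] s] inner_l2_rep_abs[OF s2]
    by (simp add: mult.commute)
  then show ?thesis
    using V_by_parts[OF assms(1,2), of b] assms(3) by (simp add: grad_inner_Basis)
qed

text \<open>Membership of \<open>Rop\<close> in the closure \<open>V\<close> supplies the
  approximating test functions, one sequence each for the real and the imaginary part. Convergence
  in the graph norm controls the function and all partial derivatives at once.\<close>

lemma Kc_H10:
  fixes \<Omega> :: "'a::euclidean_space set"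
  assumes \<Omega>: "open \<Omega>"
  shows "H10 \<Omega> (l2_fun (Kc \<Omega> f))"
proof -
  let ?R1 = "Rop \<Omega> (fst f)" and ?R2 = "Rop \<Omega> (snd f)"
  have Kc: "Kc \<Omega> f = (fst ?R1, fst ?R2)" by (simp add: Kc_def K_def)
  define G where "G b = l2_fun (comp_l2 b (snd ?R1), comp_l2 b (snd ?R2))" for b
  have seq: "\<exists>p. (\<forall>n. test_fun \<Omega> (p n)) \<and> (\<lambda>n. graph_grad (p n)) \<longlonglongrightarrow> Rop \<Omega> g" for g
  proof -
    have "Rop \<Omega> g \<in> closure (graph_grad ` Collect (test_fun \<Omega>))" using Rop_in_V[of \<Omega> g] by (simp add: V_def)
    then obtain P where P: "\<And>n. P n \<in> graph_grad ` Collect (test_fun \<Omega>)" "P \<longlonglongrightarrow> Rop \<Omega> g"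
      unfolding closure_sequential by blast
    from P(1) have "\<forall>n. \<exists>p. test_fun \<Omega> p \<and> P n = graph_grad p" by auto
    then obtain p where p: "\<And>n. test_fun \<Omega> (p n)" "\<And>n. P n = graph_grad (p n)" by metis
    then have "P = (\<lambda>n. graph_grad (p n))" by blast
    then show ?thesis using p P(2) by blast
  qed
  obtain p where p: "\<And>n. test_fun \<Omega> (p n)" "(\<lambda>n. graph_grad (p n)) \<longlonglongrightarrow> ?R1" using seq by blast
  obtain q where q: "\<And>n. test_fun \<Omega> (q n)" "(\<lambda>n. graph_grad (q n)) \<longlonglongrightarrow> ?R2" using seq by blast
  have lim: "(\<lambda>n. L2sq \<Omega> (\<lambda>x. complex_of_real (P n x) + \<i> * complex_of_real (Q n x) - l2_fun w x)) \<longlonglongrightarrow> 0"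
    if PQ: "\<And>n. sqint (P n)" "\<And>n. sqint (Q n)" "(\<lambda>n. abs_l2 (P n)) \<longlonglongrightarrow> fst w" "(\<lambda>n. abs_l2 (Q n)) \<longlonglongrightarrow> snd w"
    for P Q :: "nat \<Rightarrow> 'a \<Rightarrow> real" and w
  proof -
    have s: "sqint (\<lambda>x. complex_of_real (P n x) + \<i> * complex_of_real (Q n x))" for n
    proof (rule sqint_add)
      show "sqint (\<lambda>x. complex_of_real (P n x))"
        using sqint_measurable[OF PQ(1)[of n]] by (intro sqint_bound[OF PQ(1)[of n], of _ 1]) auto
      show "sqint (\<lambda>x. \<i> * complex_of_real (Q n x))"
        using sqint_measurable[OF PQ(2)[of n]] by (intro sqint_bound[OF PQ(2)[of n], of _ 1]) (auto simp: norm_mult)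
    qed
    have e: "l2_pair (\<lambda>x. complex_of_real (P n x) + \<i> * complex_of_real (Q n x) - l2_fun w x) = (abs_l2 (P n), abs_l2 (Q n)) - w" for n
      by (subst l2_pair_diff[symmetric, OF s sqint_l2_fun]) (simp add: l2_pair_def l2_fun_def)
    have "(\<lambda>n. (norm ((abs_l2 (P n), abs_l2 (Q n)) - w))\<^sup>2) \<longlonglongrightarrow> (norm ((fst w, snd w) - w))\<^sup>2"
      by (intro tendsto_intros PQ)
    then have "(\<lambda>n. (norm ((abs_l2 (P n), abs_l2 (Q n)) - w))\<^sup>2) \<longlonglongrightarrow> 0" by simp
    then show ?thesis
    proof (rule Lim_null_comparison[rotated], intro always_eventually allI)
      fix n
      show "norm (L2sq \<Omega> (\<lambda>x. complex_of_real (P n x) + \<i> * complex_of_real (Q n x) - l2_fun w x)) \<le> (norm ((abs_l2 (P n), abs_l2 (Q n)) - w))\<^sup>2"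
        using sqint_L2(2,3)[OF \<Omega> sqint_diff[OF s[of n] sqint_l2_fun[of w]]] by (simp add: e)
    qed
  qed
  have gl: "(\<lambda>n. abs_l2 (pd b (p n))) \<longlonglongrightarrow> comp_l2 b (snd r)"
    if p: "\<And>n. test_fun \<Omega> (p n)" "(\<lambda>n. graph_grad (p n)) \<longlonglongrightarrow> r" and b: "b \<in> Basis" for p r b
  proof -
    have "(\<lambda>n. abs_l2 (grad (p n))) \<longlonglongrightarrow> snd r"
      using tendsto_snd[OF p(2)] by (simp add: graph_grad_def)
    then have n0: "(\<lambda>n. norm (abs_l2 (grad (p n)) - snd r)) \<longlonglongrightarrow> 0"
      by (simp add: LIM_zero_iff tendsto_norm_zero)
    have "abs_l2 (pd b (p n)) = comp_l2 b (abs_l2 (grad (p n)))" for n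
      using comp_l2_abs[OF test_fun_grad_sqint[OF p(1)], of b n] b by (simp add: grad_inner_Basis)
    then have "norm (abs_l2 (pd b (p n)) - comp_l2 b (snd r)) \<le> norm (abs_l2 (grad (p n)) - snd r)" for n
      using norm_comp_l2_diff[OF b] by simp
    then have "(\<lambda>n. abs_l2 (pd b (p n)) - comp_l2 b (snd r)) \<longlonglongrightarrow> 0"
      by (intro Lim_null_comparison[OF _ n0] always_eventually) auto
    then show ?thesis by (simp add: LIM_zero_iff)
  qed
  have fl: "(\<lambda>n. abs_l2 (p n)) \<longlonglongrightarrow> fst r" if "(\<lambda>n. graph_grad (p n)) \<longlonglongrightarrow> r" for p :: "nat \<Rightarrow> 'a \<Rightarrow> real" and r
    using tendsto_fst[OF that] by (simp add: graph_grad_def)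
  have wp: "weak_pd \<Omega> b (l2_fun (Kc \<Omega> f)) (G b)" if b: "b \<in> Basis" for b
    unfolding weak_pd_def
  proof (intro allI impI)
    fix \<eta> assume \<eta>: "test_fun \<Omega> \<eta>"
    note t = test_fun_pd[OF \<eta> b]
    have i: "set_lebesgue_integral lebesgue \<Omega> (\<lambda>x. l2_fun w x * complex_of_real (pd b \<eta> x))
        = Complex (fst w \<bullet> abs_l2 (pd b \<eta>)) (snd w \<bullet> abs_l2 (pd b \<eta>))"
      "set_lebesgue_integral lebesgue \<Omega> (\<lambda>x. l2_fun w x * complex_of_real (\<eta> x))
        = Complex (fst w \<bullet> abs_l2 \<eta>) (snd w \<bullet> abs_l2 \<eta>)" for w
      using set_integral_l2_fun[OF \<Omega> test_fun_sqint[OF t]] set_integral_l2_fun[OF \<Omega> test_fun_sqint[OF \<eta>]]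
        test_fun_off[OF t] test_fun_off[OF \<eta>] by blast+
    show "set_lebesgue_integral lebesgue \<Omega> (\<lambda>x. l2_fun (Kc \<Omega> f) x * complex_of_real (pd b \<eta> x))
        = - set_lebesgue_integral lebesgue \<Omega> (\<lambda>x. G b x * complex_of_real (\<eta> x))"
      unfolding G_def i
      using V_comp_by_parts[OF Rop_in_V \<eta> b, of "fst f"] V_comp_by_parts[OF Rop_in_V \<eta> b, of "snd f"]
      by (simp add: Kc complex_eq_iff)
  qed
  show ?thesis unfolding H10_def
  proof (intro conjI exI)
    show "L2 \<Omega> (l2_fun (Kc \<Omega> f))" by (rule sqint_L2(1)[OF \<Omega> sqint_l2_fun])
    show "\<forall>b\<in>Basis. L2 \<Omega> (G b) \<and> weak_pd \<Omega> b (l2_fun (Kc \<Omega> f)) (G b)"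
      using wp sqint_L2(1)[OF \<Omega> sqint_l2_fun] by (simp add: G_def)
    show "\<forall>n. test_fun \<Omega> (p n) \<and> test_fun \<Omega> (q n)" using p(1) q(1) by blast
    show "(\<lambda>n. L2sq \<Omega> (\<lambda>x. complex_of_real (p n x) + \<i> * complex_of_real (q n x) - l2_fun (Kc \<Omega> f) x)) \<longlonglongrightarrow> 0"
      using p q fl[OF p(2)] fl[OF q(2)] by (intro lim test_fun_sqint) (auto simp: Kc)
    show "\<forall>b\<in>Basis. (\<lambda>n. L2sq \<Omega> (\<lambda>x. complex_of_real (pd b (p n) x) + \<i> * complex_of_real (pd b (q n) x) - G b x)) \<longlonglongrightarrow> 0"
    proof
      fix b :: 'a assume b: "b \<in> Basis"
      show "(\<lambda>n. L2sq \<Omega> (\<lambda>x. complex_of_real (pd b (p n) x) + \<i> * complex_of_real (pd b (q n) x) - G b x)) \<longlonglongrightarrow> 0"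
        unfolding G_def using gl[OF p b] gl[OF q b] test_fun_sqint[OF test_fun_pd[OF p(1) b]] test_fun_sqint[OF test_fun_pd[OF q(1) b]]
        by (intro lim) auto
    qed
  qed
qed

lemma Kc_weak_lap:
  assumes \<Omega>: "open \<Omega>"
  shows "weak_lap \<Omega> (l2_fun (Kc \<Omega> f)) (l2_fun (Kc \<Omega> f - f))"
  unfolding weak_lap_def
proof (intro allI impI)
  fix \<eta> assume \<eta>: "test_fun \<Omega> \<eta>"
  note t = lap_test_test_fun[OF \<eta>]
  have i: "set_lebesgue_integral lebesgue \<Omega> (\<lambda>x. l2_fun w x * complex_of_real (lap_test \<eta> x))
      = Complex (fst w \<bullet> abs_l2 (lap_test \<eta>)) (snd w \<bullet> abs_l2 (lap_test \<eta>))"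
    "set_lebesgue_integral lebesgue \<Omega> (\<lambda>x. l2_fun w x * complex_of_real (\<eta> x))
      = Complex (fst w \<bullet> abs_l2 \<eta>) (snd w \<bullet> abs_l2 \<eta>)" for w
    using set_integral_l2_fun[OF \<Omega> test_fun_sqint[OF t]] set_integral_l2_fun[OF \<Omega> test_fun_sqint[OF \<eta>]]
      test_fun_off[OF t] test_fun_off[OF \<eta>] by blast+
  show "set_lebesgue_integral lebesgue \<Omega> (\<lambda>x. l2_fun (Kc \<Omega> f) x * complex_of_real (lap_test \<eta> x))
      = set_lebesgue_integral lebesgue \<Omega> (\<lambda>x. l2_fun (Kc \<Omega> f - f) x * complex_of_real (\<eta> x))"
    unfolding i
    using K_weak_lap[OF \<eta>, of "fst f"] K_weak_lap[OF \<eta>, of "snd f"]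
    by (simp add: Kc_def inner_diff_left)
qed

lemma L2_set_integrable:
  fixes \<Omega> :: "'a::euclidean_space set"
  assumes \<Omega>: "open \<Omega>" "bounded \<Omega>" and h: "L2 \<Omega> h"
  shows "set_integrable lebesgue \<Omega> h"
proof -
  have hm[measurable]: "(\<lambda>x. indicator \<Omega> x *\<^sub>R h x) \<in> borel_measurable lebesgue"
    and hi: "integrable lebesgue (\<lambda>x. indicator \<Omega> x *\<^sub>R (cmod (h x))\<^sup>2)"
    using h by (auto simp: L2_def set_borel_measurable_def set_integrable_def)
  have "\<Omega> \<in> lmeasurable" using \<Omega> by (rule lmeasurable_open[rotated])
  then have "integrable lebesgue (indicator \<Omega> :: 'a \<Rightarrow> real)"
    by (intro integrable_real_indicator) (auto simp: fmeasurable_def)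
  from Bochner_Integration.integrable_add[OF this hi]
  have "integrable lebesgue (\<lambda>x. indicator \<Omega> x *\<^sub>R h x)"
  proof (rule Bochner_Integration.integrable_bound)
    have "y \<le> 1 + y\<^sup>2" for y :: real
    proof -
      have "2 * y \<le> y\<^sup>2 + 1" using zero_le_power2[of "y - 1"] by (simp add: power2_diff)
      moreover have "0 \<le> y\<^sup>2" by simp
      ultimately show ?thesis by linarith
    qed
    then show "AE x in lebesgue. norm (indicator \<Omega> x *\<^sub>R h x) \<le> norm (indicator \<Omega> x + indicator \<Omega> x *\<^sub>R (cmod (h x))\<^sup>2)"
      by (auto simp: indicator_def)
  qed measurable
  then show ?thesis by (simp add: set_integrable_def)
qed

text \<open>\<open>lap\<close> is only a choice among weak Laplacians. Two of them have the same
  integrals against test functions and are integrable on the bounded \<Omega>, so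
  \<open>du_Bois_Reymond\<close> identifies them almost everywhere.\<close>

lemma lap_unique:
  fixes \<Omega> :: "'a::euclidean_space set"
  assumes \<Omega>: "open \<Omega>" "bounded \<Omega>" and F: "L2 \<Omega> F" "weak_lap \<Omega> u F"
  shows "L2 \<Omega> (lap \<Omega> u)" "AE x in lebesgue. x \<in> \<Omega> \<longrightarrow> lap \<Omega> u x = F x"
proof -
  have l: "L2 \<Omega> (lap \<Omega> u) \<and> weak_lap \<Omega> u (lap \<Omega> u)"
    unfolding lap_def by (rule someI[of _ F]) (use F in blast)
  then show "L2 \<Omega> (lap \<Omega> u)" by blast
  have si: "set_integrable lebesgue \<Omega> (lap \<Omega> u)" "set_integrable lebesgue \<Omega> F"
    using L2_set_integrable[OF \<Omega>] l F by auto
  have "AE x in lebesgue. x \<in> \<Omega> \<longrightarrow> lap \<Omega> u x - F x = 0"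
  proof (rule du_Bois_Reymond[OF \<Omega>(1)])
    show "set_integrable lebesgue \<Omega> (\<lambda>x. lap \<Omega> u x - F x)" using si by (rule set_integral_diff)
    fix \<eta> assume \<eta>: "test_fun \<Omega> \<eta>"
    obtain C where C: "\<And>x. \<bar>\<eta> x\<bar> \<le> C"
    proof -
      obtain C where c: "0 \<le> C" "\<And>x. norm (\<eta> x) \<le> C * indicator (tsupp \<eta>) x"
        using continuous_compact_support_bounded[of \<eta> "tsupp \<eta>"] \<eta> smooth_continuous[OF test_fun_smooth[OF \<eta>]]
          test_fun_compact[OF \<eta>] zero_off_tsupp by blast
      then have "\<bar>\<eta> x\<bar> \<le> C" for x using c(2)[of x] c(1) by (cases "x \<in> tsupp \<eta>") auto
      then show ?thesis using that by blast
    qed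
    have em[measurable]: "\<eta> \<in> borel_measurable lebesgue"
      by (rule measurable_completion)
        (use sqint_measurable[OF test_fun_sqint[OF \<eta>]] in simp)
    have ie: "set_integrable lebesgue \<Omega> (\<lambda>x. k x * complex_of_real (\<eta> x))" if k: "set_integrable lebesgue \<Omega> k" for k
    proof -
      have ik: "integrable lebesgue (\<lambda>x. indicator \<Omega> x *\<^sub>R k x)" using k by (simp add: set_integrable_def)
      have "integrable lebesgue (\<lambda>x. (indicator \<Omega> x *\<^sub>R k x) * complex_of_real (\<eta> x))"
      proof (rule Bochner_Integration.integrable_bound[OF integrable_mult_right[OF integrable_norm[OF ik], of C]])
        have [measurable]: "(\<lambda>x. indicator \<Omega> x *\<^sub>R k x) \<in> borel_measurable lebesgue" using ik by auto
        show "(\<lambda>x. (indicator \<Omega> x *\<^sub>R k x) * complex_of_real (\<eta> x)) \<in> borel_measurable lebesgue" by measurable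
        have C0: "0 \<le> C" by (rule order_trans[OF abs_ge_zero C])
        show "AE x in lebesgue. norm ((indicator \<Omega> x *\<^sub>R k x) * complex_of_real (\<eta> x)) \<le> norm (C * norm (indicator \<Omega> x *\<^sub>R k x))"
        proof (rule AE_I2)
          fix x
          show "norm ((indicator \<Omega> x *\<^sub>R k x) * complex_of_real (\<eta> x)) \<le> norm (C * norm (indicator \<Omega> x *\<^sub>R k x))"
            using mult_left_mono[OF C[of x] norm_ge_zero[of "indicator \<Omega> x *\<^sub>R k x"]] C0
            by (simp add: norm_mult abs_mult mult_ac)
        qed
      qed
      then show ?thesis by (simp add: set_integrable_def)
    qed
    have "set_lebesgue_integral lebesgue \<Omega> (\<lambda>x. \<eta> x *\<^sub>R (lap \<Omega> u x - F x))
        = set_lebesgue_integral lebesgue \<Omega> (\<lambda>x. lap \<Omega> u x * complex_of_real (\<eta> x) - F x * complex_of_real (\<eta> x))"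
      by (simp add: scaleR_conv_of_real algebra_simps)
    also have "\<dots> = set_lebesgue_integral lebesgue \<Omega> (\<lambda>x. lap \<Omega> u x * complex_of_real (\<eta> x))
        - set_lebesgue_integral lebesgue \<Omega> (\<lambda>x. F x * complex_of_real (\<eta> x))"
      by (rule set_integral_diff(2)[OF ie[OF si(1)] ie[OF si(2)]])
    also have "\<dots> = 0" using l F(2) \<eta> by (simp add: weak_lap_def)
    finally show "set_lebesgue_integral lebesgue \<Omega> (\<lambda>x. \<eta> x *\<^sub>R (lap \<Omega> u x - F x)) = 0" .
  qed
  then show "AE x in lebesgue. x \<in> \<Omega> \<longrightarrow> lap \<Omega> u x = F x" by eventually_elim auto
qed

lemma weak_lap_cong_AE:
  assumes u: "u \<in> borel_measurable borel" "v \<in> borel_measurable borel" "AE x in lborel. u x = v x"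
    and "open \<Omega>" "weak_lap \<Omega> v F"
  shows "weak_lap \<Omega> u F"
  unfolding weak_lap_def
proof (intro allI impI)
  have [measurable]: "\<Omega> \<in> sets borel" using assms by simp
  fix \<eta> assume \<eta>: "test_fun \<Omega> \<eta>"
  note t = lap_test_test_fun[OF \<eta>]
  have [measurable]: "lap_test \<eta> \<in> borel_measurable borel" by (rule sqint_measurable[OF test_fun_sqint[OF t]])
  note [measurable] = u(1,2)
  have m: "(\<lambda>x. indicator \<Omega> x *\<^sub>R (u x * complex_of_real (lap_test \<eta> x))) \<in> borel_measurable lborel"
    "(\<lambda>x. indicator \<Omega> x *\<^sub>R (v x * complex_of_real (lap_test \<eta> x))) \<in> borel_measurable lborel"
    by measurable
  have "set_lebesgue_integral lebesgue \<Omega> (\<lambda>x. u x * complex_of_real (lap_test \<eta> x))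
      = set_lebesgue_integral lebesgue \<Omega> (\<lambda>x. v x * complex_of_real (lap_test \<eta> x))"
    unfolding set_lebesgue_integral_def integral_completion[OF m(1)] integral_completion[OF m(2)]
    using u(3) by (intro integral_cong_AE m) (auto elim!: eventually_mono)
  then show "set_lebesgue_integral lebesgue \<Omega> (\<lambda>x. u x * complex_of_real (lap_test \<eta> x))
      = set_lebesgue_integral lebesgue \<Omega> (\<lambda>x. F x * complex_of_real (\<eta> x))"
    using assms(5) \<eta> by (simp add: weak_lap_def)
qed

text \<open>K is bounded from L^2 into H: |K f| \<le> |f|, and the Laplacian K f - f has norm at
  most 2 |f|, giving 1 + 4 \<le> 3^2. It is stated for functions equal to K f almost everywhere
  because a difference of representatives need not be the chosen representative of the
  difference.\<close>

lemma Hnorm_Kc_le: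
  assumes \<Omega>: "open \<Omega>" "bounded \<Omega>" and u: "u \<in> borel_measurable borel" "AE x in lborel. u x = l2_fun (Kc \<Omega> f) x"
  shows "Hnorm \<Omega> u \<le> 3 * norm f"
proof -
  have su: "sqint u" using u by (intro sqint_bound[OF sqint_l2_fun[of "Kc \<Omega> f"], of _ 1]) auto
  have pu: "l2_pair u = Kc \<Omega> f"
    using l2_pair_diff[OF su sqint_l2_fun[of "Kc \<Omega> f"]] norm_l2_pair[OF sqint_diff[OF su sqint_l2_fun[of "Kc \<Omega> f"]]] u
      integral_eq_zero_AE[of "\<lambda>x. (cmod (u x - l2_fun (Kc \<Omega> f) x))\<^sup>2" lborel] by simp
  have w: "weak_lap \<Omega> u (l2_fun (Kc \<Omega> f - f))"
    by (rule weak_lap_cong_AE[OF u(1) l2_fun_measurable u(2) \<Omega>(1) Kc_weak_lap[OF \<Omega>(1)]])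
  note L = sqint_L2[OF \<Omega>(1) sqint_l2_fun[of "Kc \<Omega> f - f"]]
  note l = lap_unique[OF \<Omega> L(1) w]
  have "L2sq \<Omega> u \<le> (norm f)\<^sup>2"
    using sqint_L2(2)[OF \<Omega>(1) su] power_mono[OF norm_Kc_le[of \<Omega> f] norm_ge_zero, of 2] unfolding pu by linarith
  moreover have "L2sq \<Omega> (lap \<Omega> u) \<le> (2 * norm f)\<^sup>2"
  proof -
    have "L2sq \<Omega> (lap \<Omega> u) = L2sq \<Omega> (l2_fun (Kc \<Omega> f - f))" by (rule L2sq_cong_AE[OF l(2) l(1) L(1)])
    also have "\<dots> \<le> (norm (Kc \<Omega> f - f))\<^sup>2" using L(2) by simp
    also have "\<dots> \<le> (2 * norm f)\<^sup>2"
      using norm_triangle_ineq4[of "Kc \<Omega> f" f] norm_Kc_le[of \<Omega> f] by (intro power_mono) auto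
    finally show ?thesis .
  qed
  ultimately have "L2sq \<Omega> u + L2sq \<Omega> (lap \<Omega> u) \<le> 5 * (norm f)\<^sup>2"
    by (simp add: power_mult_distrib)
  also have "\<dots> \<le> (3 * norm f)\<^sup>2" unfolding power_mult_distrib by (intro mult_right_mono) auto
  finally have "Hnorm \<Omega> u \<le> sqrt ((3 * norm f)\<^sup>2)" unfolding Hnorm_def by (rule real_sqrt_le_mono)
  also have "sqrt ((3 * norm f)\<^sup>2) = 3 * norm f" by (rule real_sqrt_unique) auto
  finally show ?thesis .
qed

section \<open>The branch of standing waves\<close>

text \<open>The pointwise algebra, with W and F the values of K f and f. Since S^\<alpha> = m,
  scaling turns |W|^\<alpha> into m |W|^\<alpha>; the definitions of m and \<omega> are the real and
  the imaginary part of c e^(i \<theta>) = m e^(i \<gamma>) - i \<omega>.\<close>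

lemma K_scaled_branch_eq:
  fixes \<theta> \<gamma> m :: real and c W :: complex
  assumes \<alpha>: "0 < \<alpha>" and m: "m = Re (c * exp (\<i> * complex_of_real \<theta>)) / cos \<gamma>" "0 < m" and \<gamma>: "cos \<gamma> \<noteq> 0"
    and S: "S = m powr (1 / \<alpha>)" and \<omega>: "\<omega> = m * sin \<gamma> - Im (c * exp (\<i> * complex_of_real \<theta>))"
    and F: "F = (1 + c) * W + (exp (\<i> * complex_of_real (\<gamma> - \<theta>)) * complex_of_real m) * gpow \<alpha> W"
  shows "exp (\<i> * complex_of_real \<theta>) * (S *\<^sub>R (W - F))
    + exp (\<i> * complex_of_real \<gamma>) * complex_of_real (cmod (S *\<^sub>R W) powr \<alpha>) * (S *\<^sub>R W)
    = \<i> * complex_of_real \<omega> * (S *\<^sub>R W)"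
proof -
  have S0: "0 < S" using m(2) by (simp add: S)
  have "S powr \<alpha> = m" using \<alpha> m(2) by (simp add: S powr_powr)
  then have Sp: "cmod (S *\<^sub>R W) powr \<alpha> = m * cmod W powr \<alpha>"
    using S0 by (simp add: powr_mult)
  let ?t = "exp (\<i> * complex_of_real \<theta>)" and ?g = "exp (\<i> * complex_of_real \<gamma>)"
  have e: "?t * exp (\<i> * complex_of_real (\<gamma> - \<theta>)) = ?g"
    by (simp add: exp_add[symmetric] algebra_simps)
  have "complex_of_real m * ?g - c * ?t = \<i> * complex_of_real \<omega>"
    using \<gamma> m(1) by (simp add: complex_eq_iff \<omega> Re_exp Im_exp)
  then have k: "c * ?t = complex_of_real m * ?g - \<i> * complex_of_real \<omega>" by (simp add: algebra_simps)
  have "?t * (W - F) = - (c * ?t) * W - (?t * exp (\<i> * complex_of_real (\<gamma> - \<theta>))) * complex_of_real m * gpow \<alpha> W"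
    unfolding F by (simp add: algebra_simps)
  also have "\<dots> = - (complex_of_real m * ?g - \<i> * complex_of_real \<omega>) * W - ?g * complex_of_real m * (complex_of_real (cmod W powr \<alpha>) * W - W)"
    unfolding e k by (simp add: gpow_def algebra_simps)
  also have "\<dots> = \<i> * complex_of_real \<omega> * W - ?g * complex_of_real (m * cmod W powr \<alpha>) * W"
    by (simp add: algebra_simps)
  finally have "?t * (W - F) + ?g * complex_of_real (m * cmod W powr \<alpha>) * W = \<i> * complex_of_real \<omega> * W" by simp
  then have "S *\<^sub>R (?t * (W - F) + ?g * complex_of_real (m * cmod W powr \<alpha>) * W) = S *\<^sub>R (\<i> * complex_of_real \<omega> * W)" by simp
  then show ?thesis unfolding Sp by (simp add: scaleR_add_right)
qed

text \<open>A domain is taken to be nonempty, since on the empty set no function is nontrivial.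
  Elements of H are determined almost everywhere, so the equation and nontriviality are stated in
  that sense; continuity into H is written out with \<open>Hnorm\<close> because
  \<open>Hspace\<close> consists of functions rather than points of a metric type.\<close>

theorem theorem1p2:
  fixes \<Omega> :: "'a::euclidean_space set" and \<theta> \<gamma> :: real
  assumes "open \<Omega>" "bounded \<Omega>" "connected \<Omega>" "\<Omega> \<noteq> {}"
    and "-(pi/2) < \<theta>" "\<theta> < pi/2" "-(pi/2) < \<gamma>" "\<gamma> < pi/2"
  shows "\<exists>\<alpha>0 > 0. \<exists>(U :: real \<Rightarrow> 'a \<Rightarrow> complex) (\<omega> :: real \<Rightarrow> real).
     (\<forall>\<alpha>\<in>{0<..<\<alpha>0}. U \<alpha> \<in> Hspace \<Omega>)
   \<and> (\<forall>\<alpha>\<in>{0<..<\<alpha>0}. \<forall>\<epsilon>>0. \<exists>\<delta>>0. \<forall>\<beta>\<in>{0<..<\<alpha>0}.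
        \<bar>\<beta> - \<alpha>\<bar> < \<delta> \<longrightarrow> Hnorm \<Omega> (\<lambda>x. U \<beta> x - U \<alpha> x) < \<epsilon>)
   \<and> continuous_on {0..\<alpha>0} \<omega>
   \<and> (\<forall>\<alpha>\<in>{0<..<\<alpha>0}.
        \<not> (AE x in lebesgue. x \<in> \<Omega> \<longrightarrow> U \<alpha> x = 0)
      \<and> (AE x in lebesgue. x \<in> \<Omega> \<longrightarrow>
           exp (\<i> * complex_of_real \<theta>) * lap \<Omega> (U \<alpha>) x
           + exp (\<i> * complex_of_real \<gamma>) * complex_of_real (cmod (U \<alpha> x) powr \<alpha>) * U \<alpha> x
           = \<i> * complex_of_real (\<omega> \<alpha>) * U \<alpha> x))"
proof -
  note \<Omega> = assms(1-4)
  obtain \<phi> \<kappa> \<kappa>' where \<kappa>: "0 < \<kappa>" "\<kappa> < 1" and \<phi>: "norm \<phi> = 1" "K \<Omega> \<phi> = \<kappa> *\<^sub>R \<phi>"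
    "AE x in lborel. x \<in> \<Omega> \<longrightarrow> 0 < rep_l2 \<phi> x" and \<kappa>': "0 \<le> \<kappa>'" "\<kappa>' < \<kappa>"
    and gap: "\<And>f. f \<bullet> \<phi> = 0 \<Longrightarrow> norm (K \<Omega> f) \<le> \<kappa>' * norm f"
    by (rule ground_state[OF \<Omega>]) (rule that; blast)
  have cg: "0 < cos \<gamma>" and ct: "0 < cos \<theta>" using assms by (auto intro!: cos_gt_zero_pi)
  let ?t = "exp (\<i> * complex_of_real \<theta>)"
  define m where "m c = Re (c * ?t) / cos \<gamma>" for c
  define B where "B c = exp (\<i> * complex_of_real (\<gamma> - \<theta>)) * complex_of_real (m c)" for c
  have nt: "cmod ?t = 1" "cmod (exp (\<i> * complex_of_real (\<gamma> - \<theta>))) = 1" by (simp_all add: norm_exp_i_times)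
  have B_lip: "cmod (B c - B d) \<le> 1 / cos \<gamma> * cmod (c - d)" for c d
  proof -
    have "B c - B d = exp (\<i> * complex_of_real (\<gamma> - \<theta>)) * complex_of_real (Re ((c - d) * ?t) / cos \<gamma>)"
      by (simp add: B_def m_def right_diff_distrib diff_divide_distrib left_diff_distrib)
    then have "cmod (B c - B d) = \<bar>Re ((c - d) * ?t)\<bar> / cos \<gamma>"
      using cg by (simp only: norm_mult nt norm_of_real) simp
    also have "\<dots> \<le> cmod ((c - d) * ?t) / cos \<gamma>" using cg by (intro divide_right_mono abs_Re_le_cmod) auto
    finally show ?thesis by (simp add: norm_mult nt)
  qed
  have G_0: "Gop \<Omega> 0 f = 0" for f
    by (simp add: Gop_def l2_pair_def abs_l2_zero zero_prod_def)
  have L: "0 \<le> 1 / cos \<gamma>" and N: "0 < 1 / real DIM('a)" using cg by simp_all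
  obtain a c f where a: "0 < a" "continuous_on {0..a} c" "continuous_on {0..a} f" "c 0 = complex_of_real (1 / \<kappa> - 1)"
    and cf: "\<And>\<alpha>. \<alpha> \<in> {0..a} \<Longrightarrow> coef \<phi> (f \<alpha>) = 1 \<and>
      f \<alpha> = cmul (1 + c \<alpha>) (K \<Omega> (fst (f \<alpha>)), K \<Omega> (snd (f \<alpha>))) + cmul (B (c \<alpha>)) (Gop \<Omega> \<alpha> (f \<alpha>))"
    using perturbed_eigenvalue_branch[of "K \<Omega>" \<phi> \<kappa> \<kappa>' "1 / cos \<gamma>" B "Gop \<Omega>" "1 / real DIM('a)",
          OF K_add K_scaleR K_symmetric \<phi>(1,2) \<kappa>' gap L B_lip Gop_lipschitz[OF \<Omega>(1,2) \<phi>(2,1) \<kappa>(1) \<phi>(3)] N Gop_continuous G_0]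
    by blast
  have mc: "continuous_on {0..a} (\<lambda>\<alpha>. m (c \<alpha>))"
    unfolding m_def using cg by (intro continuous_intros a) auto
  have "0 < m (c 0)"
  proof -
    have "0 < (1 / \<kappa> - 1) * cos \<theta>" using \<kappa> ct by simp
    then show ?thesis unfolding m_def a(4) using cg by (simp add: Re_exp)
  qed
  then obtain d where d: "0 < d" "\<And>\<alpha>. \<alpha> \<in> {0..a} \<Longrightarrow> dist \<alpha> 0 < d \<Longrightarrow> dist (m (c \<alpha>)) (m (c 0)) < m (c 0)"
    using bspec[OF mc[unfolded continuous_on_iff], of 0] a(1) by auto
  \<comment> \<open>The branch exists up to a, m stays positive below d, and exponents up to 1/N
    keep the nonlinear term in L^2. Half of d is used because the interval for \<omega> is
    closed.\<close>
  define \<alpha>0 where "\<alpha>0 = min a (min (d / 2) (1 / real DIM('a)))"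
  have \<alpha>0: "0 < \<alpha>0" "\<alpha>0 \<le> a" "\<alpha>0 < d" "\<alpha>0 \<le> 1 / real DIM('a)" using a d by (auto simp: \<alpha>0_def)
  have mpos: "0 < m (c \<alpha>)" if "\<alpha> \<in> {0..\<alpha>0}" for \<alpha>
    using d(2)[of \<alpha>] that \<alpha>0 by (auto simp: dist_real_def)
  define \<omega> where "\<omega> \<alpha> = m (c \<alpha>) * sin \<gamma> - Im (c \<alpha> * ?t)" for \<alpha>
  \<comment> \<open>The exponent 1/\<alpha> has no limit at 0, so this amplitude is used only on the
    open interval; \<omega> depends on c alone and is continuous up to 0.\<close>
  define S where "S \<alpha> = m (c \<alpha>) powr (1 / \<alpha>)" for \<alpha>
  define h where "h \<alpha> = S \<alpha> *\<^sub>R f \<alpha>" for \<alpha>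
  define U where "U \<alpha> = l2_fun (Kc \<Omega> (h \<alpha>))" for \<alpha>
  have sub: "{0<..<\<alpha>0} \<subseteq> {0..a}" "{0..\<alpha>0} \<subseteq> {0..a}" using \<alpha>0 by auto
  have "continuous_on {0..\<alpha>0} \<omega>"
    unfolding \<omega>_def by (intro continuous_intros continuous_on_subset[OF mc sub(2)] continuous_on_subset[OF a(2) sub(2)])
  moreover have hc: "continuous_on {0<..<\<alpha>0} h"
    unfolding h_def S_def using less_imp_neq[OF mpos]
    by (intro continuous_intros continuous_on_subset[OF mc sub(1)] continuous_on_subset[OF a(3) sub(1)]) force+
  have "\<exists>\<delta>>0. \<forall>\<beta>\<in>{0<..<\<alpha>0}. \<bar>\<beta> - \<alpha>\<bar> < \<delta> \<longrightarrow> Hnorm \<Omega> (\<lambda>x. U \<beta> x - U \<alpha> x) < \<epsilon>"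
    if \<alpha>: "\<alpha> \<in> {0<..<\<alpha>0}" and \<epsilon>: "0 < \<epsilon>" for \<alpha> \<epsilon>
  proof -
    obtain \<delta> where \<delta>: "0 < \<delta>" "\<And>\<beta>. \<beta> \<in> {0<..<\<alpha>0} \<Longrightarrow> dist \<beta> \<alpha> < \<delta> \<Longrightarrow> dist (h \<beta>) (h \<alpha>) < \<epsilon> / 3"
      using bspec[OF hc[unfolded continuous_on_iff] \<alpha>] \<epsilon> by (metis zero_less_divide_iff zero_less_numeral)
    have "Hnorm \<Omega> (\<lambda>x. U \<beta> x - U \<alpha> x) < \<epsilon>" if \<beta>: "\<beta> \<in> {0<..<\<alpha>0}" "\<bar>\<beta> - \<alpha>\<bar> < \<delta>" for \<beta>
    proof -
      have "Hnorm \<Omega> (\<lambda>x. U \<beta> x - U \<alpha> x) \<le> 3 * norm (h \<beta> - h \<alpha>)"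
      proof (rule Hnorm_Kc_le[OF \<Omega>(1,2)])
        show "(\<lambda>x. U \<beta> x - U \<alpha> x) \<in> borel_measurable borel" unfolding U_def by measurable
        show "AE x in lborel. U \<beta> x - U \<alpha> x = l2_fun (Kc \<Omega> (h \<beta> - h \<alpha>)) x"
          using l2_fun_diff[of "Kc \<Omega> (h \<beta>)" "Kc \<Omega> (h \<alpha>)"] unfolding U_def Kc_diff by eventually_elim simp
      qed
      also have "\<dots> < \<epsilon>" using \<delta>(2)[OF \<beta>(1)] \<beta>(2) by (simp add: dist_norm)
      finally show ?thesis .
    qed
    then show ?thesis using \<delta>(1) by blast
  qed
  moreover have "U \<alpha> \<in> Hspace \<Omega>" for \<alpha>
    unfolding Hspace_def U_def
    using Kc_H10[OF \<Omega>(1)] Kc_weak_lap[OF \<Omega>(1)] sqint_L2(1)[OF \<Omega>(1) sqint_l2_fun] by blast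
  moreover have "\<not> (AE x in lebesgue. x \<in> \<Omega> \<longrightarrow> U \<alpha> x = 0)
      \<and> (AE x in lebesgue. x \<in> \<Omega> \<longrightarrow>
           exp (\<i> * complex_of_real \<theta>) * lap \<Omega> (U \<alpha>) x
           + exp (\<i> * complex_of_real \<gamma>) * complex_of_real (cmod (U \<alpha> x) powr \<alpha>) * U \<alpha> x
           = \<i> * complex_of_real (\<omega> \<alpha>) * U \<alpha> x)" if \<alpha>: "\<alpha> \<in> {0<..<\<alpha>0}" for \<alpha>
  proof
    have \<alpha>a: "\<alpha> \<in> {0..a}" using \<alpha> sub by blast
    have m0: "0 < m (c \<alpha>)" using mpos[of \<alpha>] \<alpha> by auto
    have S0: "0 < S \<alpha>" using m0 by (simp add: S_def)
    define v where "v = Kc \<Omega> (f \<alpha>)"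
    have eqf: "f \<alpha> = cmul (1 + c \<alpha>) v + cmul (B (c \<alpha>)) (Gop \<Omega> \<alpha> (f \<alpha>))"
      using cf[OF \<alpha>a] by (simp add: v_def Kc_def)
    have G: "Gop \<Omega> \<alpha> (f \<alpha>) = l2_pair (\<lambda>x. gpow \<alpha> (l2_fun v x))" by (simp add: Gop_def v_def)
    have Gfix: "AE x in lborel. l2_fun (Gop \<Omega> \<alpha> (f \<alpha>)) x = gpow \<alpha> (l2_fun v x)"
      unfolding G v_def using \<alpha> \<alpha>0(4) by (intro l2_fun_l2_pair gpow_sqint) auto
    have F: "AE x in lborel. l2_fun (f \<alpha>) x = (1 + c \<alpha>) * l2_fun v x + B (c \<alpha>) * gpow \<alpha> (l2_fun v x)"
      using l2_fun_add[of "cmul (1 + c \<alpha>) v" "cmul (B (c \<alpha>)) (Gop \<Omega> \<alpha> (f \<alpha>))"] l2_fun_cmul[of "1 + c \<alpha>" v]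
        l2_fun_cmul[of "B (c \<alpha>)" "Gop \<Omega> \<alpha> (f \<alpha>)"] Gfix unfolding eqf[symmetric]
      by eventually_elim simp
    have Kh: "Kc \<Omega> (h \<alpha>) = S \<alpha> *\<^sub>R v" by (simp add: h_def Kc_scaleR v_def)
    have Uv: "AE x in lborel. U \<alpha> x = S \<alpha> *\<^sub>R l2_fun v x"
      unfolding U_def Kh by (rule l2_fun_scaleR)
    \<comment> \<open>If U vanished on \<Omega>, then K f would vanish everywhere, since it is 0
      outside \<Omega>; the fixed point equation would give f = 0, against the normalization that
      the coefficient of f along \<phi> is 1.\<close>
    show "\<not> (AE x in lebesgue. x \<in> \<Omega> \<longrightarrow> U \<alpha> x = 0)"
    proof
      assume "AE x in lebesgue. x \<in> \<Omega> \<longrightarrow> U \<alpha> x = 0"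
      then have "AE x in lborel. x \<in> \<Omega> \<longrightarrow> U \<alpha> x = 0" by (simp add: AE_lebesgue_iff_lborel)
      then have "AE x in lborel. l2_fun (f \<alpha>) x = 0"
        using Uv Kc_support[OF \<Omega>(1), of "f \<alpha>"] F unfolding v_def[symmetric]
      proof eventually_elim
        case (elim x)
        then have "l2_fun v x = 0" using S0 by (cases "x \<in> \<Omega>") auto
        then show ?case using elim by simp
      qed
      then have "(norm (f \<alpha>))\<^sup>2 = 0"
        unfolding norm_l2_fun by (intro integral_eq_zero_AE) (auto elim!: eventually_mono)
      then have "f \<alpha> = 0" by simp
      then show False using cf[OF \<alpha>a] by (simp add: coef_def complex_eq_iff)
    qed
    have lap: "AE x in lborel. x \<in> \<Omega> \<longrightarrow> lap \<Omega> (U \<alpha>) x = l2_fun (Kc \<Omega> (h \<alpha>) - h \<alpha>) x"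
      unfolding AE_lebesgue_iff_lborel[symmetric] U_def
      by (rule lap_unique(2)[OF \<Omega>(1,2) sqint_L2(1)[OF \<Omega>(1) sqint_l2_fun] Kc_weak_lap[OF \<Omega>(1)]])
    have vf: "Kc \<Omega> (h \<alpha>) - h \<alpha> = S \<alpha> *\<^sub>R (v - f \<alpha>)" unfolding Kh by (simp add: h_def scaleR_diff_right)
    have "AE x in lborel. x \<in> \<Omega> \<longrightarrow>
           ?t * lap \<Omega> (U \<alpha>) x
           + exp (\<i> * complex_of_real \<gamma>) * complex_of_real (cmod (U \<alpha> x) powr \<alpha>) * U \<alpha> x
           = \<i> * complex_of_real (\<omega> \<alpha>) * U \<alpha> x"
      using lap[unfolded vf] l2_fun_scaleR[of "S \<alpha>" "v - f \<alpha>"] l2_fun_diff[of v "f \<alpha>"] F Uv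
    proof eventually_elim
      case (elim x)
      show ?case
      proof
        assume "x \<in> \<Omega>"
        then have l: "lap \<Omega> (U \<alpha>) x = S \<alpha> *\<^sub>R (l2_fun v x - l2_fun (f \<alpha>) x)" using elim by simp
        show "?t * lap \<Omega> (U \<alpha>) x
           + exp (\<i> * complex_of_real \<gamma>) * complex_of_real (cmod (U \<alpha> x) powr \<alpha>) * U \<alpha> x
           = \<i> * complex_of_real (\<omega> \<alpha>) * U \<alpha> x"
          unfolding l elim(5)
          by (rule K_scaled_branch_eq[OF _ m_def[of "c \<alpha>"] m0 _ S_def \<omega>_def])
            (use \<alpha> cg elim(4) in \<open>auto simp: B_def\<close>)
      qed
    qed
    then show "AE x in lebesgue. x \<in> \<Omega> \<longrightarrow>
           ?t * lap \<Omega> (U \<alpha>) x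
           + exp (\<i> * complex_of_real \<gamma>) * complex_of_real (cmod (U \<alpha> x) powr \<alpha>) * U \<alpha> x
           = \<i> * complex_of_real (\<omega> \<alpha>) * U \<alpha> x" by (simp only: AE_lebesgue_iff_lborel)
  qed
  ultimately show ?thesis using \<alpha>0(1) by blast
qed

end
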